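(* Let $(\Sigma,g,\phi)$ be a complete $\phi$-parabolic manifold with density. Let $q\in C^\infty(\Sigma)$ and assume that the gradient Schrödinger operator $L_{\phi,q}:=\Delta+g(\nabla\phi,\nabla\,\cdot\,)+q$ is stable. If $u$ is a bounded smooth function on $\Sigma$ with $L_{\phi,q}u=0$, then $u$ is either identically zero or has no zeroes on $\Sigma$. Hence, if there is a bounded smooth function in the kernel of $L_{\phi,q}$ that is not identically zero, the linear space of bounded smooth functions in the kernel of $L_{\phi,q}$ is one dimensional.
   Context: All manifolds are smooth, connected, orientable and without boundary unless stated otherwise. A manifold with density $(\Sigma,g,\phi)$ is a Riemannian manifold $(\Sigma,g)$ together with a function $\phi\in C^\infty(\Sigma)$; it is complete if $(\Sigma,g)$ is. $\Delta$, $\nabla$ and $dv_\Sigma$ are the Laplacian, gradient and volume measure of $g$. $C_0^\infty(\Sigma)$ denotes the space of compactly supported piecewise smooth functions on $\Sigma$. $(\Sigma,g,\phi)$ is $\phi$-parabolic if every function $u\ge 0$ on $\Sigma$ with $\Delta u+g(\nabla\phi,\nabla u)\le 0$ is constant. $L_{\phi,q}$ is stable if $$\lambda_1^\phi(\Sigma):=\inf\left\{\frac{\int_\Sigma(|\nabla f|^2-qf^2)e^\phi\,dv_\Sigma}{\int_\Sigma f^2e^\phi\,dv_\Sigma}:\ f\in C_0^\infty(\Sigma)\setminus\{0\}\right\}\ge 0.$$ *)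

theory Defs
  imports "HOL-Analysis.Analysis" "HOL-Library.Function_Algebras"
begin

section \<open>Smooth functions on open subsets of Euclidean space\<close>

text \<open>Both notions are meant for open \<open>S\<close>, and are only applied to such sets.\<close>

primrec Ck_on ::
    "nat \<Rightarrow> 'a::euclidean_space set \<Rightarrow> ('a \<Rightarrow> 'b::real_normed_vector) \<Rightarrow> bool" where
  "Ck_on 0 S f \<longleftrightarrow> continuous_on S f"
| "Ck_on (Suc k) S f \<longleftrightarrow>
     f differentiable_on S \<and> (\<forall>b\<in>Basis. Ck_on k S (\<lambda>x. frechet_derivative f (at x) b))"

definition smooth_on ::
    "'a::euclidean_space set \<Rightarrow> ('a \<Rightarrow> 'b::real_normed_vector) \<Rightarrow> bool" where
  "smooth_on S f \<longleftrightarrow> (\<forall>k. Ck_on k S f)"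

definition partial :: "'n \<Rightarrow> (real ^ 'n \<Rightarrow> real) \<Rightarrow> real ^ 'n \<Rightarrow> real" where
  "partial i f x = frechet_derivative f (at x) (axis i 1)"


section \<open>Smooth manifolds\<close>

text \<open>
  The manifold \<open>\<Sigma>\<close> is (the universe of) a Hausdorff, second countable type \<open>'m\<close>, equipped with a
  smooth atlas (not necessarily maximal) of charts with values in \<open>real ^ 'n\<close>, so that
  \<open>dim \<Sigma> = CARD('n)\<close>. A chart is a pair \<open>(U, \<psi>)\<close>; the values of \<open>\<psi>\<close> outside \<open>U\<close> are irrelevant.
  Charts have open image in \<open>real ^ 'n\<close>, hence there is no boundary.
\<close>

type_synonym ('m, 'n) chart = "'m set \<times> ('m \<Rightarrow> (real, 'n) vec)"

definition is_chart :: "('m::topological_space, 'n::finite) chart \<Rightarrow> bool" where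
  "is_chart c \<longleftrightarrow> open (fst c) \<and> open (snd c ` fst c) \<and>
     (\<exists>\<psi>'. homeomorphism (fst c) (snd c ` fst c) (snd c) \<psi>')"

definition chart_inv :: "('m, 'n::finite) chart \<Rightarrow> real ^ 'n \<Rightarrow> 'm" where
  "chart_inv c = inv_into (fst c) (snd c)"

definition transition ::
    "('m, 'n::finite) chart \<Rightarrow> ('m, 'n) chart \<Rightarrow> real ^ 'n \<Rightarrow> real ^ 'n" where
  "transition c d = snd d \<circ> chart_inv c"

definition overlap :: "('m, 'n::finite) chart \<Rightarrow> ('m, 'n) chart \<Rightarrow> (real ^ 'n) set" where
  "overlap c d = snd c ` (fst c \<inter> fst d)"

definition jacobian ::
    "('m, 'n::finite) chart \<Rightarrow> ('m, 'n) chart \<Rightarrow> real ^ 'n \<Rightarrow> real ^ 'n ^ 'n" where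
  "jacobian c d x = matrix (frechet_derivative (transition c d) (at x))"

definition smooth_atlas ::
    "('m::{t2_space, second_countable_topology}, 'n::finite) chart set \<Rightarrow> bool" where
  "smooth_atlas A \<longleftrightarrow>
     (\<forall>c\<in>A. is_chart c) \<and> (\<Union>c\<in>A. fst c) = UNIV \<and>
     (\<forall>c\<in>A. \<forall>d\<in>A. smooth_on (overlap c d) (transition c d))"

text \<open>The oriented atlas \<open>B\<close> defines the same smooth structure as \<open>A\<close>, but need not be
  contained in \<open>A\<close>.\<close>

definition orientable ::
    "('m::{t2_space, second_countable_topology}, 'n::finite) chart set \<Rightarrow> bool" where
  "orientable A \<longleftrightarrow>
     (\<exists>B. smooth_atlas B \<and> smooth_atlas (A \<union> B) \<and>
       (\<forall>c\<in>B. \<forall>d\<in>B. \<forall>x\<in>overlap c d. det (jacobian c d x) > 0))"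

definition smooth_fun :: "('m, 'n::finite) chart set \<Rightarrow> ('m \<Rightarrow> real) \<Rightarrow> bool" where
  "smooth_fun A f \<longleftrightarrow> (\<forall>c\<in>A. smooth_on (snd c ` fst c) (f \<circ> chart_inv c))"

definition chart_at :: "('m, 'n::finite) chart set \<Rightarrow> 'm \<Rightarrow> ('m, 'n) chart" where
  "chart_at A p = (SOME c. c \<in> A \<and> p \<in> fst c)"


section \<open>Riemannian metrics\<close>

text \<open>
  A metric tensor is given by its components: \<open>g c x\<close> is the matrix \<open>(g\<^sub>i\<^sub>j)\<close> in the chart \<open>c\<close>, at
  the point with coordinates \<open>x\<close>. The last condition is the transformation law of a covariant
  2-tensor.
\<close>

type_synonym ('m, 'n) metric_tensor =
  "('m, 'n) chart \<Rightarrow> (real, 'n) vec \<Rightarrow> ((real, 'n) vec, 'n) vec"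

definition riemannian_metric ::
    "('m, 'n::finite) chart set \<Rightarrow> ('m, 'n) metric_tensor \<Rightarrow> bool" where
  "riemannian_metric A g \<longleftrightarrow>
     (\<forall>c\<in>A. (\<forall>i j. smooth_on (snd c ` fst c) (\<lambda>x. g c x $ i $ j)) \<and>
        (\<forall>x\<in>snd c ` fst c. transpose (g c x) = g c x \<and> (\<forall>v. v \<noteq> 0 \<longrightarrow> v \<bullet> (g c x *v v) > 0))) \<and>
     (\<forall>c\<in>A. \<forall>d\<in>A. \<forall>x\<in>overlap c d.
        g c x = transpose (jacobian c d x) ** g d (transition c d x) ** jacobian c d x)"

definition riemannian_manifold ::
    "('m::{t2_space, second_countable_topology}, 'n::finite) chart set
      \<Rightarrow> ('m, 'n) metric_tensor \<Rightarrow> bool" where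
  "riemannian_manifold A g \<longleftrightarrow>
     smooth_atlas A \<and> connected (UNIV :: 'm set) \<and> orientable A \<and> riemannian_metric A g"

definition manifold_with_density ::
    "('m::{t2_space, second_countable_topology}, 'n::finite) chart set
      \<Rightarrow> ('m, 'n) metric_tensor \<Rightarrow> ('m \<Rightarrow> real) \<Rightarrow> bool" where
  "manifold_with_density A g \<phi> \<longleftrightarrow> riemannian_manifold A g \<and> smooth_fun A \<phi>"


subsection \<open>Riemannian distance and completeness\<close>

definition piecewise_C1_curve ::
    "('m::topological_space, 'n::finite) chart set \<Rightarrow> (real \<Rightarrow> 'm) \<Rightarrow> bool" where
  "piecewise_C1_curve A \<gamma> \<longleftrightarrow>
     (\<forall>t\<in>{0..1}. \<exists>c\<in>A. \<exists>e>0. \<gamma> ` ({0..1} \<inter> cball t e) \<subseteq> fst c \<and>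
        (snd c \<circ> \<gamma>) piecewise_C1_differentiable_on ({0..1} \<inter> cball t e))"

definition speed ::
    "('m, 'n::finite) chart set \<Rightarrow> ('m, 'n) metric_tensor \<Rightarrow> (real \<Rightarrow> 'm) \<Rightarrow> real \<Rightarrow> real" where
  "speed A g \<gamma> t =
     (let c = chart_at A (\<gamma> t); v = vector_derivative (snd c \<circ> \<gamma>) (at t)
      in sqrt (v \<bullet> (g c (snd c (\<gamma> t)) *v v)))"

text \<open>The length is an extended nonnegative integral, since the library's piecewise \<open>C\<^sup>1\<close> functions
  may have an unbounded derivative near their break points. It is infinite for a curve that is
  not rectifiable.\<close>

definition curve_length ::
    "('m, 'n::finite) chart set \<Rightarrow> ('m, 'n) metric_tensor \<Rightarrow> (real \<Rightarrow> 'm) \<Rightarrow> ennreal" where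
  "curve_length A g \<gamma> = (\<integral>\<^sup>+ t\<in>{0..1}. ennreal (speed A g \<gamma> t) \<partial>lborel)"

definition riem_dist ::
    "('m::topological_space, 'n::finite) chart set \<Rightarrow> ('m, 'n) metric_tensor
      \<Rightarrow> 'm \<Rightarrow> 'm \<Rightarrow> real" where
  "riem_dist A g p q =
     enn2real (INF \<gamma>\<in>{\<gamma>. piecewise_C1_curve A \<gamma> \<and> \<gamma> 0 = p \<and> \<gamma> 1 = q}. curve_length A g \<gamma>)"

definition complete_manifold ::
    "('m::topological_space, 'n::finite) chart set \<Rightarrow> ('m, 'n) metric_tensor \<Rightarrow> bool" where
  "complete_manifold A g \<longleftrightarrow> Metric_space.mcomplete UNIV (riem_dist A g)"


subsection \<open>Volume measure\<close>

text \<open>The Borel measure characterised by \<open>dv = sqrt (det (g\<^sub>i\<^sub>j)) dx\<close> in every chart, completed.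
  Completion makes integrals insensitive to the values of an integrand on null sets, such as
  those of the gradient of a piecewise smooth function where it is not differentiable.\<close>

definition is_volume ::
    "('m::topological_space, 'n::finite) chart set \<Rightarrow> ('m, 'n) metric_tensor
      \<Rightarrow> 'm measure \<Rightarrow> bool" where
  "is_volume A g \<mu> \<longleftrightarrow> sets \<mu> = sets borel \<and>
     (\<forall>c\<in>A. \<forall>B\<in>sets borel. B \<subseteq> fst c \<longrightarrow>
        emeasure \<mu> B = (\<integral>\<^sup>+ x\<in>snd c ` B. ennreal (sqrt (det (g c x))) \<partial>lborel))"

definition volume ::
    "('m::topological_space, 'n::finite) chart set \<Rightarrow> ('m, 'n) metric_tensor \<Rightarrow> 'm measure" where
  "volume A g = completion (THE \<mu>. is_volume A g \<mu>)"


subsection \<open>Gradient and Laplacian\<close>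

text \<open>Components of the gradient in the chart \<open>c\<close>: \<open>(\<nabla>u)\<^sup>i = \<Sum>\<^sub>j g\<^sup>i\<^sup>j \<partial>\<^sub>j u\<close>.\<close>

definition grad_in ::
    "('m, 'n::finite) metric_tensor \<Rightarrow> ('m, 'n) chart \<Rightarrow> ('m \<Rightarrow> real) \<Rightarrow> real ^ 'n \<Rightarrow> real ^ 'n" where
  "grad_in g c u x = matrix_inv (g c x) *v (\<chi> j. partial j (u \<circ> chart_inv c) x)"

text \<open>Divergence of the vector field with components \<open>X\<close> in the chart \<open>c\<close>:
  \<open>div X = (1 / sqrt (det g)) * \<Sum>\<^sub>i \<partial>\<^sub>i (sqrt (det g) * X\<^sup>i)\<close>.\<close>

definition div_in ::
    "('m, 'n::finite) metric_tensor \<Rightarrow> ('m, 'n) chart \<Rightarrow> (real ^ 'n \<Rightarrow> real ^ 'n)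
      \<Rightarrow> real ^ 'n \<Rightarrow> real" where
  "div_in g c X x =
     (\<Sum>i\<in>UNIV. partial i (\<lambda>y. sqrt (det (g c y)) * X y $ i) x) / sqrt (det (g c x))"

text \<open>The function \<open>g(\<nabla>u, \<nabla>v)\<close> and the Laplacian \<open>\<Delta>u = div (\<nabla>u)\<close>. By the transformation law of
  \<open>g\<close> the choice of a chart around \<open>p\<close> does not matter.\<close>

definition grad_inner ::
    "('m, 'n::finite) chart set \<Rightarrow> ('m, 'n) metric_tensor
      \<Rightarrow> ('m \<Rightarrow> real) \<Rightarrow> ('m \<Rightarrow> real) \<Rightarrow> 'm \<Rightarrow> real" where
  "grad_inner A g u v p =
     (let c = chart_at A p; x = snd c p
      in grad_in g c u x \<bullet> (g c x *v grad_in g c v x))"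

definition laplacian ::
    "('m, 'n::finite) chart set \<Rightarrow> ('m, 'n) metric_tensor \<Rightarrow> ('m \<Rightarrow> real) \<Rightarrow> 'm \<Rightarrow> real" where
  "laplacian A g u p =
     (let c = chart_at A p in div_in g c (grad_in g c u) (snd c p))"


section \<open>Parabolicity, gradient Schroedinger operators and stability\<close>

definition parabolic ::
    "('m, 'n::finite) chart set \<Rightarrow> ('m, 'n) metric_tensor \<Rightarrow> ('m \<Rightarrow> real) \<Rightarrow> bool" where
  "parabolic A g \<phi> \<longleftrightarrow>
     (\<forall>u. smooth_fun A u \<and> (\<forall>p. u p \<ge> 0) \<and>
          (\<forall>p. laplacian A g u p + grad_inner A g \<phi> u p \<le> 0)
        \<longrightarrow> (\<exists>k. \<forall>p. u p = k))"

definition schroedinger ::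
    "('m, 'n::finite) chart set \<Rightarrow> ('m, 'n) metric_tensor \<Rightarrow> ('m \<Rightarrow> real) \<Rightarrow> ('m \<Rightarrow> real)
      \<Rightarrow> ('m \<Rightarrow> real) \<Rightarrow> 'm \<Rightarrow> real" where
  "schroedinger A g \<phi> q u p = laplacian A g u p + grad_inner A g \<phi> u p + q p * u p"

text \<open>Piecewise smooth: continuous, and equal to a smooth function on each of finitely many closed
  pieces that cover \<open>\<Sigma>\<close> and have null boundary. Finitely many pieces suffice for compactly
  supported functions: all the pieces of a locally finite family that do not meet the support
  can be merged into one.\<close>

definition piecewise_smooth ::
    "('m::topological_space, 'n::finite) chart set \<Rightarrow> ('m, 'n) metric_tensor
      \<Rightarrow> ('m \<Rightarrow> real) \<Rightarrow> bool" where
  "piecewise_smooth A g f \<longleftrightarrow> continuous_on UNIV f \<and>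
     (\<exists>\<K>. finite \<K> \<and> \<Union>\<K> = UNIV \<and>
        (\<forall>K\<in>\<K>. closed K \<and> frontier K \<in> null_sets (volume A g) \<and>
           (\<exists>h. smooth_fun A h \<and> (\<forall>p\<in>K. f p = h p))))"

definition C0_infty ::
    "('m::topological_space, 'n::finite) chart set \<Rightarrow> ('m, 'n) metric_tensor
      \<Rightarrow> ('m \<Rightarrow> real) set" where
  "C0_infty A g = {f. piecewise_smooth A g f \<and> compact (closure {p. f p \<noteq> 0})}"

text \<open>The infimum is taken in the extended reals, as it may be \<open>-\<infinity>\<close>.\<close>

definition lambda1 ::
    "('m::topological_space, 'n::finite) chart set \<Rightarrow> ('m, 'n) metric_tensor
      \<Rightarrow> ('m \<Rightarrow> real) \<Rightarrow> ('m \<Rightarrow> real) \<Rightarrow> ereal" where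
  "lambda1 A g \<phi> q =
     (INF f\<in>C0_infty A g - {\<lambda>p. 0}.
        ereal ((LINT p|volume A g. (grad_inner A g f f p - q p * (f p)\<^sup>2) * exp (\<phi> p)) /
               (LINT p|volume A g. (f p)\<^sup>2 * exp (\<phi> p))))"

definition stable_operator ::
    "('m::topological_space, 'n::finite) chart set \<Rightarrow> ('m, 'n) metric_tensor
      \<Rightarrow> ('m \<Rightarrow> real) \<Rightarrow> ('m \<Rightarrow> real) \<Rightarrow> bool" where
  "stable_operator A g \<phi> q \<longleftrightarrow> lambda1 A g \<phi> q \<ge> 0"

definition bounded_kernel ::
    "('m, 'n::finite) chart set \<Rightarrow> ('m, 'n) metric_tensor \<Rightarrow> ('m \<Rightarrow> real) \<Rightarrow> ('m \<Rightarrow> real)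
      \<Rightarrow> ('m \<Rightarrow> real) set" where
  "bounded_kernel A g \<phi> q =
     {u. smooth_fun A u \<and> bounded (range u) \<and> (\<forall>p. schroedinger A g \<phi> q u p = 0)}"

text \<open>Function spaces carry no \<open>real_vector\<close> instance in the library, so linear algebra in them
  goes through the locale constants of \<open>module\<close> and \<open>vector_space\<close>, with this scaling.\<close>

definition scale_fun :: "real \<Rightarrow> ('m \<Rightarrow> real) \<Rightarrow> 'm \<Rightarrow> real" where
  "scale_fun a u = (\<lambda>p. a * u p)"

lemma vector_space_scale_fun: "vector_space scale_fun"
  by unfold_locales (auto simp: scale_fun_def fun_eq_iff algebra_simps)

end

theory Submission
  imports Defs
begin

text \<open>
 For a test function \<open>rho \<ge> 0\<close>, the limit of a minimising sequence of
 \<open>\<integral> \<bar>\<nabla>f\<bar>\<^sup>2 d\<nu> + \<integral> rho (f - 1)\<^sup>2 d\<nu>\<close> is, by Weyl's lemma, a smooth function with values in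
 \<open>[0, 1]\<close> that is superharmonic for the drift Laplacian. Parabolicity forces it to be \<open>1\<close>, so there
 are test functions \<open>f n\<close> converging to \<open>1\<close> locally in \<open>L\<^sup>2\<close> whose energies tend to \<open>0\<close>. Let \<open>u\<close> be a
 bounded solution. By stability and the boundedness of \<open>u\<close>, the functions \<open>f n * \<bar>u\<bar>\<close> (with \<open>\<bar>u\<bar>\<close>
 smoothed to \<open>sqrt (u^2 + d^2)\<close>) minimise the nonnegative form of the operator in the limit,
 so \<open>\<bar>u\<bar>\<close> is a weak solution, hence smooth by Weyl's lemma. The strong maximum principle shows
 that \<open>\<bar>u\<bar>\<close> vanishes identically or nowhere. Applied to \<open>u p * v - v p * u\<close> this gives the dimension.
\<close>

text \<open>The definition of \<open>parabolic\<close> speaks of smooth functions only, so the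
  energy minimiser can be inserted into it only once it is known to be smooth; the same regularity
  theory is reused for \<open>abs u\<close>. No Sobolev space is introduced: a weak solution is a
  sequence of test functions that is Cauchy in local L2 and satisfies the equation in the limit
  against every test function. Such sequences arise because a near-minimiser satisfies the
  Euler-Lagrange equation up to its energy excess, and because Cauchy-Schwarz for the nonnegative
  stability form turns small form values into small pairings. Local L2 bounds are the obstacle,
  since \<open>rh\<close> controls functions only where it is positive; a translation inequality
  spreads this control over the connected manifold. Regularity works with mollified, hence smooth,
  functions and bounds that are uniform along a filter; mollification errors are commutators, which
  gain one derivative and so drive a bootstrap. In the last part the smoothness of
  \<open>abs u\<close> is decisive: at a zero it has an interior minimum and so a vanishing
  derivative, which Hopf's boundary lemma excludes next to a ball where \<open>u\<close> has no
  zero.\<close>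

abbreviation "pt == partial"
abbreviation "ind == indicator"
abbreviation "enn == ennreal"
abbreviation ev_seq (binder "EV " 10) where "ev_seq P == eventually P sequentially"
abbreviation "bmb == borel_measurable borel"
abbreviation sum_univ (binder "SU " 10) where "sum_univ f == sum f UNIV"
abbreviation lebesgue_int (binder "LI " 10) where "lebesgue_int f == integral\<^sup>L lborel f"
abbreviation lebesgue_nn_int (binder "NN " 10) where "lebesgue_nn_int f == nn_integral lborel f"
abbreviation lim_seq (infixr "~~>" 60) where "f ~~> l == f \<longlonglongrightarrow> l"
notation scaleR (infixr "*." 75)

section \<open>Calculus in coordinates\<close>

lemma at_deriv_eq:
 assumes "(f has_derivative f') (at x)" shows "frechet_derivative f (at x) = f'"
 using frechet_derivative_at[OF assms] by simp

lemma Ck_on_cong: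
 assumes "open S" "!!x. x : S ==> f x = g x" "Ck_on k S f"
 shows "Ck_on k S g"
 using assms(2,3)
proof (induction k arbitrary: f g)
 case 0
 thus ?case by (metis Ck_on.simps(1) continuous_on_cong)
next
 case (Suc k)
 have df: "f differentiable (at x)" if "x : S" for x
  using Suc.prems(2) that assms(1) by (auto simp: differentiable_on_eq_differentiable_at)
 have eq: "frechet_derivative f (at x) = frechet_derivative g (at x)" if "x : S" for x
  by (rule frechet_derivative_transform_within_open[OF df[OF that] assms(1) that Suc.prems(1)])
 have "g differentiable (at x)" if x: "x : S" for x
 proof -
  have "(f has_derivative frechet_derivative f (at x)) (at x)"
   using df[OF x] frechet_derivative_works by blast
  hence "(g has_derivative frechet_derivative f (at x)) (at x)"
   by (rule has_derivative_transform_within_open[OF _ assms(1) x]) (use Suc.prems(1) in auto)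
  thus ?thesis unfolding differentiable_def by blast
 qed
 hence 1: "g differentiable_on S" using assms(1) by (simp add: differentiable_on_eq_differentiable_at)
 have "Ck_on k S (%x. frechet_derivative g (at x) b)" if "b : Basis" for b
  by (rule Suc.IH[of "%x. frechet_derivative f (at x) b"]) (use eq Suc.prems(2) that in auto)
 with 1 show ?case by simp
qed

lemma Ck_on_continuous: "Ck_on k S f ==> continuous_on S f"
 by (cases k) (auto intro: differentiable_imp_continuous_on)

lemma Ck_on_Suc_imp: "Ck_on (Suc k) S f ==> Ck_on k S f"
 by (induction k arbitrary: f) (auto intro: differentiable_imp_continuous_on)

lemma Ck_on_subset: "Ck_on k S f ==> T <= S ==> Ck_on k T f"
 by (induction k arbitrary: f) (auto intro: continuous_on_subset differentiable_on_subset)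

lemma Ck_on_local:
 assumes "open S" "!!x. x : S ==> EX T. open T & x : T & Ck_on k T f"
 shows "Ck_on k S f"
 using assms(2)
proof (induction k arbitrary: f)
 case 0
 have "isCont f x" if "x : S" for x
  using 0[OF that] by (auto simp: continuous_on_eq_continuous_at)
 thus ?case by (simp add: assms(1) continuous_on_eq_continuous_at)
next
 case (Suc k)
 have "f differentiable (at x)" if "x : S" for x
  using Suc.prems[OF that] by (auto simp: differentiable_on_eq_differentiable_at)
 moreover have "Ck_on k S (%x. frechet_derivative f (at x) b)" if "b : Basis" for b
  by (rule Suc.IH) (use Suc.prems that in fastforce)
 ultimately show ?case using assms(1) by (simp add: differentiable_on_eq_differentiable_at)
qed

text \<open>\<open>Ck_on\<close> refers to the choice operator \<open>frechet_derivative\<close>; by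
  uniqueness of derivatives any explicit derivative \<open>f'\<close> on an open set will do. The
  closure properties below go through this rule.\<close>

lemma Ck_on_SucI:
 assumes "open S" "!!x. x : S ==> (f has_derivative f' x) (at x)"
  "!!b. b : Basis ==> Ck_on k S (%x. f' x b)"
 shows "Ck_on (Suc k) S f"
proof -
 have "f differentiable_on S"
  using assms(1,2) by (auto simp: differentiable_on_eq_differentiable_at differentiable_def)
 moreover have "Ck_on k S (%x. frechet_derivative f (at x) b)" if "b : Basis" for b
  by (rule Ck_on_cong[OF assms(1) _ assms(3)[OF that]]) (use at_deriv_eq[OF assms(2)] in auto)
 ultimately show ?thesis by simp
qed

lemma Ck_on_SucD:
 assumes "open S" "Ck_on (Suc k) S f" "x : S"
 shows "(f has_derivative frechet_derivative f (at x)) (at x)"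
 using assms frechet_derivative_works by (auto simp: differentiable_on_eq_differentiable_at)

lemma Ck_on_const: "open S ==> Ck_on k S (%x. c)"
proof (induction k arbitrary: c)
 case (Suc k)
 thus ?case by (intro Ck_on_SucI[where f' = "%x h. 0"]) (auto intro!: derivative_eq_intros)
qed auto

lemma Ck_on_bounded_linear:
 assumes "open S" "bounded_linear F" shows "Ck_on k S F"
proof (cases k)
 case 0
 thus ?thesis using assms(2) by (simp add: linear_continuous_on)
next
 case (Suc j)
 show ?thesis unfolding Suc
  by (rule Ck_on_SucI[where f' = "%x h. F h"])
   (use assms in "auto intro: bounded_linear_imp_has_derivative Ck_on_const")
qed

lemma Ck_on_add:
 assumes "open S" "Ck_on k S f" "Ck_on k S g" shows "Ck_on k S (%x. f x + g x)"
 using assms(2,3)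
proof (induction k arbitrary: f g)
 case (Suc k)
 show ?case
 proof (rule Ck_on_SucI[where f' = "%x h. frechet_derivative f (at x) h + frechet_derivative g (at x) h"])
  show "((%x. f x + g x) has_derivative (%h. frechet_derivative f (at x) h + frechet_derivative g (at x) h)) (at x)"
   if "x : S" for x
   by (rule has_derivative_add[OF Ck_on_SucD[OF assms(1) Suc.prems(1) that] Ck_on_SucD[OF assms(1) Suc.prems(2) that]])
 qed (use Suc assms(1) in auto)
qed (auto intro: continuous_intros)

lemma Ck_on_compose_linear:
 assumes "open S" "bounded_linear F" "Ck_on k S f" shows "Ck_on k S (%x. F (f x))"
 using assms(3)
proof (induction k arbitrary: f)
 case 0
 thus ?case by (simp add: assms(2) linear_continuous_on_compose bounded_linear.continuous_on)
next
 case (Suc k)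
 show ?case
 proof (rule Ck_on_SucI[where f' = "%x h. F (frechet_derivative f (at x) h)"])
  show "((%x. F (f x)) has_derivative (%h. F (frechet_derivative f (at x) h))) (at x)" if "x : S" for x
   by (rule bounded_linear.has_derivative[OF assms(2) Ck_on_SucD[OF assms(1) Suc.prems that]])
 qed (use Suc assms(1) in auto)
qed

lemma Ck_on_mult:
 fixes f g :: "'a::euclidean_space => real"
 assumes "open S" "Ck_on k S f" "Ck_on k S g" shows "Ck_on k S (%x. f x * g x)"
 using assms(2,3)
proof (induction k arbitrary: f g)
 case (Suc k)
 show ?case
 proof (rule Ck_on_SucI[where f' = "%x h. f x * frechet_derivative g (at x) h + frechet_derivative f (at x) h * g x"])
  show "Ck_on k S (%x. f x * frechet_derivative g (at x) b + frechet_derivative f (at x) b * g x)"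
   if "b : Basis" for b
   by (intro Ck_on_add Suc.IH assms) (use Suc.prems that Ck_on_Suc_imp in auto)
  show "((%x. f x * g x) has_derivative (%h. f x * frechet_derivative g (at x) h + frechet_derivative f (at x) h * g x)) (at x)"
   if "x : S" for x
   by (rule has_derivative_mult[OF Ck_on_SucD[OF assms(1) Suc.prems(1) that] Ck_on_SucD[OF assms(1) Suc.prems(2) that]])
 qed (rule assms)
qed (auto intro: continuous_intros)

lemma Ck_on_sum:
 assumes "open S" "!!i. i : I ==> Ck_on k S (f i)"
 shows "Ck_on k S (%x. SUM i:I. f i x)"
 using assms(2)
proof (induction I rule: infinite_finite_induct)
 case (insert i I) thus ?case using Ck_on_add[OF assms(1), of k "f i"] by simp
qed (auto intro: Ck_on_const assms(1))

text \<open>Expanding the inner derivative in the basis writes the derivative of the composite as a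
  finite sum of products, so the induction closes under \<open>Ck_on_mult\<close> and
  \<open>Ck_on_sum\<close>. \<open>f\<close> varies in the induction because its partial derivatives
  take its place.\<close>

lemma Ck_on_compose:
 fixes f :: "'b::euclidean_space => real" and T :: "'a::euclidean_space => 'b"
 assumes "open S" "open S'" "Ck_on k S' f" "Ck_on k S T" "T ` S <= S'"
 shows "Ck_on k S (%x. f (T x))"
 using assms(3,4)
proof (induction k arbitrary: f)
 case 0
 thus ?case using assms(5) by (auto intro: continuous_on_compose2)
next
 case (Suc k)
 let ?T' = "%x. frechet_derivative T (at x)" and ?f' = "%x. frechet_derivative f (at x)"
 show ?case
 proof (rule Ck_on_SucI[where f' = "%x h. SUM c:Basis. (?T' x h \<bullet> c) * ?f' (T x) c"])
  fix x assume x: "x : S"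
  have T: "(T has_derivative ?T' x) (at x)" using Ck_on_SucD[OF assms(1) Suc.prems(2) x] .
  have f: "(f has_derivative ?f' (T x)) (at (T x))"
   using Ck_on_SucD[OF assms(2) Suc.prems(1)] assms(5) x by auto
  have lin: "linear (?f' (T x))" using f has_derivative_linear by blast
  have "((%x. f (T x)) has_derivative (%h. ?f' (T x) (?T' x h))) (at x)"
   using has_derivative_compose[OF T f] by simp
  moreover have "?f' (T x) (?T' x h) = (SUM c:Basis. (?T' x h \<bullet> c) * ?f' (T x) c)" for h
   by (subst (1) euclidean_representation[of "?T' x h", symmetric])
    (simp add: linear_sum[OF lin] linear_scale[OF lin] del: euclidean_representation)
  ultimately show "((%x. f (T x)) has_derivative (%h. SUM c:Basis. (?T' x h \<bullet> c) * ?f' (T x) c)) (at x)"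
   by simp
 next
  fix b :: 'a assume b: "b : Basis"
  show "Ck_on k S (%x. SUM c:Basis. (?T' x b \<bullet> c) * ?f' (T x) c)"
  proof (intro Ck_on_sum Ck_on_mult assms)
   fix c :: 'b assume c: "c : Basis"
   show "Ck_on k S (%x. ?T' x b \<bullet> c)"
    by (rule Ck_on_compose_linear[OF assms(1) bounded_linear_inner_left]) (use Suc.prems b in auto)
   show "Ck_on k S (%x. ?f' (T x) c)"
    using Suc.IH[of "%y. ?f' y c"] Suc.prems c Ck_on_Suc_imp by auto
  qed
 qed (rule assms)
qed

lemma smooth_on_cong: "open S ==> smooth_on S f ==> (!!x. x : S ==> f x = g x) ==> smooth_on S g"
 unfolding smooth_on_def using Ck_on_cong[of S f g] by simp

lemma smooth_on_continuous: "smooth_on S f ==> continuous_on S f"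
 unfolding smooth_on_def using Ck_on_continuous by blast

lemma smooth_on_subset: "smooth_on S f ==> T <= S ==> smooth_on T f"
 unfolding smooth_on_def using Ck_on_subset by blast

lemma smooth_on_local:
 "open S ==> (!!x. x : S ==> EX T. open T & x : T & smooth_on T f) ==> smooth_on S f"
 unfolding smooth_on_def using Ck_on_local[of S _ f] by meson

lemma smooth_on_const: "open S ==> smooth_on S (%x. c)"
 unfolding smooth_on_def by (simp add: Ck_on_const)

lemma smooth_on_linear: "open S ==> bounded_linear F ==> smooth_on S F"
 unfolding smooth_on_def by (simp add: Ck_on_bounded_linear)

lemma smooth_on_id: "open S ==> smooth_on S (%x. x)"
 by (rule smooth_on_linear) auto

lemma smooth_on_nth: "open S ==> smooth_on S (%x. x $ i)"
 by (rule smooth_on_linear) (auto intro: bounded_linear_vec_nth)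

lemma smooth_on_compose_linear: "open S ==> bounded_linear F ==> smooth_on S f ==> smooth_on S (%x. F (f x))"
 unfolding smooth_on_def by (blast intro: Ck_on_compose_linear)

lemma smooth_on_add: "open S ==> smooth_on S f ==> smooth_on S g ==> smooth_on S (%x. f x + g x)"
 unfolding smooth_on_def by (blast intro: Ck_on_add)

lemma smooth_on_uminus: "open S ==> smooth_on S f ==> smooth_on S (%x. - f x)"
 using smooth_on_compose_linear[OF _ bounded_linear_minus[OF bounded_linear_ident]] .

lemma smooth_on_diff: "open S ==> smooth_on S f ==> smooth_on S g ==> smooth_on S (%x. f x - g x)"
 using smooth_on_add[of S f "%x. - g x"] smooth_on_uminus[of S g] by simp

lemma smooth_on_mult:
 fixes f g :: "'a::euclidean_space => real"
 shows "open S ==> smooth_on S f ==> smooth_on S g ==> smooth_on S (%x. f x * g x)"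
 unfolding smooth_on_def by (simp add: Ck_on_mult)

lemma smooth_on_power:
 fixes f :: "'a::euclidean_space => real"
 shows "open S ==> smooth_on S f ==> smooth_on S (%x. f x ^ n)"
 by (induction n) (auto intro: smooth_on_mult smooth_on_const)

lemma smooth_on_sum:
 "open S ==> (!!i. i : I ==> smooth_on S (f i)) ==> smooth_on S (%x. SUM i:I. f i x)"
 unfolding smooth_on_def using Ck_on_sum[of S I _ f] by meson

lemma smooth_on_prod:
 fixes f :: "'i => 'a::euclidean_space => real"
 assumes "open S" "!!i. i : I ==> smooth_on S (f i)"
 shows "smooth_on S (%x. PROD i:I. f i x)"
 using assms(2)
proof (induction I rule: infinite_finite_induct)
 case (insert i I) thus ?case using smooth_on_mult[OF assms(1), of "f i"] by simp
qed (auto intro: smooth_on_const assms(1))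

lemma smooth_on_compose:
 fixes f :: "'b::euclidean_space => real" and T :: "'a::euclidean_space => 'b"
 assumes "open S" "open S'" "smooth_on S' f" "smooth_on S T" "T ` S <= S'"
 shows "smooth_on S (%x. f (T x))"
 using assms Ck_on_compose unfolding smooth_on_def by blast

lemmas smooth_intros = smooth_on_const smooth_on_id smooth_on_nth smooth_on_add smooth_on_diff
 smooth_on_uminus smooth_on_mult smooth_on_power smooth_on_sum smooth_on_prod

lemma Ck_on_real_SucI:
 fixes f f' :: "real => real"
 assumes "open S" "!!x. x : S ==> (f has_real_derivative f' x) (at x)" "Ck_on k S f'"
 shows "Ck_on (Suc k) S f"
 by (rule Ck_on_SucI[where f' = "%x h. h * f' x"])
  (use assms in \<open>auto simp: has_field_derivative_def mult.commute[of _ "f' _"]\<close>)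

lemma smooth_on_exp: "open S ==> smooth_on S (exp :: real => real)"
proof -
 assume S: "open S"
 have "Ck_on k S (exp :: real => real)" for k
  by (induction k) (auto intro!: Ck_on_real_SucI[OF S] continuous_intros simp del: Ck_on.simps(2)
   intro: DERIV_exp)
 thus ?thesis by (simp add: smooth_on_def)
qed

text \<open>Differentiation only changes the exponent and a constant factor, hence the induction
  with \<open>a\<close> arbitrary. The exponents -1 and 1/2 give reciprocals and square
  roots.\<close>

lemma smooth_on_powr: "smooth_on {0<..} (%x::real. x powr a)"
proof -
 have "Ck_on k {0<..} (%x::real. x powr a)" for k
 proof (induction k arbitrary: a)
  case 0 thus ?case by (auto intro!: continuous_intros)
 next
  case (Suc k)
  have "Ck_on k {0<..} (%x::real. a * x powr (a - 1))"
   by (intro Ck_on_mult Ck_on_const Suc) auto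
  thus ?case
   by (intro Ck_on_real_SucI[where f' = "%x. a * x powr (a - 1)"]) (auto intro!: derivative_eq_intros)
 qed
 thus ?thesis by (simp add: smooth_on_def)
qed

lemma smooth_on_inverse:
 fixes f :: "'a::euclidean_space => real"
 assumes "open S" "smooth_on S f" "!!x. x : S ==> f x > 0"
 shows "smooth_on S (%x. inverse (f x))"
proof -
 have "smooth_on S (%x. f x powr (-1))"
  by (rule smooth_on_compose[OF assms(1) _ smooth_on_powr assms(2)]) (use assms(3) in auto)
 thus ?thesis by (rule smooth_on_cong[OF assms(1)]) (use assms(3) in "auto simp: powr_minus less_imp_le")
qed

lemma smooth_on_divide:
 fixes f :: "'a::euclidean_space => real"
 assumes "open S" "smooth_on S g" "smooth_on S f" "!!x. x : S ==> f x > 0"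
 shows "smooth_on S (%x. g x / f x)"
 unfolding divide_inverse by (intro smooth_on_mult smooth_on_inverse assms)

lemma smooth_on_sqrt:
 fixes f :: "'a::euclidean_space => real"
 assumes "open S" "smooth_on S f" "!!x. x : S ==> f x > 0"
 shows "smooth_on S (%x. sqrt (f x))"
proof -
 have "smooth_on S (%x. f x powr (1/2))"
  by (rule smooth_on_compose[OF assms(1) _ smooth_on_powr assms(2)]) (use assms(3) in auto)
 thus ?thesis by (rule smooth_on_cong[OF assms(1)]) (use assms(3) in "auto simp: powr_half_sqrt less_imp_le")
qed

lemma smooth_on_exp_compose:
 fixes f :: "'a::euclidean_space => real"
 assumes "open S" "smooth_on S f" shows "smooth_on S (%x. exp (f x))"
 by (rule smooth_on_compose[OF assms(1) open_UNIV smooth_on_exp[OF open_UNIV] assms(2)]) auto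

section \<open>Partial derivatives\<close>

lemma Basis_axis: "(b::real^'n) : Basis \<longleftrightarrow> (EX i. b = axis i 1)"
 by (auto simp: Basis_vec_def)

lemma smooth_on_partial:
 fixes f :: "real^'n => real"
 assumes "smooth_on S f" shows "smooth_on S (pt i f)"
proof -
 have "Ck_on k S (pt i f)" for k
  using assms unfolding smooth_on_def partial_def
  by (metis Ck_on.simps(2) axis_in_Basis_iff real_inner_1_right inner_real_def Basis_axis)
 thus ?thesis by (simp add: smooth_on_def)
qed

lemma smooth_on_differentiable: "open S ==> smooth_on S f ==> x : S ==> f differentiable (at x)"
 unfolding smooth_on_def using Ck_on.simps(2)[of 0 S f] differentiable_on_eq_differentiable_at[of S f] by blast

lemma partial_has_derivative:
 fixes f :: "real^'n => real"
 assumes "f differentiable (at x)"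
 shows "(f has_derivative (%h. SU i. h $ i * pt i f x)) (at x)"
proof -
 have d: "(f has_derivative frechet_derivative f (at x)) (at x)"
  using assms frechet_derivative_works by blast
 hence lin: "linear (frechet_derivative f (at x))" by (rule has_derivative_linear)
 have "frechet_derivative f (at x) h = (SU i. h $ i * pt i f x)" for h
 proof -
  have "frechet_derivative f (at x) h = frechet_derivative f (at x) (SU i. h $ i *. axis i 1)"
   by (simp add: basis_expansion[of h, unfolded scalar_mult_eq_scaleR])
  also have "... = (SU i. h $ i *. frechet_derivative f (at x) (axis i 1))"
   by (simp add: linear_sum[OF lin] linear_scale[OF lin])
  finally show ?thesis by (simp add: partial_def)
 qed
 hence "frechet_derivative f (at x) = (%h. SU i. h $ i * pt i f x)" by blast
 thus ?thesis using d by simp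
qed

lemma partial_eqI:
 fixes f :: "real^'n => real"
 assumes "(f has_derivative f') (at x)" shows "pt i f x = f' (axis i 1)"
 using at_deriv_eq[OF assms] by (simp add: partial_def)

lemma partial_cong:
 fixes f :: "real^'n => real"
 assumes "open S" "x : S" "!!y. y : S ==> f y = g y"
 shows "pt i f x = pt i g x"
proof (cases "f differentiable (at x)")
 case True
 thus ?thesis unfolding partial_def
  using frechet_derivative_transform_within_open[OF True assms] by simp
next
 \<comment> \<open>If one function is not differentiable at \<open>x\<close>, neither is the other,
   and both derivatives are the same arbitrary choice from an empty predicate; the equation
   persists.\<close>
 case False
 have "~ g differentiable (at x)"
 proof
  assume "g differentiable (at x)"
  then obtain g' where "(g has_derivative g') (at x)" unfolding differentiable_def by blast
  hence "(f has_derivative g') (at x)"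
   by (rule has_derivative_transform_within_open[OF _ assms(1,2)]) (use assms(3) in auto)
  thus False using False unfolding differentiable_def by blast
 qed
 hence "!!f'. ~ (g has_derivative f') (at x)" unfolding differentiable_def by blast
 moreover have "!!f'. ~ (f has_derivative f') (at x)" using False unfolding differentiable_def by blast
 ultimately show ?thesis unfolding partial_def frechet_derivative_def by simp
qed

lemma partial_add:
 fixes f g :: "real^'n => real"
 assumes "f differentiable (at x)" "g differentiable (at x)"
 shows "pt i (%x. f x + g x) x = pt i f x + pt i g x"
 using partial_eqI[OF has_derivative_add[OF partial_has_derivative[OF assms(1)] partial_has_derivative[OF assms(2)]], of i]
  partial_eqI[OF partial_has_derivative[OF assms(1)], of i] partial_eqI[OF partial_has_derivative[OF assms(2)], of i]
 by simp

lemma partial_diff: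
 fixes f g :: "real^'n => real"
 assumes "f differentiable (at x)" "g differentiable (at x)"
 shows "pt i (%x. f x - g x) x = pt i f x - pt i g x"
 using partial_eqI[OF has_derivative_diff[OF partial_has_derivative[OF assms(1)] partial_has_derivative[OF assms(2)]], of i]
  partial_eqI[OF partial_has_derivative[OF assms(1)], of i] partial_eqI[OF partial_has_derivative[OF assms(2)], of i]
 by simp

lemma partial_uminus:
 fixes f :: "real^'n => real"
 assumes "f differentiable (at x)"
 shows "pt i (%x. - f x) x = - pt i f x"
 using partial_eqI[OF has_derivative_minus[OF partial_has_derivative[OF assms]], of i]
  partial_eqI[OF partial_has_derivative[OF assms], of i] by simp

lemma partial_mult:
 fixes f g :: "real^'n => real"
 assumes "f differentiable (at x)" "g differentiable (at x)"
 shows "pt i (%x. f x * g x) x = f x * pt i g x + pt i f x * g x"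
 using partial_eqI[OF has_derivative_mult[OF partial_has_derivative[OF assms(1)] partial_has_derivative[OF assms(2)]], of i]
  partial_eqI[OF partial_has_derivative[OF assms(1)], of i] partial_eqI[OF partial_has_derivative[OF assms(2)], of i]
 by simp

lemma partial_const [simp]: "pt i (%x. c) x = 0"
 by (rule partial_eqI[OF has_derivative_const])

lemma partial_sum:
 fixes f :: "'j => real^'n => real"
 assumes "finite J" "!!j. j : J ==> f j differentiable (at x)"
 shows "pt i (%x. SUM j:J. f j x) x = (SUM j:J. pt i (f j) x)"
 using assms
 by (induction J rule: finite_induct) (simp_all add: partial_add differentiable_sum)

lemma partial_compose_real:
 fixes f :: "real^'n => real"
 assumes "f differentiable (at x)" "(th has_real_derivative d) (at (f x))"
 shows "pt i (%x. th (f x)) x = d * pt i f x"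
proof -
 have "((%x. th (f x)) has_derivative (%h. d * (SU i. h $ i * pt i f x))) (at x)"
  using has_derivative_compose[OF partial_has_derivative[OF assms(1)]] assms(2)
  unfolding has_field_derivative_def by fastforce
 from partial_eqI[OF this, of i] partial_eqI[OF partial_has_derivative[OF assms(1)], of i]
 show ?thesis by simp
qed

lemma partial_line_derivative:
 fixes f :: "real^'n => real"
 assumes "f differentiable (at (x + t *. h))"
 shows "((%t. f (x + t *. h)) has_real_derivative (SU i. h $ i * pt i f (x + t *. h))) (at t)"
proof -
 have "((%t. f (x + t *. h)) has_derivative (%s. SU i. (s *. h) $ i * pt i f (x + t *. h))) (at t)"
  by (rule has_derivative_compose[where f = "%t. x + t *. h", OF _ partial_has_derivative[OF assms]])
   (auto intro!: derivative_eq_intros)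
 moreover have "(%s. SU i. (s *. h) $ i * pt i f (x + t *. h)) = (*) (SU i. h $ i * pt i f (x + t *. h))"
  by (auto simp: fun_eq_iff sum_distrib_left sum_distrib_right mult_ac intro!: sum.cong)
 ultimately show ?thesis unfolding has_field_derivative_def by simp
qed

lemma partial_commute:
 fixes f :: "real^'n => real"
 assumes S: "open S" "x : S" and f: "smooth_on S f"
 shows "pt i (pt j f) x = pt j (pt i f) x"
proof -
 obtain r where r: "r > 0" "ball x r <= S" using S open_contains_ball by blast
 let ?ei = "axis i 1 :: real^'n" and ?ej = "axis j 1 :: real^'n"
 have dsum: "(SU l. (axis k 1 :: real^'n) $ l * F l) = F k" for k F
  by (simp add: axis_def if_distrib[of "%z. z * _"] cong: if_cong)
 have smp: "smooth_on S (pt k f)" for k using f by (rule smooth_on_partial)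
 have dif: "f differentiable (at y)" "pt k f differentiable (at y)" if "y : S" for y k
  using smooth_on_differentiable[OF S(1)] f smp that by blast+
 have cont: "continuous_on S (pt k (pt l f))" for k l
  by (intro smooth_on_continuous smooth_on_partial f)
 text \<open>Two applications of the mean value theorem to the second difference of \<open>f\<close>.\<close>
 have key: "EX y:ball x (2 * s). f (x + s *. axis a 1 + s *. axis b 1) - f (x + s *. axis a 1) - f (x + s *. axis b 1) + f x
   = s * s * pt a (pt b f) y" if s: "0 < s" "2 * s < r" for s a b
 proof -
  let ?a = "axis a 1 :: real^'n" and ?b = "axis b 1 :: real^'n"
  have dx: "dist x (x + p *. ?a + q *. ?b) <= p + q" if "0 <= p" "0 <= q" for p q
  proof -
   have "dist x (x + p *. ?a + q *. ?b) = norm (p *. ?a + q *. ?b)"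
    by (metis add.assoc add_diff_cancel_left' dist_commute dist_norm)
   also have "... <= p + q"
    by (rule order_trans[OF norm_triangle_ineq]) (use that in simp)
   finally show ?thesis .
  qed
  have inS': "x + p *. ?a + q *. ?b : S" if "0 <= p" "p <= s" "0 <= q" "q <= s" for p q
  proof -
   have "x + p *. ?a + q *. ?b : ball x r" using dx[of p q] that s by auto
   thus ?thesis using r by auto
  qed
  have d1: "((%q. f (x + s *. ?a + q *. ?b) - f (x + q *. ?b)) has_real_derivative
    (pt b f (x + s *. ?a + q *. ?b) - pt b f (x + q *. ?b))) (at q)" if "0 <= q" "q <= s" for q
   using partial_line_derivative[OF dif(1)[OF inS'[of s q]]]
    partial_line_derivative[OF dif(1), of x q ?b] inS'[of 0 q] that s
   by (auto intro!: derivative_eq_intros simp: dsum)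
  obtain q where q: "0 < q" "q < s" and
   e1: "(f (x + s *. ?a + s *. ?b) - f (x + s *. ?b)) - (f (x + s *. ?a + 0 *. ?b) - f (x + 0 *. ?b))
    = (s - 0) * (pt b f (x + s *. ?a + q *. ?b) - pt b f (x + q *. ?b))"
   using MVT2[OF s(1) d1] by blast
  have d2: "((%p. pt b f ((x + q *. ?b) + p *. ?a)) has_real_derivative
    (pt a (pt b f) ((x + q *. ?b) + p *. ?a))) (at p)" if "0 <= p" "p <= s" for p
  proof -
   have "(x + q *. ?b) + p *. ?a : S" using inS'[of p q] that q by (simp add: add_ac)
   from partial_line_derivative[OF dif(2)[OF this]] show ?thesis by (simp add: dsum)
  qed
  obtain p where p: "0 < p" "p < s" and
   e2: "pt b f (x + q *. ?b + s *. ?a) - pt b f (x + q *. ?b + 0 *. ?a)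
    = (s - 0) * pt a (pt b f) ((x + q *. ?b) + p *. ?a)"
   using MVT2[OF s(1) d2] by blast
  have "(x + q *. ?b) + p *. ?a : ball x (2 * s)"
   using dx[of p q] p q by (simp add: add_ac)
  moreover have "f (x + s *. axis a 1 + s *. axis b 1) - f (x + s *. axis a 1) - f (x + s *. axis b 1) + f x
   = s * s * pt a (pt b f) ((x + q *. ?b) + p *. ?a)"
   using e1 e2 by (simp add: add_ac algebra_simps)
  ultimately show ?thesis by blast
 qed
 \<comment> \<open>The second difference is symmetric in the two directions, so the mixed
   derivatives agree at two suitable points within \<open>2 * s\<close> of \<open>x\<close>; letting
   \<open>s\<close> tend to 0, continuity forces equality at \<open>x\<close>.\<close>
 have ex: "EX y z. y : ball x (2 * s) & z : ball x (2 * s) & pt i (pt j f) y = pt j (pt i f) z"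
  if s: "0 < s" "2 * s < r" for s
 proof -
  obtain y where y: "y : ball x (2 * s)" "f (x + s *. ?ei + s *. ?ej) - f (x + s *. ?ei) - f (x + s *. ?ej) + f x
   = s * s * pt i (pt j f) y" using key[OF s, of i j] by auto
  obtain z where z: "z : ball x (2 * s)" "f (x + s *. ?ej + s *. ?ei) - f (x + s *. ?ej) - f (x + s *. ?ei) + f x
   = s * s * pt j (pt i f) z" using key[OF s, of j i] by auto
  have "s * s * pt i (pt j f) y = s * s * pt j (pt i f) z"
  proof -
   have c: "x + s *. ?ei + s *. ?ej = x + s *. ?ej + s *. ?ei" by simp
   show ?thesis using y(2) z(2) unfolding c by linarith
  qed
  thus ?thesis using y z s by auto
 qed
 show ?thesis
 proof (rule ccontr)
  assume ne: "~ ?thesis"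
  define e where "e = abs (pt i (pt j f) x - pt j (pt i f) x) / 2"
  have e: "e > 0" using ne by (simp add: e_def)
  have "isCont (pt i (pt j f)) x" "isCont (pt j (pt i f)) x"
   using cont S by (auto simp: continuous_on_eq_continuous_at)
  then obtain d1 d2 where d: "d1 > 0" "d2 > 0"
   "!!y. dist y x < d1 ==> abs (pt i (pt j f) y - pt i (pt j f) x) < e"
   "!!y. dist y x < d2 ==> abs (pt j (pt i f) y - pt j (pt i f) x) < e"
   using e unfolding continuous_at_eps_delta dist_real_def by metis
  define s where "s = min (min d1 d2) r / 4"
  have s: "0 < s" "2 * s < r" "2 * s < d1" "2 * s < d2" using d r by (auto simp: s_def)
  obtain y z where "y : ball x (2 * s)" "z : ball x (2 * s)"
   "pt i (pt j f) y = pt j (pt i f) z" using ex[OF s(1,2)] by blast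
  thus False using d(3)[of y] d(4)[of z] s e_def by (auto simp: dist_commute abs_if split: if_splits)
 qed
qed

section \<open>Flat functions, bumps and cutoffs\<close>

definition flat :: "nat => real => real" where
 "flat m x = (if x > 0 then inverse x ^ m * exp (- inverse x) else 0)"

lemma flat_pos: "x > 0 ==> flat m x > 0" and flat_zero: "x <= 0 ==> flat m x = 0"
 and flat_nonneg: "flat m x >= 0"
 by (auto simp: flat_def)

lemma power_le_fact_exp: "0 <= y ==> y ^ k <= fact k * exp (y::real)"
proof -
 assume y: "0 <= y"
 have "(SUM n:{k}. y ^ n /\<^sub>R fact n) <= (\<Sum>n. y ^ n /\<^sub>R fact n)"
  by (rule sum_le_suminf) (use y summable_exp_generic[of y] in auto)
 thus ?thesis by (simp add: exp_def field_simps)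
qed

text \<open>With \<open>y = 1 / x\<close>, the bound
  \<open>y ^ (m + 2) <= fact (m + 2) * exp y\<close> leaves two spare powers of \<open>x\<close>.
  This makes the difference quotient of \<open>flat m\<close> at 0 tend to 0.\<close>

lemma flat_le_square: "abs (flat m x) <= fact (m + 2) * x^2"
proof (cases "x > 0")
 case True
 define y where "y = inverse x"
 define K :: real where "K = fact (m + 2)"
 have y: "y > 0" "y * x = 1" using True by (auto simp: y_def)
 have "y ^ (m + 2) <= K * exp y" unfolding K_def using y by (intro power_le_fact_exp) simp
 hence "y ^ (m + 2) * exp (- y) <= K" by (simp add: exp_minus field_simps)
 hence "y ^ (m + 2) * exp (- y) * x^2 <= K * x^2" by (rule mult_right_mono) simp
 also have "y ^ (m + 2) * exp (- y) * x^2 = (y ^ m * exp (- y)) * (y * x)^2"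
  by (simp add: power_add power_mult_distrib power2_eq_square mult_ac)
 finally have "inverse x ^ m * exp (- inverse x) <= fact (m + 2) * x^2"
  unfolding y(2) unfolding y_def K_def by simp
 thus ?thesis using True by (simp add: flat_def)
qed (simp add: flat_def)

text \<open>The negative powers of \<open>x\<close> are built into the family so that it is closed
  under differentiation; smoothness is then a single induction over all \<open>m\<close> at
  once.\<close>

lemma flat_deriv: "(flat m has_real_derivative flat (m + 2) x - m * flat (m + 1) x) (at x)"
proof -
 consider "x > 0" | "x < 0" | "x = 0" by linarith
 thus ?thesis
 proof cases
  case 1
  have "((%x. inverse x ^ m * exp (- inverse x)) has_real_derivative flat (m + 2) x - m * flat (m + 1) x) (at x)"
  proof (rule DERIV_cong)
   show "((%x. inverse x ^ m * exp (- inverse x)) has_real_derivative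
     real m * inverse x ^ (m - 1) * - (inverse x)\<^sup>2 * exp (- inverse x) + inverse x ^ m * (exp (- inverse x) * (inverse x)^2)) (at x)"
    using 1 by (auto intro!: derivative_eq_intros simp: power2_eq_square divide_inverse)
   show "real m * inverse x ^ (m - 1) * - (inverse x)\<^sup>2 * exp (- inverse x) + inverse x ^ m * (exp (- inverse x) * (inverse x)^2)
     = flat (m + 2) x - m * flat (m + 1) x"
    using 1 by (cases m) (simp_all add: flat_def power2_eq_square)
  qed
  thus ?thesis
   by (rule has_field_derivative_transform_within_open[of _ _ _ "{0<..}"]) (use 1 in "auto simp: flat_def")
 next
  case 2
  have "((%x. 0) has_real_derivative flat (m + 2) x - m * flat (m + 1) x) (at x)"
   using 2 by (auto simp: flat_def)
  thus ?thesis
   by (rule has_field_derivative_transform_within_open[of _ _ _ "{..<0}"]) (use 2 in "auto simp: flat_def")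
 next
  case 3
  have "((%h. flat m h / h) \<longlongrightarrow> 0) (at 0)"
  proof (rule Lim_null_comparison)
   have "norm (flat m h / h) <= fact (m + 2) * abs h" if "h ~= 0" for h
   proof -
    define K :: real where "K = fact (m + 2)"
    have "abs (flat m h) <= K * abs h * abs h" using flat_le_square[of m h] by (simp add: K_def power2_eq_square mult.assoc del: fact_Suc)
    thus ?thesis using that unfolding K_def[symmetric] by (simp add: divide_le_eq)
   qed
   thus "\<forall>\<^sub>F h in at 0. norm (flat m h / h) <= fact (m + 2) * abs h"
    by (auto simp: eventually_at_filter)
   have "((%h::real. fact (m + 2) * abs h) \<longlongrightarrow> fact (m + 2) * abs 0) (at 0)"
    by (intro tendsto_intros)
   thus "((%h::real. fact (m + 2) * abs h) \<longlongrightarrow> 0) (at 0)" by simp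
  qed
  thus ?thesis using 3 by (simp add: DERIV_def flat_def)
 qed
qed

lemma smooth_on_flat: "smooth_on UNIV (flat m)"
proof -
 have "Ck_on k UNIV (flat m)" for k
 proof (induction k arbitrary: m)
  case 0
  show ?case by (simp add: continuous_on_eq_continuous_at DERIV_isCont[OF flat_deriv])
 next
  case (Suc k)
  have "Ck_on k UNIV (%x. flat (m + 2) x + (- real m) * flat (m + 1) x)"
   by (intro Ck_on_add Ck_on_mult Ck_on_const Suc) auto
  thus ?case by (intro Ck_on_real_SucI[OF _ flat_deriv]) auto
 qed
 thus ?thesis by (simp add: smooth_on_def)
qed

lemma smooth_on_flat_compose:
 fixes f :: "'a::euclidean_space => real"
 assumes "open S" "smooth_on S f" shows "smooth_on S (%x. flat m (f x))"
 by (rule smooth_on_compose[OF assms(1) open_UNIV smooth_on_flat assms(2)]) auto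

lemma smooth_on_dist_square: "open S ==> smooth_on S (%x::real^'n. (dist a x)^2)"
proof -
 assume S: "open S"
 have "smooth_on S (%x::real^'n. SU i. (a $ i - x $ i)^2)"
  by (intro smooth_intros S)
 thus ?thesis
  by (simp add: dist_norm norm_vec_def L2_set_def sum_nonneg)
qed

definition bump :: "real^'n => real => real^'n => real" where
 "bump a r x = flat 0 (r^2 - (dist a x)^2)"

lemma smooth_bump: "open S ==> smooth_on S (bump a r)"
 unfolding bump_def by (intro smooth_on_flat_compose smooth_intros smooth_on_dist_square) auto

lemma bump_nonneg: "bump a r x >= 0"
 by (simp add: bump_def flat_nonneg)

lemma bump_pos_iff: "r > 0 ==> bump a r x > 0 \<longleftrightarrow> x : ball a r"
proof -
 assume "r > 0"
 hence "r^2 - (dist a x)^2 > 0 \<longleftrightarrow> dist a x < r"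
  using power2_less_imp_less[of "dist a x" r] power_strict_mono[of "dist a x" r 2] by auto
 thus ?thesis unfolding bump_def using flat_pos[of _ 0] flat_zero[of _ 0] by (metis less_irrefl linorder_not_le mem_ball)
qed

lemma bump_zero: "r > 0 ==> x ~: ball a r ==> bump a r x = 0"
 using bump_pos_iff[of r a x] bump_nonneg[of a r x] by auto

text \<open>The quotient \<open>f / (f + g)\<close> of two flat functions: \<open>f\<close> vanishes
  outside the ball of radius \<open>r\<close>, \<open>g\<close> inside that of radius
  \<open>s\<close>. Since \<open>s < r\<close> they have no common zero.\<close>

lemma exists_cutoff:
 fixes a :: "real^'n"
 assumes "0 < s" "s < r"
 obtains xx :: "real^'n => real" where "smooth_on UNIV xx" "!!x. 0 <= xx x" "!!x. xx x <= 1"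
  "!!x. x : cball a s ==> xx x = 1" "!!x. x ~: ball a r ==> xx x = 0"
proof -
 let ?f = "%x. flat 0 (r^2 - (dist a x)^2)" and ?g = "%x. flat 0 ((dist a x)^2 - s^2)"
 let ?c = "%x. ?f x / (?f x + ?g x)"
 have sr: "s^2 < r^2" using assms by (simp add: power_strict_mono)
 have pos: "?f x + ?g x > 0" for x
 proof (cases "(dist a x)^2 < r^2")
  case True thus ?thesis using flat_pos[of "r^2 - (dist a x)^2" 0] flat_nonneg[of 0 "(dist a x)^2 - s^2"] by linarith
 next
  case False thus ?thesis using sr flat_pos[of "(dist a x)^2 - s^2" 0] flat_nonneg[of 0 "r^2 - (dist a x)^2"] by linarith
 qed
 have 1: "smooth_on UNIV ?c"
  by (intro smooth_on_divide smooth_on_flat_compose smooth_intros smooth_on_dist_square pos) auto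
 have 2: "0 <= ?c x" "?c x <= 1" for x
  using pos[of x] flat_nonneg[of 0 "r^2 - (dist a x)^2"] flat_nonneg[of 0 "(dist a x)^2 - s^2"] by auto
 have 3: "?c x = 1" if "x : cball a s" for x
 proof -
  have "(dist a x)^2 <= s^2" using that assms by (simp add: power_mono)
  thus ?thesis using pos[of x] by (simp add: flat_zero)
 qed
 have 4: "?c x = 0" if "x ~: ball a r" for x
 proof -
  have "r^2 <= (dist a x)^2" using that assms by (simp add: power_mono)
  thus ?thesis by (simp add: flat_zero)
 qed
 show thesis by (rule that[of ?c, OF 1 2 3 4])
qed

section \<open>Invariance of Lebesgue measure and Taylor estimates\<close>

lemma integral_translation:
 fixes f :: "real^'n => real"
 shows "(LI x. f (x + h)) = (LI x. f x)"
proof -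
 have "(LI x. f x) = (\<integral>x. f x \<partial>distr lborel borel ((+) h))"
  by (simp add: lborel_distr_plus)
 also have "... = (LI x. f (h + x))"
 proof (cases "f : bmb")
  case True thus ?thesis by (subst integral_distr) auto
 next
  \<comment> \<open>Without measurability neither side is integrable, and both integrals are 0 by
    convention.\<close>
  case False
  have 1: "~ integrable (distr lborel borel ((+) h)) f"
   using False by (auto simp: lborel_distr_plus dest: borel_measurable_integrable)
  have "~ integrable lborel (%x. f (h + x))"
  proof
   assume "integrable lborel (%x. f (h + x))"
   hence [measurable]: "(%x. f (h + x)) : bmb" by (auto dest: borel_measurable_integrable)
   have "(%x. f (h + (x - h))) : bmb"
    by (rule measurable_compose[where g = "%x. f (h + x)" and N = borel]) measurable
   thus False using False by simp
  qed
  thus ?thesis using 1 by (simp add: not_integrable_integral_eq)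
 qed
 finally show ?thesis by (simp add: add.commute)
qed

lemma nn_integral_affine:
 fixes f :: "real^'n => ennreal"
 assumes [measurable]: "f : bmb" and c: "c ~= 0"
 shows "(NN x. f x) = enn (abs c ^ CARD('n)) * (NN x. f (t + c *. x))"
 by (subst lborel_affine[OF c, of t])
  (simp add: nn_integral_density nn_integral_distr nn_integral_cmult ennreal_power)

lemma nn_integral_translation:
 fixes f :: "real^'n => ennreal"
 assumes "f : bmb"
 shows "(NN x. f (t + x)) = (NN x. f x)"
 using nn_integral_affine[OF assms, of 1 t] by simp

lemma integral_affine:
 fixes f :: "real^'n => real"
 assumes [measurable]: "f : bmb" and c: "c ~= 0"
 shows "(LI x. f x) = (abs c ^ CARD('n)) * (LI x. f (t + c *. x))"
proof -
 have "(LI x. f x) = (\<integral>x. f x \<partial>density (distr lborel borel (%x. t + c *. x)) (%_. enn (abs c ^ CARD('n))))"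
  using lborel_affine[OF c, of t] by (simp add: ennreal_power)
 also have "... = (LI x. abs c ^ CARD('n) * f (t + c *. x))"
  by (subst integral_density) (auto simp: integral_distr)
 finally show ?thesis by simp
qed

lemma sum_axis [simp]: "(SU i. axis k (1::real) $ i * F i) = F k"
 by (simp add: axis_def if_distrib[of "%z. z * _"] cong: if_cong)

lemma abs_sum_le_card:
 fixes f :: "'n::finite => real"
 shows "(!!i. abs (f i) <= c) ==> abs (SU i. f i) <= real CARD('n) * c"
 using sum_norm_bound[of UNIV f c] by simp

text \<open>The mean value theorem is used twice along the segment, and each of the two sums over
  coordinates costs a factor \<open>CARD('n)\<close>. The constant is crude; only the quadratic
  order in \<open>h\<close> matters.\<close>

lemma Taylor_second_order:
 fixes f :: "real^'n => real"
 assumes S: "open S" "convex S" and f: "smooth_on S f"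
  and M: "!!i j y. y : S ==> abs (pt i (pt j f) y) <= M" and x: "x : S" "x + h : S"
 shows "abs (f (x + h) - f x - (SU i. h $ i * pt i f x)) <= (real CARD('n))^2 * M * (norm h)^2"
proof -
 have M0: "0 <= M" using M[OF x(1)] abs_ge_zero order_trans by blast
 have seg: "x + t *. h : S" if "0 <= t" "t <= 1" for t
 proof -
  have "x + t *. h = (1 - t) *. x + t *. (x + h)" by (simp add: algebra_simps)
  thus ?thesis using convexD[OF S(2) x, of "1 - t" t] that by simp
 qed
 have dif: "f differentiable (at y)" "pt k f differentiable (at y)" if "y : S" for y k
  using smooth_on_differentiable[OF S(1)] f smooth_on_partial[OF f] that by blast+
 have hi: "abs (h $ i) <= norm h" for i by (rule component_le_norm_cart)
 obtain t where t: "0 < t" "t < 1" "f (x + 1 *. h) - f (x + 0 *. h) = (1 - 0) * (SU i. h $ i * pt i f (x + t *. h))"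
  using MVT2[OF zero_less_one partial_line_derivative[OF dif(1)[OF seg]]] by blast
 have b: "abs (pt i f (x + t *. h) - pt i f x) <= real CARD('n) * (norm h * M)" for i
 proof -
  obtain s where s: "0 < s" "s < t" "pt i f (x + t *. h) - pt i f (x + 0 *. h) = (t - 0) * (SU j. h $ j * pt j (pt i f) (x + s *. h))"
   using MVT2[OF t(1) partial_line_derivative[OF dif(2)[OF seg]]] t by auto
  have "abs (SU j. h $ j * pt j (pt i f) (x + s *. h)) <= real CARD('n) * (norm h * M)"
   by (rule abs_sum_le_card) (use M seg s t hi in "auto simp: abs_mult intro!: mult_mono")
  moreover have "abs (pt i f (x + t *. h) - pt i f x) <= 1 * abs (SU j. h $ j * pt j (pt i f) (x + s *. h))"
   using s(3) t by (simp add: abs_mult) (intro mult_left_le_one_le, auto)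
  ultimately show ?thesis by simp
 qed
 have "f (x + h) - f x - (SU i. h $ i * pt i f x) = (SU i. h $ i * (pt i f (x + t *. h) - pt i f x))"
  using t(3) by (simp add: sum_subtractf algebra_simps)
 also have "abs (...) <= real CARD('n) * (norm h * (real CARD('n) * (norm h * M)))"
  by (rule abs_sum_le_card) (use b hi in "auto simp: abs_mult intro!: mult_mono")
 finally show ?thesis by (simp add: power2_eq_square mult_ac)
qed

text \<open>A quadratic remainder bound survives integration over a parameter and passage to a
  limit. Derivatives under the integral sign (\<open>conv_has_derivative\<close>,
  \<open>mol_deriv\<close>) and of pointwise limits (\<open>smooth_limit\<close>) are obtained in
  this way.\<close>

lemma has_derivative_quadratic:
 fixes f :: "'a::real_normed_vector => real"
 assumes L: "bounded_linear L" and r: "r > 0"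
  and q: "!!h. norm h < r ==> abs (f (x + h) - f x - L h) <= C * (norm h)^2"
 shows "(f has_derivative L) (at x)"
 unfolding has_derivative_at
proof (rule conjI[OF L], rule Lim_null_comparison)
 have "norm (norm (f (x + h) - f x - L h) / norm h) <= C * norm h" if "h ~= 0" "norm h < r" for h
  using q[OF that(2)] that by (simp add: divide_le_eq power2_eq_square mult.assoc)
 thus "\<forall>\<^sub>F h in at 0. norm (norm (f (x + h) - f x - L h) / norm h) <= C * norm h"
  unfolding eventually_at by (intro exI[of _ r]) (use r in auto)
 have "((%h::'a. C * norm h) \<longlongrightarrow> C * norm (0::'a)) (at 0)" by (intro tendsto_intros)
 thus "((%h::'a. C * norm h) \<longlongrightarrow> 0) (at 0)" by simp
qed

section \<open>Test functions and convolution\<close>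

definition tfun :: "(real^'n => real) => bool" where
 "tfun f \<longleftrightarrow> smooth_on UNIV f & (EX R. ALL x. R < norm x --> f x = 0)"

lemma tfun_smooth: "tfun f ==> smooth_on UNIV f" by (simp add: tfun_def)

lemma tfun_differentiable: "tfun f ==> f differentiable (at x)"
 using smooth_on_differentiable[of UNIV f x] by (simp add: tfun_def)

lemma tfun_continuous: "tfun f ==> continuous_on UNIV f"
 using smooth_on_continuous by (auto simp: tfun_def)

lemma tfun_measurable: "tfun f ==> f : bmb"
 using tfun_continuous by (intro borel_measurable_continuous_onI)

lemma smooth_UNIV_measurable: "smooth_on UNIV (f :: real^'n => real) ==> f : bmb"
 by (intro borel_measurable_continuous_onI smooth_on_continuous)

lemma tfun_partial:
 fixes f :: "real^'n => real"
 shows "tfun f ==> tfun (pt i f)"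
proof -
 assume t: "tfun f"
 then obtain R where R: "!!x. R < norm x ==> f x = 0" by (auto simp: tfun_def)
 have "pt i f x = 0" if "R < norm x" for x
  using partial_cong[of "{x. R < norm x}" x f "%_. 0" i] R that open_Collect_less[of "%_. R" "norm :: real^'n => real"]
  by (auto intro: continuous_intros)
 thus ?thesis using t smooth_on_partial unfolding tfun_def by blast
qed

lemma tfun_mult: "smooth_on UNIV a ==> tfun f ==> tfun (%x. a x * f x)"
 unfolding tfun_def by (auto intro!: smooth_on_mult)

lemma tfun_cmult: "tfun f ==> tfun (%x. c * f x)"
 by (rule tfun_mult) (auto intro: smooth_on_const)

lemma tfun_add: "tfun f ==> tfun g ==> tfun (%x. f x + g x)"
proof -
 assume "tfun f" "tfun g"
 then obtain R R' where "!!x. R < norm x ==> f x = 0" "!!x. R' < norm x ==> g x = 0"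
  "smooth_on UNIV f" "smooth_on UNIV g" by (auto simp: tfun_def)
 thus ?thesis unfolding tfun_def by (auto intro!: smooth_on_add exI[of _ "max R R'"])
qed

lemma tfun_uminus: "tfun f ==> tfun (%x. - f x)"
 using tfun_cmult[of f "-1"] by simp

lemma tfun_diff: "tfun f ==> tfun g ==> tfun (%x. f x - g x)"
 using tfun_add[of f "%x. - g x"] tfun_uminus[of g] by simp

lemma tfun_sum: "finite I ==> (!!i. i : I ==> tfun (f i)) ==> tfun (%x. SUM i:I. f i x)"
proof (induction I rule: finite_induct)
 case empty thus ?case by (simp add: tfun_def smooth_on_const)
qed (simp add: tfun_add)

lemma tfun_affine:
 fixes f :: "real^'n => real"
 assumes "tfun f" "c ~= 0" shows "tfun (%y. f (a + c *. y))"
proof -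
 obtain R where R: "!!x. R < norm x ==> f x = 0" using assms by (auto simp: tfun_def)
 have s: "smooth_on UNIV (%y::real^'n. a + c *. y)"
  by (intro smooth_intros smooth_on_linear) (auto intro: bounded_linear_scaleR_right)
 have "f (a + c *. y) = 0" if "(R + norm a) / abs c < norm y" for y
 proof (rule R)
  have "R + norm a < norm (c *. y)" using that assms(2) by (simp add: divide_less_eq mult.commute)
  thus "R < norm (a + c *. y)" using norm_triangle_ineq4[of "a + c *. y" a] by simp
 qed
 thus ?thesis using smooth_on_compose[OF open_UNIV open_UNIV _ s, of f] assms(1) unfolding tfun_def by blast
qed

lemma tfun_reflect: "tfun f ==> tfun (%y. f (x - y))"
 using tfun_affine[of f "-1" x] by simp

lemma partial_affine:
 fixes f :: "real^'n => real"
 assumes "f differentiable (at (a + c *. y))"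
 shows "pt i (%y. f (a + c *. y)) y = c * pt i f (a + c *. y)"
proof -
 have "((%y. f (a + c *. y)) has_derivative (%k. SU i. (c *. k) $ i * pt i f (a + c *. y))) (at y)"
  by (rule has_derivative_compose[where f = "%y. a + c *. y", OF _ partial_has_derivative[OF assms]])
   (auto intro!: derivative_eq_intros)
 hence "pt i (%y. f (a + c *. y)) y = (SU j. (c *. (axis i 1 :: real^'n)) $ j * pt j f (a + c *. y))"
  by (rule partial_eqI)
 also have "... = (SU j. c * ((axis i 1 :: real^'n) $ j * pt j f (a + c *. y)))"
  by (simp only: vector_scaleR_component real_scaleR_def mult.assoc)
 finally show ?thesis by (simp only: sum_distrib_left[symmetric] sum_axis)
qed

lemma partial_reflect: "tfun f ==> pt i (%y. f (x - y)) y = - pt i f (x - y)"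
 using partial_affine[of f x "-1" y i] tfun_differentiable[of f] by simp

lemma tfun_bounded: assumes "tfun f" obtains M where "M >= 0" "!!x. abs (f x) <= M"
proof -
 obtain R where R: "!!x. R < norm x ==> f x = 0" using assms by (auto simp: tfun_def)
 have "compact (f ` cball 0 R)"
  by (intro compact_continuous_image continuous_on_subset[OF tfun_continuous[OF assms]]) auto
 then obtain M where M: "!!x. x : cball 0 R ==> abs (f x) <= M"
  using compact_imp_bounded[of "f ` cball 0 R"] unfolding bounded_iff by fastforce
 have "abs (f x) <= max M 0" for x using M[of x] R[of x] by (cases "R < norm x") auto
 thus thesis using that[of "max M 0"] by auto
qed

lemma tfun_bounded2: assumes "tfun f" obtains M where "M >= 0" "!!i j x. abs (pt i (pt j f) x) <= M"
proof -
 have "EX M. M >= 0 & (ALL x. abs (pt i (pt j f) x) <= M)" for i j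
  using tfun_bounded[OF tfun_partial[OF tfun_partial[OF assms]]] by metis
 then obtain M where M: "!!i j. M i j >= 0" "!!i j x. abs (pt i (pt j f) x) <= M i j" by metis
 show thesis
 proof
  show "0 <= (SU i. SU j. M i j)" by (intro sum_nonneg M)
  show "abs (pt i (pt j f) x) <= (SU i. SU j. M i j)" for i j x
  proof -
   have "M i j <= (SU j. M i j)" by (rule member_le_sum) (auto simp: M)
   also have "... <= (SU i. SU j. M i j)"
    by (rule member_le_sum[of i UNIV "%i. SU j. M i j"]) (auto simp: M intro: sum_nonneg)
   finally show ?thesis using M(2)[of i j x] by linarith
  qed
 qed
qed

lemma continuous_support_integrable:
 fixes f :: "real^'n => real"
 assumes "continuous_on UNIV f" "!!x. R < norm x ==> f x = 0"
 shows "integrable lborel f"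
proof -
 have "integrable lborel (%x. ind (cball 0 R) x *. f x)"
  by (intro borel_integrable_compact continuous_on_subset[OF assms(1)]) auto
 moreover have "(%x. ind (cball 0 R) x *. f x) = f"
  using assms(2) by (auto simp: indicator_def fun_eq_iff not_le)
 ultimately show ?thesis by simp
qed

lemma tfun_integrable: "tfun f ==> integrable lborel f"
 using continuous_support_integrable[OF tfun_continuous] unfolding tfun_def by metis

lemma integrable_bounded_mult:
 fixes W b :: "real^'n => real"
 assumes "integrable lborel W" "b : bmb" "!!x. abs (b x) <= M"
 shows "integrable lborel (%x. b x * W x)"
proof (rule Bochner_Integration.integrable_bound)
 show "integrable lborel (%x. M * abs (W x))" using assms(1) by simp
 show "AE x in lborel. norm (b x * W x) <= norm (M * abs (W x))"
 proof (rule AE_I2)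
  fix x
  have "abs (b x) * abs (W x) <= M * abs (W x)" by (rule mult_right_mono[OF assms(3)]) simp
  moreover have "0 <= M" using assms(3)[of x] by linarith
  ultimately show "norm (b x * W x) <= norm (M * abs (W x))" by (simp add: abs_mult)
 qed
qed (use assms in measurable)

lemma tfun_mult_integrable:
 assumes "tfun b" "integrable lborel W" shows "integrable lborel (%x. b x * W x)"
 using tfun_bounded[OF assms(1)] integrable_bounded_mult[OF assms(2) tfun_measurable[OF assms(1)]] by metis

text \<open>By translation invariance, the difference quotients of \<open>f\<close> have integral zero.\<close>

lemma tfun_integral_partial:
 fixes f :: "real^'n => real"
 assumes "tfun f" shows "(LI x. pt i f x) = 0"
proof -
 obtain R where R: "!!x. R < norm x ==> f x = 0" using assms by (auto simp: tfun_def)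
 obtain M where M: "M >= 0" "!!x. abs (pt i f x) <= M" using tfun_bounded[OF tfun_partial[OF assms]] by metis
 let ?e = "axis i 1 :: real^'n" and ?h = "%n. inverse (real (Suc n))"
 have ld: "((%t. f (x + t *. ?e)) has_real_derivative pt i f (x + t *. ?e)) (at t)" for x t
  using partial_line_derivative[of f x t ?e] tfun_differentiable[OF assms] by simp
 let ?G = "%n x. (f (x + ?h n *. ?e) - f x) / ?h n"
 have [measurable]: "f : bmb" "pt i f : bmb"
  by (intro tfun_measurable tfun_partial assms)+
 have "(%n. (LI x. ?G n x)) ~~> (LI x. pt i f x)"
 proof (rule integral_dominated_convergence[where w = "%x. ind (cball 0 (R + 1)) x *. M"])
  show "integrable lborel (%x::real^'n. ind (cball 0 (R + 1)) x *. M)"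
   by (rule borel_integrable_compact) auto
  show "AE x in lborel. (%n. ?G n x) ~~> pt i f x"
  proof (rule AE_I2)
   fix x
   have "((%h. (f (x + h *. ?e) - f x) / h) \<longlongrightarrow> pt i f x) (at 0)"
    using ld[of x 0] by (simp add: DERIV_def)
   moreover have "filterlim ?h (at 0) sequentially"
    by (rule filterlim_atI[OF LIMSEQ_inverse_real_of_nat]) auto
   ultimately show "(%n. ?G n x) ~~> pt i f x" by (rule filterlim_compose)
  qed
  show "AE x in lborel. norm (?G n x) <= ind (cball 0 (R + 1)) x *. M" for n
  proof (rule AE_I2)
   fix x
   have h: "0 < ?h n" "?h n <= 1" by (auto simp: inverse_le_1_iff)
   show "norm (?G n x) <= ind (cball 0 (R + 1)) x *. M"
   proof (cases "norm x <= R + 1")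
    case True
    obtain t where "f (x + ?h n *. ?e) - f (x + 0 *. ?e) = (?h n - 0) * pt i f (x + t *. ?e)"
     using MVT2[OF h(1) ld] by blast
    hence "?G n x = pt i f (x + t *. ?e)" using h by simp
    thus ?thesis using True M by (simp add: indicator_def)
   next
    case False
    have "norm x <= norm (x + ?h n *. ?e) + norm (?h n *. ?e)" using norm_triangle_ineq4[of "x + ?h n *. ?e" "?h n *. ?e"] by simp
    also have "norm (?h n *. ?e) = ?h n" using h by simp
    finally have "R < norm (x + ?h n *. ?e)" "R < norm x" using False h by linarith+
    thus ?thesis using R M by simp
   qed
  qed
 qed measurable
 moreover have "(LI x. ?G n x) = 0" for n
 proof -
  have i: "integrable lborel f" by (rule tfun_integrable[OF assms])
  have "integrable lborel (%x. f (x + ?h n *. ?e))"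
   using tfun_integrable[OF tfun_affine[OF assms, of 1 "?h n *. ?e"]] by (simp add: add.commute)
  hence "(LI x. ?G n x) = ((LI x. f (x + ?h n *. ?e)) - (LI x. f x)) / ?h n"
   using i by simp
  thus ?thesis using integral_translation[of f] by simp
 qed
 ultimately show ?thesis using LIMSEQ_unique[OF _ tendsto_const[of 0]] by simp
qed

lemma integral_by_parts:
 assumes "tfun f" "smooth_on UNIV g"
 shows "(LI x. f x * pt i g x) = - (LI x. pt i f x * g x)"
proof -
 have t: "tfun (%x. f x * g x)" using tfun_mult[OF assms(2,1)] by (simp add: mult.commute)
 have "pt i (%x. f x * g x) x = f x * pt i g x + pt i f x * g x" for x
  using partial_mult[OF tfun_differentiable[OF assms(1)] smooth_on_differentiable[OF open_UNIV assms(2)]] by simp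
 moreover have "integrable lborel (%x. f x * pt i g x)" "integrable lborel (%x. pt i f x * g x)"
  using tfun_integrable[OF tfun_mult[OF smooth_on_partial[OF assms(2)] assms(1)]]
   tfun_integrable[OF tfun_mult[OF assms(2) tfun_partial[OF assms(1)]]] by (simp_all add: mult.commute)
 ultimately show ?thesis using tfun_integral_partial[OF t, of i] by simp
qed

section \<open>Convolution with smooth kernels\<close>

definition conv :: "(real^'n => real) => (real^'n => real) => real^'n => real" where
 "conv ka W x = (LI y. ka (x - y) * W y)"

lemma conv_integrable: "tfun ka ==> integrable lborel W ==> integrable lborel (%y. ka (x - y) * W y)"
 by (rule tfun_mult_integrable[OF tfun_reflect])

text \<open>The Taylor remainder of the kernel is bounded uniformly in \<open>y\<close>, so it may
  be integrated against \<open>abs (W y)\<close>; integrability of \<open>W\<close> is all that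
  enters.\<close>

lemma conv_has_derivative:
 fixes ka :: "real^'n => real"
 assumes ka: "tfun ka" and W: "integrable lborel W"
 shows "(conv ka W has_derivative (%h. SU i. h $ i * conv (pt i ka) W x)) (at x)"
proof -
 obtain M where M: "M >= 0" "!!i j x. abs (pt i (pt j ka) x) <= M" using tfun_bounded2[OF ka] by metis
 let ?C = "(real CARD('n))^2 * M" and ?I = "(LI y. abs (W y))"
 show ?thesis
 proof (rule has_derivative_quadratic[where r = 1 and C = "?C * ?I"])
  show "bounded_linear (%h. SU i. h $ i * conv (pt i ka) W x)"
   by (intro bounded_linear_intros bounded_linear_compose[OF bounded_linear_mult_left bounded_linear_vec_nth])
  fix h :: "real^'n"
  have i1: "integrable lborel (%y. ka (x - y) * W y)" "integrable lborel (%y. pt i ka (x - y) * W y)" for x i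
   by (intro conv_integrable ka W tfun_partial)+
  have "conv ka W (x + h) - conv ka W x - (SU i. h $ i * conv (pt i ka) W x)
    = (LI y. (ka (x + h - y) - ka (x - y) - (SU i. h $ i * pt i ka (x - y))) * W y)"
  proof -
   have eq: "(ka (x + h - y) - ka (x - y) - (SU i. h $ i * pt i ka (x - y))) * W y
    = ka (x + h - y) * W y - ka (x - y) * W y - (SU i. h $ i * (pt i ka (x - y) * W y))" for y
    by (simp only: left_diff_distrib sum_distrib_right mult.assoc)
   have 1: "integrable lborel (%y. h $ i * (pt i ka (x - y) * W y))" for i
    by (rule integrable_mult_right) (rule i1(2))
   show ?thesis unfolding eq conv_def
    by (subst Bochner_Integration.integral_diff Bochner_Integration.integral_sum,
      (intro Bochner_Integration.integrable_diff Bochner_Integration.integrable_sum i1(1) 1)+)+ simp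
  qed
  also have "abs (...) <= (LI y. ?C * (norm h)^2 * abs (W y))"
  proof (rule order_trans[OF integral_abs_bound], rule integral_mono_AE')
   show "AE y in lborel. abs ((ka (x + h - y) - ka (x - y) - (SU i. h $ i * pt i ka (x - y))) * W y) <= ?C * (norm h)^2 * abs (W y)"
   proof (rule AE_I2)
    fix y
    have "abs (ka (x - y + h) - ka (x - y) - (SU i. h $ i * pt i ka (x - y))) <= ?C * (norm h)^2"
     by (rule Taylor_second_order[OF open_UNIV convex_UNIV tfun_smooth[OF ka] M(2)]) auto
    moreover have "x - y + h = x + h - y" by simp
    ultimately show "abs ((ka (x + h - y) - ka (x - y) - (SU i. h $ i * pt i ka (x - y))) * W y) <= ?C * (norm h)^2 * abs (W y)"
     unfolding abs_mult by (intro mult_right_mono) auto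
   qed
  qed (use W M in auto)
  finally show "abs (conv ka W (x + h) - conv ka W x - (SU i. h $ i * conv (pt i ka) W x)) <= ?C * ?I * (norm h)^2"
   by (simp add: mult_ac)
 qed simp
qed

lemma partial_conv:
 assumes "tfun ka" "integrable lborel W"
 shows "pt i (conv ka W) = conv (pt i ka) W"
 using partial_eqI[OF conv_has_derivative[OF assms], of i]
 by (auto simp: fun_eq_iff)

lemma smooth_on_conv:
 assumes "tfun ka" "integrable lborel W" shows "smooth_on UNIV (conv ka W)"
proof -
 have "Ck_on k UNIV (conv ka W)" for k using assms(1)
 proof (induction k arbitrary: ka)
  case 0
  thus ?case
   using has_derivative_continuous[OF conv_has_derivative[OF 0 assms(2)]] by (simp add: continuous_on_eq_continuous_at)
 next
  case (Suc k)
  show ?case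
   by (rule Ck_on_SucI[OF open_UNIV conv_has_derivative[OF Suc.prems assms(2)]])
    (auto simp: Basis_axis intro!: Suc.IH tfun_partial Suc.prems)
 qed
 thus ?thesis by (simp add: smooth_on_def)
qed

lemma conv_support:
 assumes "!!x. r < norm x ==> ka x = 0" "!!x. R < norm x ==> W x = 0" "r + R < norm x"
 shows "conv ka W x = 0"
proof -
 have "ka (x - y) * W y = 0" for y
 proof -
  have "r < norm (x - y) \<or> R < norm y"
   using norm_triangle_ineq[of "x - y" y] assms(3) by simp linarith
  thus ?thesis using assms(1,2) by auto
 qed
 hence "(%y. ka (x - y) * W y) = (%y. 0)" by blast
 thus ?thesis by (simp add: conv_def)
qed

lemma tfun_conv:
 assumes "tfun ka" "integrable lborel W" "!!x. R < norm x ==> W x = 0"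
 shows "tfun (conv ka W)"
proof -
 obtain r where "!!x. r < norm x ==> ka x = 0" using assms by (auto simp: tfun_def)
 hence "conv ka W x = 0" if "r + R < norm x" for x using conv_support[of r ka R W x] assms(3) that by blast
 thus ?thesis using smooth_on_conv[OF assms(1,2)] unfolding tfun_def by blast
qed

lemma conv_partial_swap:
 assumes "tfun ka" "tfun W" shows "conv (pt i ka) W = conv ka (pt i W)"
proof
 fix x
 have "conv (pt i ka) W x = - (LI y. pt i (%y. ka (x - y)) y * W y)"
  by (simp add: conv_def partial_reflect[OF assms(1)])
 also have "... = conv ka (pt i W) x"
  using integral_by_parts[OF tfun_reflect[OF assms(1)] tfun_smooth[OF assms(2)], of x i]
  by (simp add: conv_def)
 finally show "conv (pt i ka) W x = conv ka (pt i W) x" .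
qed

section \<open>Local square norms, kernels of small support, mollifiers\<close>

lemma measurable_balls [measurable]:
 "ball (a::real^'n) s : sets borel" "cball a s : sets borel"
 by auto

text \<open>A squared L2 norm, kept in \<open>ennreal\<close> so that Fatou's lemma and Fubini's
  theorem apply without prior integrability.\<close>

definition N2 :: "real^'n => real => (real^'n => real) => ennreal" where
 "N2 a s W = (NN y. ind (ball a s) y * enn ((W y)^2))"

lemma N2_mono: "s <= s' ==> N2 a s W <= N2 a s' W"
 unfolding N2_def by (intro nn_integral_mono mult_right_mono) (auto simp: indicator_def)

lemma N2_le:
 assumes "!!x. x : ball a s ==> (V x)^2 <= c * (W x)^2" "W : bmb" "c >= 0"
 shows "N2 a s V <= enn c * N2 a s W"
proof -
 have "N2 a s V <= (NN y. enn c * (ind (ball a s) y * enn ((W y)^2)))"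
  unfolding N2_def
 proof (rule nn_integral_mono)
  fix x
  show "ind (ball a s) x * enn ((V x)^2) <= enn c * (ind (ball a s) x * enn ((W x)^2))"
   using assms(1)[of x] assms(3) by (cases "x : ball a s") (auto simp: ennreal_mult[symmetric] intro!: ennreal_leI)
 qed
 also note [measurable] = assms(2)
 have "(NN y. enn c * (ind (ball a s) y * enn ((W y)^2))) = enn c * N2 a s W"
  unfolding N2_def by (rule nn_integral_cmult) measurable
 finally show ?thesis .
qed

lemma N2_cong: "(!!x. x : ball a s ==> V x = W x) ==> N2 a s V = N2 a s W"
 unfolding N2_def by (intro nn_integral_cong) (auto simp: indicator_def)

lemma N2_add:
 assumes [measurable]: "V : bmb" "W : bmb"
 shows "N2 a s (%x. V x + W x) <= 2 * N2 a s V + 2 * N2 a s W"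
proof -
 have sq: "(v + w)^2 <= 2 * v^2 + 2 * w^2" for v w :: real
  using zero_le_power2[of "v - w"] by (simp add: power2_eq_square algebra_simps)
 have "N2 a s (%x. V x + W x) <= (NN y. 2 * (ind (ball a s) y * enn ((V y)^2)) + 2 * (ind (ball a s) y * enn ((W y)^2)))"
  unfolding N2_def
 proof (rule nn_integral_mono)
  fix x
  have "enn ((V x + W x)^2) <= 2 * enn ((V x)^2) + 2 * enn ((W x)^2)"
   using ennreal_leI[OF sq[of "V x" "W x"]] by (simp add: ennreal_mult)
  thus "ind (ball a s) x * enn ((V x + W x)^2) <= 2 * (ind (ball a s) x * enn ((V x)^2)) + 2 * (ind (ball a s) x * enn ((W x)^2))"
   by (cases "x : ball a s") auto
 qed
 also have "... = 2 * N2 a s V + 2 * N2 a s W"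
  unfolding N2_def by (simp add: nn_integral_add nn_integral_cmult)
 finally show ?thesis .
qed

lemma N2_empty: "s <= 0 ==> N2 a s V = 0"
 unfolding N2_def by (simp add: ball_empty)

text \<open>Cauchy-Schwarz on the ball outside which the kernel vanishes: the indicator is doubled,
  one copy serving as the second factor, whose square integrates to the volume of the ball.\<close>

lemma kernel_square_le:
 fixes W k :: "real^'n => real"
 assumes W: "integrable lborel W" and [measurable]: "k : bmb" and c: "!!y. abs (k y) <= c"
  and e: "0 < e" "!!y. e < dist x y ==> k y = 0"
 shows "enn ((LI y. k y * W y)^2) <= enn (c^2 * (unit_ball_vol (real CARD('n)) * e ^ CARD('n)))
  * (NN y. ind (cball x e) y * enn ((W y)^2))"
proof -
 have c0: "0 <= c" using c[of x] by linarith
 have [measurable]: "W : bmb" using W by (auto dest: borel_measurable_integrable)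
 let ?I = "(NN y. ind (cball x e) y * (ind (cball x e) y * enn (abs (W y))))"
 have "enn (abs (LI y. k y * W y)) <= (NN y. enn (abs (k y * W y)))"
  using integral_norm_bound_ennreal[OF integrable_bounded_mult[OF W _ c]] by simp
 also have "... <= (NN y. enn c * (ind (cball x e) y * (ind (cball x e) y * enn (abs (W y)))))"
 proof (rule nn_integral_mono)
  fix y
  show "enn (abs (k y * W y)) <= enn c * (ind (cball x e) y * (ind (cball x e) y * enn (abs (W y))))"
   using c[of y] e(2)[of y] c0
   by (cases "y : cball x e") (auto simp: abs_mult ennreal_mult[symmetric] not_le intro!: ennreal_leI mult_right_mono)
 qed
 also have "... = enn c * ?I" by (simp add: nn_integral_cmult)
 finally have "(enn (abs (LI y. k y * W y)))^2 <= (enn c * ?I)^2" by (intro power_mono) auto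
 also have "... = enn (c^2) * ?I^2" using c0 by (simp add: power_mult_distrib ennreal_power)
 also have "?I^2 <= (NN y. (ind (cball x e) y)^2) * (NN y. (ind (cball x e) y * enn (abs (W y)))^2)"
  by (rule Cauchy_Schwarz_nn_integral) auto
 also have "(NN y. (ind (cball x e) y)^2) = enn (unit_ball_vol (real CARD('n)) * e ^ CARD('n))"
 proof -
  have "(NN y. (ind (cball x e) y)^2) = (NN y. ind (cball x e) y)"
   by (intro nn_integral_cong) (auto simp: indicator_def)
  thus ?thesis using emeasure_cball[of e x] e by simp
 qed
 also have "(NN y. (ind (cball x e) y * enn (abs (W y)))^2) = (NN y. ind (cball x e) y * enn ((W y)^2))"
  by (intro nn_integral_cong) (auto simp: indicator_def ennreal_power)
 finally have "(enn (abs (LI y. k y * W y)))^2 <= enn (c^2) * (enn (unit_ball_vol (real CARD('n)) * e ^ CARD('n)) * (NN y. ind (cball x e) y * enn ((W y)^2)))"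
  by (simp add: mult_left_mono)
 thus ?thesis using e by (simp add: ennreal_mult ennreal_power mult.assoc)
qed

text \<open>Schur's test. \<open>kernel_square_le\<close> contributes one ball volume, and
  exchanging the order of integration a second one. For kernels of height comparable to
  \<open>inverse e ^ CARD('n)\<close> the resulting constant does not depend on
  \<open>e\<close>.\<close>

lemma kernel_N2_le:
 fixes W g :: "real^'n => real" and k :: "real^'n => real^'n => real"
 assumes W: "integrable lborel W" and k: "!!x. x : ball a s ==> k x : bmb"
  and c: "!!x y. x : ball a s ==> abs (k x y) <= c"
  and e: "0 < e" "!!x y. e < dist x y ==> k x y = 0" "s + e <= s'" "0 <= c"
  and g: "!!x. x : ball a s ==> g x = (LI y. k x y * W y)"
 shows "N2 a s g <= enn ((c * (unit_ball_vol (real CARD('n)) * e ^ CARD('n)))^2) * N2 a s' W"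
proof -
 let ?v = "unit_ball_vol (real CARD('n)) * e ^ CARD('n)"
 have [measurable]: "W : bmb" using W by (auto dest: borel_measurable_integrable)
 have v: "?v >= 0" using e by simp
 let ?f = "%x y. ind (ball a s') y * enn ((W y)^2) * ind {z::(real^'n) \<times> (real^'n). dist (fst z) (snd z) <= e} (x, y)"
 have cl: "{z::(real^'n) \<times> (real^'n). dist (fst z) (snd z) <= e} : sets borel"
  by (intro borel_closed closed_Collect_le continuous_intros)
 have [measurable]: "{z::(real^'n) \<times> (real^'n). dist (fst z) (snd z) <= e} : sets (lborel \<Otimes>\<^sub>M lborel)"
  using cl by (simp only: lborel_prod sets_lborel)
 have "N2 a s g <= (NN x. enn (c^2 * ?v) * (NN y. ?f x y))"
  unfolding N2_def
 proof (rule nn_integral_mono)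
  fix x
  show "ind (ball a s) x * enn ((g x)^2) <= enn (c^2 * ?v) * (NN y. ?f x y)"
  proof (cases "x : ball a s")
   case True
   have "enn ((g x)^2) <= enn (c^2 * ?v) * (NN y. ind (cball x e) y * enn ((W y)^2))"
    unfolding g[OF True] by (rule kernel_square_le[OF W k[OF True] c[OF True] e(1) e(2)])
   also have "(NN y. ind (cball x e) y * enn ((W y)^2)) <= (NN y. ?f x y)"
   proof (rule nn_integral_mono)
    fix y
    have "y : ball a s'" if "y : cball x e"
     using that True e(3) dist_triangle[of a y x] by simp
    thus "ind (cball x e) y * enn ((W y)^2) <= ?f x y" by (auto simp: indicator_def)
   qed
   finally show ?thesis using True by (simp add: mult_left_mono)
  qed simp
 qed
 also have "... = enn (c^2 * ?v) * (NN x. (NN y. ?f x y))"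
  by (rule nn_integral_cmult) (intro lborel.borel_measurable_nn_integral, measurable)
 also have "(NN x. (NN y. ?f x y)) = (NN y. (NN x. ?f x y))"
  by (rule lborel_pair.Fubini'[symmetric]) measurable
 also have "... = (NN y. ind (ball a s') y * enn ((W y)^2) * enn ?v)"
 proof (rule nn_integral_cong)
  fix y :: "real^'n"
  have "(NN x. ?f x y) = (NN x. ind (ball a s') y * enn ((W y)^2) * ind (cball y e) x)"
   by (intro nn_integral_cong) (auto simp: indicator_def dist_commute)
  also have "... = ind (ball a s') y * enn ((W y)^2) * emeasure lborel (cball y e)"
   by (simp add: nn_integral_cmult)
  finally show "(NN x. ?f x y) = ind (ball a s') y * enn ((W y)^2) * enn ?v"
   using emeasure_cball[of e y] e by simp
 qed
 also have "... = N2 a s' W * enn ?v" unfolding N2_def by (rule nn_integral_multc) measurable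
 also have "enn (c^2 * ?v) * (N2 a s' W * enn ?v) = enn ((c * ?v)^2) * N2 a s' W"
 proof -
  have "enn (c^2 * w) * enn w = enn ((c * w)^2)" if "0 <= w" for w
   using that e(4) by (subst ennreal_mult[symmetric]) (auto simp: power2_eq_square mult_ac)
  moreover have "x * (y * z) = (x * z) * y" for x y z :: ennreal by (simp add: mult_ac)
  ultimately show ?thesis using v by (simp only:)
 qed
 finally show ?thesis .
qed

definition scl :: "(real^'n => real) => real => real^'n => real" where
 "scl ka e x = inverse e ^ CARD('n) * ka (inverse e *. x)"

lemma tfun_scl: "tfun ka ==> e > 0 ==> tfun (scl ka e)"
 unfolding scl_def using tfun_cmult[OF tfun_affine[of ka "inverse e" 0]] by simp

lemma partial_scl:
 fixes ka :: "real^'n => real"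
 assumes "tfun ka" "e > 0" shows "pt i (scl ka e) x = inverse e * scl (pt i ka) e x"
proof -
 have d: "(%x. ka (0 + inverse e *. x)) differentiable (at x)"
  using tfun_differentiable[OF tfun_affine[OF assms(1), of "inverse e" 0]] assms(2) by simp
 have "pt i (scl ka e) x = inverse e ^ CARD('n) * pt i (%x. ka (0 + inverse e *. x)) x"
  unfolding scl_def using partial_mult[OF differentiable_const[of "inverse e ^ CARD('n)"] d] by simp
 thus ?thesis using partial_affine[of ka 0 "inverse e" x i] tfun_differentiable[OF assms(1)] by (simp add: scl_def)
qed

lemma scl_support: "(!!x. 1 < norm x ==> ka x = 0) ==> e > 0 ==> e < norm x ==> scl ka e x = 0"
 unfolding scl_def by (simp add: field_simps)

lemma scl_le: "(!!x. abs (ka x) <= M) ==> e > 0 ==> abs (scl ka e x) <= M * inverse e ^ CARD('n)" for ka :: "real^'n => real"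
 unfolding scl_def by (simp add: abs_mult mult.commute mult_right_mono)

lemma integral_scl:
 fixes ka :: "real^'n => real"
 assumes "ka : bmb" "e > 0" shows "(LI x. scl ka e x) = (LI x. ka x)"
 using integral_affine[OF assms(1), of "inverse e" 0] assms(2) unfolding scl_def by simp

lemma conv_scl_eq:
 fixes ka :: "real^'n => real"
 assumes "tfun ka" "tfun V" "t > 0"
 shows "conv (scl ka t) V x = (LI z. ka z * V (x - t *. z))"
proof -
 have m: "(%y. scl ka t (x - y) * V y) : bmb"
  by (intro borel_measurable_times tfun_measurable tfun_reflect tfun_scl assms)
 have "conv (scl ka t) V x = abs (- t) ^ CARD('n) * (LI z. scl ka t (x - (x + (- t) *. z)) * V (x + (- t) *. z))"
  unfolding conv_def by (rule integral_affine[OF m]) (use assms in auto)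
 also have "... = (LI z. abs (- t) ^ CARD('n) * (scl ka t (x - (x + (- t) *. z)) * V (x + (- t) *. z)))"
  by simp
 also have "... = (LI z. ka z * V (x - t *. z))"
  using assms(3) by (intro Bochner_Integration.integral_cong) (auto simp: scl_def power_mult_distrib[symmetric] mult.assoc[symmetric])
 finally show ?thesis .
qed

lemma exists_mollifier:
 obtains et :: "real^'n => real" where "tfun et" "!!x. 1 < norm x ==> et x = 0" "(LI x. et x) = 1" "!!x. 0 <= et x"
proof -
 let ?b = "bump (0::real^'n) 1"
 have z: "?b x = 0" if "1 < norm x" for x using that by (intro bump_zero) auto
 have t: "tfun ?b" unfolding tfun_def using smooth_bump[of UNIV] z by blast
 have "(LI x. ?b x) ~= 0"
 proof
  assume "(LI x. ?b x) = 0"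
  hence "AE x in lborel. ?b x = 0"
   using integral_nonneg_eq_0_iff_AE[OF tfun_integrable[OF t]] bump_nonneg by auto
  hence "AE x in lborel. x ~: ball (0::real^'n) 1"
  proof eventually_elim
   case (elim x)
   thus ?case using bump_pos_iff[of 1 0 x] by auto
  qed
  hence "emeasure lborel (ball (0::real^'n) 1) = 0"
   by (subst (asm) AE_iff_measurable[where N = "ball (0::real^'n) 1"]) auto
  thus False using emeasure_ball[of 1 "0::real^'n"] unit_ball_vol_pos[of "real CARD('n)"] by simp
 qed
 hence p: "(LI x. ?b x) > 0"
 proof -
  have "0 <= (LI x. ?b x)" by (rule Bochner_Integration.integral_nonneg) (rule bump_nonneg)
  thus ?thesis using \<open>(LI x. ?b x) ~= 0\<close> by linarith
 qed
 show thesis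
 proof
  show "tfun (%x. inverse (LI x. ?b x) * ?b x)" by (rule tfun_cmult[OF t])
  show "(LI x. inverse (LI x. ?b x) * ?b x) = 1" using p by simp
  show "0 <= inverse (LI x. ?b x) * ?b x" for x using p bump_nonneg[of 0 1 x] by simp
  show "inverse (LI x. ?b x) * ?b x = 0" if "1 < norm x" for x using z[OF that] by simp
 qed
qed

section \<open>Bounds on balls and Caccioppoli's inequality\<close>

lemma smooth_bounded_cball:
 fixes f :: "real^'n => real"
 assumes "smooth_on UNIV f" obtains M where "M >= 0" "!!x. x : cball a s ==> abs (f x) <= M"
proof -
 have "compact (f ` cball a s)"
  by (intro compact_continuous_image continuous_on_subset[OF smooth_on_continuous[OF assms]]) auto
 then obtain M where M: "!!x. x : cball a s ==> abs (f x) <= M"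
  using compact_imp_bounded[of "f ` cball a s"] unfolding bounded_iff by fastforce
 show thesis by (rule that[of "max M 0"]) (use M in "auto intro: le_max_iff_disj[THEN iffD2]")
qed

lemma Lipschitz_of_partial_bound:
 fixes f :: "real^'n => real"
 assumes f: "!!x. x : S ==> f differentiable (at x)" and S: "convex S"
  and K: "!!i x. x : S ==> abs (pt i f x) <= K" and xy: "x : S" "y : S"
 shows "abs (f x - f y) <= real CARD('n) * K * dist x y"
proof -
 let ?h = "x - y"
 have seg: "y + t *. ?h : S" if "0 <= t" "t <= 1" for t
 proof -
  have "y + t *. ?h = (1 - t) *. y + t *. x" by (simp add: algebra_simps)
  thus ?thesis using convexD[OF S xy(2,1), of "1 - t" t] that by simp
 qed
 have K0: "0 <= K" using K[OF xy(1)] abs_ge_zero order_trans by blast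
 obtain t where t: "0 < t" "t < 1" "f (y + 1 *. ?h) - f (y + 0 *. ?h) = (1 - 0) * (SU i. ?h $ i * pt i f (y + t *. ?h))"
  using MVT2[OF zero_less_one partial_line_derivative[OF f[OF seg]]] by blast
 hence "abs (SU i. ?h $ i * pt i f (y + t *. ?h)) <= real CARD('n) * (norm ?h * K)"
  by (intro abs_sum_le_card) (auto simp: abs_mult K0 simp del: vector_minus_component intro!: mult_mono component_le_norm_cart K seg)
 thus ?thesis using t(3) by (simp add: dist_norm mult_ac)
qed

lemma smooth_Lipschitz_cball:
 fixes f :: "real^'n => real"
 assumes "smooth_on UNIV f"
 obtains L where "L >= 0" "!!x y. x : cball a s ==> y : cball a s ==> abs (f x - f y) <= L * dist x y"
proof -
 have "EX M. M >= 0 & (ALL x : cball a s. abs (pt i f x) <= M)" for i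
  using smooth_bounded_cball[OF smooth_on_partial[OF assms]] by metis
 then obtain M where M: "!!i. M i >= 0" "!!i x. x : cball a s ==> abs (pt i f x) <= M i" by metis
 define K where "K = (SU i. M i)"
 have K: "K >= 0" "!!i x. x : cball a s ==> abs (pt i f x) <= K"
  using M order_trans[OF M(2) member_le_sum[of _ UNIV M]] by (auto simp: K_def intro!: sum_nonneg)
 show thesis
  by (rule that[of "real CARD('n) * K"])
   (use K Lipschitz_of_partial_bound[OF smooth_on_differentiable[OF open_UNIV assms UNIV_I] convex_cball K(2)] in auto)
qed

lemma tfun_Lipschitz:
 fixes f :: "real^'n => real"
 assumes "tfun f" obtains L where "L >= 0" "!!x y. abs (f x - f y) <= L * dist x y"
proof -
 have "EX M. M >= 0 & (ALL x. abs (pt i f x) <= M)" for i using tfun_bounded[OF tfun_partial[OF assms]] by metis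
 then obtain M where M: "!!i. M i >= 0" "!!i x. abs (pt i f x) <= M i" by metis
 define K where "K = (SU i. M i)"
 have K: "K >= 0" "!!i x. abs (pt i f x) <= K"
  using M order_trans[OF M(2) member_le_sum[of _ UNIV M]] by (auto simp: K_def intro!: sum_nonneg)
 show thesis
  by (rule that[of "real CARD('n) * K"])
   (use K Lipschitz_of_partial_bound[OF tfun_differentiable[OF assms] convex_UNIV K(2)] in auto)
qed

text \<open>For a cutoff \<open>xx\<close> read \<open>p\<close> as \<open>xx\<close> times the
  gradient of \<open>V\<close>, \<open>w\<close> as \<open>V\<close> times the gradient of
  \<open>xx\<close>, and \<open>g\<close>, \<open>v\<close>, \<open>h\<close> as \<open>xx\<close>
  times \<open>G\<close>, \<open>V\<close>, \<open>H\<close>; then \<open>xx\<close> times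
  \<open>2 * w + p\<close> is the gradient of \<open>xx^2 * V\<close>. By Young's inequality the
  mixed terms consume \<open>lam / 2\<close> and \<open>lam / 4\<close> of the ellipticity constant,
  which leaves \<open>lam / 4\<close>.\<close>

lemma elliptic_pointwise_bound:
 fixes A :: "'n::finite => 'n => real" and p w g :: "'n => real"
 assumes lam: "0 < lam" "lam * (SU i. (p i)^2) <= (SU i. SU j. A i j * p i * p j)"
  and Lam: "!!i j. abs (A i j) <= Lam"
 shows "lam / 4 * (SU i. (p i)^2) <= v * h + (SU i. (2 * w i + p i) * ((SU j. A i j * p j) - g i))
  + ((2 * (real CARD('n))^2 * Lam^2 / lam + 1) * (SU i. (w i)^2) + (1 / lam + 1) * (SU i. (g i)^2) + v^2 + h^2)"
proof -
 let ?n = "real CARD('n)" and ?P = "SU i. (p i)^2" and ?W = "SU i. (w i)^2" and ?G = "SU i. (g i)^2"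
 have n: "?n > 0" by simp
 have ag: "- (x * y) <= t * x^2 + (1 / (4 * t)) * y^2" if "t > 0" for x y t :: real
 proof -
  have "0 <= (2 * t * x + y)^2" by simp
  also have "... = 4 * t * (t * x^2 + x * y + (1 / (4 * t)) * y^2)"
   using that by (simp add: power2_eq_square field_simps)
  finally have "0 <= t * x^2 + x * y + (1 / (4 * t)) * y^2" using that by (simp add: zero_le_mult_iff)
  thus ?thesis by simp
 qed
 have t1: "- (SU i. SU j. 2 * w i * (A i j * p j)) <= lam / 2 * ?P + 2 * ?n^2 * Lam^2 / lam * ?W"
 proof -
  \<comment> \<open>The weight \<open>lam / (2 * ?n)\<close> is chosen so that the sum over the
    \<open>?n\<close> values of \<open>i\<close> costs \<open>lam / 2\<close> in total.\<close>
  have "- (2 * w i * (A i j * p j)) <= lam / (2 * ?n) * (p j)^2 + 2 * ?n * Lam^2 / lam * (w i)^2" for i j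
  proof -
   have "- (p j * (2 * w i * A i j)) <= lam / (2 * ?n) * (p j)^2 + (1 / (4 * (lam / (2 * ?n)))) * (2 * w i * A i j)^2"
    by (rule ag) (use lam n in simp)
   also have "(1 / (4 * (lam / (2 * ?n)))) * (2 * w i * A i j)^2 = 2 * ?n / lam * (w i)^2 * (A i j)^2"
    using lam n by (simp add: power_mult_distrib field_simps)
   also have "... <= 2 * ?n / lam * (w i)^2 * Lam^2"
    using lam n power_mono[OF Lam, of i j 2] by (intro mult_left_mono) auto
   finally show ?thesis by (simp add: mult_ac)
  qed
  hence "(SU i. SU j. - (2 * w i * (A i j * p j))) <= (SU i. SUM j:(UNIV::'n set). lam / (2 * ?n) * (p j)^2 + 2 * ?n * Lam^2 / lam * (w i)^2)"
   by (intro sum_mono)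
  also have "... = ?n * (lam / (2 * ?n) * ?P) + ?n * (2 * ?n * Lam^2 / lam * ?W)"
   by (simp add: sum.distrib sum_distrib_left)
  also have "... = lam / 2 * ?P + 2 * ?n^2 * Lam^2 / lam * ?W" using n by (simp add: power2_eq_square)
  finally show ?thesis by (simp add: sum_negf)
 qed
 have t2: "(SU i. p i * g i) <= lam / 4 * ?P + 1 / lam * ?G"
 proof -
  have "p i * g i <= lam / 4 * (p i)^2 + 1 / lam * (g i)^2" for i
   using ag[of "lam / 4" "- p i" "g i"] lam by simp
  hence "(SU i. p i * g i) <= (SU i. lam / 4 * (p i)^2 + 1 / lam * (g i)^2)" by (intro sum_mono)
  thus ?thesis by (simp add: sum.distrib sum_distrib_left)
 qed
 have t3: "(SU i. 2 * w i * g i) <= ?W + ?G"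
 proof -
  have "2 * w i * g i <= (w i)^2 + (g i)^2" for i using sum_squares_bound[of "w i" "g i"] by simp
  hence "(SU i. 2 * w i * g i) <= (SU i. (w i)^2 + (g i)^2)" by (intro sum_mono)
  thus ?thesis by (simp add: sum.distrib)
 qed
 have t4: "- (v * h) <= v^2 + h^2" using sum_squares_bound[of v "- h"] sum_squares_bound[of v h] by (simp add: power2_eq_square)
 have e: "(SU i. (2 * w i + p i) * ((SU j. A i j * p j) - g i))
  = (SU i. SU j. 2 * w i * (A i j * p j)) + (SU i. SU j. A i j * p i * p j) - (SU i. p i * g i) - (SU i. 2 * w i * g i)"
  by (simp add: sum.distrib sum_subtractf algebra_simps sum_distrib_left)
 have "(2 * ?n^2 * Lam^2 / lam + 1) * ?W = 2 * ?n^2 * Lam^2 / lam * ?W + ?W" "(1 / lam + 1) * ?G = 1 / lam * ?G + ?G"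
  by (simp_all add: distrib_right)
 thus ?thesis using t1 t2 t3 t4 lam(2) unfolding e by linarith
qed

lemma smooth_ball_integrable:
 fixes f :: "real^'n => real"
 assumes "smooth_on UNIV f" shows "integrable lborel (%x. ind (ball a s) x * f x)"
proof -
 have "integrable lborel (%x. ind (ball a s) x *. (ind (cball a s) x *. f x))"
  by (intro integrable_mult_indicator borel_integrable_compact compact_cball
    continuous_on_subset[OF smooth_on_continuous[OF assms]]) auto
 moreover have "(%x. ind (ball a s) x *. (ind (cball a s) x *. f x)) = (%x. ind (ball a s) x * f x)"
  by (auto simp: indicator_def fun_eq_iff)
 ultimately show ?thesis by simp
qed

lemma N2_smooth_eq:
 fixes f :: "real^'n => real"
 assumes "smooth_on UNIV f" shows "N2 a s f = enn (LI x. ind (ball a s) x * (f x)^2)"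
proof -
 have "N2 a s f = (NN x. enn (ind (ball a s) x * (f x)^2))"
  unfolding N2_def by (intro nn_integral_cong) (auto simp: indicator_def)
 also have "... = enn (LI x. ind (ball a s) x * (f x)^2)"
  by (rule nn_integral_eq_integral[OF smooth_ball_integrable[OF smooth_on_power[OF open_UNIV assms]]]) auto
 finally show ?thesis .
qed

text \<open>Caccioppoli's inequality, with a constant independent of the solution and the data. The
  field \<open>X\<close>, that is \<open>xx^2 * V\<close> times the flux minus \<open>G\<close>, has
  compact support, so its divergence \<open>D\<close> integrates to 0;
  \<open>elliptic_pointwise_bound\<close> estimates the squared gradient by \<open>D\<close> plus
  terms without derivatives of \<open>V\<close>.\<close>

lemma energy_estimate:
 fixes A :: "'n::finite => 'n => real^'n => real"
 assumes s: "0 < s" "s < r" and A: "!!i j. smooth_on UNIV (A i j)"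
  and lam: "0 < lam" "!!x p. x : ball a r ==> lam * (SU i. (p i)^2) <= (SU i. SU j. A i j x * p i * p j)"
 shows "EX C>=0. ALL V G H l. smooth_on UNIV V --> (ALL i. smooth_on UNIV (G i)) --> smooth_on UNIV H -->
  (ALL x:ball a r. (SU i. pt i (%x. SU j. A i j x * pt j V x) x) = (SU i. pt i (G i) x) + H x) -->
  N2 a s (pt l V) <= enn C * (N2 a r V + (SU i. N2 a r (G i)) + N2 a r H)"
proof -
 \<comment> \<open>Strictly below \<open>r\<close>, so that the cutoff vanishes on an open set
   containing the complement of \<open>ball a r\<close>, and its derivatives vanish there
   too.\<close>
 define r' where "r' = (s + r) / 2"
 have r': "s < r'" "r' < r" using s by (auto simp: r'_def)
 obtain xx :: "real^'n => real" where xx: "smooth_on UNIV xx" "!!x. 0 <= xx x" "!!x. xx x <= 1"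
  "!!x. x : cball a s ==> xx x = 1" "!!x. x ~: ball a r' ==> xx x = 0"
  using exists_cutoff[OF s(1) r'(1)] by metis
 have xx0: "xx x = 0" "pt i xx x = 0" if "x ~: ball a r" for x i
 proof -
  have x: "x : - cball a r'" using that r' by auto
  thus "xx x = 0" using xx(5) by auto
  show "pt i xx x = 0" using partial_cong[OF _ x, of xx "%_. 0" i] xx(5) by (auto simp: open_Compl)
 qed
 have txx: "tfun xx"
 proof -
  have "xx x = 0" if "norm a + r < norm x" for x
   using that norm_triangle_ineq2[of x a] by (intro xx0) (auto simp: dist_norm norm_minus_commute)
  thus ?thesis using xx(1) unfolding tfun_def by blast
 qed
 obtain K where K: "K >= 0" "!!i x. abs (pt i xx x) <= K"
 proof -
  have "EX M. M >= 0 & (ALL x. abs (pt i xx x) <= M)" for i using tfun_bounded[OF tfun_partial[OF txx]] by metis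
  then obtain M where M: "!!i. M i >= 0" "!!i x. abs (pt i xx x) <= M i" by metis
  show thesis by (rule that[of "SU i. M i"])
   (use M order_trans[OF M(2) member_le_sum[of _ UNIV M]] in "auto intro!: sum_nonneg")
 qed
 obtain Lam where Lam: "Lam >= 0" "!!i j x. x : ball a r ==> abs (A i j x) <= Lam"
 proof -
  have "EX M. M >= 0 & (ALL x:cball a r. abs (A i j x) <= M)" for i j using smooth_bounded_cball[OF A] by metis
  then obtain M where M: "!!i j. M i j >= 0" "!!i j x. x : cball a r ==> abs (A i j x) <= M i j" by metis
  have "M i j <= (SU i. SU j. M i j)" for i j
   by (rule order_trans[OF member_le_sum[of j UNIV "M i"] member_le_sum[of i UNIV "%i. SU j. M i j"]])
    (auto intro!: sum_nonneg M)
  thus thesis by (intro that[of "SU i. SU j. M i j"]) (use M order_trans in "auto intro!: sum_nonneg intro: order_trans[OF M(2)]")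
 qed
 define n where "n = real CARD('n)"
 have n0: "n >= 0" by (simp add: n_def)
 define C1 where "C1 = (2 * n^2 * Lam^2 / lam + 1) * (n * K^2) + (1 / lam + 1) + 1"
 have C1: "C1 >= 0" using lam by (simp add: C1_def n_def)
 show ?thesis
 proof (intro exI[of _ "4 / lam * C1"] conjI allI impI)
  show "0 <= 4 / lam * C1" using lam C1 by simp
  fix V H and G :: "'n => real^'n => real" and l
  assume V: "smooth_on UNIV V" and "ALL i. smooth_on UNIV (G i)" and H: "smooth_on UNIV H"
   and eq: "ALL x:ball a r. (SU i. pt i (%x. SU j. A i j x * pt j V x) x) = (SU i. pt i (G i) x) + H x"
  hence G: "smooth_on UNIV (G i)" for i by blast
  let ?Y = "%i x. (SU j. A i j x * pt j V x)"
  have Y: "smooth_on UNIV (?Y i)" for i by (intro smooth_intros A smooth_on_partial V open_UNIV)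
  define X where "X = (%i x. (xx x * (xx x * V x)) * (?Y i x - G i x))"
  have X: "tfun (X i)" for i
   using tfun_mult[OF smooth_on_mult[OF open_UNIV smooth_on_mult[OF open_UNIV xx(1) V] smooth_on_diff[OF open_UNIV Y[of i] G[of i]]] txx]
   unfolding X_def by (simp add: mult_ac)
  define D where "D = (%x. SU i. pt i (X i) x)"
  have tD: "tfun D" unfolding D_def by (intro tfun_sum tfun_partial X) simp
  have D0: "(LI x. D x) = 0"
   unfolding D_def by (subst Bochner_Integration.integral_sum) (auto intro: tfun_integrable tfun_partial X simp: tfun_integral_partial X)
  define R where "R = (%x. (V x)^2 + (SU i. (G i x)^2) + (H x)^2)"
  have R: "smooth_on UNIV R" unfolding R_def by (intro smooth_intros V G H open_UNIV)
  have dif: "f differentiable (at x)" if "smooth_on UNIV f" for f :: "real^'n => real" and x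
   using smooth_on_differentiable[OF open_UNIV that UNIV_I] .
  have pX: "pt i (X i) x = (xx x * (xx x * V x)) * (pt i (?Y i) x - pt i (G i) x)
    + (2 * (V x * pt i xx x) + xx x * pt i V x) * (xx x * (?Y i x - G i x))" for i x
  proof -
   have "pt i (X i) x = (xx x * (xx x * V x)) * pt i (%x. ?Y i x - G i x) x + pt i (%x. xx x * (xx x * V x)) x * (?Y i x - G i x)"
    unfolding X_def by (rule partial_mult) (intro dif smooth_intros xx V A G smooth_on_partial open_UNIV)+
   also have "pt i (%x. xx x * (xx x * V x)) x = xx x * (xx x * pt i V x + pt i xx x * V x) + pt i xx x * (xx x * V x)"
    by (subst partial_mult, (intro dif smooth_intros xx V open_UNIV)+)+ simp
   also have "pt i (%x. ?Y i x - G i x) x = pt i (?Y i) x - pt i (G i) x"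
    by (rule partial_diff) (intro dif Y G)+
   finally show ?thesis by (simp add: algebra_simps)
  qed
  have pw: "lam / 4 * ((xx x)^2 * (pt l V x)^2) <= D x + C1 * (ind (ball a r) x * R x)" for x
  proof (cases "x : ball a r")
   case True
   let ?p = "%i. xx x * pt i V x" and ?w = "%i. V x * pt i xx x" and ?g = "%i. xx x * G i x"
   have "D x = (xx x * (xx x * V x)) * ((SU i. pt i (?Y i) x) - (SU i. pt i (G i) x))
     + (SU i. (2 * ?w i + ?p i) * (xx x * (?Y i x - G i x)))"
    unfolding D_def pX by (simp add: sum.distrib sum_distrib_left sum_subtractf right_diff_distrib)
   also have "(SU i. pt i (?Y i) x) - (SU i. pt i (G i) x) = H x" using eq True by simp
   finally have D: "D x = (xx x * V x) * (xx x * H x) + (SU i. (2 * ?w i + ?p i) * ((SU j. A i j x * ?p j) - ?g i))"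
    by (simp add: sum_distrib_left right_diff_distrib mult_ac)
   have "lam / 4 * (SU i. (?p i)^2) <= D x + ((2 * n^2 * Lam^2 / lam + 1) * (SU i. (?w i)^2) + (1 / lam + 1) * (SU i. (?g i)^2) + (xx x * V x)^2 + (xx x * H x)^2)"
    unfolding D n_def by (rule elliptic_pointwise_bound) (use lam True Lam in auto)
   also have "... <= D x + C1 * R x"
   proof -
    have le1: "(xx x * y)^2 <= y^2" for y
    proof -
     have "(xx x)^2 <= 1" using xx(2,3) by (simp add: power_le_one)
     from mult_right_mono[OF this, of "y^2"] show ?thesis by (simp add: power_mult_distrib)
    qed
    have "(SU i. (?w i)^2) <= (SUM i:(UNIV::'n set). (V x)^2 * K^2)"
    proof (rule sum_mono)
     fix i
     have "(pt i xx x)^2 <= K^2" using power_mono[OF K(2), of i x 2] by simp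
     thus "(?w i)^2 <= (V x)^2 * K^2" by (simp add: power_mult_distrib mult_left_mono)
    qed
    hence W: "(SU i. (?w i)^2) <= n * K^2 * (V x)^2" by (simp add: n_def mult_ac)
    have Gs: "(SU i. (?g i)^2) <= (SU i. (G i x)^2)" by (intro sum_mono le1)
    have "(2 * n^2 * Lam^2 / lam + 1) * (SU i. (?w i)^2) <= (2 * n^2 * Lam^2 / lam + 1) * (n * K^2 * (V x)^2)"
     using lam by (intro mult_left_mono W) auto
    moreover have "(1 / lam + 1) * (SU i. (?g i)^2) <= (1 / lam + 1) * (SU i. (G i x)^2)"
     using lam by (intro mult_left_mono Gs) auto
    moreover have "(2 * n^2 * Lam^2 / lam + 1) * (n * K^2 * (V x)^2) + (1 / lam + 1) * (SU i. (G i x)^2) + (V x)^2 + (H x)^2 <= C1 * R x"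
    proof -
     let ?a = "(2 * n^2 * Lam^2 / lam + 1) * (n * K^2)" and ?b = "1 / lam + 1" and ?G = "SU i. (G i x)^2"
     have nn: "0 <= ?a" "0 <= ?b" "0 <= ?G" "0 <= 1 / lam" using lam by (auto simp: n_def sum_nonneg)
     have "C1 * R x = ?a * (V x)^2 + ?b * ?G + (V x)^2 + (H x)^2 + (?a * (?G + (H x)^2) + ?b * ((V x)^2 + (H x)^2) + ?G)"
     proof -
      have "(a + b + 1) * (v + g + h) = a * v + b * g + v + h + (a * (g + h) + b * (v + h) + g)" for a b v g h :: real
       by (simp add: algebra_simps)
      thus ?thesis unfolding C1_def R_def .
     qed
     moreover have "0 <= ?a * (?G + (H x)^2) + ?b * ((V x)^2 + (H x)^2) + ?G"
      using nn n0 by (intro add_nonneg_nonneg mult_nonneg_nonneg) auto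
     ultimately show ?thesis by (simp add: mult.assoc)
    qed
    ultimately show ?thesis using le1[of "V x"] le1[of "H x"] by linarith
   qed
   finally have "lam / 4 * (SU i. (?p i)^2) <= D x + C1 * R x" .
   moreover have "lam / 4 * (?p l)^2 <= lam / 4 * (SU i. (?p i)^2)"
    using lam by (intro mult_left_mono member_le_sum[of l UNIV "%i. (?p i)^2"]) auto
   ultimately show ?thesis using True by (simp add: power_mult_distrib)
  next
   case False
   thus ?thesis unfolding D_def pX by (simp add: xx0)
  qed
  have iD: "integrable lborel D" by (rule tfun_integrable[OF tD])
  have iR: "integrable lborel (%x. ind (ball a r) x * R x)" by (rule smooth_ball_integrable[OF R])
  have t2: "tfun (%x. (xx x)^2 * (pt l V x)^2)"
  proof -
   have "smooth_on UNIV (%x. xx x * (pt l V x)^2)" by (intro smooth_intros xx smooth_on_partial V open_UNIV)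
   from tfun_mult[OF this txx] show ?thesis by (simp add: power2_eq_square mult_ac)
  qed
  have "lam / 4 * (LI x. (xx x)^2 * (pt l V x)^2) = (LI x. lam / 4 * ((xx x)^2 * (pt l V x)^2))" by simp
  also have "... <= (LI x. D x + C1 * (ind (ball a r) x * R x))"
   by (intro integral_mono pw Bochner_Integration.integrable_add integrable_mult_right iD iR tfun_integrable[OF t2])
  also have "... = C1 * (LI x. ind (ball a r) x * R x)"
   using iD iR D0 by simp
  finally have main: "(LI x. (xx x)^2 * (pt l V x)^2) <= 4 / lam * C1 * (LI x. ind (ball a r) x * R x)"
   using lam by (simp add: field_simps)
  have "N2 a s (pt l V) = enn (LI x. ind (ball a s) x * (pt l V x)^2)"
   by (rule N2_smooth_eq[OF smooth_on_partial[OF V]])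
  also have "... <= enn (LI x. (xx x)^2 * (pt l V x)^2)"
  proof (rule ennreal_leI, rule integral_mono)
   show "ind (ball a s) x * (pt l V x)^2 <= (xx x)^2 * (pt l V x)^2" for x
    using xx(4)[of x] by (cases "x : ball a s") auto
  qed (auto intro!: smooth_ball_integrable smooth_on_power smooth_on_partial V tfun_integrable[OF t2])
  also have "... <= enn (4 / lam * C1 * (LI x. ind (ball a r) x * R x))" by (rule ennreal_leI[OF main])
  also have "... = enn (4 / lam * C1) * enn (LI x. ind (ball a r) x * R x)"
   using lam C1 by (intro ennreal_mult' ) auto
  also have "enn (LI x. ind (ball a r) x * R x) = N2 a r V + (SU i. N2 a r (G i)) + N2 a r H"
  proof -
   have i: "integrable lborel (%x. ind (ball a r) x * (f x)^2)" if "smooth_on UNIV f" for f :: "real^'n => real"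
    by (intro smooth_ball_integrable smooth_on_power that open_UNIV)
   have "(LI x. ind (ball a r) x * R x) = (LI x. ind (ball a r) x * (V x)^2)
     + (SU i. (LI x. ind (ball a r) x * (G i x)^2)) + (LI x. ind (ball a r) x * (H x)^2)"
   proof -
    have gen: "(LI x. u x + (SU i. w i x) + v x) = (LI x. u x) + (SU i. (LI x. w i x)) + (LI x. v x)"
     if "integrable lborel u" "!!i. integrable lborel (w i)" "integrable lborel v" for u v :: "real^'n => real" and w :: "'n => real^'n => real"
     using that by (simp add: Bochner_Integration.integral_sum)
    show ?thesis unfolding R_def distrib_left sum_distrib_left by (rule gen[OF i[OF V] i[OF G] i[OF H]])
   qed
   thus ?thesis by (simp add: N2_smooth_eq V G H sum_nonneg)
  qed
  finally show "N2 a s (pt l V) <= enn (4 / lam * C1) * (N2 a r V + (SU i. N2 a r (G i)) + N2 a r H)" .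
 qed
qed

section \<open>Interior regularity of weak solutions\<close>

text \<open>Local boundedness: on every smaller ball, and only eventually along \<open>F\<close>.
  The index filter is left general because the commutator estimates involve two mollification scales
  at once and live on a product filter.\<close>

definition L2b :: "'i filter => real^'n => real => ('i => real^'n => real) => bool" where
 "L2b F a R v \<longleftrightarrow> (ALL s<R. EX C::real. \<forall>\<^sub>F i in F. N2 a s (v i) <= enn C)"

text \<open>Boundedness in the local Sobolev space of order \<open>k\<close>, meant for families of
  smooth functions, whose classical derivatives appear here.\<close>

primrec Hb :: "nat => 'i filter => real^'n => real => ('i => real^'n => real) => bool" where
 "Hb 0 F a R v \<longleftrightarrow> L2b F a R v"
| "Hb (Suc k) F a R v \<longleftrightarrow> L2b F a R v & (ALL l. Hb k F a R (%i. pt l (v i)))"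

lemma Hb_L2b: "Hb k F a R v ==> L2b F a R v"
 by (cases k) auto

lemma Hb_SucD: "Hb (Suc k) F a R v ==> Hb k F a R v"
 by (induction k arbitrary: v) auto

lemma L2bE:
 assumes "L2b F a R v" "s < R"
 obtains C where "0 <= C" "\<forall>\<^sub>F i in F. N2 a s (v i) <= enn C"
proof -
 obtain C where "\<forall>\<^sub>F i in F. N2 a s (v i) <= enn C" using assms by (auto simp: L2b_def)
 hence "\<forall>\<^sub>F i in F. N2 a s (v i) <= enn (max C 0)"
  by eventually_elim (auto elim!: order_trans intro!: ennreal_leI)
 thus thesis using that[of "max C 0"] by auto
qed

lemma L2b_le:
 assumes "L2b F a R v" "!!s. s < R ==> EX s'<R. EX C>=0. \<forall>\<^sub>F i in F. N2 a s (w i) <= enn C * N2 a s' (v i)"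
 shows "L2b F a R w"
 unfolding L2b_def
proof (intro allI impI)
 fix s assume "s < R"
 then obtain s' C where s': "s' < R" "C >= 0" "\<forall>\<^sub>F i in F. N2 a s (w i) <= enn C * N2 a s' (v i)" using assms(2) by blast
 obtain C' where C': "0 <= C'" "\<forall>\<^sub>F i in F. N2 a s' (v i) <= enn C'" using L2bE[OF assms(1) s'(1)] by blast
 have "\<forall>\<^sub>F i in F. N2 a s (w i) <= enn (C * C')" using s'(3) C'(2)
 proof eventually_elim
  case (elim i)
  note elim(1)
  also have "enn C * N2 a s' (v i) <= enn C * enn C'" by (rule mult_left_mono[OF elim(2)]) simp
  finally show ?case using s' C' by (simp add: ennreal_mult)
 qed
 thus "EX C. \<forall>\<^sub>F i in F. N2 a s (w i) <= enn C" by blast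
qed

lemma L2b_add:
 assumes "L2b F a R v" "L2b F a R w" "!!i. smooth_on UNIV (v i)" "!!i. smooth_on UNIV (w i)"
 shows "L2b F a R (%i x. v i x + w i x)"
 unfolding L2b_def
proof (intro allI impI)
 fix s assume s: "s < R"
 obtain C C' where C: "0 <= C" "\<forall>\<^sub>F i in F. N2 a s (v i) <= enn C" "0 <= C'" "\<forall>\<^sub>F i in F. N2 a s (w i) <= enn C'"
  using L2bE[OF assms(1) s] L2bE[OF assms(2) s] by metis
 have "\<forall>\<^sub>F i in F. N2 a s (%x. v i x + w i x) <= enn (2 * C + 2 * C')" using C(2,4)
 proof eventually_elim
  case (elim i)
  have "N2 a s (%x. v i x + w i x) <= 2 * N2 a s (v i) + 2 * N2 a s (w i)"
   by (rule N2_add) (intro smooth_UNIV_measurable assms)+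
  also have "... <= 2 * enn C + 2 * enn C'" using elim by (intro add_mono mult_left_mono) auto
  also have "... = enn (2 * C + 2 * C')" using C by (simp add: ennreal_mult)
  finally show ?case .
 qed
 thus "EX C. \<forall>\<^sub>F i in F. N2 a s (%x. v i x + w i x) <= enn C" by blast
qed

lemma L2b_mult:
 assumes "L2b F a R v" "smooth_on UNIV b" "!!i. smooth_on UNIV (v i)"
 shows "L2b F a R (%i x. b x * v i x)"
proof (rule L2b_le[OF assms(1)])
 fix s assume s: "s < R"
 obtain M where M: "M >= 0" "!!x. x : cball a s ==> abs (b x) <= M" using smooth_bounded_cball[OF assms(2)] by metis
 have "N2 a s (%x. b x * v i x) <= enn (M^2) * N2 a s (v i)" for i
 proof (rule N2_le)
  fix x assume "x : ball a s"
  hence "(b x)^2 <= M^2" using M(2)[of x] power_mono[of "abs (b x)" M 2] by auto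
  thus "(b x * v i x)^2 <= M^2 * (v i x)^2" by (simp add: power_mult_distrib mult_right_mono)
 next
  show "v i : bmb" by (rule smooth_UNIV_measurable[OF assms(3)])
 qed simp
 hence "\<forall>\<^sub>F i in F. N2 a s (%x. b x * v i x) <= enn (M^2) * N2 a s (v i)" by simp
 thus "EX s'<R. EX C>=0. \<forall>\<^sub>F i in F. N2 a s (%x. b x * v i x) <= enn C * N2 a s' (v i)"
  using s zero_le_power2[of M] by blast
qed

lemma smooth_dif: "smooth_on UNIV (f :: real^'n => real) ==> f differentiable (at x)"
 using smooth_on_differentiable[OF open_UNIV _ UNIV_I] .

lemma Hb_add:
 assumes "Hb k F a R v" "Hb k F a R w" "!!i. smooth_on UNIV (v i)" "!!i. smooth_on UNIV (w i)"
 shows "Hb k F a R (%i x. v i x + w i x)"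
 using assms
proof (induction k arbitrary: v w)
 case 0 thus ?case by (simp add: L2b_add)
next
 case (Suc k)
 have "pt l (%x. v i x + w i x) = (%x. pt l (v i) x + pt l (w i) x)" for l i
  by (intro ext partial_add smooth_dif Suc.prems)
 thus ?case using Suc by (auto intro!: L2b_add Suc.IH smooth_on_partial)
qed

lemma Hb_mult:
 assumes "Hb k F a R v" "smooth_on UNIV b" "!!i. smooth_on UNIV (v i)"
 shows "Hb k F a R (%i x. b x * v i x)"
 using assms
proof (induction k arbitrary: v b)
 case 0 thus ?case by (simp add: L2b_mult)
next
 case (Suc k)
 have eq: "pt l (%x. b x * v i x) = (%x. b x * pt l (v i) x + pt l b x * v i x)" for l i
  by (intro ext partial_mult smooth_dif Suc.prems)
 have "Hb k F a R (%i. pt l (%x. b x * v i x))" for l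
  unfolding eq
 proof (rule Hb_add)
  show "Hb k F a R (%i x. b x * pt l (v i) x)"
   using Suc.prems by (intro Suc.IH smooth_on_partial) auto
  show "Hb k F a R (%i x. pt l b x * v i x)"
   by (intro Suc.IH smooth_on_partial Suc.prems Hb_SucD[OF Suc.prems(1)])
 qed (intro smooth_intros smooth_on_partial Suc.prems open_UNIV)+
 thus ?case using Suc.prems by (simp add: L2b_mult)
qed

lemma Hb_uminus:
 assumes "Hb k F a R v" "!!i. smooth_on UNIV (v i)"
 shows "Hb k F a R (%i x. - v i x)"
 using Hb_mult[OF assms(1) smooth_on_const[OF open_UNIV, of "-1"] assms(2)] by simp

lemma Hb_diff:
 assumes "Hb k F a R v" "Hb k F a R w" "!!i. smooth_on UNIV (v i)" "!!i. smooth_on UNIV (w i)"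
 shows "Hb k F a R (%i x. v i x - w i x)"
 using Hb_add[OF assms(1) Hb_uminus[OF assms(2,4)] assms(3)] smooth_on_uminus[OF open_UNIV assms(4)] by simp

lemma Hb_zero: fixes a :: "real^'n" shows "Hb k F a R (%i x. 0)"
proof (induction k)
 case 0 show ?case by (auto simp: L2b_def N2_def)
next
 case (Suc k)
 have "pt l (%x. 0) = (%x::real^'n. 0)" for l by (simp add: fun_eq_iff)
 thus ?case using Suc Hb_L2b[OF Suc] by simp
qed

lemma Hb_sum:
 assumes "finite J" "!!j. j : J ==> Hb k F a R (v j)" "!!i j. j : J ==> smooth_on UNIV (v j i)"
 shows "Hb k F a R (%i x. SUM j:J. v j i x)"
 using assms
proof (induction J rule: finite_induct)
 case empty thus ?case by (simp add: Hb_zero)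
next
 case (insert j J)
 have "Hb k F a R (%i x. v j i x + (SUM j:J. v j i x))"
  using insert by (intro Hb_add smooth_on_sum) auto
 thus ?case using insert by simp
qed

text \<open>A mollified equation holds at \<open>x\<close> only once the mollification radius is
  below the distance of \<open>x\<close> to the boundary; hence the smaller balls and the passage
  along \<open>F\<close>.\<close>

definition evb :: "'i filter => real^'n => real => ('i => real^'n => bool) => bool" where
 "evb F a R P \<longleftrightarrow> (ALL s<R. \<forall>\<^sub>F i in F. ALL x:ball a s. P i x)"

lemma elliptic_gain_L2:
 fixes A :: "'n::finite => 'n => real^'n => real"
 assumes A: "!!i j. smooth_on UNIV (A i j)"
  and lam: "0 < lam" "!!x p. x : ball a R ==> lam * (SU i. (p i)^2) <= (SU i. SU j. A i j x * p i * p j)"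
  and sm: "!!i. smooth_on UNIV (V i)" "!!i l. smooth_on UNIV (G l i)" "!!i. smooth_on UNIV (H i)"
  and b: "L2b F a R V" "!!l. L2b F a R (G l)" "L2b F a R H"
  and eq: "evb F a R (%i x. (SU l. pt l (%x. SU j. A l j x * pt j (V i) x) x) = (SU l. pt l (G l i) x) + H i x)"
 shows "L2b F a R (%i. pt l (V i))"
 unfolding L2b_def
proof (intro allI impI)
 fix s assume s: "s < R"
 show "EX C. \<forall>\<^sub>F i in F. N2 a s (pt l (V i)) <= enn C"
 proof (cases "0 < s")
  case False thus ?thesis by (simp add: N2_empty)
 next
  case True
  define r where "r = (s + R) / 2"
  have r: "s < r" "r < R" using s by (auto simp: r_def)
  have lam': "lam * (SU i. (p i)^2) <= (SU i. SU j. A i j x * p i * p j)" if "x : ball a r" for x p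
   using lam(2) that r by auto
  obtain C where C0: "C >= 0 & (ALL V G H l. smooth_on UNIV V --> (ALL i. smooth_on UNIV (G i)) --> smooth_on UNIV H -->
   (ALL x:ball a r. (SU i. pt i (%x. SU j. A i j x * pt j V x) x) = (SU i. pt i (G i) x) + H x) -->
   N2 a s (pt l V) <= enn C * (N2 a r V + (SU i. N2 a r (G i)) + N2 a r H))"
   by (rule exE[OF energy_estimate[where a = a, OF True r(1) A lam(1)]]) (erule lam', rule that)
  note C = conjunct1[OF C0] conjunct2[OF C0, rule_format]
  obtain CV CH where CV: "0 <= CV" "\<forall>\<^sub>F i in F. N2 a r (V i) <= enn CV" and CH: "0 <= CH" "\<forall>\<^sub>F i in F. N2 a r (H i) <= enn CH"
   using L2bE[OF b(1) r(2)] L2bE[OF b(3) r(2)] by metis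
  have "EX C. 0 <= C & (\<forall>\<^sub>F i in F. N2 a r (G l i) <= enn C)" for l using L2bE[OF b(2) r(2)] by metis
  then obtain CG where CG: "!!l. 0 <= CG l" "!!l. \<forall>\<^sub>F i in F. N2 a r (G l i) <= enn (CG l)" by metis
  have "\<forall>\<^sub>F i in F. ALL l:UNIV. N2 a r (G l i) <= enn (CG l)" using CG(2) by (intro eventually_ball_finite) auto
  moreover have "\<forall>\<^sub>F i in F. ALL x:ball a r. (SU l. pt l (%x. SU j. A l j x * pt j (V i) x) x) = (SU l. pt l (G l i) x) + H i x"
   using eq r(2) unfolding evb_def by blast
  ultimately have "\<forall>\<^sub>F i in F. N2 a s (pt l (V i)) <= enn (C * (CV + (SU l. CG l) + CH))" using CV(2) CH(2)
  proof eventually_elim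
   case (elim i)
   have "N2 a s (pt l (V i)) <= enn C * (N2 a r (V i) + (SU l. N2 a r (G l i)) + N2 a r (H i))"
    by (rule C(2)[of "V i" "%l. G l i" "H i"]) (use sm elim in auto)
   also have "... <= enn C * (enn CV + (SU l. enn (CG l)) + enn CH)"
    using elim by (intro mult_left_mono add_mono sum_mono) auto
   also have "... = enn (C * (CV + (SU l. CG l) + CH))"
    using C(1) CV(1) CH(1) CG(1) by (simp add: sum_nonneg ennreal_mult add_nonneg_nonneg)
   finally show ?case .
  qed
  thus ?thesis by blast
 qed
qed

text \<open>Differentiating the equation in direction \<open>m\<close> gives an equation of the same
  form for \<open>pt m\<close> of the solution. The derivative of the coefficients goes into the new
  datum in place of \<open>G\<close>; it contains first derivatives of \<open>V\<close> only and is
  therefore bounded to the order that the induction requires.\<close>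

lemma elliptic_gain:
 fixes A :: "'n::finite => 'n => real^'n => real"
 assumes A: "!!i j. smooth_on UNIV (A i j)"
  and lam: "0 < lam" "!!x p. x : ball a R ==> lam * (SU i. (p i)^2) <= (SU i. SU j. A i j x * p i * p j)"
  and "!!i. smooth_on UNIV (V i)" "!!i l. smooth_on UNIV (G l i)" "!!i. smooth_on UNIV (H i)"
  and "Hb k F a R V" "!!l. Hb k F a R (G l)" "Hb k F a R H"
  and "evb F a R (%i x. (SU l. pt l (%x. SU j. A l j x * pt j (V i) x) x) = (SU l. pt l (G l i) x) + H i x)"
 shows "Hb (Suc k) F a R V"
 using assms(4-)
proof (induction k arbitrary: V G H)
 case 0
 have "L2b F a R (%i. pt l (V i))" for l
  by (rule elliptic_gain_L2[OF A lam, where V = V and G = G and H = H]) (use 0 in auto)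
 thus ?case using 0 by simp
next
 case (Suc k)
 let ?a = "%l i x. SU j. A l j x * pt j (V i) x" and ?b = "%m l i x. SU j. A l j x * pt j (pt m (V i)) x" and ?c = "%m l i x. SU j. pt m (A l j) x * pt j (V i) x"
 note sm = Suc.prems(1-3)
 note smI = smooth_intros A sm smooth_on_partial open_UNIV
 have "Hb (Suc k) F a R (%i. pt m (V i))" for m
 proof (rule Suc.IH[where G = "%l i x. pt m (G l i) x - ?c m l i x" and H = "%i. pt m (H i)"])
  show "smooth_on UNIV (pt m (V i))" "smooth_on UNIV (%x. pt m (G l i) x - ?c m l i x)" "smooth_on UNIV (pt m (H i))" for i l
   by (intro smI)+
  show "Hb k F a R (%i. pt m (V i))" "Hb k F a R (%i. pt m (H i))" using Suc.prems by auto
  show "Hb k F a R (%i x. pt m (G l i) x - ?c m l i x)" for l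
   using Suc.prems by (intro Hb_diff Hb_sum Hb_mult smI) auto
  show "evb F a R (%i x. (SU l. pt l (?b m l i) x) =
   (SU l. pt l (%x. pt m (G l i) x - ?c m l i x) x) + pt m (H i) x)"
   unfolding evb_def
  proof (intro allI impI)
   fix s assume "s < R"
   with Suc.prems(7) have "\<forall>\<^sub>F i in F. ALL x:ball a s. (SU l. pt l (?a l i) x) = (SU l. pt l (G l i) x) + H i x"
    unfolding evb_def by blast
   thus "\<forall>\<^sub>F i in F. ALL x:ball a s. (SU l. pt l (?b m l i) x) =
    (SU l. pt l (%x. pt m (G l i) x - ?c m l i x) x) + pt m (H i) x"
   proof eventually_elim
    case (elim i)
    show ?case
    proof
     fix x assume x: "x : ball a s"
     have pc: "pt l (pt m f) = pt m (pt l f)" if "smooth_on UNIV f" for l and f :: "real^'n => real"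
      using partial_commute[OF open_UNIV UNIV_I that] by (simp add: fun_eq_iff)
     have e1: "pt m (%x. SU l. pt l (?a l i) x) x = pt m (%x. (SU l. pt l (G l i) x) + H i x) x"
      by (rule partial_cong[OF open_ball x]) (use elim in auto)
     have mY: "pt m (?a l i) = (%x. ?b m l i x + ?c m l i x)" for l
     proof
      fix x
      have "pt m (?a l i) x = (SU j. pt m (%x. A l j x * pt j (V i) x) x)"
       by (rule partial_sum) (auto intro!: smooth_dif smI)
      also have "... = (SU j. A l j x * pt m (pt j (V i)) x + pt m (A l j) x * pt j (V i) x)"
       by (intro sum.cong refl partial_mult smooth_dif smI)
      finally show "pt m (?a l i) x = ?b m l i x + ?c m l i x"
       by (simp add: sum.distrib pc[OF sm(1)])
     qed
     have "pt m (%x. SU l. pt l (?a l i) x) x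
       = (SU l. pt m (pt l (?a l i)) x)"
      by (rule partial_sum) (auto intro!: smooth_dif smI)
     also have "... = (SU l. pt l (%x. ?b m l i x + ?c m l i x) x)"
     proof -
      have "pt m (pt l (?a l i)) = pt l (pt m (?a l i))" for l
       by (rule pc[symmetric]) (intro smI)
      thus ?thesis by (simp only: mY)
     qed
     also have "... = (SU l. pt l (?b m l i) x + pt l (?c m l i) x)"
      by (intro sum.cong refl partial_add smooth_dif smI)
     also have "... = (SU l. pt l (?b m l i) x) + (SU l. pt l (?c m l i) x)"
      by (rule sum.distrib)
     finally have l: "pt m (%x. SU l. pt l (?a l i) x) x = ..." .
     have "pt m (%x. (SU l. pt l (G l i) x) + H i x) x = pt m (%x. (SU l. pt l (G l i) x)) x + pt m (H i) x"
      by (intro partial_add smooth_dif smI)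
     also have "pt m (%x. (SU l. pt l (G l i) x)) x = (SU l. pt m (pt l (G l i)) x)"
      by (rule partial_sum) (auto intro!: smooth_dif smI)
     also have "... = (SU l. pt l (pt m (G l i)) x)" by (simp add: pc[OF sm(2)])
     finally have r: "pt m (%x. (SU l. pt l (G l i) x) + H i x) x = (SU l. pt l (pt m (G l i)) x) + pt m (H i) x" .
     have "(SU l. pt l (%x. pt m (G l i) x - ?c m l i x) x)
      = (SU l. pt l (pt m (G l i)) x - pt l (?c m l i) x)"
      by (intro sum.cong refl partial_diff smooth_dif smI)
     thus "(SU l. pt l (?b m l i) x) =
      (SU l. pt l (%x. pt m (G l i) x - ?c m l i x) x) + pt m (H i) x"
      using e1 l r by (simp add: sum_subtractf)
    qed
   qed
  qed
 qed
 thus ?case using Hb_L2b[OF Suc.prems(4)] by simp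
qed

section \<open>Mollification and Friedrichs commutators\<close>

definition eps :: "nat => real" where "eps m = inverse (real (Suc m))"

lemma eps_pos [simp]: "0 < eps m" by (simp add: eps_def)

lemma LIMSEQ_eps: "eps ~~> 0"
 using LIMSEQ_inverse_real_of_nat by (simp add: eps_def[abs_def])

lemma eventually_eps_le: "0 < r ==> EV m. eps m <= r"
 using order_tendstoD(2)[OF LIMSEQ_eps, of r] by (auto elim: eventually_mono)

text \<open>The height of the scaled kernel cancels against the volume of its support, so the
  constant is the same at every scale.\<close>

lemma conv_scl_N2:
 fixes ka :: "real^'n => real"
 assumes ka: "tfun ka" "!!x. 1 < norm x ==> ka x = 0" and M: "0 <= M" "!!x. abs (ka x) <= M"
  and W: "integrable lborel W" and e: "0 < e" "s + e <= s'"
 shows "N2 a s (conv (scl ka e) W) <= enn ((M * unit_ball_vol (real CARD('n)))^2) * N2 a s' W"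
proof -
 have "N2 a s (conv (scl ka e) W) <= enn ((M * inverse e ^ CARD('n) * (unit_ball_vol (real CARD('n)) * e ^ CARD('n)))^2) * N2 a s' W"
 proof (rule kernel_N2_le[OF W, where k = "%x y. scl ka e (x - y)"])
  show "(%y. scl ka e (x - y)) : bmb" for x
   by (intro tfun_measurable tfun_reflect tfun_scl ka e)
  show "abs (scl ka e (x - y)) <= M * inverse e ^ CARD('n)" for x y by (rule scl_le[OF M(2) e(1)])
  show "scl ka e (x - y) = 0" if "e < dist x y" for x y
   using scl_support[OF ka(2) e(1)] that by (simp add: dist_norm)
 qed (use e M in "auto simp: conv_def")
 moreover have "M * inverse e ^ CARD('n) * (unit_ball_vol (real CARD('n)) * e ^ CARD('n)) = M * unit_ball_vol (real CARD('n))"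
  using e(1) by (simp add: power_inverse field_simps)
 ultimately show ?thesis by simp
qed

lemma conv_L2b:
 fixes ka :: "real^'n => real"
 assumes ka: "tfun ka" "!!x. 1 < norm x ==> ka x = 0" and V: "!!i. integrable lborel (V i)" "L2b F a R V"
 shows "L2b (sequentially \<times>\<^sub>F F) a R (%p. conv (scl ka (eps (fst p))) (V (snd p)))"
 unfolding L2b_def
proof (intro allI impI)
 fix s assume s: "s < R"
 define s' where "s' = (s + R) / 2"
 have s': "s < s'" "s' < R" using s by (auto simp: s'_def)
 obtain M where M: "0 <= M" "!!x. abs (ka x) <= M" using tfun_bounded[OF ka(1)] by metis
 obtain C where C: "0 <= C" "\<forall>\<^sub>F i in F. N2 a s' (V i) <= enn C" using L2bE[OF V(2) s'(2)] by metis
 have "EV m. eps m <= s' - s" by (rule eventually_eps_le) (use s' in simp)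
 from eventually_prodI[OF this C(2)]
 have "\<forall>\<^sub>F p in sequentially \<times>\<^sub>F F. N2 a s (conv (scl ka (eps (fst p))) (V (snd p))) <= enn ((M * unit_ball_vol (real CARD('n)))^2 * C)"
 proof eventually_elim
  case (elim p)
  have "N2 a s (conv (scl ka (eps (fst p))) (V (snd p))) <= enn ((M * unit_ball_vol (real CARD('n)))^2) * N2 a s' (V (snd p))"
   by (rule conv_scl_N2[OF ka M V(1)]) (use elim in auto)
  also have "... <= enn ((M * unit_ball_vol (real CARD('n)))^2) * enn C" using elim by (intro mult_left_mono) auto
  finally show ?case using C by (simp add: ennreal_mult)
 qed
 thus "EX C. \<forall>\<^sub>F p in sequentially \<times>\<^sub>F F. N2 a s (conv (scl ka (eps (fst p))) (V (snd p))) <= enn C" by blast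
qed

text \<open>The commutator of multiplication by \<open>b\<close> with convolution by
  \<open>ka\<close>: the error made when an equation with variable coefficients is
  mollified.\<close>

definition cm :: "(real^'n => real) => (real^'n => real) => (real^'n => real) => real^'n => real" where
 "cm ka b W = (%x. b x * conv ka W x - conv ka (%y. b y * W y) x)"

text \<open>The factor \<open>1 / \<epsilon>\<close> from the derivative of the kernel is compensated by \<open>\<bar>b x - b y\<bar> \<le> L \<epsilon>\<close>.\<close>

lemma cm_L2b:
 fixes ka :: "real^'n => real"
 assumes ka: "tfun ka" "!!x. 1 < norm x ==> ka x = 0" and b: "smooth_on UNIV b"
  and V: "!!i. tfun (V i)" "L2b F a R V"
 shows "L2b (sequentially \<times>\<^sub>F F) a R (%p. cm (pt l (scl ka (eps (fst p)))) b (V (snd p)))"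
 unfolding L2b_def
proof (intro allI impI)
 fix s assume s: "s < R"
 define s' where "s' = (s + R) / 2"
 have s': "s < s'" "s' < R" using s by (auto simp: s'_def)
 obtain M where M: "0 <= M" "!!x. abs (pt l ka x) <= M" using tfun_bounded[OF tfun_partial[OF ka(1)]] by metis
 have ka'0: "pt l ka x = 0" if "1 < norm x" for x
  using partial_cong[of "{x. 1 < norm x}" x ka "%_. 0" l] ka(2) that open_Collect_less[of "%_. 1" "norm :: real^'n => real"]
  by (auto intro: continuous_intros)
 obtain L where L: "0 <= L" "!!x y. x : cball a s' ==> y : cball a s' ==> abs (b x - b y) <= L * dist x y"
  using smooth_Lipschitz_cball[OF b] by metis
 obtain C where C: "0 <= C" "\<forall>\<^sub>F i in F. N2 a s' (V i) <= enn C" using L2bE[OF V(2) s'(2)] by metis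
 let ?c = "(L * M * unit_ball_vol (real CARD('n)))^2"
 have est: "N2 a s (cm (pt l (scl ka e)) b W) <= enn ?c * N2 a s' W" if e: "0 < e" "s + e <= s'" and W: "tfun W" for e W
 proof -
  let ?k = "pt l (scl ka e)"
  have k: "tfun ?k" by (intro tfun_partial tfun_scl ka e)
  have keq: "?k x = inverse e * scl (pt l ka) e x" for x by (rule partial_scl[OF ka(1) e(1)])
  have k0: "?k (x - y) = 0" if "e < dist x y" for x y
  proof -
   have "1 < norm (inverse e *. (x - y))" unfolding norm_scaleR using that e by (simp add: dist_norm field_simps)
   from ka'0[OF this] show ?thesis by (simp add: keq scl_def)
  qed
  have "N2 a s (cm ?k b W) <= enn ((L * M * inverse e ^ CARD('n) * (unit_ball_vol (real CARD('n)) * e ^ CARD('n)))^2) * N2 a s' W"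
  proof (rule kernel_N2_le[OF tfun_integrable[OF W], where k = "%x y. (b x - b y) * ?k (x - y)"])
   show "(%y. (b x - b y) * ?k (x - y)) : bmb" for x
    by (intro borel_measurable_times borel_measurable_diff borel_measurable_const smooth_UNIV_measurable[OF b] tfun_measurable tfun_reflect k)
   show "(b x - b y) * ?k (x - y) = 0" if "e < dist x y" for x y using k0[OF that] by simp
   show "abs ((b x - b y) * ?k (x - y)) <= L * M * inverse e ^ CARD('n)" if x: "x : ball a s" for x y
   proof (cases "e < dist x y")
    case True thus ?thesis using k0[OF True] L M e by simp
   next
    case False
    have "abs (b x - b y) <= L * dist x y"
     by (rule L(2)) (use x False e s' dist_triangle[of a y x] in auto)
    also have "... <= L * e" using False L by (intro mult_left_mono) auto
    finally have 1: "abs (b x - b y) <= L * e" .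
    have "abs (?k (x - y)) <= inverse e * (M * inverse e ^ CARD('n))"
     unfolding keq abs_mult using e scl_le[where ka = "pt l ka" and x = "x - y", OF M(2) e(1)] by (intro mult_mono) auto
    with 1 have "abs (b x - b y) * abs (?k (x - y)) <= (L * e) * (inverse e * (M * inverse e ^ CARD('n)))"
     using L e by (intro mult_mono) auto
    also have "(L * e) * (inverse e * (M * inverse e ^ CARD('n))) = (e * inverse e) * (L * M * inverse e ^ CARD('n))"
     by (simp only: mult_ac)
    also have "e * inverse e = 1" using e by simp
    finally show ?thesis by (simp add: abs_mult)
   qed
   show "cm ?k b W x = (LI y. (b x - b y) * ?k (x - y) * W y)" for x
   proof -
    have i: "integrable lborel (%y. ?k (x - y) * W y)" "integrable lborel (%y. ?k (x - y) * (b y * W y))"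
     by (intro conv_integrable k tfun_integrable W tfun_mult[OF b])+
    have "(b x - b y) * ?k (x - y) * W y = b x * (?k (x - y) * W y) - ?k (x - y) * (b y * W y)" for y
     by (simp add: algebra_simps)
    thus ?thesis using i by (simp add: cm_def conv_def)
   qed
  qed (use e L M in auto)
  moreover have "L * M * inverse e ^ CARD('n) * (unit_ball_vol (real CARD('n)) * e ^ CARD('n)) = L * M * unit_ball_vol (real CARD('n))"
   using e(1) by (simp add: power_inverse field_simps)
  ultimately show ?thesis by simp
 qed
 have "EV m. eps m <= s' - s" by (rule eventually_eps_le) (use s' in simp)
 from eventually_prodI[OF this C(2)]
 have "\<forall>\<^sub>F p in sequentially \<times>\<^sub>F F. N2 a s (cm (pt l (scl ka (eps (fst p)))) b (V (snd p))) <= enn (?c * C)"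
 proof eventually_elim
  case (elim p)
  have "N2 a s (cm (pt l (scl ka (eps (fst p)))) b (V (snd p))) <= enn ?c * N2 a s' (V (snd p))"
   by (rule est[OF _ _ V(1)]) (use elim in auto)
  also have "... <= enn ?c * enn C" using elim by (intro mult_left_mono) auto
  finally show ?case using C by (simp add: ennreal_mult)
 qed
 thus "EX C. \<forall>\<^sub>F p in sequentially \<times>\<^sub>F F. N2 a s (cm (pt l (scl ka (eps (fst p)))) b (V (snd p))) <= enn C" by blast
qed

lemma smooth_cm:
 assumes "tfun ka" "smooth_on UNIV b" "integrable lborel W" "integrable lborel (%y. b y * W y)"
 shows "smooth_on UNIV (cm ka b W)"
 unfolding cm_def by (intro smooth_intros smooth_on_conv assms open_UNIV)

lemma smooth_cm_tfun:
 assumes "tfun ka" "smooth_on UNIV b" "tfun W" shows "smooth_on UNIV (cm ka b W)"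
 by (intro smooth_cm assms tfun_integrable tfun_mult)

lemma partial_cm:
 assumes "tfun ka" "smooth_on UNIV b" "integrable lborel W" "integrable lborel (%y. b y * W y)"
 shows "pt l (cm ka b W) = (%x. pt l b x * conv ka W x + cm (pt l ka) b W x)"
proof
 fix x
 have d: "b differentiable (at x)" "conv ka W differentiable (at x)" "conv ka (%y. b y * W y) differentiable (at x)"
  "(%x. b x * conv ka W x) differentiable (at x)"
  by (intro smooth_dif smooth_on_mult smooth_on_conv assms open_UNIV)+
 show "pt l (cm ka b W) x = pt l b x * conv ka W x + cm (pt l ka) b W x"
  unfolding cm_def by (simp add: partial_diff[OF d(4,3)] partial_mult[OF d(1,2)] partial_conv assms)
qed

lemma cm_partial_swap:
 assumes "tfun ka" "smooth_on UNIV b" "tfun W"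
 shows "cm (pt l ka) b W = (%x. cm ka b (pt l W) x - conv ka (%y. pt l b y * W y) x)"
proof
 fix x
 have tb: "tfun (%y. b y * W y)" by (rule tfun_mult[OF assms(2,3)])
 have "pt l (%y. b y * W y) = (%y. b y * pt l W y + pt l b y * W y)"
  by (intro ext partial_mult smooth_dif assms tfun_smooth[OF assms(3)])
 hence "conv (pt l ka) (%y. b y * W y) x = (LI y. ka (x - y) * (b y * pt l W y) + ka (x - y) * (pt l b y * W y))"
  unfolding conv_partial_swap[OF assms(1) tb] by (simp add: conv_def distrib_left)
 also have "... = conv ka (%y. b y * pt l W y) x + conv ka (%y. pt l b y * W y) x"
  unfolding conv_def by (intro Bochner_Integration.integral_add conv_integrable assms tfun_integrable tfun_mult tfun_partial smooth_on_partial)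
 finally show "cm (pt l ka) b W x = cm ka b (pt l W) x - conv ka (%y. pt l b y * W y) x"
  unfolding cm_def conv_partial_swap[OF assms(1,3)] by simp
qed

lemma partial_cm_tfun:
 assumes "tfun ka" "smooth_on UNIV b" "tfun W"
 shows "pt l (cm ka b W) = (%x. cm ka (pt l b) W x + cm ka b (pt l W) x)"
 using partial_cm[OF assms(1,2) tfun_integrable[OF assms(3)] tfun_integrable[OF tfun_mult[OF assms(2,3)]], of l] cm_partial_swap[OF assms, of l]
 by (simp add: cm_def fun_eq_iff)

text \<open>At order 0 a derivative of the commutator falls on \<open>b\<close> or on the kernel,
  and \<open>cm_L2b\<close> covers the second case. At higher orders \<open>partial_cm_tfun\<close>
  expresses derivatives of commutators by commutators with derivatives of \<open>b\<close> or of
  \<open>V\<close>, to which the induction applies. This gain of one order closes the bootstrap in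
  \<open>weyl_core\<close>.\<close>

lemma cm_gain:
 fixes ka :: "real^'n => real"
 assumes ka: "tfun ka" "!!x. 1 < norm x ==> ka x = 0"
  and "smooth_on UNIV b" "!!i. tfun (V i)" "Hb k F a R V"
 shows "Hb (Suc k) (sequentially \<times>\<^sub>F F) a R (%p. cm (scl ka (eps (fst p))) b (V (snd p)))"
 using assms(3-)
proof (induction k arbitrary: b V)
 case (0 b V)
 let ?S = "sequentially \<times>\<^sub>F F"
 have t: "tfun (scl ka (eps m))" for m by (rule tfun_scl[OF ka(1) eps_pos])
 note i = tfun_integrable[OF 0(2)] tfun_integrable[OF tfun_mult[OF 0(1,2)]]
 have V: "L2b F a R V" "L2b F a R (%i y. b y * V i y)" using 0 by (auto intro: L2b_mult tfun_smooth)
 have c: "L2b ?S a R (%p. conv (scl ka (eps (fst p))) (V (snd p)))"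
  by (rule conv_L2b[OF ka i(1) V(1)])
 have "L2b ?S a R (%p x. b x * conv (scl ka (eps (fst p))) (V (snd p)) x)"
  by (intro L2b_mult c 0(1) smooth_on_conv t i)
 moreover have "L2b ?S a R (%p. conv (scl ka (eps (fst p))) (%y. b y * V (snd p) y))"
  by (rule conv_L2b[OF ka i(2) V(2)])
 ultimately have "Hb 0 ?S a R (%p x. b x * conv (scl ka (eps (fst p))) (V (snd p)) x - conv (scl ka (eps (fst p))) (%y. b y * V (snd p) y) x)"
  by (intro Hb_diff smooth_on_mult smooth_on_conv t i 0(1) open_UNIV) (simp_all only: Hb.simps(1))
 hence 1: "L2b ?S a R (%p. cm (scl ka (eps (fst p))) b (V (snd p)))"
  unfolding cm_def by (simp only: Hb.simps(1))
 have "L2b ?S a R (%p. pt l (cm (scl ka (eps (fst p))) b (V (snd p))))" for l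
  unfolding partial_cm[OF t 0(1) i]
  by (intro L2b_add L2b_mult c cm_L2b[OF ka 0(1,2) V(1)] smooth_on_partial 0(1) smooth_on_conv smooth_on_mult smooth_cm_tfun 0(2) t tfun_partial i open_UNIV)
 thus ?case using 1 by simp
next
 case (Suc k b V)
 let ?S = "sequentially \<times>\<^sub>F F"
 have t: "tfun (scl ka (eps m))" for m by (rule tfun_scl[OF ka(1) eps_pos])
 have "Hb (Suc k) ?S a R (%p. pt l (cm (scl ka (eps (fst p))) b (V (snd p))))" for l
  unfolding partial_cm_tfun[OF t Suc.prems(1,2)]
 proof (rule Hb_add)
  show "Hb (Suc k) ?S a R (%p. cm (scl ka (eps (fst p))) (pt l b) (V (snd p)))"
   by (intro Suc.IH smooth_on_partial Suc.prems Hb_SucD[OF Suc.prems(3)])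
  show "Hb (Suc k) ?S a R (%p. cm (scl ka (eps (fst p))) b (%x. pt l (V (snd p)) x))"
   using Suc.prems(3) by (intro Suc.IH[of b "%i. pt l (V i)"] tfun_partial Suc.prems(1,2)) auto
 qed (intro smooth_cm_tfun t smooth_on_partial tfun_partial Suc.prems)+
 moreover have "L2b ?S a R (%p. cm (scl ka (eps (fst p))) b (V (snd p)))"
  by (rule Hb_L2b[OF Suc.IH[OF Suc.prems(1,2) Hb_SucD[OF Suc.prems(3)]]])
 ultimately show ?case by (simp del: Hb.simps(2) add: Hb.simps(2)[of "Suc k"])
qed

text \<open>By Fubini the mollifier moves onto the test function \<open>ze\<close>, whose Lipschitz
  bound makes the error at scale \<open>e\<close> at most \<open>L * e\<close> times the L1 norm of
  \<open>U\<close>.\<close>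

lemma tendsto_mollify:
 fixes et :: "real^'n => real"
 assumes et: "tfun et" "!!x. 1 < norm x ==> et x = 0" "(LI x. et x) = 1" "!!x. 0 <= et x"
  and U: "integrable lborel U" and ze: "tfun ze"
 shows "(%i. (LI y. ze y * conv (scl et (eps i)) U y)) ~~> (LI y. ze y * U y)"
proof -
 obtain L where L: "L >= 0" "!!x y. abs (ze x - ze y) <= L * dist x y" using tfun_Lipschitz[OF ze] by metis
 have [measurable]: "U : bmb" using U by (auto dest: borel_measurable_integrable)
 note [measurable] = tfun_measurable[OF ze]
 have est: "abs ((LI y. ze y * conv (scl et e) U y) - (LI y. ze y * U y)) <= L * e * (LI z. abs (U z))" if e: "0 < e" for e
 proof -
  let ?k = "scl et e"
  have k: "tfun ?k" by (rule tfun_scl[OF et(1) e])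
  note [measurable] = tfun_measurable[OF k]
  have k1: "(LI x. ?k x) = 1" using integral_scl[OF tfun_measurable[OF et(1)] e] et(3) by simp
  have kz: "tfun (%y. ?k (y - z))" for z using tfun_affine[OF k, of 1 "- z"] by simp
  have kz1: "(LI y. ?k (y - z)) = 1" for z using integral_translation[of ?k "- z"] k1 by simp
  obtain M where M: "0 <= M" "!!x. abs (?k x) <= M" using tfun_bounded[OF k] by metis
  have int: "integrable (lborel \<Otimes>\<^sub>M lborel) (%(y, z). ze y * (?k (y - z) * U z))"
  proof (rule lborel_pair.Fubini_integrable)
   show "(%(y, z). ze y * (?k (y - z) * U z)) : borel_measurable (lborel \<Otimes>\<^sub>M lborel)" by measurable
   show "AE y in lborel. integrable lborel (%z. case (y, z) of (y, z) => ze y * (?k (y - z) * U z))"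
    using conv_integrable[OF k U] by auto
   show "integrable lborel (%y. (LI z. norm (case (y, z) of (y, z) => ze y * (?k (y - z) * U z))))"
   proof (rule Bochner_Integration.integrable_bound)
    show "integrable lborel (%y. abs (ze y) * (M * (LI z. abs (U z))))"
     using tfun_integrable[OF ze] by simp
    show "AE y in lborel. norm (LI z. norm (case (y, z) of (y, z) => ze y * (?k (y - z) * U z))) <= norm (abs (ze y) * (M * (LI z. abs (U z))))"
    proof (rule AE_I2)
     fix y
     have "(LI z. abs (ze y * (?k (y - z) * U z))) = abs (ze y) * (LI z. abs (?k (y - z) * U z))"
      by (simp add: abs_mult[of "ze y"])
     also have "... <= abs (ze y) * (LI z. M * abs (U z))"
     proof (intro mult_left_mono integral_mono)
      show "integrable lborel (%z. abs (?k (y - z) * U z))" by (intro integrable_abs conv_integrable k U)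
      show "integrable lborel (%z. M * abs (U z))" using U by simp
      show "abs (?k (y - z) * U z) <= M * abs (U z)" for z unfolding abs_mult by (intro mult_right_mono M(2)) simp
     qed simp
     finally show "norm (LI z. norm (case (y, z) of (y, z) => ze y * (?k (y - z) * U z))) <= norm (abs (ze y) * (M * (LI z. abs (U z))))"
      using M by (simp add: integral_nonneg_AE abs_mult)
    qed
   qed measurable
  qed
  have kzi: "integrable lborel (%y. ze y * ?k (y - z))" for z
   by (intro tfun_integrable tfun_mult tfun_smooth[OF ze] kz)
  have "(LI y. ze y * conv ?k U y) = (LI y. (LI z. ze y * (?k (y - z) * U z)))"
   by (simp add: conv_def)
  also have "... = (LI z. (LI y. ze y * (?k (y - z) * U z)))"
   using lborel_pair.Fubini_integral[OF int] by simp
  also have "... = (LI z. (LI y. ze y * ?k (y - z)) * U z)"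
   by (simp add: mult.assoc[symmetric])
  finally have 1: "(LI y. ze y * conv ?k U y) = (LI z. (LI y. ze y * ?k (y - z)) * U z)" .
  have close: "abs ((LI y. ze y * ?k (y - z)) - ze z) <= L * e" for z
  proof -
   have "(LI y. ze y * ?k (y - z)) - ze z = (LI y. (ze y - ze z) * ?k (y - z))"
    using kzi[of z] tfun_integrable[OF kz[of z]] kz1[of z] by (simp add: left_diff_distrib)
   also have "abs (...) <= (LI y. L * e * ?k (y - z))"
   proof (rule order_trans[OF integral_abs_bound], rule integral_mono_AE')
    show "AE y in lborel. abs ((ze y - ze z) * ?k (y - z)) <= L * e * ?k (y - z)"
    proof (rule AE_I2)
     fix y
     have kp: "0 <= ?k (y - z)" using et(4) e by (simp add: scl_def)
     show "abs ((ze y - ze z) * ?k (y - z)) <= L * e * ?k (y - z)"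
     proof (cases "e < dist y z")
      case True
      hence "?k (y - z) = 0" using scl_support[OF et(2) e] by (simp add: dist_norm)
      thus ?thesis by simp
     next
      case False
      have "abs (ze y - ze z) <= L * e" using L(2)[of y z] mult_left_mono[OF _ L(1), of "dist y z" e] False by linarith
      thus ?thesis using kp by (simp add: abs_mult mult_right_mono)
     qed
    qed
   qed (use tfun_integrable[OF kz] L e et(4) in "auto simp: scl_def")
   also have "... = L * e" using kz1[of z] by simp
   finally show ?thesis .
  qed
  have i2: "integrable lborel (%z. (LI y. ze y * ?k (y - z)) * U z)"
  proof -
   obtain Mz where Mz: "!!x. abs (ze x) <= Mz" using tfun_bounded[OF ze] by metis
   show ?thesis
   proof (rule integrable_bounded_mult[OF U])
   show "abs ((LI y. ze y * ?k (y - z))) <= L * e + Mz" for z using close[of z] Mz[of z] by linarith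
   show "(%z. (LI y. ze y * ?k (y - z))) : bmb" by measurable
   qed
  qed
  have "(LI y. ze y * conv ?k U y) - (LI y. ze y * U y) = (LI z. ((LI y. ze y * ?k (y - z)) - ze z) * U z)"
   unfolding 1 using i2 tfun_mult_integrable[OF ze U] by (simp add: left_diff_distrib)
  also have "abs (...) <= (LI z. L * e * abs (U z))"
   using U L e close by (intro order_trans[OF integral_abs_bound] integral_mono_AE') (auto simp: abs_mult intro!: AE_I2 mult_right_mono)
  finally show ?thesis by simp
 qed
 have "(%i. (LI y. ze y * conv (scl et (eps i)) U y) - (LI y. ze y * U y)) ~~> 0"
 proof (rule Lim_null_comparison)
  show "EV i. norm ((LI y. ze y * conv (scl et (eps i)) U y) - (LI y. ze y * U y)) <= L * eps i * (LI z. abs (U z))"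
   using est[OF eps_pos] by auto
  have "(%i. L * eps i * (LI z. abs (U z))) ~~> L * 0 * (LI z. abs (U z))"
   by (intro tendsto_intros LIMSEQ_eps)
  thus "(%i. L * eps i * (LI z. abs (U z))) ~~> 0" by simp
 qed
 thus ?thesis by (simp add: LIM_zero_iff)
qed

text \<open>Pointwise convergence of all derivatives up to order \<open>k\<close>, just enough for
  Fatou's lemma in \<open>Hb_limit\<close>.\<close>

primrec DL :: "nat => (nat => real^'n => real) => (real^'n => real) => bool" where
 "DL 0 w v \<longleftrightarrow> (ALL x. (%i. w i x) ~~> v x)"
| "DL (Suc k) w v \<longleftrightarrow> (ALL x. (%i. w i x) ~~> v x) & (ALL l. DL k (%i. pt l (w i)) (pt l v))"

lemma DL_tendsto: "DL k w v ==> (%i. w i x) ~~> v x"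
 by (cases k) auto

lemma DL_SucD: "DL (Suc k) w v ==> DL k w v"
 by (induction k arbitrary: w v) auto

lemma DL_add:
 assumes "DL k w v" "DL k w' v'" "!!i. smooth_on UNIV (w i)" "smooth_on UNIV v" "!!i. smooth_on UNIV (w' i)" "smooth_on UNIV v'"
 shows "DL k (%i x. w i x + w' i x) (%x. v x + v' x)"
 using assms
proof (induction k arbitrary: w v w' v')
 case 0 thus ?case by (auto intro: tendsto_add)
next
 case (Suc k)
 have eq: "pt l (%x. w i x + w' i x) = (%x. pt l (w i) x + pt l (w' i) x)"
  "pt l (%x. v x + v' x) = (%x. pt l v x + pt l v' x)" for l i
  by (intro ext partial_add smooth_dif Suc.prems)+
 have "DL k (%i x. pt l (w i) x + pt l (w' i) x) (%x. pt l v x + pt l v' x)" for l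
  using Suc.prems by (intro Suc.IH smooth_on_partial) auto
 thus ?case using Suc.prems by (auto simp: eq intro: tendsto_add)
qed

lemma DL_mult:
 assumes "DL k w v" "smooth_on UNIV b" "!!i. smooth_on UNIV (w i)" "smooth_on UNIV v"
 shows "DL k (%i x. b x * w i x) (%x. b x * v x)"
 using assms
proof (induction k arbitrary: w v b)
 case 0 thus ?case by (auto intro: tendsto_mult_left)
next
 case (Suc k)
 have eq: "pt l (%x. b x * w i x) = (%x. b x * pt l (w i) x + pt l b x * w i x)"
  "pt l (%x. b x * v x) = (%x. b x * pt l v x + pt l b x * v x)" for l i
  by (intro ext partial_mult smooth_dif Suc.prems)+
 have "DL k (%i x. b x * pt l (w i) x) (%x. b x * pt l v x)" for l
  using Suc.prems by (intro Suc.IH smooth_on_partial) auto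
 moreover have "DL k (%i x. pt l b x * w i x) (%x. pt l b x * v x)" for l
  using Suc.prems DL_SucD[OF Suc.prems(1)] by (intro Suc.IH smooth_on_partial) auto
 ultimately have "DL k (%i x. b x * pt l (w i) x + pt l b x * w i x) (%x. b x * pt l v x + pt l b x * v x)" for l
  by (intro DL_add smooth_on_mult smooth_on_partial Suc.prems open_UNIV)
 thus ?case using DL_tendsto[OF Suc.prems(1)] by (auto simp: eq intro: tendsto_mult_left)
qed

text \<open>A bound along the product filter holds with one constant for all large \<open>m\<close>
  and \<open>i\<close>. For fixed large \<open>m\<close>, Fatou's lemma lets \<open>i\<close> tend
  to infinity, and the constant survives for \<open>W m\<close>.\<close>

lemma Hb_limit:
 assumes "Hb k (sequentially \<times>\<^sub>F sequentially) a R W2" "!!m. DL k (%i. W2 (m, i)) (W m)" "!!p. smooth_on UNIV (W2 p)"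
 shows "Hb k sequentially a R W"
proof -
 have base: "L2b sequentially a R W" if W2: "L2b (sequentially \<times>\<^sub>F sequentially) a R W2" "!!m x. (%i. W2 (m, i) x) ~~> W m x"
  "!!p. smooth_on UNIV (W2 p)" for W2 W
  unfolding L2b_def
 proof (intro allI impI)
  fix s assume "s < R"
  then obtain C where C: "0 <= C" "\<forall>\<^sub>F p in sequentially \<times>\<^sub>F sequentially. N2 a s (W2 p) <= enn C" using L2bE[OF W2(1)] by metis
  then obtain N where N: "!!m n. m >= N ==> n >= N ==> N2 a s (W2 (n, m)) <= enn C"
   unfolding eventually_prod_sequentially by blast
  have "N2 a s (W m) <= enn C" if m: "m >= N" for m
  proof -
   note [measurable] = smooth_UNIV_measurable[OF W2(3)]
   have lim: "(%i. ind (ball a s) x * enn ((W2 (m, i) x)^2)) ~~> ind (ball a s) x * enn ((W m x)^2)" for x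
   proof (cases "x : ball a s")
    case True
    have "(%i. enn ((W2 (m, i) x)^2)) ~~> ennreal ((W m x)^2)" by (intro tendsto_ennrealI tendsto_power W2)
    thus ?thesis using True by simp
   qed simp
   have "N2 a s (W m) = (NN x. liminf (%i. ind (ball a s) x * enn ((W2 (m, i) x)^2)))"
    unfolding N2_def by (intro nn_integral_cong) (simp add: lim_imp_Liminf[OF _ lim])
   also have "... <= liminf (%i. N2 a s (W2 (m, i)))"
    unfolding N2_def by (rule nn_integral_liminf) measurable
   also have "... <= limsup (%i. N2 a s (W2 (m, i)))" by (rule Liminf_le_Limsup) simp
   also have "... <= enn C"
    by (rule Limsup_bounded) (use N m in "auto simp: eventually_sequentially")
   finally show ?thesis .
  qed
  thus "EX C. EV m. N2 a s (W m) <= enn C"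
   unfolding eventually_sequentially by blast
 qed
 show ?thesis using assms
 proof (induction k arbitrary: W2 W)
  case 0
  have "L2b sequentially a R W" by (rule base[of W2]) (use 0 in auto)
  thus ?case by simp
 next
  case (Suc k)
  have "L2b sequentially a R W" by (rule base[of W2]) (use Suc.prems in auto)
  moreover have "Hb k sequentially a R (%i. pt l (W i))" for l
  proof (rule Suc.IH[of "%p. pt l (W2 p)"])
   show "smooth_on UNIV (pt l (W2 p))" for p by (rule smooth_on_partial[OF Suc.prems(3)])
  qed (use Suc.prems in auto)
  ultimately show ?case by simp
 qed
qed

lemma DL_conv_mollify:
 fixes et :: "real^'n => real"
 assumes et: "tfun et" "!!x. 1 < norm x ==> et x = 0" "(LI x. et x) = 1" "!!x. 0 <= et x"
  and U: "integrable lborel U" "!!x. r < norm x ==> U x = 0" and ka: "tfun ka"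
  and b: "smooth_on UNIV b" "integrable lborel (%y. b y * U y)"
 shows "DL k (%i. conv ka (%y. b y * conv (scl et (eps i)) U y)) (conv ka (%y. b y * U y))"
 using ka
proof (induction k arbitrary: ka)
 have base: "(%i. conv ka (%y. b y * conv (scl et (eps i)) U y) x) ~~> conv ka (%y. b y * U y) x" if "tfun ka" for ka x
  using tendsto_mollify[OF et U(1) tfun_mult[OF b(1) tfun_reflect[OF that]], of x]
  by (simp add: conv_def mult_ac)
 { case 0 thus ?case by (simp add: base)
 next
  case (Suc k)
  have t: "integrable lborel (%y. b y * conv (scl et (eps i)) U y)" for i
   by (intro tfun_integrable tfun_mult b tfun_conv[OF _ U] tfun_scl et eps_pos)
  show ?case using Suc by (simp add: base partial_conv t b tfun_partial) }
qed

text \<open>\<open>cm_gain\<close> wants smooth arguments, which \<open>U\<close> is not. It is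
  applied to mollifications of \<open>U\<close> at a second scale of index \<open>i\<close>; that
  scale is then removed by \<open>Hb_limit\<close>.\<close>

lemma cm_gain_mollify:
 fixes et :: "real^'n => real"
 assumes et: "tfun et" "!!x. 1 < norm x ==> et x = 0" "(LI x. et x) = 1" "!!x. 0 <= et x"
  and U: "integrable lborel U" "!!x. r < norm x ==> U x = 0"
  and b: "smooth_on UNIV b" "integrable lborel (%y. b y * U y)"
  and H: "Hb k sequentially a R (%m. conv (scl et (eps m)) U)"
 shows "Hb (Suc k) sequentially a R (%m. cm (scl et (eps m)) b U)"
proof (rule Hb_limit)
 have tU: "tfun (conv (scl et (eps i)) U)" for i by (intro tfun_conv[OF _ U] tfun_scl et eps_pos)
 have ts: "tfun (scl et (eps i))" for i by (intro tfun_scl et eps_pos)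
 show "Hb (Suc k) (sequentially \<times>\<^sub>F sequentially) a R (%p. cm (scl et (eps (fst p))) b (conv (scl et (eps (snd p))) U))"
  by (rule cm_gain[OF et(1,2) b(1) tU H])
 show "smooth_on UNIV (cm (scl et (eps (fst p))) b (conv (scl et (eps (snd p))) U))" for p
  by (intro smooth_cm_tfun ts b tU)
 fix m
 have i1: "integrable lborel (%y. 1 * U y)" using U by simp
 have 1: "DL (Suc k) (%i. conv (scl et (eps m)) (conv (scl et (eps i)) U)) (conv (scl et (eps m)) U)"
  using DL_conv_mollify[OF et U ts[of m] smooth_on_const[OF open_UNIV, of 1] i1, where k = "Suc k"] by (simp only: mult_1)
 have 2: "DL (Suc k) (%i. conv (scl et (eps m)) (%y. b y * conv (scl et (eps i)) U y)) (conv (scl et (eps m)) (%y. b y * U y))"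
  by (rule DL_conv_mollify[OF et U ts b])
 have s: "smooth_on UNIV (conv (scl et (eps m)) (conv (scl et (eps i)) U))" "smooth_on UNIV (conv (scl et (eps m)) U)"
  "smooth_on UNIV (conv (scl et (eps m)) (%y. b y * conv (scl et (eps i)) U y))" "smooth_on UNIV (conv (scl et (eps m)) (%y. b y * U y))" for i
  by (intro smooth_on_conv ts tfun_integrable tU tfun_mult b U)+
 have "DL (Suc k) (%i x. b x * conv (scl et (eps m)) (conv (scl et (eps i)) U) x + (-1) * conv (scl et (eps m)) (%y. b y * conv (scl et (eps i)) U y) x)
   (%x. b x * conv (scl et (eps m)) U x + (-1) * conv (scl et (eps m)) (%y. b y * U y) x)"
  by (intro DL_add DL_mult 1 2 s smooth_on_mult smooth_on_const b open_UNIV)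
 thus "DL (Suc k) (%i. cm (scl et (eps (fst (m, i)))) b (conv (scl et (eps (snd (m, i)))) U)) (cm (scl et (eps m)) b U)"
  by (simp add: cm_def)
qed

lemma conv_mollify_L2b:
 fixes ka :: "real^'n => real"
 assumes ka: "tfun ka" "!!x. 1 < norm x ==> ka x = 0" and W: "integrable lborel W" "!!s. s < R ==> N2 a s W < \<infinity>"
 shows "L2b sequentially a R (%m. conv (scl ka (eps m)) W)"
 unfolding L2b_def
proof (intro allI impI)
 fix s assume s: "s < R"
 define s' where "s' = (s + R) / 2"
 have s': "s < s'" "s' < R" using s by (auto simp: s'_def)
 obtain M where M: "0 <= M" "!!x. abs (ka x) <= M" using tfun_bounded[OF ka(1)] by metis
 obtain C where C: "N2 a s' W = enn C" "0 <= C" using W(2)[OF s'(2)] by (cases "N2 a s' W") auto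
 have "EV m. eps m <= s' - s" by (rule eventually_eps_le) (use s' in simp)
 hence "EV m. N2 a s (conv (scl ka (eps m)) W) <= enn ((M * unit_ball_vol (real CARD('n)))^2 * C)"
 proof eventually_elim
  case (elim m)
  have "N2 a s (conv (scl ka (eps m)) W) <= enn ((M * unit_ball_vol (real CARD('n)))^2) * N2 a s' W"
   by (rule conv_scl_N2[OF ka M W(1)]) (use elim in auto)
  thus ?case using C by (simp add: ennreal_mult)
 qed
 thus "EX C. EV m. N2 a s (conv (scl ka (eps m)) W) <= enn C" by blast
qed

lemma conv_mollify_Hb:
 fixes ka :: "real^'n => real"
 assumes ka: "tfun ka" "!!x. 1 < norm x ==> ka x = 0" and W: "tfun W"
 shows "Hb k sequentially a R (%m. conv (scl ka (eps m)) W)"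
 using W
proof (induction k arbitrary: W)
 case 0
 show ?case using conv_mollify_L2b[OF ka tfun_integrable[OF 0], of R a] by (simp add: N2_smooth_eq[OF tfun_smooth[OF 0]])
next
 case (Suc k)
 have "pt l (conv (scl ka (eps m)) W) = conv (scl ka (eps m)) (pt l W)" for l m
  by (simp add: partial_conv conv_partial_swap tfun_scl ka tfun_integrable Suc.prems)
 thus ?case using Suc conv_mollify_L2b[OF ka tfun_integrable[OF Suc.prems], of R a]
  by (simp add: N2_smooth_eq[OF tfun_smooth[OF Suc.prems]] tfun_partial)
qed

text \<open>Friedrichs' method: the mollified weak solution solves the equation up to commutators.\<close>

lemma mollified_equation:
 fixes A :: "'n::finite => 'n => real^'n => real"
 assumes A: "!!i j. smooth_on UNIV (A i j)" and sym: "!!i j. A i j = A j i" and Q: "smooth_on UNIV Q"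
  and U: "integrable lborel U" "!!b. smooth_on UNIV b ==> integrable lborel (%y. b y * U y)" and k: "tfun k"
  and weak: "(LI y. ((SU i. pt i (%y. SU j. A i j y * pt j (%y. k (x - y)) y) y) + Q y * k (x - y)) * U y) = (LI y. k (x - y) * f y)"
 shows "(SU i. pt i (%x. SU j. A i j x * pt j (conv k U) x) x)
  = (SU i. pt i (%x. SU j. pt j (cm k (A i j) U) x - cm k (pt j (A i j)) U x) x)
   + (conv k f x - (Q x * conv k U x - cm k Q U x))"
proof -
 have tk: "tfun (pt i k)" "tfun (pt i (pt j k))" for i j by (intro tfun_partial k)+
 note AU = U(2)[OF A] U(2)[OF smooth_on_partial[OF A]] U(2)[OF Q]
 have ps: "pt j (%y. k (x - y)) = (%y. - pt j k (x - y))" for j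
  by (intro ext partial_reflect k)
 have dd: "(SU i. pt i (%y. SU j. A i j y * pt j (%y. k (x - y)) y) y)
   = (SU i. SU j. A i j y * pt i (pt j k) (x - y) - pt i (A i j) y * pt j k (x - y))" for y
 proof (rule sum.cong[OF refl])
  fix i
  have d: "(%y. - pt j k (x - y)) differentiable (at y)" for j
   by (intro smooth_dif tfun_smooth tfun_uminus tfun_reflect tk)
  have "pt i (%y. SU j. A i j y * pt j (%y. k (x - y)) y) y = (SU j. pt i (%y. A i j y * - pt j k (x - y)) y)"
   unfolding ps by (rule partial_sum[OF finite]) (intro differentiable_mult smooth_dif A d)
  also have "... = (SU j. A i j y * pt i (pt j k) (x - y) - pt i (A i j) y * pt j k (x - y))"
  proof (rule sum.cong[OF refl])
   fix j
   have "pt i (%y. - pt j k (x - y)) y = pt i (pt j k) (x - y)"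
    using partial_uminus[OF tfun_differentiable[OF tfun_reflect[OF tk(1)]]] partial_reflect[OF tk(1)] by simp
   thus "pt i (%y. A i j y * - pt j k (x - y)) y = A i j y * pt i (pt j k) (x - y) - pt i (A i j) y * pt j k (x - y)"
    using partial_mult[of "A i j" y "%y. - pt j k (x - y)" i, OF smooth_dif[OF A] d] by simp
  qed
  finally show "pt i (%y. SU j. A i j y * pt j (%y. k (x - y)) y) y
   = (SU j. A i j y * pt i (pt j k) (x - y) - pt i (A i j) y * pt j k (x - y))" .
 qed
 have "conv k f x = (LI y. ((SU i. SU j. A i j y * pt i (pt j k) (x - y) - pt i (A i j) y * pt j k (x - y)) + Q y * k (x - y)) * U y)"
  unfolding conv_def weak[symmetric] dd ..
 also have "... = (LI y. (SU i. SU j. pt i (pt j k) (x - y) * (A i j y * U y) - pt j k (x - y) * (pt i (A i j) y * U y)) + k (x - y) * (Q y * U y))"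
  by (intro Bochner_Integration.integral_cong refl) (simp add: algebra_simps sum_distrib_left)
 also have "... = (SU i. SU j. conv (pt i (pt j k)) (%y. A i j y * U y) x - conv (pt j k) (%y. pt i (A i j) y * U y) x) + conv k (%y. Q y * U y) x"
  using conv_integrable[OF tk(2) AU(1)] conv_integrable[OF tk(1) AU(2)] conv_integrable[OF k AU(3)]
  by (simp add: conv_def Bochner_Integration.integral_sum)
 finally have weak': "conv k f x = (SU i. SU j. conv (pt i (pt j k)) (%y. A i j y * U y) x)
   - (SU i. SU j. conv (pt j k) (%y. pt i (A i j) y * U y) x) + conv k (%y. Q y * U y) x"
  by (simp add: sum_subtractf)
 \<comment> \<open>The first-order terms of the weak equation carry the indices of \<open>A\<close>
   in the order opposite to that in the commutators; symmetry of \<open>A\<close> matches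
   them.\<close>
 have sw: "(SU i. SU j. conv (pt j k) (%y. pt i (A i j) y * U y) x) = (SU i. SU j. conv (pt i k) (%y. pt j (A i j) y * U y) x)"
  by (subst sum.swap) (simp add: sym)
 have G: "pt i (%x. SU j. pt j (cm k (A i j) U) x - cm k (pt j (A i j)) U x) x
  = pt i (%x. SU j. A i j x * pt j (conv k U) x) x
   - (SU j. conv (pt i (pt j k)) (%y. A i j y * U y) x) + (SU j. conv (pt i k) (%y. pt j (A i j) y * U y) x)" for i
 proof -
  have e: "(%x. SU j. pt j (cm k (A i j) U) x - cm k (pt j (A i j)) U x)
   = (%x. ((SU j. A i j x * pt j (conv k U) x) - (SU j. conv (pt j k) (%y. A i j y * U y) x)) + (SU j. conv k (%y. pt j (A i j) y * U y) x))"
   unfolding partial_cm[OF k A U(1) AU(1)] unfolding cm_def partial_conv[OF k U(1)]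
   by (simp add: fun_eq_iff sum.distrib sum_subtractf)
  have d: "(%x. SU j. A i j x * pt j (conv k U) x) differentiable (at x)"
   "(%x. SU j. conv (pt j k) (%y. A i j y * U y) x) differentiable (at x)"
   "(%x. SU j. conv k (%y. pt j (A i j) y * U y) x) differentiable (at x)"
   "(%x. (SU j. A i j x * pt j (conv k U) x) - (SU j. conv (pt j k) (%y. A i j y * U y) x)) differentiable (at x)"
   by (intro smooth_dif smooth_on_diff smooth_on_sum smooth_on_mult smooth_on_partial smooth_on_conv A U AU k tk open_UNIV)+
  have "pt i (%x. SU j. conv (pt j k) (%y. A i j y * U y) x) x = (SU j. conv (pt i (pt j k)) (%y. A i j y * U y) x)"
   by (subst partial_sum) (auto simp: partial_conv tk AU intro!: smooth_dif smooth_on_conv)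
  moreover have "pt i (%x. SU j. conv k (%y. pt j (A i j) y * U y) x) x = (SU j. conv (pt i k) (%y. pt j (A i j) y * U y) x)"
   by (subst partial_sum) (auto simp: partial_conv k AU intro!: smooth_dif smooth_on_conv)
  ultimately show ?thesis unfolding e by (simp add: partial_add[OF d(4,3)] partial_diff[OF d(1,2)])
 qed
 show ?thesis unfolding G using weak' sw by (simp add: cm_def sum.distrib sum_subtractf)
qed

section \<open>Sobolev embedding by averages at shrinking scales\<close>

definition mol :: "(real^'n => real) => real => (real^'n => real) => real^'n => real" where
 "mol ka t V x = (LI z. ka z * V (x - t *. z))"

lemma smooth_shift:
 fixes V :: "real^'n => real"
 assumes "tfun V" shows "smooth_on UNIV (%z. V (x - t *. z))"
proof -
 have "smooth_on UNIV (%z::real^'n. x - t *. z)"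
  by (intro smooth_intros smooth_on_linear) (auto intro: bounded_linear_scaleR_right)
 from smooth_on_compose[OF open_UNIV open_UNIV tfun_smooth[OF assms] this] show ?thesis by simp
qed

lemma mol_integrable: "tfun ka ==> tfun V ==> integrable lborel (%z. ka z * V (x - t *. z))"
 using tfun_integrable[OF tfun_mult[OF smooth_shift]] by (simp add: mult.commute)

lemma tfun_nth_mult: "tfun ka ==> tfun (%z. z $ l * ka z)"
 by (intro tfun_mult smooth_on_nth open_UNIV)

text \<open>\<open>mol\<close> has the scale inside \<open>V\<close> and not inside the kernel, so
  it can be differentiated in \<open>t\<close> everywhere. The derivative falls on \<open>V\<close>
  and merely multiplies the kernel by a coordinate, which keeps its support in the unit ball;
  \<open>mol_bound\<close> can therefore iterate.\<close>

lemma mol_deriv: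
 fixes ka V :: "real^'n => real"
 assumes ka: "tfun ka" "!!x. 1 < norm x ==> ka x = 0" and V: "tfun V"
 shows "((%t. mol ka t V x) has_real_derivative (- (SU l. mol (%z. z $ l * ka z) t (pt l V) x))) (at t)"
proof -
 obtain M where M: "M >= 0" "!!i j x. abs (pt i (pt j V) x) <= M" using tfun_bounded2[OF V] by metis
 let ?D = "- (SU l. mol (%z. z $ l * ka z) t (pt l V) x)" and ?C = "(real CARD('n))^2 * M"
 have "((%t. mol ka t V x) has_derivative (%h. ?D * h)) (at t)"
 proof (rule has_derivative_quadratic[where r = 1 and C = "?C * (LI z. abs (ka z))"])
  show "bounded_linear (%h. ?D * h)" by (rule bounded_linear_mult_right)
 next
  fix h :: real
  have eq: "ka z * (V (x - t *. z + (- h) *. z) - V (x - t *. z) - (SU l. ((- h) *. z) $ l * pt l V (x - t *. z)))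
   = ka z * V (x - (t + h) *. z) - ka z * V (x - t *. z) + h * (SU l. (z $ l * ka z) * pt l V (x - t *. z))" for z
  proof -
   have "x - t *. z + (- h) *. z = x - (t + h) *. z" by (simp add: algebra_simps)
   moreover have "(SU l. ((- h) *. z) $ l * pt l V (x - t *. z)) = - h * (SU l. z $ l * pt l V (x - t *. z))"
    by (simp add: sum_distrib_left mult.assoc sum_negf)
   moreover have "(SU l. (z $ l * ka z) * pt l V (x - t *. z)) = ka z * (SU l. z $ l * pt l V (x - t *. z))"
    by (simp add: sum_distrib_left mult_ac)
   ultimately show ?thesis by (simp only: right_diff_distrib) (simp add: algebra_simps)
  qed
  have i: "integrable lborel (%z. (z $ l * ka z) * pt l V (x - t *. z))" for l
   by (intro mol_integrable tfun_nth_mult tfun_partial ka V)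
  have "mol ka (t + h) V x - mol ka t V x - ?D * h
   = (LI z. ka z * (V (x - t *. z + (- h) *. z) - V (x - t *. z) - (SU l. ((- h) *. z) $ l * pt l V (x - t *. z))))"
   unfolding eq using mol_integrable[OF ka(1) V] i by (simp add: mol_def Bochner_Integration.integral_sum mult.commute)
  also have "abs (...) <= (LI z. ?C * h^2 * abs (ka z))"
  proof (rule order_trans[OF integral_abs_bound], rule integral_mono_AE')
   show "AE z in lborel. abs (ka z * (V (x - t *. z + (- h) *. z) - V (x - t *. z) - (SU l. ((- h) *. z) $ l * pt l V (x - t *. z)))) <= ?C * h^2 * abs (ka z)"
   proof (rule AE_I2)
    fix z
    show "abs (ka z * (V (x - t *. z + (- h) *. z) - V (x - t *. z) - (SU l. ((- h) *. z) $ l * pt l V (x - t *. z)))) <= ?C * h^2 * abs (ka z)"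
    proof (cases "1 < norm z")
     case True thus ?thesis using ka(2) M by simp
    next
     case False
     have "abs (V (x - t *. z + (- h) *. z) - V (x - t *. z) - (SU l. ((- h) *. z) $ l * pt l V (x - t *. z))) <= ?C * (norm ((- h) *. z))^2"
      by (rule Taylor_second_order[OF open_UNIV convex_UNIV tfun_smooth[OF V] M(2)]) auto
     also have "?C * (norm ((- h) *. z))^2 <= ?C * h^2"
     proof (rule mult_left_mono)
      have "(norm ((- h) *. z))^2 <= h^2 * 1"
       unfolding norm_scaleR power_mult_distrib using False by (intro mult_mono) (auto simp: power_le_one)
      thus "(norm ((- h) *. z))^2 <= h^2" by simp
     qed (use M in simp)
     finally have "abs (ka z) * abs (V (x - t *. z + (- h) *. z) - V (x - t *. z) - (SU l. ((- h) *. z) $ l * pt l V (x - t *. z))) <= abs (ka z) * (?C * h^2)"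
      by (rule mult_left_mono) simp
     thus ?thesis unfolding abs_mult by (simp only: mult_ac)
    qed
   qed
  qed (use tfun_integrable[OF ka(1)] M in auto)
  finally show "abs (mol ka (t + h) V x - mol ka t V x - ?D * h) <= ?C * (LI z. abs (ka z)) * (norm h)^2" by (simp add: mult_ac)
 qed simp
 thus ?thesis unfolding has_field_derivative_def .
qed

text \<open>Each \<open>L\<^sup>2\<close> derivative improves the blow-up rate of the averages by \<open>t powr (1/2) = sg\<close>.\<close>

lemma mol_bound:
 fixes ka :: "real^'n => real"
 assumes s: "0 < sg0" "s + sg0^2 < R" and "N <= CARD('n)" "tfun ka" "!!x. 1 < norm x ==> ka x = 0"
  "!!i. tfun (V i)" "Hb N F a R V"
 shows "EX C>=0. \<forall>\<^sub>F i in F. ALL x:ball a s. ALL sg. 0 < sg & sg <= sg0 --> abs (mol ka (sg^2) (V i) x) <= C / sg ^ (CARD('n) - N)"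
 using assms(3-)
proof (induction N arbitrary: ka V)
 case 0
 note ka = 0(2,3) and V = 0(4)
 define n where "n = CARD('n)"
 define v where "v = unit_ball_vol (real CARD('n))"
 have v: "v >= 0" by (simp add: v_def)
 obtain M where M: "0 <= M" "!!x. abs (ka x) <= M" using tfun_bounded[OF ka(1)] by metis
 obtain C where C: "0 <= C" "\<forall>\<^sub>F i in F. N2 a (s + sg0^2) (V i) <= enn C" using L2bE[OF Hb_L2b[OF 0(5)] s(2)] by metis
 show ?case
 proof (intro exI conjI)
  show "0 <= sqrt (M^2 * v * C)" using v C by simp
  show "\<forall>\<^sub>F i in F. ALL x:ball a s. ALL sg. 0 < sg & sg <= sg0 --> abs (mol ka (sg^2) (V i) x) <= sqrt (M^2 * v * C) / sg ^ (CARD('n) - 0)"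
   using C(2)
  proof eventually_elim
   case (elim i)
   show ?case
   proof (intro ballI allI impI)
    fix x sg assume x: "x : ball a s" and sg: "0 < sg & sg <= sg0"
    define t where "t = sg^2"
    have t: "0 < t" "t <= sg0^2" using sg by (auto simp: t_def power_mono)
    let ?k = "%y. scl ka t (x - y)"
    have "enn ((mol ka t (V i) x)^2) = enn ((LI y. ?k y * V i y)^2)"
     using conv_scl_eq[OF ka(1) V t(1), of i x] by (simp add: mol_def conv_def)
    also have "... <= enn ((M * inverse t ^ n)^2 * (v * t ^ n)) * (NN y. ind (cball x t) y * enn ((V i y)^2))"
     unfolding v_def n_def
    proof (rule kernel_square_le[OF tfun_integrable[OF V]])
     show "?k : bmb" by (intro tfun_measurable tfun_reflect tfun_scl ka t)
     show "abs (?k y) <= M * inverse t ^ CARD('n)" for y using scl_le[where ka = ka and x = "x - y", OF M(2) t(1)] .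
     show "?k y = 0" if "t < dist x y" for y
     proof -
      have "1 < norm (inverse t *. (x - y))" unfolding norm_scaleR using that t by (simp add: dist_norm field_simps)
      from ka(2)[OF this] show ?thesis by (simp add: scl_def)
     qed
    qed (rule t)
    also have "(NN y. ind (cball x t) y * enn ((V i y)^2)) <= N2 a (s + sg0^2) (V i)"
     unfolding N2_def
    proof (rule nn_integral_mono)
     fix y
     have "y : ball a (s + sg0^2)" if "y : cball x t" using that x t dist_triangle[of a y x] by simp
     thus "ind (cball x t) y * enn ((V i y)^2) <= ind (ball a (s + sg0^2)) y * enn ((V i y)^2)"
      by (auto simp: indicator_def)
    qed
    also have "... <= enn C" by (rule elim)
    finally have "enn ((mol ka t (V i) x)^2) <= enn ((M * inverse t ^ n)^2 * (v * t ^ n)) * enn C"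
     by (simp add: mult_left_mono)
    hence "(mol ka t (V i) x)^2 <= (M * inverse t ^ n)^2 * (v * t ^ n) * C"
     using C v t by (simp add: ennreal_mult[symmetric])
    also have "... = M^2 * v * C * (inverse t ^ n * (inverse t ^ n * t ^ n))" by (simp add: power2_eq_square mult_ac)
    also have "inverse t ^ n * t ^ n = 1" using t by (simp add: power_mult_distrib[symmetric])
    also have "M^2 * v * C * (inverse t ^ n * 1) = M^2 * v * C / (sg ^ n)^2"
     by (simp add: t_def power_inverse divide_inverse power_mult[symmetric] mult.commute)
    finally have "sqrt ((mol ka t (V i) x)^2) <= sqrt (M^2 * v * C / (sg ^ n)^2)" by (rule real_sqrt_le_mono)
    thus "abs (mol ka (sg^2) (V i) x) <= sqrt (M^2 * v * C) / sg ^ (CARD('n) - 0)"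
     using sg by (simp add: t_def n_def real_sqrt_divide)
   qed
  qed
 qed
next
 case (Suc N)
 note ka = Suc.prems(2,3) and V = Suc.prems(4)
 define d where "d = CARD('n) - Suc N"
 have d: "CARD('n) - N = Suc d" using Suc.prems(1) by (simp add: d_def)
 let ?P = "%l C. \<forall>\<^sub>F i in F. ALL x:ball a s. ALL sg. 0 < sg & sg <= sg0 --> abs (mol (%z. z $ l * ka z) (sg^2) (pt l (V i)) x) <= C / sg ^ (CARD('n) - N)"
 have "EX C>=0. ?P l C" for l
 proof (rule Suc.IH)
  show "N <= CARD('n)" using Suc.prems(1) by simp
  show "tfun (%z. z $ l * ka z)" "!!i. tfun (pt l (V i))" by (intro tfun_nth_mult tfun_partial ka V)+
  show "x $ l * ka x = 0" if "1 < norm x" for x using ka(2)[OF that] by simp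
  show "Hb N F a R (%i. pt l (V i))" using Suc.prems(5) by simp
 qed
 from choice[OF allI[OF this]] obtain Cl where Cl0: "ALL l. Cl l >= 0 & ?P l (Cl l)" ..
 have Cl: "!!l. Cl l >= 0" "!!l. ?P l (Cl l)" using Cl0 by (simp_all only: simp_thms)
 let ?P0 = "%C. \<forall>\<^sub>F i in F. ALL x:ball a s. ALL sg. 0 < sg & sg <= sg0 --> abs (mol ka (sg^2) (V i) x) <= C / sg ^ (CARD('n) - N)"
 have "EX C>=0. ?P0 C"
  by (rule Suc.IH[OF _ ka V Hb_SucD[OF Suc.prems(5)]]) (use Suc.prems(1) in simp)
 then obtain C0 where C00: "C0 >= 0 & ?P0 C0" ..
 note C0 = conjunct1[OF C00] conjunct2[OF C00]
 \<comment> \<open>The 2 comes from the derivative of \<open>ta^2\<close>, whose factor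
   \<open>ta\<close> also cancels one power of \<open>1 / ta\<close>.\<close>
 define K where "K = 2 * (SU l. Cl l)"
 have K: "K >= 0" using Cl(1) by (simp add: K_def sum_nonneg)
 have ev: "\<forall>\<^sub>F i in F. ALL l:UNIV. ALL x:ball a s. ALL sg. 0 < sg & sg <= sg0 --> abs (mol (%z. z $ l * ka z) (sg^2) (pt l (V i)) x) <= Cl l / sg ^ (CARD('n) - N)"
  using Cl(2) by (intro eventually_ball_finite) auto
 show ?case
 proof (intro exI conjI)
  \<comment> \<open>\<open>C0 / sg0\<close> accounts for the average at the fixed scale
    \<open>sg0\<close>, and \<open>sg0 * K\<close> for its variation between the scales
    \<open>sg\<close> and \<open>sg0\<close>.\<close>
  show "0 <= C0 / sg0 + sg0 * K" using C0 K s by simp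
  show "\<forall>\<^sub>F i in F. ALL x:ball a s. ALL sg. 0 < sg & sg <= sg0 --> abs (mol ka (sg^2) (V i) x) <= (C0 / sg0 + sg0 * K) / sg ^ (CARD('n) - Suc N)"
   using ev C0(2)
  proof eventually_elim
   case (elim i)
   show ?case
   proof (intro ballI allI impI)
    fix x sg assume x: "x : ball a s" and sg: "0 < sg & sg <= sg0"
    let ?\<phi> = "%sg. mol ka (sg^2) (V i) x"
    let ?\<phi>' = "%ta. - (SU l. mol (%z. z $ l * ka z) (ta^2) (pt l (V i)) x) * (2 * ta)"
    have der: "(?\<phi> has_real_derivative ?\<phi>' ta) (at ta)" for ta
    proof -
     have "((%ta::real. ta^2) has_real_derivative 2 * ta) (at ta)" by (auto intro!: derivative_eq_intros)
     from DERIV_chain2[OF mol_deriv[OF ka V] this] show ?thesis .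
    qed
    have bd: "abs (?\<phi>' ta) <= K / sg ^ d" if ta: "sg <= ta" "ta <= sg0" for ta
    proof -
     have ta0: "0 < ta" using ta sg by linarith
     have "abs (SU l. mol (%z. z $ l * ka z) (ta^2) (pt l (V i)) x) <= (SU l. Cl l / ta ^ Suc d)"
      by (rule order_trans[OF sum_abs sum_mono]) (use elim(1) x ta0 ta d in auto)
     also have "... = K / 2 / ta ^ Suc d" by (simp add: K_def sum_divide_distrib)
     finally have "abs (?\<phi>' ta) <= K / 2 / ta ^ Suc d * (2 * ta)"
      using ta0 by (simp only: abs_mult abs_minus_cancel) (intro mult_mono, auto simp: K)
     also have "... = K / ta ^ d" using ta0 by simp
     also have "... <= K / sg ^ d" using ta sg K by (intro divide_left_mono power_mono mult_pos_pos) auto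
     finally show ?thesis .
    qed
    have diff: "abs (?\<phi> sg0 - ?\<phi> sg) <= sg0 * (K / sg ^ d)"
    proof (cases "sg = sg0")
     case True thus ?thesis using K sg by simp
    next
     case False
     hence lt: "sg < sg0" using sg by simp
     obtain ta where ta: "sg < ta" "ta < sg0" "?\<phi> sg0 - ?\<phi> sg = (sg0 - sg) * ?\<phi>' ta"
      using MVT2[OF lt der] by blast
     have "abs (?\<phi> sg0 - ?\<phi> sg) = (sg0 - sg) * abs (?\<phi>' ta)" using ta(3) lt by (simp only: abs_mult)
     also have "... <= sg0 * (K / sg ^ d)" using bd[of ta] ta lt sg by (intro mult_mono) auto
     finally show ?thesis .
    qed
    have "abs (?\<phi> sg0) <= C0 / sg0 ^ Suc d" using elim(2) x s d by auto
    also have "... = C0 / sg0 / sg0 ^ d" by simp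
    also have "... <= C0 / sg0 / sg ^ d" using sg C0 s by (intro divide_left_mono power_mono mult_pos_pos) auto
    finally have "abs (?\<phi> sg) <= C0 / sg0 / sg ^ d + sg0 * (K / sg ^ d)" using diff by linarith
    thus "abs (?\<phi> sg) <= (C0 / sg0 + sg0 * K) / sg ^ (CARD('n) - Suc N)"
     unfolding d_def[symmetric] by (simp add: add_divide_distrib)
   qed
  qed
 qed
qed

lemma mol_close:
 fixes et :: "real^'n => real"
 assumes et: "tfun et" "!!x. 1 < norm x ==> et x = 0" "(LI x. et x) = 1" "!!x. 0 <= et x"
  and V: "tfun V" and c: "!!z. norm z <= 1 ==> abs (V (x - t *. z) - V x) <= c"
 shows "abs (mol et t V x - V x) <= c"
proof -
 have "mol et t V x - V x = (LI z. et z * V (x - t *. z) - et z * V x)"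
  using mol_integrable[OF et(1) V] tfun_integrable[OF et(1)] et(3) by (simp add: mol_def)
 also have "abs (...) <= (LI z. c * et z)"
 proof (rule order_trans[OF integral_abs_bound], rule integral_mono_AE')
  show "AE z in lborel. abs (et z * V (x - t *. z) - et z * V x) <= c * et z"
  proof (rule AE_I2)
   fix z
   show "abs (et z * V (x - t *. z) - et z * V x) <= c * et z"
   proof (cases "1 < norm z")
    case False
    have "abs (et z * V (x - t *. z) - et z * V x) = et z * abs (V (x - t *. z) - V x)"
     using et(4)[of z] by (simp add: right_diff_distrib[symmetric] abs_mult)
    thus ?thesis using mult_left_mono[OF c[of z] et(4)[of z]] False by (simp add: mult.commute)
   qed (simp add: et)
  qed
  show "AE z in lborel. 0 <= c * et z" using c[of 0] et(4) by (intro AE_I2) simp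
 qed (use tfun_integrable[OF et(1)] in auto)
 also have "... = c" using et(3) by simp
 finally show ?thesis .
qed

text \<open>With \<open>CARD('n)\<close> derivatives the exponent in \<open>mol_bound\<close> is 0,
  so the averages are bounded uniformly in the scale. Each member is Lipschitz, so its averages tend
  to it as the scale shrinks; its Lipschitz constant may depend on the index, the bound does
  not.\<close>

lemma Hb_imp_bounded:
 fixes a :: "real^'n"
 assumes V: "!!i. tfun (V i)" and H: "Hb CARD('n) F a R V" and s: "s < R"
 shows "EX C>=0. \<forall>\<^sub>F i in F. ALL x:ball a s. abs (V i x) <= C"
proof -
 obtain et :: "real^'n => real" where et: "tfun et" "!!x. 1 < norm x ==> et x = 0" "(LI x. et x) = 1" "!!x. 0 <= et x"
  using exists_mollifier by blast
 define sg0 where "sg0 = sqrt ((R - s) / 2)"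
 have sg0: "0 < sg0" "s + sg0^2 < R" using s by (auto simp: sg0_def field_simps)
 obtain C where C: "C >= 0" "\<forall>\<^sub>F i in F. ALL x:ball a s. ALL sg. 0 < sg & sg <= sg0 --> abs (mol et (sg^2) (V i) x) <= C / sg ^ (CARD('n) - CARD('n))"
  using mol_bound[OF sg0 order_refl et(1,2) V H] by blast
 have "\<forall>\<^sub>F i in F. ALL x:ball a s. abs (V i x) <= C" using C(2)
 proof eventually_elim
  case (elim i)
  show ?case
  proof
   fix x assume x: "x : ball a s"
   obtain L where L: "L >= 0" "!!x y. abs (V i x - V i y) <= L * dist x y" using tfun_Lipschitz[OF V] by metis
   show "abs (V i x) <= C"
   proof (rule field_le_epsilon)
    fix e :: real assume e: "0 < e"
    define sg where "sg = min sg0 (sqrt (e / (L + 1)))"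
    have sg: "0 < sg" "sg <= sg0" using sg0 e L by (auto simp: sg_def)
    have "sg^2 <= (sqrt (e / (L + 1)))^2" using sg by (intro power_mono) (auto simp: sg_def)
    hence "sg^2 <= e / (L + 1)" using e L by simp
    hence "L * sg^2 <= e" using L e by (simp add: field_simps) (smt (verit) zero_le_power2)
    have "abs (mol et (sg^2) (V i) x - V i x) <= L * sg^2"
    proof (rule mol_close[OF et V])
     fix z :: "real^'n" assume "norm z <= 1"
     have "abs (V i (x - sg^2 *. z) - V i x) <= L * dist (x - sg^2 *. z) x" by (rule L)
     also have "... = L * (sg^2 * norm z)" by (simp add: dist_norm)
     also have "... <= L * (sg^2 * 1)" using L \<open>norm z <= 1\<close> by (intro mult_left_mono) auto
     finally show "abs (V i (x - sg^2 *. z) - V i x) <= L * sg^2" by simp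
    qed
    moreover have "abs (mol et (sg^2) (V i) x) <= C" using elim x sg by auto
    ultimately show "abs (V i x) <= C + e" using \<open>L * sg^2 <= e\<close> by linarith
   qed
  qed
 qed
 thus ?thesis using C by blast
qed

section \<open>Smooth limits and Weyl's lemma\<close>

definition pd :: "'n list => (real^'n => real) => real^'n => real" where
 "pd ls f = foldr pt ls f"

lemma pd_simps [simp]: "pd [] f = f" "pd (l # ls) f = pt l (pd ls f)"
 by (auto simp: pd_def)

lemma tfun_pd: "tfun f ==> tfun (pd ls f)"
 by (induction ls) (auto intro: tfun_partial)

lemma Hb_pd: "Hb (k + length ls) F a R v ==> Hb k F a R (%i. pd ls (v i))"
proof (induction ls arbitrary: k)
 case (Cons l ls)
 have "Hb (Suc k) F a R (%i. pd ls (v i))" by (rule Cons.IH) (use Cons.prems in simp)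
 thus ?case by simp
qed simp

text \<open>All derivatives are integrated by parts onto the kernel. \<open>k'\<close> is found
  before \<open>V\<close>, so that one kernel serves a whole sequence of functions.\<close>

lemma conv_pd_swap:
 assumes "tfun k" shows "EX k'. tfun k' & (ALL V. tfun V --> conv k (pd ls V) = conv k' V)"
 using assms
proof (induction ls arbitrary: k)
 case (Cons l ls)
 obtain k' where k': "tfun k'" "ALL V. tfun V --> conv (pt l k) (pd ls V) = conv k' V"
  using Cons.IH[OF tfun_partial[OF Cons.prems]] by blast
 thus ?case using conv_partial_swap[OF Cons.prems tfun_pd] by auto
qed auto

text \<open>The Taylor estimate with a second-order bound uniform in \<open>m\<close> passes to the
  pointwise limit and identifies \<open>f (i # ls)\<close> as a partial derivative of
  \<open>f ls\<close>. Indexing the limits by lists of directions makes the induction on the order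
  immediate.\<close>

lemma smooth_limit:
 fixes v :: "nat => real^'n => real"
 assumes v: "!!m. tfun (v m)"
  and bd: "!!ls s. s < R ==> EX C. EV m. ALL x:ball a s. abs (pd ls (v m) x) <= C"
  and lim: "!!ls x. x : ball a R ==> (%m. pd ls (v m) x) ~~> f ls x"
 shows "smooth_on (ball a R) (f ls)"
proof -
 have der: "(f ls has_derivative (%h. SU i. h $ i * f (i # ls) x)) (at x)" if x: "x : ball a R" for ls x
 proof -
  define s where "s = (dist a x + R) / 2"
  have s: "dist a x < s" "s < R" using x by (auto simp: s_def)
  have "EX C. EV m. ALL x:ball a s. abs (pd (fst p # snd p # ls) (v m) x) <= C" for p by (rule bd[OF s(2)])
  from choice[OF allI[OF this]] obtain C' where C': "ALL p. EV m. ALL x:ball a s. abs (pd (fst p # snd p # ls) (v m) x) <= C' p" ..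
  define C where "C = (%i j. C' (i, j))"
  have C: "EV m. ALL x:ball a s. abs (pd (i # j # ls) (v m) x) <= C i j" for i j
   using C'[rule_format, of "(i, j)"] by (simp only: C_def fst_conv snd_conv)
  define M where "M = (SU i. SU j. abs (C i j))"
  have CM: "C i j <= M" for i j
  proof -
   have "C i j <= abs (C i j)" by simp
   also have "... <= (SU j. abs (C i j))" by (rule member_le_sum) auto
   also have "... <= M" unfolding M_def by (rule member_le_sum[of i UNIV "%i. SU j. abs (C i j)"]) (auto intro: sum_nonneg)
   finally show ?thesis .
  qed
  have ev: "EV m. ALL i:UNIV. ALL j:UNIV. ALL x:ball a s. abs (pd (i # j # ls) (v m) x) <= C i j"
   by (intro eventually_ball_finite ballI C finite)
  show ?thesis
  proof (rule has_derivative_quadratic[where r = "s - dist a x" and C = "(real CARD('n))^2 * M"])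
   show "bounded_linear (%h. SU i. h $ i * f (i # ls) x)"
    by (intro bounded_linear_intros bounded_linear_compose[OF bounded_linear_mult_left bounded_linear_vec_nth])
   show "0 < s - dist a x" using s by simp
   fix h :: "real^'n" assume h: "norm h < s - dist a x"
   have xh: "x + h : ball a s" using h norm_triangle_ineq[of "x - a" h] by (simp add: dist_norm norm_minus_commute add_diff_eq algebra_simps)
   have xs: "x : ball a s" using s by simp
   have sub: "ball a s <= ball a R" using s by auto
   have "(%m. abs (pd ls (v m) (x + h) - pd ls (v m) x - (SU i. h $ i * pd (i # ls) (v m) x)))
     ~~> abs (f ls (x + h) - f ls x - (SU i. h $ i * f (i # ls) x))"
    using xh xs sub by (intro tendsto_rabs tendsto_diff tendsto_sum tendsto_mult_left lim) auto
   moreover have "EV m. abs (pd ls (v m) (x + h) - pd ls (v m) x - (SU i. h $ i * pd (i # ls) (v m) x)) <= (real CARD('n))^2 * M * (norm h)^2"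
    using ev
   proof eventually_elim
    case (elim m)
    have "abs (pt i (pt j (pd ls (v m))) y) <= M" if "y : ball a s" for i j y
     using elim[rule_format, of i j y] that CM[of i j] by simp
    from Taylor_second_order[OF open_ball convex_ball smooth_on_subset[OF tfun_smooth[OF tfun_pd[OF v]]] this xs xh]
    show ?case by simp
   qed
   ultimately show "abs (f ls (x + h) - f ls x - (SU i. h $ i * f (i # ls) x)) <= (real CARD('n))^2 * M * (norm h)^2"
    by (rule tendsto_upperbound) simp
  qed
 qed
 have "Ck_on k (ball a R) (f ls)" for k
 proof (induction k arbitrary: ls)
  case 0
  thus ?case using has_derivative_continuous[OF der] by (simp add: continuous_on_eq_continuous_at)
 next
  case (Suc k)
  show ?case
   by (rule Ck_on_SucI[OF open_ball der]) (auto simp: Basis_axis intro: Suc)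
 qed
 thus ?thesis by (simp add: smooth_on_def)
qed

text \<open>Inserting the reflected kernel as a test function shows that the mollifications
  \<open>v\<close> of \<open>U\<close> solve the equation classically up to commutators. All their
  derivatives are then locally bounded, uniformly along the sequence, and converge; the limit of
  \<open>v\<close> itself is \<open>V\<close>.\<close>

lemma weyl_core:
 fixes A :: "'n::finite => 'n => real^'n => real"
 assumes A: "!!i j. smooth_on UNIV (A i j)" and sym: "!!i j. A i j = A j i" and Q: "smooth_on UNIV Q" and f: "tfun f"
  and lam: "0 < lam" "!!x p. x : ball a R ==> lam * (SU i. (p i)^2) <= (SU i. SU j. A i j x * p i * p j)"
  and U: "integrable lborel U" "!!x. r0 < norm x ==> U x = 0" "!!b. smooth_on UNIV b ==> integrable lborel (%y. b y * U y)"
  and UN: "!!s. s < R ==> N2 a s U < \<infinity>"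
  and weak: "!!pp r. tfun pp ==> r < R ==> (!!y. y ~: ball a r ==> pp y = 0) ==>
   (LI y. ((SU i. pt i (%y. SU j. A i j y * pt j pp y) y) + Q y * pp y) * U y) = (LI y. pp y * f y)"
 shows "EX V. smooth_on (ball a R) V & (ALL pp r. tfun pp --> r < R --> (ALL y. y ~: ball a r --> pp y = 0) -->
  (LI y. pp y * U y) = (LI y. pp y * V y))"
proof -
 obtain et :: "real^'n => real" where et: "tfun et" "!!x. 1 < norm x ==> et x = 0" "(LI x. et x) = 1" "!!x. 0 <= et x"
  using exists_mollifier by blast
 let ?k = "%m. scl et (eps m)"
 define v where "v = (%m. conv (?k m) U)"
 have tk: "tfun (?k m)" for m by (intro tfun_scl et eps_pos)
 have tv: "tfun (v m)" for m unfolding v_def by (intro tfun_conv[OF tk U(1,2)])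
 let ?G = "%i m x. SU j. pt j (cm (?k m) (A i j) U) x - cm (?k m) (pt j (A i j)) U x"
 let ?H = "%m x. conv (?k m) f x - (Q x * v m x - cm (?k m) Q U x)"
 have eq: "evb sequentially a R (%m x. (SU i. pt i (%x. SU j. A i j x * pt j (v m) x) x) = (SU i. pt i (?G i m) x) + ?H m x)"
  unfolding evb_def
 proof (intro allI impI)
  fix s assume s: "s < R"
  define s' where "s' = (s + R) / 2"
  have s': "s < s'" "s' < R" using s by (auto simp: s'_def)
  have "EV m. eps m <= s' - s" by (rule eventually_eps_le) (use s' in simp)
  thus "EV m. ALL x:ball a s. (SU i. pt i (%x. SU j. A i j x * pt j (v m) x) x) = (SU i. pt i (?G i m) x) + ?H m x"
  proof eventually_elim
   case (elim m)
   show ?case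
   proof
    fix x assume x: "x : ball a s"
    have z: "?k m (x - y) = 0" if "y ~: ball a s'" for y
    proof -
     have "eps m < dist x y" using that x elim dist_triangle[of a y x] by simp
     hence "1 < norm (inverse (eps m) *. (x - y))" unfolding norm_scaleR using eps_pos[of m] by (simp add: abs_of_pos dist_norm field_simps)
     from et(2)[OF this] show ?thesis by (simp add: scl_def)
    qed
    show "(SU i. pt i (%x. SU j. A i j x * pt j (v m) x) x) = (SU i. pt i (?G i m) x) + ?H m x"
     unfolding v_def
     by (rule mollified_equation[OF A sym Q U(1,3) tk weak[OF tfun_reflect[OF tk] s'(2) z]])
   qed
  qed
 qed
 \<comment> \<open>Bootstrap: bounds of order \<open>k\<close> for \<open>v\<close> give order
   \<open>k + 1\<close> for the commutators, hence order \<open>k\<close> for the data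
   \<open>?G\<close> and \<open>?H\<close>, and \<open>elliptic_gain\<close> returns order
   \<open>k + 1\<close> for \<open>v\<close>.\<close>
 have hb: "Hb k sequentially a R v" for k
 proof (induction k)
  case 0
  show ?case unfolding v_def using conv_mollify_L2b[OF et(1,2) U(1) UN] by simp
 next
  case (Suc k)
  have cmH: "Hb (Suc k) sequentially a R (%m. cm (?k m) b U)" if "smooth_on UNIV b" for b
   by (rule cm_gain_mollify[OF et U(1,2) that U(3)[OF that] Suc[unfolded v_def]])
  have smc: "smooth_on UNIV (cm (?k m) b U)" if "smooth_on UNIV b" for b m
   by (intro smooth_cm tk that U)
  show ?case
  proof (rule elliptic_gain[OF A lam, where G = ?G and H = ?H and V = v])
   show "smooth_on UNIV (v i)" for i by (rule tfun_smooth[OF tv])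
   show "smooth_on UNIV (?G l i)" for l i by (intro smooth_intros smooth_on_partial smc A open_UNIV)
   show "smooth_on UNIV (?H i)" for i by (intro smooth_intros smc Q tfun_smooth[OF tv] smooth_on_conv tk tfun_integrable f open_UNIV)
   show "Hb k sequentially a R (?G l)" for l
   proof (intro Hb_sum Hb_diff)
    show "Hb k sequentially a R (%i. pt j (cm (?k i) (A l j) U))" for j using cmH[OF A] by simp
    show "Hb k sequentially a R (%i. cm (?k i) (pt j (A l j)) U)" for j
     by (rule Hb_SucD[OF cmH[OF smooth_on_partial[OF A]]])
   qed (intro finite smooth_intros smooth_on_partial smc A open_UNIV)+
   show "Hb k sequentially a R ?H"
    by (intro Hb_diff Hb_mult conv_mollify_Hb[OF et(1,2) f] Suc Q Hb_SucD[OF cmH[OF Q]] smooth_on_conv tk tfun_integrable f smc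
      smooth_on_diff smooth_on_mult tfun_smooth[OF tv] open_UNIV)
  qed (use Suc eq in auto)
 qed
 have bd: "EX C. 0 <= C & (EV m. ALL x:ball a s. abs (pd ls (v m) x) <= C)" if "s < R" for ls s
  using Hb_imp_bounded[OF tfun_pd[OF tv] Hb_pd[OF hb] that, of ls] by blast
 have conv_k: "convergent (%m. conv k (v m) x)" if k: "tfun k" for k x
  using tendsto_mollify[OF et U(1) tfun_reflect[OF k], of x] unfolding conv_def v_def convergent_def by blast
 \<comment> \<open>Weak convergence becomes pointwise: averaging \<open>pd ls (v m)\<close> at scale
   \<open>t\<close> changes its value at \<open>x\<close> by at most \<open>L * t\<close>, uniformly
   in large \<open>m\<close>, while at fixed \<open>t\<close> the averages are pairings of
   \<open>v m\<close> with one test function, and these converge.\<close>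
 have cvg: "convergent (%m. pd ls (v m) x)" if x: "x : ball a R" for ls x
 proof -
  define s where "s = (dist a x + R) / 2"
  have s: "dist a x < s" "s < R" using x by (auto simp: s_def)
  have "EX C. 0 <= C & (EV m. ALL x:ball a s. abs (pd (l # ls) (v m) x) <= C)" for l by (rule bd[OF s(2)])
  from choice[OF allI[OF this]] obtain C where C0: "ALL l. 0 <= C l & (EV m. ALL x:ball a s. abs (pd (l # ls) (v m) x) <= C l)" ..
  note C = C0[rule_format, THEN conjunct1] C0[rule_format, THEN conjunct2]
  define K where "K = (SU l. C l)"
  have K: "0 <= K" "C l <= K" for l unfolding K_def using C(1) by (auto intro!: sum_nonneg member_le_sum)
  define L where "L = real CARD('n) * K"
  have L: "0 <= L" using K by (simp add: L_def)
  have ev: "EV m. ALL l:UNIV. ALL x:ball a s. abs (pd (l # ls) (v m) x) <= C l"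
   using C by (intro eventually_ball_finite) auto
  have "Cauchy (%m. pd ls (v m) x)"
  proof (rule metric_CauchyI)
   fix e :: real assume e: "0 < e"
   \<comment> \<open>Half of the gap \<open>s - dist a x\<close> keeps the averaging ball inside
     \<open>ball a s\<close>; the other bound yields \<open>L * t <= e / 4\<close>, with
     \<open>L + 1\<close> guarding against \<open>L = 0\<close>.\<close>
   define t where "t = min ((s - dist a x) / 2) (e / (4 * (L + 1)))"
   have t: "0 < t" "t <= (s - dist a x) / 2" "t <= e / (4 * (L + 1))" using s e L unfolding t_def by (simp_all only: min.cobounded1 min.cobounded2) simp
   hence t': "t < s - dist a x" using s by simp
   have "L * t <= (L + 1) * (e / (4 * (L + 1)))" using t L by (intro mult_mono) auto
   also have "... = e / 4"
   proof -
    have "p * (e / (4 * p)) = e / 4" if "p ~= 0" for p using that by simp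
    from this[of "L + 1"] L show ?thesis by linarith
   qed
   finally have Lt: "L * t <= e / 4" .
   obtain k' where k': "tfun k'" "ALL V. tfun V --> conv (scl et t) (pd ls V) = conv k' V"
    using conv_pd_swap[OF tfun_scl[OF et(1) t(1)]] by blast
   have close: "EV m. abs (conv k' (v m) x - pd ls (v m) x) <= L * t" using ev
   proof eventually_elim
    case (elim m)
    have "conv k' (v m) x = mol et t (pd ls (v m)) x"
     using k'(2) tv conv_scl_eq[OF et(1) tfun_pd[OF tv] t(1), of ls m x] by (simp add: mol_def)
    moreover have "abs (mol et t (pd ls (v m)) x - pd ls (v m) x) <= L * t"
    proof (rule mol_close[OF et tfun_pd[OF tv]])
     fix z :: "real^'n" assume z: "norm z <= 1"
     have tz: "norm (t *. z) <= t" using z t by (simp add: mult_left_le)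
     have in1: "x - t *. z : ball a s"
      using tz t' norm_triangle_ineq[of "a - x" "t *. z"] by (simp add: dist_norm algebra_simps)
     have "abs (pd ls (v m) (x - t *. z) - pd ls (v m) x) <= real CARD('n) * K * dist (x - t *. z) x"
     proof (rule Lipschitz_of_partial_bound[where S = "ball a s"])
      show "abs (pt i (pd ls (v m)) y) <= K" if "y : ball a s" for i y using elim[rule_format, of i y] that K(2)[of i] by simp
     qed (use in1 s in "auto intro: tfun_differentiable tfun_pd tv")
     also have "... <= L * t" unfolding L_def using K tz by (intro mult_left_mono) (auto simp: dist_norm)
     finally show "abs (pd ls (v m) (x - t *. z) - pd ls (v m) x) <= L * t" .
    qed
    ultimately show ?case by simp
   qed
   obtain N1 where N1: "!!m. m >= N1 ==> abs (conv k' (v m) x - pd ls (v m) x) <= L * t" using close unfolding eventually_sequentially by blast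
   have "Cauchy (%m. conv k' (v m) x)" using conv_k[OF k'(1)] by (simp add: Cauchy_convergent_iff)
   then obtain N2 where N2: "!!m n. m >= N2 ==> n >= N2 ==> dist (conv k' (v m) x) (conv k' (v n) x) < e / 4"
    using e unfolding Cauchy_def by (meson divide_pos_pos zero_less_numeral)
   show "EX M. ALL m>=M. ALL n>=M. dist (pd ls (v m) x) (pd ls (v n) x) < e"
   proof (intro exI allI impI)
    fix m n assume mn: "max N1 N2 <= m" "max N1 N2 <= n"
    show "dist (pd ls (v m) x) (pd ls (v n) x) < e"
    proof -
     have "abs (conv k' (v m) x - pd ls (v m) x) <= L * t" "abs (conv k' (v n) x - pd ls (v n) x) <= L * t"
      "abs (conv k' (v m) x - conv k' (v n) x) < e / 4"
      using N1[of m] N1[of n] N2[of m n] mn by (auto simp: dist_real_def)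
     thus ?thesis using Lt e unfolding dist_real_def by linarith
    qed
   qed
  qed
  thus ?thesis by (simp add: Cauchy_convergent_iff)
 qed
 define g where "g = (%ls x. lim (%m. pd ls (v m) x))"
 have lim: "(%m. pd ls (v m) x) ~~> g ls x" if "x : ball a R" for ls x
  using cvg[OF that] by (simp add: g_def convergent_LIMSEQ_iff)
 have "smooth_on (ball a R) (g [])"
  by (rule smooth_limit[where v = v, OF tv _ lim]) (use bd in blast)+
 moreover have "(LI y. pp y * U y) = (LI y. pp y * g [] y)"
  if pp: "tfun pp" and s: "s < R" and z: "ALL y. y ~: ball a s --> pp y = 0" for pp s
 proof -
  obtain C where C: "0 <= C" "EV m. ALL x:ball a s. abs (v m x) <= C" using bd[OF s, of "[]"] by auto
  obtain N where N: "!!m x. m >= N ==> x : ball a s ==> abs (v m x) <= C" using C(2) unfolding eventually_sequentially by blast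
  have pl: "(%m. pp x * v (m + N) x) ~~> pp x * g [] x" for x
  proof (cases "x : ball a s")
   case True
   hence "(%m. v m x) ~~> g [] x" using lim[of x "[]"] s by auto
   thus ?thesis by (intro tendsto_mult_left LIMSEQ_ignore_initial_segment)
  qed (use z in simp)
  have m: "(%x. pp x * v m x) : bmb" for m by (intro borel_measurable_times tfun_measurable pp tv)
  have "(%m. (LI x. pp x * v (m + N) x)) ~~> (LI x. pp x * g [] x)"
  proof (rule integral_dominated_convergence[where w = "%x. C * abs (pp x)"])
   show "(%x. pp x * g [] x) : borel_measurable lborel"
    by (rule borel_measurable_LIMSEQ_real[OF pl]) (use m in simp)
   show "AE x in lborel. norm (pp x * v (i + N) x) <= C * abs (pp x)" for i
   proof (rule AE_I2)
    fix x
    show "norm (pp x * v (i + N) x) <= C * abs (pp x)"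
    proof (cases "x : ball a s")
     case True
     have "abs (pp x) * abs (v (i + N) x) <= abs (pp x) * C" using True by (intro mult_left_mono N) auto
     thus ?thesis by (simp add: abs_mult mult.commute)
    qed (use z in simp)
   qed
  qed (use tfun_integrable[OF pp] pl m in auto)
  moreover have "(%m. (LI x. pp x * v m x)) ~~> (LI x. pp x * U x)"
   unfolding v_def by (rule tendsto_mollify[OF et U(1) pp])
  ultimately show ?thesis using LIMSEQ_unique LIMSEQ_ignore_initial_segment by blast
 qed
 ultimately show ?thesis by blast
qed

section \<open>L2 limits and the local form of Weyl's lemma\<close>

lemma smooth_extend:
 fixes g :: "real^'n => real"
 assumes "open S" "closed K" "K <= S" "smooth_on S g" "!!x. x ~: K ==> g x = 0"
 shows "smooth_on UNIV g"
proof (rule smooth_on_local[OF open_UNIV])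
 fix x
 show "EX T. open T & x : T & smooth_on T g"
 proof (cases "x : S")
  case True thus ?thesis using assms by blast
 next
  case False
  have o: "open (- K)" using assms(2) by auto
  have "smooth_on (- K) g"
   by (rule smooth_on_cong[OF o smooth_on_const[OF o, of 0]]) (use assms(5) in auto)
  thus ?thesis using o False assms(3) by blast
 qed
qed

text \<open>The Riesz-Fischer argument: a rapidly converging subsequence converges almost
  everywhere, and Fatou's lemma compares its limit with the whole sequence.\<close>

lemma L2_complete:
 fixes G :: "nat => real^'n => real"
 assumes G: "!!j. G j : bmb"
  and C: "!!e. 0 < e ==> EX N. ALL i>=N. ALL j>=N. N2 a s (%x. G i x - G j x) <= enn e"
 obtains U where "U : bmb" "!!x. x ~: ball a s ==> U x = 0" "(%j. N2 a s (%x. G j x - U x)) ~~> 0"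
proof -
 note [measurable] = G
 have "EX N. ALL i>=N. ALL j>=N. N2 a s (%x. G i x - G j x) <= enn ((1/4) ^ k)" for k :: nat by (rule C) simp
 from choice[OF allI[OF this]] obtain N where N: "ALL k. ALL i>=N k. ALL j>=N k. N2 a s (%x. G i x - G j x) <= enn ((1/4) ^ k)" ..
 \<comment> \<open>Partial sums make the subsequence indices monotone and force both
   \<open>N k <= r k\<close> and \<open>k <= r k\<close>.\<close>
 define r where "r = (%k. \<Sum>l\<le>k. Suc (N l))"
 have ra: "Suc (N k) <= r k" for k unfolding r_def by (rule member_le_sum[of k "{..k}" "%l. Suc (N l)"]) auto
 have rb: "r k <= r (Suc k)" for k by (simp add: r_def)
 have rN: "N k <= r k" "N k <= r (Suc k)" for k
  using ra[of k] rb[of k] by linarith+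
 have kr: "k <= r k" for k by (induction k) (auto simp: r_def)
 let ?d = "%k x. G (r (Suc k)) x - G (r k) x"
 have d: "N2 a s (?d k) <= enn ((1/4) ^ k)" for k using N[rule_format, OF rN(2) rN(1)] .
 \<comment> \<open>The weight \<open>2 ^ k\<close> is affordable since the \<open>k\<close>-th term
   is at most \<open>(1/4) ^ k\<close>; finiteness of \<open>?S x\<close> then bounds the increments
   by a geometric series of ratio \<open>sqrt (1/2)\<close>.\<close>
 let ?S = "%x. \<Sum>k. enn (2 ^ k) * (ind (ball a s) x * enn ((?d k x)^2))"
 have "(NN x. ?S x) = (\<Sum>k. enn (2 ^ k) * N2 a s (?d k))"
  unfolding N2_def by (subst nn_integral_suminf) (auto simp: nn_integral_cmult)
 also have "... <= (\<Sum>k. enn ((1/2) ^ k))"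
 proof (rule suminf_le)
  fix k
  have "enn (2 ^ k) * N2 a s (?d k) <= enn (2 ^ k) * enn ((1/4) ^ k)" by (rule mult_left_mono[OF d]) simp
  also have "... = enn ((1/2) ^ k)" by (simp add: ennreal_mult[symmetric] power_mult_distrib[symmetric])
  finally show "enn (2 ^ k) * N2 a s (?d k) <= enn ((1/2) ^ k)" .
 qed auto
 also have "... = enn (\<Sum>k. (1/2) ^ k)" by (rule suminf_ennreal2) auto
 finally have "(NN x. ?S x) ~= \<infinity>" by (auto simp: top_unique)
 hence "AE x in lborel. ?S x ~= \<infinity>" by (intro nn_integral_PInf_AE) auto
 hence cv: "AE x in lborel. x : ball a s --> convergent (%k. G (r k) x)"
 proof eventually_elim
  case (elim x)
  show ?case
  proof
   assume x: "x : ball a s"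
   have Sx: "?S x = (\<Sum>k. enn (2 ^ k * (?d k x)^2))" using x by (simp add: ennreal_mult)
   obtain c where c: "?S x = enn c" "0 <= c"
   proof (cases "?S x" rule: ennreal_cases)
    case (real c) thus thesis by (intro that)
   next
    case top thus thesis using elim unfolding infinity_ennreal_def by (rule notE[rotated])
   qed
   have dk: "(?d k x)^2 <= c * (1/2) ^ k" for k
   proof -
    have "(SUM l:{k}. enn (2 ^ l * (?d l x)^2)) <= (\<Sum>l. enn (2 ^ l * (?d l x)^2))"
     by (rule sum_le_suminf) auto
    hence "enn (2 ^ k * (?d k x)^2) <= enn c" unfolding Sx[symmetric] c(1) by simp
    hence "2 ^ k * (?d k x)^2 <= c" using c(2) by (simp only: ennreal_le_iff)
    thus ?thesis by (simp add: power_divide pos_le_divide_eq mult.commute)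
   qed
   have bd: "abs (?d k x) <= sqrt c * (sqrt (1/2)) ^ k" for k
    proof -
    have "sqrt ((?d k x)^2) <= sqrt (c * (1/2) ^ k)" by (rule real_sqrt_le_mono[OF dk])
    thus ?thesis unfolding real_sqrt_abs by (simp only: real_sqrt_mult real_sqrt_power)
   qed
   have sm: "summable (%k. sqrt c * (sqrt (1/2)) ^ k)"
    by (intro summable_mult summable_geometric) (simp add: real_sqrt_divide)
   have "summable (%k. ?d k x)" by (rule summable_comparison_test'[OF sm, of 0]) (use bd in simp)
   hence "convergent (%n. \<Sum>k<n. ?d k x)" by (simp add: summable_iff_convergent)
   moreover have "(\<Sum>k<n. ?d k x) = G (r n) x - G (r 0) x" for n by (induction n) auto
   ultimately have "convergent (%n. (G (r n) x - G (r 0) x) + G (r 0) x)"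
    by (intro convergent_add convergent_const) simp
   thus "convergent (%k. G (r k) x)" by simp
  qed
 qed
 define U where "U = (%x. ind (ball a s) x * lim (%k. G (r k) x))"
 have U[measurable]: "U : bmb" unfolding U_def by measurable
 have "(%j. N2 a s (%x. G j x - U x)) ~~> 0"
 proof (rule tendsto_zero_ennreal)
  fix e' :: real assume e': "0 < e'"
  define e where "e = e' / 2"
  have e: "0 < e" "e < e'" using e' by (auto simp: e_def)
  obtain M where M: "!!i j. i >= M ==> j >= M ==> N2 a s (%x. G i x - G j x) <= enn e" using C[OF e(1)] by blast
  have "N2 a s (%x. G j x - U x) <= enn e" if j: "j >= M" for j
  proof -
   have "N2 a s (%x. G j x - U x) = (NN x. liminf (%k. ind (ball a s) x * enn ((G j x - G (r k) x)^2)))"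
    unfolding N2_def
   proof (rule nn_integral_cong_AE)
    show "AE x in lborel. ind (ball a s) x * enn ((G j x - U x)^2) = liminf (%k. ind (ball a s) x * enn ((G j x - G (r k) x)^2))"
     using cv
    proof eventually_elim
     case (elim x)
     show ?case
     proof (cases "x : ball a s")
      case True
      hence "(%k. G (r k) x) ~~> U x" using elim by (simp add: U_def convergent_LIMSEQ_iff)
      hence "(%k. enn ((G j x - G (r k) x)^2)) ~~> ennreal ((G j x - U x)^2)"
       by (intro tendsto_ennrealI tendsto_power tendsto_diff tendsto_const)
      from lim_imp_Liminf[OF _ this] show ?thesis using True by simp
     qed (simp add: Liminf_const)
    qed
   qed
   also have "... <= liminf (%k. N2 a s (%x. G j x - G (r k) x))" unfolding N2_def by (rule nn_integral_liminf) measurable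
   also have "... <= limsup (%k. N2 a s (%x. G j x - G (r k) x))" by (rule Liminf_le_Limsup) simp
   also have "... <= enn e"
   proof (rule Limsup_bounded)
    show "EV k. N2 a s (%x. G j x - G (r k) x) <= enn e"
     unfolding eventually_sequentially using M[OF j order_trans[OF _ kr]] by (intro exI[of _ M]) simp
   qed
   finally show ?thesis .
  qed
  moreover have "enn e < enn e'" using e by (simp add: ennreal_lessI)
  ultimately show "EV j. N2 a s (%x. G j x - U x) < enn e'"
   unfolding eventually_sequentially by (intro exI[of _ M]) (auto intro: order_le_less_trans)
 qed
 thus thesis by (intro that[of U] U) (auto simp: U_def)
qed

text \<open>The quadratic form attains a positive minimum on the compact product of \<open>K\<close>
  with the unit sphere; homogeneity extends the bound to all \<open>p\<close>.\<close>

lemma uniform_ellipticity: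
 fixes A :: "'n::finite => 'n => real^'n => real"
 assumes K: "compact K" and A: "!!i j. continuous_on K (A i j)"
  and pos: "!!x p. x : K ==> p ~= 0 ==> 0 < (SU i. SU j. A i j x * p $ i * p $ j)"
 shows "EX lam>0. ALL x:K. ALL p. lam * (SU i. (p i)^2) <= (SU i. SU j. A i j x * p i * p j)"
proof (cases "K = {}")
 case True thus ?thesis by (auto intro: exI[of _ 1])
next
 case False
 let ?q = "%z. SU i. SU j. A i j (fst z) * snd z $ i * snd z $ j"
 have c: "compact (K \<times> sphere (0::real^'n) 1)" by (intro compact_Times K compact_sphere)
 have ne: "K \<times> sphere (0::real^'n) 1 ~= {}"
 proof -
  have "(axis undefined 1 :: real^'n) : sphere 0 1" by (simp add: dist_norm)
  thus ?thesis using False by blast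
 qed
 have ct: "continuous_on (K \<times> sphere (0::real^'n) 1) ?q"
  by (intro continuous_intros continuous_on_compose2[OF A]) auto
 obtain z0 where z0: "z0 : K \<times> sphere (0::real^'n) 1" "!!z. z : K \<times> sphere (0::real^'n) 1 ==> ?q z0 <= ?q z"
  using continuous_attains_inf[OF c ne ct] by blast
 have "snd z0 ~= 0" using z0(1) by (auto simp: sphere_def dist_norm)
 hence lam: "0 < ?q z0" using z0(1) by (intro pos) auto
 show ?thesis
 proof (intro exI conjI ballI allI)
  show "0 < ?q z0" by (rule lam)
  fix x and p :: "'n => real" assume x: "x : K"
  define v where "v = (\<chi> i. p i)"
  have nv: "(norm v)^2 = (SU i. (p i)^2)"
   by (simp add: v_def norm_vec_def L2_set_def sum_nonneg)
  show "?q z0 * (SU i. (p i)^2) <= (SU i. SU j. A i j x * p i * p j)"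
  proof (cases "v = 0")
   case True
   hence "p i = 0" for i by (auto simp: v_def vec_eq_iff)
   thus ?thesis by simp
  next
   case False
   let ?w = "inverse (norm v) *. v"
   have "?q z0 <= ?q (x, ?w)" by (rule z0(2)) (use x False in "auto simp: sphere_def dist_norm")
   also have "?q (x, ?w) = (inverse (norm v))^2 * (SU i. SU j. A i j x * p i * p j)"
    by (simp add: v_def sum_distrib_left power2_eq_square mult_ac)
   finally have "?q z0 * (norm v)^2 <= (inverse (norm v))^2 * (SU i. SU j. A i j x * p i * p j) * (norm v)^2"
    by (rule mult_right_mono) simp
   also have "... = (inverse (norm v) * norm v)^2 * (SU i. SU j. A i j x * p i * p j)"
    by (simp only: power_mult_distrib mult_ac)
   finally show ?thesis using False by (simp add: nv)
  qed
 qed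
qed

lemma cutoff_mult_smooth:
 fixes g :: "real^'n => real"
 assumes "open S" "cball a r <= S" "smooth_on UNIV xx" "!!x. x ~: ball a r ==> xx x = 0" "smooth_on S g"
 shows "tfun (%x. xx x * g x)"
proof -
 have "smooth_on UNIV (%x. xx x * g x)"
  by (rule smooth_extend[OF assms(1) closed_cball assms(2)])
   (use assms in "auto intro!: smooth_on_mult smooth_on_subset[OF assms(3)]")
 moreover have "xx x * g x = 0" if "norm a + r < norm x" for x
  using assms(4)[of x] that norm_triangle_ineq2[of x a] by (auto simp: dist_norm norm_minus_commute)
 ultimately show ?thesis unfolding tfun_def by blast
qed

lemma tfun_ball_support:
 fixes g :: "real^'n => real"
 assumes "tfun g" "!!y. y ~: ball a r ==> g y = 0" "y ~: cball a r"
 shows "pt i g y = 0"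
 using partial_cong[of "- cball a r" y g "%_. 0" i] assms by (auto simp: open_Compl)

text \<open>Both parts rest on \<open>abs w <= t + w^2 / t\<close>, a linearised Cauchy-Schwarz
  inequality. The parameter \<open>t\<close> stays free so that the two terms can be balanced in
  \<open>N2_tendsto_integral\<close>.\<close>

lemma
 fixes W b :: "real^'n => real"
 assumes W: "W : bmb" "N2 a s W < \<infinity>" and b: "b : bmb" "!!x. x : ball a s ==> abs (b x) <= M"
   "!!x. x ~: ball a s ==> b x * W x = 0" and t: "0 < t" and s: "0 < s"
 shows N2_integrable_mult: "integrable lborel (%x. b x * W x)"
  and N2_integral_mult_le: "abs (LI x. b x * W x) <= M * (t * measure lborel (ball a s) + enn2real (N2 a s W) / t)"
proof -
 note [measurable] = W(1) b(1)
 have M0: "0 <= M" using b(2)[of a] s by (simp add: order_trans[OF abs_ge_zero])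
 have iW: "integrable lborel (%x. ind (ball a s) x * (W x)^2)"
 proof (rule integrableI_bounded)
  have "(NN x. enn (norm (ind (ball a s) x * (W x)^2))) = N2 a s W"
   unfolding N2_def by (intro nn_integral_cong) (auto simp: indicator_def)
  thus "(NN x. enn (norm (ind (ball a s) x * (W x)^2))) < \<infinity>" using W(2) by simp
 qed measurable
 have eN: "enn2real (N2 a s W) = (LI x. ind (ball a s) x * (W x)^2)"
 proof -
  have "N2 a s W = (NN x. enn (ind (ball a s) x * (W x)^2))"
   unfolding N2_def by (intro nn_integral_cong) (auto simp: indicator_def)
  also have "... = enn (LI x. ind (ball a s) x * (W x)^2)"
   by (rule nn_integral_eq_integral[OF iW]) auto
  finally show ?thesis by (simp add: integral_nonneg_AE)
 qed
 let ?g = "%x. M * (t * ind (ball a s) x + ind (ball a s) x * (W x)^2 / t)"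
 have ib: "integrable lborel (%x. ind (ball a s) x :: real)"
  by (rule integrable_real_indicator[OF _ emeasure_lborel_ball_finite]) simp
 have ig: "integrable lborel ?g" using iW ib by auto
 have le: "abs (b x * W x) <= ?g x" for x
 proof (cases "x : ball a s")
  case True
  have "0 <= (t - abs (W x))^2 + t * abs (W x)" using t by simp
  hence "t * abs (W x) <= t^2 + (W x)^2" by (simp add: power2_eq_square algebra_simps)
  hence "abs (W x) <= t + (W x)^2 / t" using t by (simp add: field_simps power2_eq_square)
  hence "abs (b x) * abs (W x) <= M * (t + (W x)^2 / t)" by (intro mult_mono b True M0) auto
  thus ?thesis using True by (simp add: abs_mult)
 next
  case False thus ?thesis using b(3) by simp
 qed
 show i: "integrable lborel (%x. b x * W x)"
  by (rule Bochner_Integration.integrable_bound[OF ig]) (use le in "auto intro!: AE_I2 order_trans[OF le abs_ge_self]")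
 have "abs (LI x. b x * W x) <= (LI x. ?g x)"
  by (rule order_trans[OF integral_abs_bound integral_mono[OF integrable_abs[OF i] ig le]])
 also have "... = M * (t * measure lborel (ball a s) + enn2real (N2 a s W) / t)"
  using iW ib unfolding eN by simp
 finally show "abs (LI x. b x * W x) <= M * (t * measure lborel (ball a s) + enn2real (N2 a s W) / t)" .
qed

lemma N2_tendsto_integral:
 fixes W :: "nat => real^'n => real"
 assumes W: "!!j. W j : bmb" "(%j. N2 a s (W j)) ~~> 0" and b: "tfun b" "!!x. x ~: ball a s ==> b x = 0"
  and s: "0 < s"
 shows "(%j. (LI x. b x * W j x)) ~~> 0"
proof (rule LIMSEQ_I)
 fix e :: real assume e: "0 < e"
 obtain M where M: "0 <= M" "!!x. abs (b x) <= M" using tfun_bounded[OF b(1)] by metis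
 define v where "v = measure lborel (ball a s)"
 \<comment> \<open>Fixed first, so that the constant term stays below \<open>e / 2\<close>; only
   then is \<open>N2\<close> made small compared with \<open>t\<close>.\<close>
 define t where "t = e / (2 * (M * v + 1))"
 have v: "0 <= v" by (simp add: v_def)
 hence Mv: "0 < M * v + 1" using M by (simp add: add_nonneg_pos)
 have t: "0 < t" using e Mv by (simp add: t_def)
 have tv: "M * (t * v) < e / 2"
 proof -
  have "M * (t * v) = (M * v) * t" by (simp add: mult_ac)
  also have "... < (M * v + 1) * t" using t by simp
  also have "... = e / 2"
  proof -
   have "p * (e / (2 * p)) = e / 2" if "p ~= 0" for p using that by simp
   from this[of "M * v + 1"] Mv show ?thesis unfolding t_def by linarith
  qed
  finally show ?thesis .
 qed
 have "EV j. N2 a s (W j) < enn (t * e / (2 * (M + 1)))"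
  by (rule order_tendstoD(2)[OF W(2)]) (use t e M in "simp add: ennreal_less_zero_iff")
 then obtain N where N: "!!j. j >= N ==> N2 a s (W j) < enn (t * e / (2 * (M + 1)))" by (auto simp: eventually_sequentially)
 show "EX N. ALL j>=N. norm ((LI x. b x * W j x) - 0) < e"
 proof (intro exI allI impI)
  fix j assume j: "N <= j"
  have fin: "N2 a s (W j) < \<infinity>" using N[OF j] by (auto intro: less_trans)
  have "enn2real (N2 a s (W j)) <= t * e / (2 * (M + 1))"
   using enn2real_mono[OF less_imp_le[OF N[OF j]]] t e M by simp
  hence "enn2real (N2 a s (W j)) / t <= e / (2 * (M + 1))" using t by (simp add: field_simps)
  hence "M * (enn2real (N2 a s (W j)) / t) <= M * (e / (2 * (M + 1)))" using M by (intro mult_left_mono)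
  also have "... <= e / 2" using M e by (simp add: field_simps)
  finally have *: "M * (enn2real (N2 a s (W j)) / t) <= e / 2" .
  have "abs (LI x. b x * W j x) <= M * (t * v + enn2real (N2 a s (W j)) / t)"
   unfolding v_def by (rule N2_integral_mult_le[OF W(1) fin tfun_measurable[OF b(1)] M(2) _ t s]) (use b(2) in auto)
  also have "... < e" using * tv unfolding distrib_left by linarith
  finally show "norm ((LI x. b x * W j x) - 0) < e" by simp
 qed
qed

text \<open>Here the weak solution is given only as a Cauchy sequence \<open>F\<close> that
  satisfies the equation in the limit, with coefficients known on \<open>S\<close> alone. The three
  radii serve the cutoff of the coefficients (\<open>3 * r\<close>), the hypotheses on
  \<open>F\<close> (\<open>2 * r\<close>) and the conclusion (\<open>r\<close>).\<close>

lemma weyl_local: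
 fixes A :: "'n::finite => 'n => real^'n => real" and F :: "nat => real^'n => real"
 assumes S: "open S" "cball a (3 * r) <= S" "0 < r"
  and A: "!!i j. smooth_on S (A i j)" "!!i j x. x : S ==> A i j x = A j i x"
  and pos: "!!x p. x : S ==> p ~= 0 ==> 0 < (SU i. SU j. A i j x * p $ i * p $ j)"
  and Q: "smooth_on S Q" and f: "smooth_on S f" and F: "!!j. smooth_on S (F j)"
  and C: "!!e. 0 < e ==> EX N. ALL i>=N. ALL j>=N. N2 a (2 * r) (%x. F i x - F j x) <= enn e"
  and weak: "!!pp. tfun pp ==> (!!y. y ~: ball a (2 * r) ==> pp y = 0) ==>
   (%j. (LI y. ((SU i. pt i (%y. SU j. A i j y * pt j pp y) y) + Q y * pp y) * F j y))
    ~~> (LI y. pp y * f y)"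
 shows "EX V. smooth_on (ball a r) V & (%j. N2 a r (%x. F j x - V x)) ~~> 0"
proof -
 let ?N = "N2 a (2 * r)"
 obtain xx :: "real^'n => real" where xx: "smooth_on UNIV xx" "!!x. 0 <= xx x" "!!x. xx x <= 1"
  "!!x. x : cball a (2 * r) ==> xx x = 1" "!!x. x ~: ball a (3 * r) ==> xx x = 0"
  using exists_cutoff[of "2 * r" "3 * r" a] S(3) by auto
 have cut: "tfun (%x. xx x * g x)" if "smooth_on S g" for g
  by (rule cutoff_mult_smooth[OF S(1,2) xx(1)]) (use xx(5) that in auto)
 \<comment> \<open>Interpolating with the identity matrix extends the coefficients smoothly and
   symmetrically to the whole space without changing them on the ball of radius
   \<open>2 * r\<close>.\<close>
 define A' where "A' = (%i j x. xx x * A i j x + (1 - xx x) * (if i = j then 1 else 0))"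
 define Q' where "Q' = (%x. xx x * Q x)"
 define f' where "f' = (%x. xx x * f x)"
 define F' where "F' = (%j x. xx x * F j x)"
 have A': "smooth_on UNIV (A' i j)" for i j
  unfolding A'_def by (intro smooth_on_add smooth_on_mult smooth_on_diff smooth_on_const xx tfun_smooth[OF cut[OF A(1)]] open_UNIV)
 have A'sym: "A' i j = A' j i" for i j
 proof
  fix x
  show "A' i j x = A' j i x"
  proof (cases "x : S")
   case True thus ?thesis using A(2) by (auto simp: A'_def)
  next
   case False
   hence "x ~: ball a (3 * r)" using S(2) by (auto simp: subset_iff)
   hence "xx x = 0" by (rule xx(5))
   thus ?thesis by (auto simp: A'_def)
  qed
 qed
 have on: "A' i j x = A i j x" "Q' x = Q x" "f' x = f x" "F' k x = F k x" if "x : cball a (2 * r)" for i j k x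
  using xx(4)[OF that] by (auto simp: A'_def Q'_def f'_def F'_def)
 have sub: "cball a (2 * r) <= S" and r2: "0 < 2 * r" using S by auto
 obtain lam where lam: "0 < lam" "!!x p. x : cball a (2 * r) ==> lam * (SU i. (p i)^2) <= (SU i. SU j. A i j x * p i * p j)"
  using uniform_ellipticity[OF compact_cball, of a "2 * r" A] continuous_on_subset[OF smooth_on_continuous[OF A(1)] sub] pos sub by blast
 have lam': "lam * (SU i. (p i)^2) <= (SU i. SU j. A' i j x * p i * p j)" if "x : ball a (2 * r)" for x p
  using lam(2)[of x p] that on(1) by simp
 have tF': "tfun (F' j)" for j unfolding F'_def by (rule cut[OF F])
 have tf': "tfun f'" unfolding f'_def by (rule cut[OF f])
 have Q's: "smooth_on UNIV Q'" unfolding Q'_def by (rule tfun_smooth[OF cut[OF Q]])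
 have NF: "?N (%x. F i x - F j x) = ?N (%x. F' i x - F' j x)" for i j by (rule N2_cong) (use on in auto)
 obtain U where U: "U : bmb" "!!x. x ~: ball a (2 * r) ==> U x = 0" "(%j. ?N (%x. F' j x - U x)) ~~> 0"
  using L2_complete[of F' a "2 * r", OF tfun_measurable[OF tF'] C[unfolded NF]] by blast
 note [measurable] = U(1) tfun_measurable[OF tF']
 have UN: "?N U < \<infinity>"
 proof -
  have "EV j. ?N (%x. F' j x - U x) < 1" by (rule order_tendstoD(2)[OF U(3)]) simp
  then obtain j where j: "?N (%x. F' j x - U x) < 1" by (auto simp: eventually_sequentially)
  have "?N U = ?N (%x. F' j x + - (F' j x - U x))" by simp
  also have "... <= 2 * ?N (F' j) + 2 * ?N (%x. - (F' j x - U x))" by (rule N2_add) measurable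
  also have "?N (%x. - (F' j x - U x)) = ?N (%x. F' j x - U x)" unfolding N2_def by (simp only: power2_minus)
  also have "2 * ?N (F' j) + 2 * ?N (%x. F' j x - U x) < \<infinity>"
  proof -
   have 1: "?N (F' j) < top" by (simp add: N2_smooth_eq[OF tfun_smooth[OF tF']])
   have 2: "?N (%x. F' j x - U x) < top" using j by (rule less_trans) simp
   have "2 * x + 2 * y < (top::ennreal)" if "x < top" "y < top" for x y
    using that by (simp add: ennreal_mult_less_top)
   thus ?thesis using 1 2 unfolding infinity_ennreal_def by blast
  qed
  finally show ?thesis .
 qed
 have Usupp: "U x = 0" if "norm a + 2 * r < norm x" for x
  using U(2)[of x] that norm_triangle_ineq2[of x a] by (auto simp: dist_norm norm_minus_commute)
 have bU: "integrable lborel (%y. b y * U y)" if b: "smooth_on UNIV b" for b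
 proof -
  obtain M where M: "M >= 0" "!!x. x : cball a (2 * r) ==> abs (b x) <= M" using smooth_bounded_cball[OF b] by metis
  show ?thesis by (rule N2_integrable_mult[OF U(1) UN smooth_UNIV_measurable[OF b] M(2) _ zero_less_one r2]) (use U(2) in auto)
 qed
 have iU: "integrable lborel U" using bU[OF smooth_on_const[OF open_UNIV, of 1]] by simp
 have weakU: "(LI y. ((SU i. pt i (%y. SU j. A' i j y * pt j pp y) y) + Q' y * pp y) * U y) = (LI y. pp y * f' y)"
  if pp: "tfun pp" "rh < 2 * r" "!!y. y ~: ball a rh ==> pp y = 0" for pp rh
 proof -
  let ?g = "%A Q y. (SU i. pt i (%y. SU j. A i j y * pt j pp y) y) + Q y * pp y"
  have zpp: "y ~: ball a (2 * r) ==> pp y = 0" for y using pp(2,3) by auto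
  have g0: "?g B P y = 0" if "y ~: ball a (2 * r)" for B :: "'n => 'n => real^'n => real" and P y
  proof -
   have y: "y : - cball a rh" using that pp(2) by auto
   have "pt i (%y. SU j. B i j y * pt j pp y) y = pt i (%_. 0) y" for i
    by (rule partial_cong[OF _ y]) (use tfun_ball_support[OF pp(1,3)] in auto)
   thus ?thesis using zpp[OF that] by simp
  qed
  have tg: "tfun (?g A' Q')"
   by (intro tfun_add tfun_sum tfun_partial tfun_mult A' Q's pp finite)
  have geq: "?g A Q y * F j y = ?g A' Q' y * F' j y" for y j
  proof (cases "y : ball a (2 * r)")
   case True
   have "pt i (%y. SU j. A i j y * pt j pp y) y = pt i (%y. SU j. A' i j y * pt j pp y) y" for i
    by (rule partial_cong[OF open_ball True]) (use on(1) in auto)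
   thus ?thesis using on(2,4) True by simp
  next
   case False thus ?thesis unfolding g0[OF False] by simp
  qed
  have 1: "(%j. (LI y. ?g A' Q' y * F' j y)) ~~> (LI y. pp y * f' y)"
  proof -
   have pe: "pp y * f y = pp y * f' y" for y using zpp[of y] on(3)[of y] by (cases "y : ball a (2 * r)") auto
   have "(%j. (LI y. ?g A Q y * F j y)) ~~> (LI y. pp y * f y)"
    by (rule weak[OF pp(1)]) (rule zpp)
   thus ?thesis by (simp only: geq pe)
  qed
  have "(%j. (LI y. ?g A' Q' y * (F' j y - U y))) ~~> 0"
  proof (rule N2_tendsto_integral[where W = "%j y. F' j y - U y" and b = "?g A' Q'" and a = a and s = "2 * r"])
   show "?g A' Q' x = 0" if "x ~: ball a (2 * r)" for x by (rule g0[OF that])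
  qed (use U(3) tg r2 in "auto intro: borel_measurable_diff")
  moreover have "(LI y. ?g A' Q' y * (F' j y - U y)) = (LI y. ?g A' Q' y * F' j y) - (LI y. ?g A' Q' y * U y)" for j
   unfolding right_diff_distrib
   by (rule Bochner_Integration.integral_diff) (intro tfun_mult_integrable[OF tg] tfun_integrable[OF tF'] iU)+
  ultimately have "(%j. (LI y. ?g A' Q' y * F' j y) - (LI y. ?g A' Q' y * U y)) ~~> 0" by simp
  hence "(%j. (LI y. ?g A' Q' y * F' j y)) ~~> (LI y. ?g A' Q' y * U y)" by (rule LIM_zero_cancel)
  thus ?thesis using 1 by (rule LIMSEQ_unique)
 qed
 have "EX V. smooth_on (ball a (2 * r)) V & (ALL pp rh. tfun pp --> rh < 2 * r --> (ALL y. y ~: ball a rh --> pp y = 0) -->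
  (LI y. pp y * U y) = (LI y. pp y * V y))"
  by (rule weyl_core[OF A' A'sym Q's tf' lam(1) lam' iU Usupp bU le_less_trans[OF N2_mono UN] weakU]) auto
 then obtain V where V: "smooth_on (ball a (2 * r)) V" "!!pp rh. tfun pp ==> rh < 2 * r ==> (!!y. y ~: ball a rh ==> pp y = 0) ==>
  (LI y. pp y * U y) = (LI y. pp y * V y)" by blast
 \<comment> \<open>The radius \<open>3/2 * r\<close> lies strictly between \<open>r\<close> and
   \<open>2 * r\<close>: \<open>ze\<close> is 1 where \<open>U\<close> and \<open>V\<close> are to
   be compared, and products with it are admissible in the identity for \<open>V\<close>.\<close>
 obtain ze :: "real^'n => real" where ze: "smooth_on UNIV ze" "!!x. 0 <= ze x" "!!x. ze x <= 1"
  "!!x. x : cball a r ==> ze x = 1" "!!x. x ~: ball a (3/2 * r) ==> ze x = 0"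
  using exists_cutoff[of r "3/2 * r" a] S(3) by auto
 have tV: "tfun (%x. ze x * V x)"
  by (rule cutoff_mult_smooth[OF open_ball _ ze(1) _ V(1), of a "3/2 * r"]) (use S(3) ze(5) in auto)
 have tz: "tfun (%x. ze x * F' k x)" for k by (rule tfun_mult[OF ze(1) tF'])
 let ?p = "%k x. ze x * F' k x - ze x * V x" and ?h = "%x. ze x * U x - ze x * V x"
 note [measurable] = smooth_UNIV_measurable[OF ze(1)] tfun_measurable[OF tV] tfun_measurable[OF tz]
 have hU: "?h x = 0" if "x ~: ball a (2 * r)" for x
 proof -
  have "x ~: ball a (3/2 * r)" using that S(3) by auto
  thus ?thesis by (simp add: ze(5))
 qed
 have sq: "integrable lborel (%x. (W x)^2)" "enn (LI x. (W x)^2) = ?N W"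
  if W: "W : bmb" "?N W < \<infinity>" "!!x. x ~: ball a (2 * r) ==> W x = 0" for W
 proof -
  note [measurable] = W(1)
  have e: "(NN x. enn ((W x)^2)) = ?N W"
   unfolding N2_def by (intro nn_integral_cong) (use W(3) in "auto simp: indicator_def")
  show i: "integrable lborel (%x. (W x)^2)" by (rule integrableI_nonneg) (use W(2) e in auto)
  show "enn (LI x. (W x)^2) = ?N W" using nn_integral_eq_integral[OF i] e by simp
 qed
 have z1: "(ze x * w)^2 <= 1 * w^2" for x w
  unfolding power_mult_distrib using ze(2,3) by (intro mult_right_mono) (auto simp: power_le_one)
 have Nh: "?N ?h < \<infinity>"
 proof -
  have "?N (%x. ze x * U x + - (ze x * V x)) <= 2 * ?N (%x. ze x * U x) + 2 * ?N (%x. - (ze x * V x))"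
   by (rule N2_add) measurable
  also have "... < top"
  proof -
   have "?N (%x. ze x * U x) <= enn 1 * ?N U" by (rule N2_le) (use z1 U(1) in auto)
   hence 1: "?N (%x. ze x * U x) < top" using UN by (auto intro: le_less_trans)
   have 2: "?N (%x. - (ze x * V x)) < top" by (simp add: N2_smooth_eq[OF tfun_smooth[OF tfun_uminus[OF tV]]])
   show ?thesis using 1 2 by (simp add: ennreal_mult_less_top)
  qed
  finally show ?thesis by simp
 qed
 \<comment> \<open>\<open>?h\<close> is no test function, so the identity of \<open>U\<close> and
   \<open>V\<close> is tested with \<open>ze\<close> times its smooth approximation
   \<open>?p k\<close>, which equals \<open>?h - ?d\<close>. This yields that the integral of
   \<open>?h^2 - ?d * ?h\<close> is 0, hence the square integral of \<open>?h\<close> is at most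
   that of \<open>?d\<close>, which tends to 0 with \<open>k\<close>.\<close>
 have hle: "?N ?h <= ?N (%x. F' k x - U x)" if fin: "?N (%x. F' k x - U x) < \<infinity>" for k
 proof -
  let ?d = "%x. ze x * (U x - F' k x)"
  have Nd: "?N ?d <= enn 1 * ?N (%x. F' k x - U x)"
  proof (rule N2_le)
   show "(ze x * (U x - F' k x))^2 <= 1 * (F' k x - U x)^2" for x using z1[of x "U x - F' k x"] by (simp add: power2_commute)
  qed auto
  have dm: "?d : bmb" by measurable
  have d0: "?d x = 0" if "x ~: ball a (2 * r)" for x
  proof -
   have "x ~: ball a (3/2 * r)" using that S(3) by auto
   thus ?thesis by (simp add: ze(5))
  qed
  have hm: "?h : bmb" by measurable
  have sh: "integrable lborel (%x. (?h x)^2)" "enn (LI x. (?h x)^2) = ?N ?h"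
   by (rule sq(1)[OF hm Nh], rule hU, assumption) (rule sq(2)[OF hm Nh], rule hU, assumption)
  have Ndf: "?N ?d < \<infinity>" using Nd fin by (auto intro: le_less_trans)
  have sd: "integrable lborel (%x. (?d x)^2)" "enn (LI x. (?d x)^2) = ?N ?d"
   by (rule sq(1)[OF dm Ndf], rule d0, assumption) (rule sq(2)[OF dm Ndf], rule d0, assumption)
  have tpp: "tfun (%x. ze x * ?p k x)" by (intro tfun_mult[OF ze(1)] tfun_diff tz tV)
  have "(LI y. ze y * ?p k y * U y) = (LI y. ze y * ?p k y * V y)"
   by (rule V(2)[OF tpp, of "3/2 * r"]) (use S(3) ze(5) in auto)
  moreover have "integrable lborel (%y. ze y * ?p k y * U y)" by (rule tfun_mult_integrable[OF tpp iU])
  moreover have "integrable lborel (%y. ze y * ?p k y * V y)"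
   using tfun_integrable[OF tfun_mult[OF tfun_smooth[OF tfun_diff[OF tz[of k] tV]] tV]] by (simp add: mult_ac)
  ultimately have "(LI y. ze y * ?p k y * U y - ze y * ?p k y * V y) = 0" by simp
  moreover have "ze y * ?p k y * U y - ze y * ?p k y * V y = (?h y)^2 - ?d y * ?h y" for y
   by (simp add: power2_eq_square algebra_simps)
  ultimately have 0: "(LI y. (?h y)^2 - ?d y * ?h y) = 0" by (simp only:)
  have "(LI y. ((?h y)^2 - (?d y)^2) / 2) <= (LI y. (?h y)^2 - ?d y * ?h y)"
  proof (rule integral_mono)
   show "((?h y)^2 - (?d y)^2) / 2 <= (?h y)^2 - ?d y * ?h y" for y
    using zero_le_power2[of "?h y - ?d y"] by (simp only: power2_diff) (simp add: field_simps)
   show "integrable lborel (%y. (?h y)^2 - ?d y * ?h y)"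
   proof (rule Bochner_Integration.integrable_diff[OF sh(1)], rule Bochner_Integration.integrable_bound)
    show "integrable lborel (%y. (?d y)^2 + (?h y)^2)" using sd(1) sh(1) by (rule Bochner_Integration.integrable_add)
    show "AE y in lborel. norm (?d y * ?h y) <= norm ((?d y)^2 + (?h y)^2)"
    proof (rule AE_I2)
     have "abs (p * q) <= p^2 + q^2" for p q :: real
      using sum_squares_bound[of p q] sum_squares_bound[of p "- q"] zero_le_power2[of p] zero_le_power2[of q] by (simp add: abs_le_iff)
     thus "norm (?d y * ?h y) <= norm ((?d y)^2 + (?h y)^2)" for y by (simp add: real_norm_def)
    qed
   qed measurable
  qed (use sh(1) sd(1) in simp)
  hence "(LI y. (?h y)^2) <= (LI y. (?d y)^2)" using 0 sh(1) sd(1) by simp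
  hence "?N ?h <= ?N ?d" unfolding sh(2)[symmetric] sd(2)[symmetric] by (rule ennreal_leI)
  thus ?thesis using Nd by simp
 qed
 have h0: "?N ?h = 0"
 proof -
  have "?N ?h <= 0"
  proof (rule tendsto_lowerbound[OF U(3)])
   have "EV k. ?N (%x. F' k x - U x) < 1" by (rule order_tendstoD(2)[OF U(3)]) simp
   thus "EV k. ?N ?h <= ?N (%x. F' k x - U x)"
   proof eventually_elim
    case (elim k)
    hence "?N (%x. F' k x - U x) < \<infinity>" by (rule less_trans) simp
    thus ?case by (rule hle)
   qed
  qed simp
  thus ?thesis by simp
 qed
 have le: "N2 a r (%x. F j x - V x) <= ?N (%x. F' j x - U x) + ?N (%x. F' j x - U x)" for j
 proof -
  have "N2 a r (%x. F j x - V x) = N2 a r (%x. (F' j x - U x) + (U x - ze x * V x))"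
  proof (rule N2_cong)
   fix x assume x: "x : ball a r"
   have "x : cball a (2 * r)" "x : cball a r" using x S(3) by auto
   thus "F j x - V x = (F' j x - U x) + (U x - ze x * V x)" using on(4) ze(4) by simp
  qed
  also have "... <= 2 * N2 a r (%x. F' j x - U x) + 2 * N2 a r (%x. U x - ze x * V x)" by (rule N2_add) measurable
  also have "N2 a r (%x. U x - ze x * V x) = N2 a r ?h" by (rule N2_cong) (use ze(4) in auto)
  also have "N2 a r ?h = 0" using N2_mono[of r "2 * r" a ?h] h0 S(3) by simp
  also have "2 * N2 a r (%x. F' j x - U x) + 2 * 0 = N2 a r (%x. F' j x - U x) + N2 a r (%x. F' j x - U x)"
   by (simp only: mult_zero_right add_0_right mult_2)
  also have "... <= ?N (%x. F' j x - U x) + ?N (%x. F' j x - U x)"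
   by (intro add_mono N2_mono) (use S(3) in simp_all)
  finally show ?thesis .
 qed
 have "(%j. N2 a r (%x. F j x - V x)) ~~> 0"
 proof (rule tendsto_sandwich[OF _ _ tendsto_const])
  show "EV j. N2 a r (%x. F j x - V x) <= ?N (%x. F' j x - U x) + ?N (%x. F' j x - U x)"
   by (rule always_eventually, rule allI, rule le)
  show "(%j. ?N (%x. F' j x - U x) + ?N (%x. F' j x - U x)) ~~> 0"
   using tendsto_add[OF U(3) U(3)] by simp
 qed simp
 moreover have "smooth_on (ball a r) V" by (rule smooth_on_subset[OF V(1)]) (use S(3) in auto)
 ultimately show ?thesis by blast
qed

section \<open>Change of variables and relabelling of coordinates\<close>

lemma det_reindex:
 fixes f :: "'a::finite => 'b::finite" and A :: "real^'b^'b"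
 assumes f: "bij f" shows "det (\<chi> i j. A $ f i $ f j) = det A"
proof -
 have inv: "bij (inv f)" "inj f" "inj (inv f)" using f by (auto simp: bij_imp_bij_inv bij_is_inj)
 have f_inv: "f (inv f x) = x" "inv f (f y) = y" for x y using f by (auto simp: bij_def surj_f_inv_f)
 have m: "map_permutation UNIV f p = f \<circ> p \<circ> inv f" for p
  using f by (auto simp: map_permutation_def restrict_id_def bij_def fun_eq_iff)
 have 1: "f \<circ> p \<circ> inv f permutes UNIV" "sign (f \<circ> p \<circ> inv f) = sign p" if "p permutes UNIV" for p
  using map_permutation_permutes[of f UNIV UNIV p] sign_map_permutation[of f UNIV p] f that inv by (auto simp: m)
 have 2: "inv f \<circ> p \<circ> f permutes UNIV" if "p permutes UNIV" for p
  using that f inv by (auto simp: permutes_univ fun_eq_iff) (metis f_inv)+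
 have "det A = (\<Sum>p | p permutes UNIV. of_int (sign p) * (PROD i:UNIV. A $ i $ p i))" by (simp add: det_def)
 also have "... = (\<Sum>p | p permutes UNIV. of_int (sign p) * (PROD i:UNIV. A $ f i $ f (p i)))"
 proof (rule sum.reindex_bij_witness[where i = "%p. f \<circ> p \<circ> inv f" and j = "%p. inv f \<circ> p \<circ> f"])
  fix p :: "'b => 'b" assume p: "p : {p. p permutes UNIV}"
  show e: "f \<circ> (inv f \<circ> p \<circ> f) \<circ> inv f = p" by (simp add: fun_eq_iff f_inv)
  show "inv f \<circ> p \<circ> f : {p. p permutes UNIV}" using 2 p by simp
  have "(PROD i:UNIV. A $ f i $ f ((inv f \<circ> p \<circ> f) i)) = (PROD i:UNIV. A $ i $ p i)"
   by (rule prod.reindex_bij_witness[where i = "inv f" and j = f]) (auto simp: f_inv)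
  thus "of_int (sign (inv f \<circ> p \<circ> f)) * (PROD i:UNIV. A $ f i $ f ((inv f \<circ> p \<circ> f) i))
   = of_int (sign p) * (PROD i:UNIV. A $ i $ p i)" using 1(2)[OF 2[of p]] p e by simp
 qed (use 1 in "auto simp: fun_eq_iff f_inv")
 finally show ?thesis by (simp add: det_def)
qed

lemma lborel_distr_reindex:
 fixes f :: "'a::finite => 'b::finite"
 assumes f: "bij f" shows "distr lborel borel (%x::real^'b. \<chi> i. x $ f i) = (lborel :: (real^'a) measure)"
proof (rule lborel_eqI[symmetric])
 have f_inv: "f (inv f x) = x" "inv f (f y) = y" for x y using f by (auto simp: bij_def surj_f_inv_f)
 have [measurable]: "(%x::real^'b. (\<chi> i. x $ f i) :: real^'a) : bmb"
  by (intro borel_measurable_continuous_onI continuous_intros)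
 fix l u :: "real^'a" assume le: "!!b. b : Basis ==> l \<bullet> b <= u \<bullet> b"
 have le': "l $ i <= u $ i" for i using le[of "axis i 1"] by (auto simp: inner_axis Basis_axis)
 let ?R = "%y::real^'a. (\<chi> i. y $ inv f i) :: real^'b"
 have "(%x::real^'b. (\<chi> i. x $ f i) :: real^'a) -` box l u = box (?R l) (?R u)"
  by (auto simp: mem_box_cart) (metis f_inv)+
 hence "emeasure (distr lborel borel (%x::real^'b. (\<chi> i. x $ f i) :: real^'a)) (box l u) = emeasure lborel (box (?R l) (?R u))"
  by (simp add: emeasure_distr)
 also have "... = (PROD b:Basis. (?R u - ?R l) \<bullet> b)"
  by (rule emeasure_lborel_box) (auto simp: Basis_axis inner_axis le')
 also have "(PROD b:(Basis :: (real^'b) set). (?R u - ?R l) \<bullet> b) = (PROD i:UNIV. u $ inv f i - l $ inv f i)"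
  unfolding Basis_vec_def by (simp add: UNION_singleton_eq_range prod.reindex axis_eq_axis inj_on_def inner_axis)
 also have "... = (PROD i:UNIV. u $ i - l $ i)"
  by (rule prod.reindex_bij_witness[where i = f and j = "inv f"]) (auto simp: f_inv)
 also have "... = (PROD b:Basis. (u - l) \<bullet> b)"
  unfolding Basis_vec_def by (simp add: UNION_singleton_eq_range prod.reindex axis_eq_axis inj_on_def inner_axis)
 finally show "emeasure (distr lborel borel (%x::real^'b. (\<chi> i. x $ f i) :: real^'a)) (box l u) = (PROD b:Basis. (u - l) \<bullet> b)" .
qed simp

text \<open>A bridge between the gauge integral, in which the change of variables formula is stated,
  and the nonnegative Lebesgue integral.\<close>

lemma absolutely_integrable_nonneg_iff:
 fixes h :: "'a::euclidean_space => real"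
 assumes "!!x. x : W ==> 0 <= h x" "(%x. ind W x * h x) : bmb"
 shows "h absolutely_integrable_on W & integral W h = b \<longleftrightarrow>
  0 <= b & (NN x. enn (ind W x * h x)) = enn b" (is "?L \<longleftrightarrow> ?R")
proof
 assume L: ?L
 hence "h integrable_on W" by (simp add: absolutely_integrable_on_def)
 hence hb: "(h has_integral b) W" using L by (simp add: has_integral_iff)
 show ?R using has_integral_nonneg[OF hb assms(1)] nn_integral_has_integral_lebesgue[OF assms(1) hb] by simp
next
 assume R: ?R
 have "((%x. ind W x * h x) has_integral b) UNIV"
  by (rule nn_integral_has_integral) (use assms R in "auto simp: indicator_def")
 moreover have "(%x. ind W x * h x) = (%x. if x : W then h x else 0)" by (auto simp: indicator_def)
 ultimately have "(h has_integral b) W" by (simp add: has_integral_restrict_UNIV)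
 thus ?L using nonnegative_absolutely_integrable_1[of h W] assms(1) by (auto simp: has_integral_iff)
qed

text \<open>The gauge form says that one side has the finite value \<open>b\<close> exactly if the
  other has; so the sides agree when either is finite, and otherwise both are infinite.\<close>

lemma nn_integral_change_of_variables_wellorder:
 fixes T :: "real^'m::{finite,wellorder} => real^'m::_" and f :: "real^'m::_ => real"
 assumes S: "S : sets borel" and T': "!!x. x : S ==> (T has_derivative T' x) (at x)" and inj: "inj_on T S"
  and nn: "!!y. y : T ` S ==> 0 <= f y"
  and m: "(%y. ind (T ` S) y * f y) : bmb"
   "(%x. ind S x * (abs (det (matrix (T' x))) * f (T x))) : bmb"
 shows "(NN y. enn (ind (T ` S) y * f y)) = (NN x. enn (ind S x * (abs (det (matrix (T' x))) * f (T x))))"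
  (is "?l = ?r")
proof -
 \<comment> \<open>Values are embedded in \<open>real^1\<close> because the formula is stated for
   vector-valued functions.\<close>
 have "(%x. abs (det (matrix (T' x))) *. (vec (f (T x)) :: real^1)) absolutely_integrable_on S &
   integral S (%x. abs (det (matrix (T' x))) *. (vec (f (T x)) :: real^1)) = vec b \<longleftrightarrow>
  (%y. vec (f y) :: real^1) absolutely_integrable_on (T ` S) & integral (T ` S) (%y. vec (f y) :: real^1) = vec b" for b
  by (rule has_absolute_integral_change_of_variables) (use S T' inj in "auto intro: has_derivative_at_withinI")
 hence "(%x. abs (det (matrix (T' x))) * f (T x)) absolutely_integrable_on S & integral S (%x. abs (det (matrix (T' x))) * f (T x)) = b
  \<longleftrightarrow> f absolutely_integrable_on (T ` S) & integral (T ` S) f = b" for b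
  by (simp add: absolutely_integrable_on_1_iff integral_on_1_eq)
 hence eq: "0 <= b & ?r = enn b \<longleftrightarrow> 0 <= b & ?l = enn b" for b
  using absolutely_integrable_nonneg_iff[OF _ m(1), of b] absolutely_integrable_nonneg_iff[OF _ m(2), of b] nn by auto
 show ?thesis
 proof (cases ?l)
  case (real b) thus ?thesis using eq[of b] by simp
 next
  case top
  thus ?thesis
  proof (cases ?r)
   case (real b) thus ?thesis using eq[of b] by simp
  qed simp
 qed
qed

section \<open>The weighted volume measure in charts\<close>

text \<open>The library states the change of variables formula for well-ordered coordinate index types
 only; every finite index type is in bijection with such a type.\<close>

typedef ('a::finite) index = "{..<CARD('a)}" by (rule exI[of _ 0]) simp

instantiation index :: (finite) wellorder
begin
definition "x <= y \<longleftrightarrow> Rep_index x <= Rep_index y"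
definition "x < y \<longleftrightarrow> Rep_index x < Rep_index y"
instance
proof
 fix P :: "'a index => bool" and x
 assume step: "!!x. (!!y. y < x ==> P y) ==> P x"
 show "P x" by (induction x rule: measure_induct_rule[where f = Rep_index]) (metis step less_index_def)
qed (auto simp: less_eq_index_def less_index_def Rep_index_inject)
end

instance index :: (finite) finite
 by standard (simp add: type_definition.univ[OF type_definition_index])

lemma exists_index_bij: obtains e :: "'a::finite => 'a index" where "bij e"
 using finite_same_card_bij[of "UNIV :: 'a set" "UNIV :: 'a index set"] type_definition.card[OF type_definition_index[where 'a = 'a]]
 by auto

lemma nn_integral_change_of_variables:
 fixes T :: "real^'n::finite => real^'n" and f :: "real^'n => real"
 assumes S: "S : sets borel" and T': "!!x. x : S ==> (T has_derivative T' x) (at x)" and inj: "inj_on T S"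
  and nn: "!!y. y : T ` S ==> 0 <= f y"
  and m: "(%y. ind (T ` S) y * f y) : bmb"
   "(%x. ind S x * (abs (det (matrix (T' x))) * f (T x))) : bmb"
 shows "(NN y. enn (ind (T ` S) y * f y)) = (NN x. enn (ind S x * (abs (det (matrix (T' x))) * f (T x))))"
proof -
 obtain e :: "'n => 'n index" where e: "bij e" by (rule exists_index_bij)
 \<comment> \<open>\<open>P\<close> and \<open>R\<close> relabel coordinates along \<open>e\<close>.
   They preserve Lebesgue measure by \<open>lborel_distr_reindex\<close>, and conjugation with them
   preserves the Jacobian determinant by \<open>det_reindex\<close>.\<close>
 define P :: "real^'n => real^'n index" where "P = (%x. \<chi> k. x $ inv e k)"
 define R :: "real^'n index => real^'n" where "R = (%y. \<chi> i. y $ e i)"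
 have e_inv: "e (inv e x) = x" "inv e (e y) = y" for x y using e by (auto simp: bij_def surj_f_inv_f)
 have PR: "P (R y) = y" "R (P x) = x" for x y by (simp_all add: P_def R_def vec_eq_iff e_inv)
 have lin: "bounded_linear P" "bounded_linear R"
  unfolding P_def R_def by (auto intro!: linear_conv_bounded_linear[THEN iffD1] simp: linear_iff vec_eq_iff)
 have Rm[measurable]: "R : bmb" using lin(2) by (simp add: borel_measurable_continuous_onI linear_continuous_on)
 have tr: "(NN x. F x) = (NN y. F (R y))" if "F : bmb" for F :: "real^'n => ennreal"
  using nn_integral_distr[of R lborel borel F] that lborel_distr_reindex[OF e] by (simp add: R_def[symmetric])
 have im: "x : P ` U \<longleftrightarrow> R x : U" for x U using PR by (metis imageE imageI)
 have ind: "(ind U (R y) :: real) = ind (P ` U) y" for U y by (simp add: indicator_def im)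
 have PTR: "(P \<circ> T \<circ> R) ` (P ` S) = P ` T ` S" by (auto simp: PR image_image)
 have det: "det (matrix (P \<circ> T' x \<circ> R)) = det (matrix (T' x))" for x
 proof -
  have Rax: "R (axis k 1) = axis (inv e k) 1" for k
  proof -
   have "(e i = k) = (i = inv e k)" for i using e_inv by metis
   thus ?thesis by (simp add: R_def axis_def vec_eq_iff)
  qed
  have "matrix (P \<circ> T' x \<circ> R) = (\<chi> i j. matrix (T' x) $ inv e i $ inv e j)"
   by (simp add: matrix_def Rax P_def)
  thus ?thesis using det_reindex[OF bij_imp_bij_inv[OF e], of "matrix (T' x)"] by simp
 qed
 have "(NN y. enn (ind (T ` S) y * f y)) = (NN y. enn (ind (T ` S) (R y) * f (R y)))"
  by (rule tr) (use m(1) in simp)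
 also have "... = (NN y. enn (ind ((P \<circ> T \<circ> R) ` P ` S) y * (f \<circ> R) y))"
  unfolding PTR ind by simp
 also have "... = (NN x. enn (ind (P ` S) x * (abs (det (matrix (P \<circ> T' (R x) \<circ> R))) * (f \<circ> R) ((P \<circ> T \<circ> R) x))))"
 proof (rule nn_integral_change_of_variables_wellorder)
  have "P ` S = R -` S \<inter> space borel" using im by auto
  thus "P ` S : sets borel" using measurable_sets[OF Rm S] by simp
  show "(P \<circ> T \<circ> R has_derivative P \<circ> T' (R x) \<circ> R) (at x)" if "x : P ` S" for x
   using has_derivative_compose[OF has_derivative_compose[OF bounded_linear_imp_has_derivative[OF lin(2)] T'[of "R x"]] bounded_linear_imp_has_derivative[OF lin(1)]]
    that im by (auto simp: o_def)
  show "inj_on (P \<circ> T \<circ> R) (P ` S)" using inj by (auto simp: inj_on_def PR) (metis PR)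
  show "0 <= (f \<circ> R) y" if "y : (P \<circ> T \<circ> R) ` P ` S" for y using that nn by (auto simp: PR)
  show "(%y. ind ((P \<circ> T \<circ> R) ` P ` S) y * (f \<circ> R) y) : bmb"
   unfolding PTR ind[symmetric] unfolding o_def using measurable_compose[OF Rm m(1)] by simp
  show "(%x. ind (P ` S) x * (abs (det (matrix (P \<circ> T' (R x) \<circ> R))) * (f \<circ> R) ((P \<circ> T \<circ> R) x))) : bmb"
   unfolding det ind[symmetric] unfolding o_def PR using measurable_compose[OF Rm m(2)] by simp
 qed
 also have "... = (NN x. enn (ind S (R x) * (abs (det (matrix (T' (R x)))) * f (T (R x)))))"
  unfolding det ind by (simp add: PR)
 also have "... = (NN x. enn (ind S x * (abs (det (matrix (T' x))) * f (T x))))"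
  by (rule tr[symmetric]) (use m(2) in simp)
 finally show ?thesis .
qed

section \<open>Positive definite matrices\<close>

lemma invertible_pos_definite:
 fixes G :: "real^'n^'n"
 assumes "!!v. v ~= 0 ==> v \<bullet> (G *v v) > 0" shows "det G ~= 0"
proof -
 have "ALL v. G *v v = 0 --> v = 0" using assms by (metis inner_zero_right less_irrefl)
 thus ?thesis using matrix_left_invertible_ker[of G] invertible_left_inverse[of G] invertible_det_nz[of G] by blast
qed

text \<open>All matrices on the segment from the identity to \<open>G\<close> satisfy the same
  positivity, so the determinant has no zero there; it starts at 1 and cannot change sign.\<close>

lemma det_pos_definite:
 fixes G :: "real^'n^'n"
 assumes "!!v. v ~= 0 ==> v \<bullet> (G *v v) > 0" shows "det G > 0"
proof (rule ccontr)
 assume "~ det G > 0"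
 let ?M = "%t::real. (1 - t) *. mat 1 + t *. G"
 have "continuous_on {0..1} (%t. det (?M t))"
  unfolding det_def by (intro continuous_intros)
 then obtain t where t: "0 <= t" "t <= 1" "det (?M t) = 0"
  using IVT2'[of "%t. det (?M t)" 1 0 0] \<open>~ det G > 0\<close> by auto
 moreover have "v \<bullet> (?M t *v v) > 0" if v: "v ~= 0" for v
 proof -
  have "v \<bullet> (?M t *v v) = (1 - t) * (v \<bullet> v) + t * (v \<bullet> (G *v v))"
   by (simp add: matrix_vector_mult_add_rdistrib scaleR_matrix_vector_assoc[symmetric] inner_add_right)
  moreover have "... > 0"
  proof (cases "t = 0")
   case False
   hence "0 < t * (v \<bullet> (G *v v))" using t assms[OF v] by simp
   moreover have "0 <= (1 - t) * (v \<bullet> v)" using t by simp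
   ultimately show ?thesis by linarith
  qed (use v in simp)
  ultimately show ?thesis by simp
 qed
 ultimately show False using invertible_pos_definite[of "?M t"] by blast
qed

lemma matrix_inv:
 fixes G :: "real^'n^'n"
 assumes "det G ~= 0" shows "G ** matrix_inv G = mat 1" "matrix_inv G ** G = mat 1"
proof -
 have "EX B. G ** B = mat 1 & B ** G = mat 1" using assms invertible_det_nz[of G] by (simp add: invertible_def)
 from someI_ex[OF this] show "G ** matrix_inv G = mat 1" "matrix_inv G ** G = mat 1" by (simp_all add: matrix_inv_def)
qed

lemma matrix_inv_mult_eq:
 fixes G :: "real^'n^'n"
 assumes "det G ~= 0" shows "matrix_inv G *v b = w \<longleftrightarrow> G *v w = b"
 using matrix_inv[OF assms] by (metis matrix_vector_mul_assoc matrix_vector_mul_lid)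

lemma matrix_inv_cramer:
 fixes G :: "real^'n^'n"
 assumes "det G ~= 0"
 shows "matrix_inv G $ k $ l = det (\<chi> i j. if j = k then axis l 1 $ i else G $ i $ j) / det G"
proof -
 have "G *v (matrix_inv G *v axis l 1) = axis l 1" using matrix_inv_mult_eq[OF assms] by blast
 hence "(matrix_inv G *v axis l 1) $ k = det (\<chi> i j. if j = k then axis l 1 $ i else G $ i $ j) / det G"
  using cramer[OF assms, of "matrix_inv G *v axis l 1" "axis l 1"] by simp
 thus ?thesis by (simp add: matrix_vector_mult_basis column_def)
qed

lemma smooth_on_det:
 fixes G :: "real^'k => real^'n^'n"
 assumes "open S" "!!i j. smooth_on S (%x. G x $ i $ j)" shows "smooth_on S (%x. det (G x))"
 unfolding det_def by (intro smooth_on_sum smooth_on_mult smooth_on_const smooth_on_prod assms)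

text \<open>Cramer's rule writes each entry of the inverse as a quotient of determinants, whose
  denominator is positive.\<close>

lemma smooth_on_matrix_inv:
 fixes G :: "real^'k => real^'n^'n"
 assumes S: "open S" and G: "!!i j. smooth_on S (%x. G x $ i $ j)" and pos: "!!x. x : S ==> det (G x) > 0"
 shows "smooth_on S (%x. matrix_inv (G x) $ k $ l)"
proof -
 have *: "smooth_on S (%x. (\<chi> i j. if j = k then axis l 1 $ i else G x $ i $ j) $ i $ j)" for i j
  by (cases "j = k") (use G[of i j] smooth_on_const[OF S] in simp_all)
 have "smooth_on S (%x. det (\<chi> i j. if j = k then axis l 1 $ i else G x $ i $ j) / det (G x))"
  by (intro smooth_on_divide smooth_on_det S G pos *)
 thus ?thesis by (rule smooth_on_cong[OF S]) (rule matrix_inv_cramer[symmetric], use pos in force)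
qed

lemma matrix_inv_pos_definite:
 fixes G :: "real^'n^'n"
 assumes s: "transpose G = G" and p: "!!v. v ~= 0 ==> v \<bullet> (G *v v) > 0"
 shows "matrix_inv G $ i $ j = matrix_inv G $ j $ i"
  and "v ~= 0 ==> v \<bullet> (matrix_inv G *v v) > 0"
proof -
 note d = invertible_pos_definite[OF p]
 have sym: "x \<bullet> (G *v y) = (G *v x) \<bullet> y" for x y
  using dot_lmul_matrix[of x G y] s by (metis transpose_matrix_vector)
 have "(matrix_inv G *v x) \<bullet> y = x \<bullet> (matrix_inv G *v y)" for x y
  using sym[of "matrix_inv G *v x" "matrix_inv G *v y"] matrix_inv_mult_eq[OF d] by (metis)
 from this[of "axis j 1" "axis i 1"] show "matrix_inv G $ i $ j = matrix_inv G $ j $ i"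
  by (simp add: matrix_vector_mult_basis column_def inner_axis inner_axis')
 assume v: "v ~= 0"
 let ?w = "matrix_inv G *v v"
 have w: "G *v ?w = v" using matrix_inv_mult_eq[OF d] by blast
 hence "?w ~= 0" using v by (metis matrix_vector_mult_0_right)
 from p[OF this] show "v \<bullet> (matrix_inv G *v v) > 0" by (simp add: w inner_commute)
qed

section \<open>Charts, smooth functions and test functions\<close>

locale density_manifold =
 fixes A :: "('m::{t2_space, second_countable_topology}, 'n::finite) chart set"
  and g :: "('m, 'n) metric_tensor" and \<phi> :: "'m => real"
 assumes manifold: "manifold_with_density A g \<phi>"
begin

abbreviation im :: "('m, 'n) chart => (real^'n) set" where "im c == snd c ` fst c"
abbreviation loc :: "('m, 'n) chart => ('m => real) => real^'n => real" where "loc c u == (%x. u (chart_inv c x))"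

lemma atlas: "smooth_atlas A" and conn: "connected (UNIV :: 'm set)" and metric: "riemannian_metric A g"
 and smooth_density: "smooth_fun A \<phi>"
 using manifold by (auto simp: manifold_with_density_def riemannian_manifold_def)

lemma chart_cover: "EX c:A. p : fst c"
proof -
 have "p : (UN c:A. fst c)" using atlas by (simp add: smooth_atlas_def)
 thus ?thesis by auto
qed

lemma chart_at: "chart_at A p : A" "p : fst (chart_at A p)"
proof -
 have "EX c. c : A & p : fst c" using chart_cover by blast
 from someI_ex[OF this] show "chart_at A p : A" "p : fst (chart_at A p)" by (simp_all add: chart_at_def)
qed

lemma
 assumes c: "c : A"
 shows open_dom: "open (fst c)" and open_im: "open (im c)"
  and chart_continuous: "continuous_on (fst c) (snd c)"
  and chart_inv_continuous: "continuous_on (im c) (chart_inv c)"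
  and chart_inv_chart: "!!p. p : fst c ==> chart_inv c (snd c p) = p"
proof -
 have "is_chart c" using c atlas by (auto simp: smooth_atlas_def)
 then obtain h where *: "open (fst c)" "open (im c)" "homeomorphism (fst c) (im c) (snd c) h" by (auto simp: is_chart_def)
 thus "open (fst c)" "open (im c)" "continuous_on (fst c) (snd c)" by (auto simp: homeomorphism_def)
 have inj: "inj_on (snd c) (fst c)" using *(3) by (auto simp: homeomorphism_def intro: inj_on_inverseI)
 show "chart_inv c (snd c p) = p" if "p : fst c" for p using inj that by (simp add: chart_inv_def)
 hence "chart_inv c x = h x" if "x : im c" for x using that *(3) by (auto simp: homeomorphism_def)
 thus "continuous_on (im c) (chart_inv c)" using *(3) by (simp add: homeomorphism_def cong: continuous_on_cong)
qed

lemma chart_inv_in: "x : im c ==> chart_inv c x : fst c"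
 unfolding chart_inv_def by (rule inv_into_into)
lemma chart_chart_inv: "x : im c ==> snd c (chart_inv c x) = x"
 unfolding chart_inv_def by (rule f_inv_into_f)

lemma open_chart_vimage: "c : A ==> open W ==> open {p : fst c. snd c p : W}"
 using continuous_open_preimage[OF chart_continuous open_dom, of c W] by (simp add: vimage_def Int_def)

lemma open_chart_image: assumes c: "c : A" and V: "open V" shows "open {x : im c. chart_inv c x : V}"
 using continuous_open_preimage[OF chart_inv_continuous open_im, OF c c V] by (simp add: vimage_def Int_def)

lemma overlap_eq: assumes c: "c : A" shows "overlap c d = {x : im c. chart_inv c x : fst d}"
proof -
 have "x : overlap c d \<longleftrightarrow> x : im c & chart_inv c x : fst d" for x
  unfolding overlap_def using chart_inv_chart[OF c] by (auto simp: image_iff)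
 thus ?thesis by blast
qed

lemma smooth_loc: "smooth_fun A u ==> c : A ==> smooth_on (im c) (loc c u)"
 by (simp add: smooth_fun_def o_def)

lemma smooth_loc_differentiable: "smooth_fun A u ==> c : A ==> x : im c ==> loc c u differentiable (at x)"
 using smooth_on_differentiable[OF open_im smooth_loc] by blast

lemma smooth_transition: "c : A ==> d : A ==> smooth_on (overlap c d) (transition c d)"
 using atlas by (auto simp: smooth_atlas_def)

lemma open_overlap: "c : A ==> d : A ==> open (overlap c d)"
 by (simp add: overlap_eq open_chart_image open_dom)

text \<open>\<open>smooth_fun\<close> asks for smoothness in all charts; composing with a smooth
  transition map transfers it from one chart around each point to every other.\<close>

lemma smooth_fun_localI:
 assumes "!!p. EX c:A. EX W. open W & p : fst c & snd c p : W & W <= im c & smooth_on W (loc c u)"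
 shows "smooth_fun A u"
 unfolding smooth_fun_def o_def
proof
 fix d assume d: "d : A"
 show "smooth_on (im d) (loc d u)"
 proof (rule smooth_on_local[OF open_im[OF d]])
  fix x assume x: "x : im d"
  obtain c W where c: "c : A" "open W" "chart_inv d x : fst c" "snd c (chart_inv d x) : W" "W <= im c" "smooth_on W (loc c u)"
   using assms[of "chart_inv d x"] by blast
  let ?V = "overlap d c \<inter> transition d c -` W"
  have V: "open ?V"
   by (rule continuous_open_preimage[OF smooth_on_continuous[OF smooth_transition] open_overlap]) (use c d in auto)
  have "smooth_on ?V (%y. loc c u (transition d c y))"
   by (rule smooth_on_compose[OF V c(2,6)]) (auto intro: smooth_on_subset[OF smooth_transition[OF d c(1)]])
  hence "smooth_on ?V (loc d u)"
   by (rule smooth_on_cong[OF V]) (use chart_inv_chart[OF c(1)] in "auto simp: transition_def overlap_eq[OF d]")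
  moreover have "x : ?V" using x c by (simp add: overlap_eq[OF d] transition_def)
  ultimately show "EX T. open T & x : T & smooth_on T (loc d u)" using V by blast
 qed
qed

lemma smooth_fun_continuous: assumes u: "smooth_fun A u" shows "continuous_on UNIV u"
proof -
 have "continuous_on (UN c:A. fst c) u"
 proof (rule continuous_on_open_UN)
  fix c assume c: "c : A"
  have "continuous_on (fst c) (%p. loc c u (snd c p))"
   by (rule continuous_on_compose2[OF smooth_on_continuous[OF smooth_loc[OF u c]] chart_continuous[OF c]]) auto
  thus "continuous_on (fst c) u" using chart_inv_chart[OF c] by (simp cong: continuous_on_cong)
 qed (simp add: open_dom)
 thus ?thesis using atlas by (simp add: smooth_atlas_def)
qed

lemma smooth_fun_const: "smooth_fun A (%p. k)"
 by (simp add: smooth_fun_def o_def smooth_on_const open_im)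
lemma smooth_fun_add: "smooth_fun A u ==> smooth_fun A v ==> smooth_fun A (%p. u p + v p)"
 by (simp add: smooth_fun_def o_def smooth_on_add open_im)
lemma smooth_fun_diff: "smooth_fun A u ==> smooth_fun A v ==> smooth_fun A (%p. u p - v p)"
 by (simp add: smooth_fun_def o_def smooth_on_diff open_im)
lemma smooth_fun_mult: "smooth_fun A u ==> smooth_fun A v ==> smooth_fun A (%p. u p * v p)"
 by (simp add: smooth_fun_def o_def smooth_on_mult open_im)
lemma smooth_fun_compose: "smooth_fun A u ==> smooth_on UNIV th ==> smooth_fun A (%p. th (u p :: real) :: real)"
 unfolding smooth_fun_def o_def using smooth_on_compose[OF open_im open_UNIV, of _ th] by auto

definition csupp :: "(real^'n) set => (real^'n => real) => bool" where
 "csupp S pp \<longleftrightarrow> smooth_on UNIV pp & (EX K. compact K & K <= S & (ALL x. x ~: K --> pp x = 0))"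

text \<open>Variations are made within these functions; they belong to \<open>C0_infty\<close>, as
  shown in \<open>stable_form_nonneg\<close>.\<close>

definition test :: "('m => real) => bool" where
 "test f \<longleftrightarrow> smooth_fun A f & (EX K. compact K & (ALL p. p ~: K --> f p = 0))"

definition lift :: "('m, 'n) chart => (real^'n => real) => 'm => real" where
 "lift c pp p = (if p : fst c then pp (snd c p) else 0)"

lemma csupp_tfun: "csupp S pp ==> tfun pp"
 unfolding csupp_def tfun_def by (metis compact_imp_bounded bounded_iff not_le)

lemma csupp_outside: "csupp S pp ==> x ~: S ==> pp x = 0"
 unfolding csupp_def by blast

lemma csupp_mono: "csupp S pp ==> S <= T ==> csupp T pp"
 unfolding csupp_def by blast

lemma test_smooth: "test f ==> smooth_fun A f" by (simp add: test_def)

lemma test_mult: "test f ==> smooth_fun A u ==> test (%p. f p * u p)"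
 unfolding test_def by (auto intro: smooth_fun_mult)

lemma test_cmult: "test f ==> test (%p. k * f p)"
 using test_mult[OF _ smooth_fun_const, of f k] by (simp add: mult.commute)

lemma test_add: "test f ==> test h ==> test (%p. f p + h p)"
proof -
 assume "test f" "test h"
 then obtain K L where "smooth_fun A f" "smooth_fun A h" "compact K" "compact L" "!!p. p ~: K ==> f p = 0" "!!p. p ~: L ==> h p = 0"
  unfolding test_def by blast
 thus ?thesis unfolding test_def by (intro conjI smooth_fun_add exI[of _ "K \<union> L"] compact_Un) auto
qed

lemma test_diff: "test f ==> test h ==> test (%p. f p - h p)"
 using test_add[of f "%p. - 1 * h p"] test_cmult[of h "- 1"] by simp

lemma test_zero: "test (%p. 0)"
 unfolding test_def using smooth_fun_const compact_empty by blast

lemma test_compose: "test f ==> smooth_on UNIV th ==> th 0 = 0 ==> test (%p. th (f p))"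
 unfolding test_def using smooth_fun_compose by auto

lemma loc_lift: "c : A ==> x : im c ==> loc c (lift c pp) x = pp x"
 by (simp add: lift_def chart_inv_in chart_chart_inv)

lemma lift_support:
 assumes c: "c : A" and K: "compact K" "K <= im c" "!!x. x ~: K ==> pp x = 0"
 shows "compact (chart_inv c ` K)" "chart_inv c ` K <= fst c" "p ~: chart_inv c ` K ==> lift c pp p = 0"
proof -
 show "compact (chart_inv c ` K)" using K(1,2) chart_inv_continuous[OF c] by (meson compact_continuous_image continuous_on_subset)
 show "chart_inv c ` K <= fst c" using K(2) chart_inv_in by blast
 assume "p ~: chart_inv c ` K"
 hence "snd c p ~: K" if "p : fst c" using chart_inv_chart[OF c that] by (metis imageI)
 thus "lift c pp p = 0" using K(3) by (simp add: lift_def)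
qed

lemma smooth_lift:
 assumes c: "c : A" and s: "smooth_on (im c) pp" and K: "compact K" "K <= im c" "!!x. x ~: K ==> pp x = 0"
 shows "test (lift c pp)"
proof -
 have L: "compact (chart_inv c ` K)" "chart_inv c ` K <= fst c" "p ~: chart_inv c ` K ==> lift c pp p = 0" for p
  using lift_support[where pp = pp, OF c K(1,2)] K(3) by auto
 have "smooth_fun A (lift c pp)"
 proof (rule smooth_fun_localI)
  fix p
  show "EX d:A. EX W. open W & p : fst d & snd d p : W & W <= im d & smooth_on W (loc d (lift c pp))"
  proof (cases "p : fst c")
   case True
   have "smooth_on (im c) (loc c (lift c pp))" by (rule smooth_on_cong[OF open_im[OF c] s]) (simp add: loc_lift[OF c])
   thus ?thesis using c True open_im[OF c] by blast
  next
   case False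
   obtain d where d: "d : A" "p : fst d" using chart_cover by blast
   let ?W = "{x : im d. chart_inv d x : - chart_inv c ` K}"
   have W: "open ?W" by (rule open_chart_image[OF d(1)]) (use L(1) in "simp add: compact_imp_closed open_Compl")
   have "smooth_on ?W (loc d (lift c pp))"
    by (rule smooth_on_cong[OF W smooth_on_const[OF W, of 0]]) (use L(3) in auto)
   moreover have "snd d p : ?W" using d False L(2) chart_inv_chart[OF d] by (auto simp del: image_iff)
   ultimately show ?thesis using d W by blast
  qed
 qed
 thus ?thesis unfolding test_def using L by blast
qed

lemma test_lift: "c : A ==> csupp (im c) pp ==> test (lift c pp)"
 unfolding csupp_def using smooth_lift[of c pp] smooth_on_subset[of UNIV pp "im c"] by blast

text \<open>A converse of \<open>test_lift\<close>. It allows a function lifted from one chart to be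
  read in another that contains its support, as in \<open>ediv_chart_independent\<close>.\<close>

lemma test_eq_lift:
 assumes c: "c : A" and f: "smooth_fun A f" and K: "compact K" "K <= fst c" "!!p. p ~: K ==> f p = 0"
 obtains pp where "csupp (im c) pp" "f = lift c pp"
proof
 let ?pp = "%x. if x : im c then loc c f x else 0"
 have K': "compact (snd c ` K)" using K chart_continuous[OF c] by (meson compact_continuous_image continuous_on_subset)
 have 0: "?pp x = 0" if "x ~: snd c ` K" for x
 proof (cases "x : im c")
  case True
  hence "chart_inv c x ~: K" using that chart_chart_inv[OF True] by (metis imageI)
  thus ?thesis using K(3) by simp
 qed simp
 have "smooth_on UNIV ?pp"
  by (rule smooth_extend[OF open_im[OF c] compact_imp_closed[OF K'] _ _ 0])
   (use K(2) in "auto intro: smooth_on_cong[OF open_im[OF c] smooth_loc[OF f c]]")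
 thus "csupp (im c) ?pp" unfolding csupp_def using K' K(2) 0 by blast
 show "f = lift c ?pp"
  using K chart_inv_chart[OF c] by (auto simp: lift_def fun_eq_iff)
qed

section \<open>The metric and the drift Laplacian in charts\<close>

lemma
 assumes c: "c : A"
 shows smooth_metric: "smooth_on (im c) (%x. g c x $ i $ j)"
  and metric_transpose: "x : im c ==> transpose (g c x) = g c x"
  and metric_pos: "x : im c ==> v ~= 0 ==> v \<bullet> (g c x *v v) > 0"
 using metric c by (auto simp: riemannian_metric_def)

lemma metric_transform: "c : A ==> d : A ==> x : overlap c d ==>
  g c x = transpose (jacobian c d x) ** g d (transition c d x) ** jacobian c d x"
 using metric by (simp add: riemannian_metric_def)

lemma metric_det_pos: "c : A ==> x : im c ==> det (g c x) > 0"
 by (rule det_pos_definite[OF metric_pos])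

definition ginv :: "('m, 'n) chart => 'n => 'n => real^'n => real" where
 "ginv c i j x = matrix_inv (g c x) $ i $ j"

text \<open>The density of the weighted measure with respect to Lebesgue measure in the chart, as
  proved in \<open>nu_chart\<close>.\<close>

definition vol :: "('m, 'n) chart => real^'n => real" where
 "vol c x = sqrt (det (g c x)) * exp (\<phi> (chart_inv c x))"

lemma smooth_sqrt_det: "c : A ==> smooth_on (im c) (%x. sqrt (det (g c x)))"
 by (intro smooth_on_sqrt smooth_on_det open_im smooth_metric metric_det_pos)

lemma smooth_ginv: "c : A ==> smooth_on (im c) (ginv c i j)"
 unfolding ginv_def by (intro smooth_on_matrix_inv open_im smooth_metric metric_det_pos)

lemma smooth_vol: "c : A ==> smooth_on (im c) (vol c)"
 unfolding vol_def by (intro smooth_on_mult smooth_sqrt_det smooth_on_exp_compose open_im smooth_loc smooth_density)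

lemma vol_pos: "c : A ==> x : im c ==> vol c x > 0"
 using metric_det_pos by (simp add: vol_def)

lemma ginv_sym: "c : A ==> x : im c ==> ginv c i j x = ginv c j i x"
 unfolding ginv_def by (rule matrix_inv_pos_definite(1)) (auto simp: metric_transpose metric_pos)

lemma ginv_pos: assumes "c : A" "x : im c" "p ~= 0"
 shows "0 < (SU i. SU j. ginv c i j x * p $ i * p $ j)"
proof -
 have "0 < p \<bullet> (matrix_inv (g c x) *v p)"
  by (rule matrix_inv_pos_definite(2)) (use assms in "auto simp: metric_transpose metric_pos")
 also have "... = (SU i. SU j. ginv c i j x * p $ i * p $ j)"
  by (simp add: inner_vec_def matrix_vector_mult_def ginv_def sum_distrib_left mult_ac)
 finally show ?thesis .
qed

definition dloc :: "('m, 'n) chart => ('m => real) => real^'n => real^'n" where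
 "dloc c u x = (\<chi> j. pt j (loc c u) x)"

lemma dloc_nth [simp]: "dloc c u x $ j = pt j (loc c u) x" by (simp add: dloc_def)

lemma grad_in_eq: "grad_in g c u x = matrix_inv (g c x) *v dloc c u x"
 by (simp add: grad_in_def o_def dloc_def)

lemma metric_grad: "c : A ==> x : im c ==> g c x *v grad_in g c u x = dloc c u x"
 unfolding grad_in_eq by (rule matrix_inv_mult_eq[THEN iffD1, OF _ refl]) (use metric_det_pos[of c x] in simp)

lemma dloc_transition:
 assumes c: "c : A" and d: "d : A" and u: "smooth_fun A u" and x: "x : overlap c d"
 shows "dloc c u x = transpose (jacobian c d x) *v dloc d u (transition c d x)"
proof -
 let ?T = "transition c d" and ?T' = "frechet_derivative (transition c d) (at x)"
 note x' = x[unfolded overlap_eq[OF c]]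
 have T': "(?T has_derivative ?T') (at x)"
  using smooth_on_differentiable[OF open_overlap[OF c d] smooth_transition[OF c d] x] frechet_derivative_works by blast
 have "((%y. loc d u (?T y)) has_derivative (%h. SU k. ?T' h $ k * pt k (loc d u) (?T x))) (at x)"
  by (rule has_derivative_compose[OF T' partial_has_derivative[OF smooth_loc_differentiable[OF u d]]])
   (use x' in "auto simp: transition_def")
 hence D: "(loc c u has_derivative (%h. SU k. ?T' h $ k * pt k (loc d u) (?T x))) (at x)"
  by (rule has_derivative_transform_within_open[OF _ open_overlap[OF c d] x])
   (simp add: transition_def overlap_eq[OF c] chart_inv_chart[OF d])
 show ?thesis
  by (simp add: vec_eq_iff partial_eqI[OF D] jacobian_def transpose_def matrix_vector_mult_def matrix_def)
qed

text \<open>The differential transforms by the transposed Jacobian and the metric by congruence, so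
  gradients transform by the Jacobian (\<open>Ju\<close>), and the pairing of a gradient with a
  differential is the same in all charts. This frees \<open>grad_inner\<close> from the chart chosen
  in its definition.\<close>

lemma grad_inner_eq:
 assumes c: "c : A" "p : fst c" and u: "smooth_fun A u" and v: "smooth_fun A v"
 shows "grad_inner A g u v p =
  (SU i. SU j. ginv c i j (snd c p) * pt i (loc c u) (snd c p) * pt j (loc c v) (snd c p))"
proof -
 define d where "d = chart_at A p"
 have d: "d : A" "p : fst d" by (auto simp: d_def chart_at)
 define x where "x = snd c p" define y where "y = snd d p"
 have x: "x : im c" "x : overlap c d" "transition c d x = y" "y : im d"
  using c d chart_inv_chart by (auto simp: x_def y_def overlap_eq transition_def)
 let ?J = "jacobian c d x"
 have t: "(transpose ?J *v a) \<bullet> b = a \<bullet> (?J *v b)" for a b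
  using dot_lmul_matrix[of a ?J b] by (simp add: transpose_matrix_vector)
 note m = metric_transform[OF c(1) d(1) x(2), unfolded x(3)]
 have J: "v = 0" if "transpose ?J *v v = 0" for v
 proof -
  have "det (g c x) = det ?J * det (g d y) * det ?J" unfolding m by (simp add: det_mul)
  hence "det (transpose ?J) ~= 0" using metric_det_pos[OF c(1) x(1)] by auto
  thus ?thesis using that matrix_inv_mult_eq[of "transpose ?J" 0 v] matrix_vector_mult_0_right by metis
 qed
 have "transpose ?J *v (g d y *v (?J *v grad_in g c u x)) = transpose ?J *v dloc d u y"
  using metric_grad[OF c(1) x(1), of u] dloc_transition[OF c(1) d(1) u x(2)]
  unfolding m x(3) by (simp add: matrix_vector_mul_assoc matrix_mul_assoc)
 hence "g d y *v (?J *v grad_in g c u x) = dloc d u y"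
  using J[of "g d y *v (?J *v grad_in g c u x) - dloc d u y"] by (simp add: matrix_vector_mult_diff_distrib)
 hence Ju: "grad_in g d u y = ?J *v grad_in g c u x"
  unfolding grad_in_eq[of d] using matrix_inv_mult_eq metric_det_pos[OF d(1) x(4)] by (metis less_irrefl)
 have "grad_inner A g u v p = grad_in g d u y \<bullet> dloc d v y"
  unfolding grad_inner_def Let_def d_def[symmetric] y_def[symmetric] by (simp add: metric_grad[OF d(1) x(4)])
 also have "... = grad_in g c u x \<bullet> dloc c v x"
  unfolding Ju dloc_transition[OF c(1) d(1) v x(2)] x(3) by (metis t inner_commute)
 also have "... = (SU i. SU j. ginv c i j x * pt j (loc c u) x * pt i (loc c v) x)"
  by (simp add: grad_in_eq inner_vec_def matrix_vector_mult_def ginv_def sum_distrib_right)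
 also have "... = (SU i. SU j. ginv c i j x * pt i (loc c u) x * pt j (loc c v) x)"
  by (subst sum.swap) (simp add: ginv_sym[OF c(1) x(1)] cong: sum.cong)
 finally show ?thesis by (simp add: x_def)
qed

definition acoef :: "('m, 'n) chart => 'n => 'n => real^'n => real" where
 "acoef c i j x = vol c x * ginv c i j x"

text \<open>\<open>vol c\<close> times the drift Laplacian in coordinates. Multiplication by the
  density produces divergence form with the symmetric matrix \<open>acoef\<close>, the shape needed
  for integration by parts and for \<open>weyl_local\<close>.\<close>

definition ediv :: "('m, 'n) chart => (real^'n => real) => real^'n => real" where
 "ediv c w x = (SU i. pt i (%y. SU j. acoef c i j y * pt j w y) x)"

definition wlap :: "('m => real) => 'm => real" where
 "wlap u p = laplacian A g u p + grad_inner A g \<phi> u p"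

lemma smooth_acoef: "c : A ==> smooth_on (im c) (acoef c i j)"
 unfolding acoef_def by (intro smooth_on_mult smooth_vol smooth_ginv open_im)

lemma smooth_ediv: "c : A ==> open S ==> S <= im c ==> smooth_on S w ==> smooth_on S (ediv c w)"
 unfolding ediv_def by (intro smooth_on_sum smooth_on_partial smooth_on_mult smooth_on_subset[OF smooth_acoef])

text \<open>By the product rule, the factor \<open>exp \<phi>\<close> inside \<open>vol\<close>
  produces exactly the drift term. Only the chart in which \<open>laplacian\<close> is defined can
  be treated at this stage; the other charts follow from
  \<open>ediv_chart_independent\<close>.\<close>

lemma wlap_chart_at:
 assumes u: "smooth_fun A u" and c: "c = chart_at A p"
 shows "wlap u p = ediv c (loc c u) (snd c p) / vol c (snd c p)"
proof -
 have cA: "c : A" "p : fst c" using c chart_at by auto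
 define x where "x = snd c p"
 have x: "x : im c" using cA by (simp add: x_def)
 let ?X = "%i y. SU j. ginv c i j y * pt j (loc c u) y" and ?s = "%y. sqrt (det (g c y))" and ?e = "%y. exp (loc c \<phi> y)"
 note o = open_im[OF cA(1)]
 have X: "smooth_on (im c) (?X i)" for i
  by (intro smooth_on_sum smooth_on_mult smooth_ginv cA o smooth_on_partial smooth_loc u)
 have grad: "grad_in g c u y $ i = ?X i y" for i y by (simp add: grad_in_eq matrix_vector_mult_def ginv_def)
 have e: "smooth_on (im c) ?e" by (intro smooth_on_exp_compose o smooth_loc smooth_density cA)
 have sX: "smooth_on (im c) (%y. ?s y * ?X i y)" for i by (intro smooth_on_mult o smooth_sqrt_det cA X)
 have pe: "pt i ?e x = ?e x * pt i (loc c \<phi>) x" for i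
  by (rule partial_compose_real[OF smooth_loc_differentiable[OF smooth_density cA(1) x] DERIV_exp])
 have sv: "(%y. SU j. acoef c i j y * pt j (loc c u) y) = (%y. ?e y * (?s y * ?X i y))" for i
  by (simp add: acoef_def vol_def sum_distrib_left mult_ac)
 have "pt i (%y. ?e y * (?s y * ?X i y)) x =
   ?e x * pt i (%y. ?s y * ?X i y) x + ?e x * pt i (loc c \<phi>) x * (?s x * ?X i x)" for i
  by (subst partial_mult) (use smooth_on_differentiable[OF o _ x] e sX pe in auto)
 hence "ediv c (loc c u) x = (SU i. ?e x * pt i (%y. ?s y * ?X i y) x + ?e x * pt i (loc c \<phi>) x * (?s x * ?X i x))"
  unfolding ediv_def sv by simp
 also have "... = ?e x * (SU i. pt i (%y. ?s y * ?X i y) x) + ?e x * ?s x * (SU i. pt i (loc c \<phi>) x * ?X i x)"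
  by (simp only: sum.distrib) (simp add: sum_distrib_left mult_ac)
 finally have E: "ediv c (loc c u) x = ..." .
 have G: "grad_inner A g \<phi> u p = (SU i. pt i (loc c \<phi>) x * ?X i x)"
  unfolding grad_inner_eq[OF cA smooth_density u] x_def[symmetric] by (simp add: sum_distrib_left mult_ac)
 have L: "laplacian A g u p = (SU i. pt i (%y. ?s y * ?X i y) x) / ?s x"
  unfolding laplacian_def Let_def c[symmetric] div_in_def grad x_def ..
 have pos: "?s x > 0" "?e x > 0" using metric_det_pos[OF cA(1) x] by auto
 show ?thesis unfolding wlap_def L G x_def[symmetric] E using pos by (simp add: vol_def field_simps)
qed

section \<open>The Riemannian volume and the weighted measure\<close>

lemma chart_inv_measurable: assumes c: "c : A" shows "chart_inv c : bmb"
proof (rule borel_measurableI)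
 fix V :: "'m set" assume V: "open V"
 \<comment> \<open>Off the image \<open>inv_into\<close> returns one fixed point, so a preimage
   contains the complement of the image either entirely or not at all.\<close>
 have out: "chart_inv c x = (SOME y. False)" if "x ~: im c" for x
 proof -
  have "(%y. y : fst c & snd c y = x) = (%y. False)" using that by auto
  thus ?thesis by (simp add: chart_inv_def inv_into_def)
 qed
 have "chart_inv c -` V \<inter> space borel = {x : im c. chart_inv c x : V} \<union> (if (SOME y. False) : V then - im c else {})"
 proof (rule set_eqI)
  fix x show "x : chart_inv c -` V \<inter> space borel \<longleftrightarrow>
   x : {x : im c. chart_inv c x : V} \<union> (if (SOME y. False) : V then - im c else {})"
   by (cases "x : im c") (simp_all add: out)
 qed
 moreover have "{x : im c. chart_inv c x : V} : sets borel" "- im c : sets borel"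
  using open_chart_image[OF c V] open_im[OF c] by auto
 ultimately show "chart_inv c -` V \<inter> space borel : sets borel" by auto
qed

definition cmeas :: "('m, 'n) chart => (real^'n => real) => 'm measure" where
 "cmeas c w = distr (density lborel (%x. enn (ind (im c) x * w x))) borel (chart_inv c)"

lemma im_measurable:
 "c : A ==> continuous_on (im c) w ==> (%x. ind (im c) x * w x :: real) : bmb"
 using borel_measurable_continuous_on_indicator[of "im c" w] open_im[of c] by simp

lemma emeasure_cmeas:
 assumes c: "c : A" and w: "continuous_on (im c) w" and B: "B : sets borel"
 shows "emeasure (cmeas c w) B = (NN x. enn (ind (im c) x * w x) * ind B (chart_inv c x))"
proof -
 note [measurable] = chart_inv_measurable[OF c] im_measurable[OF c w] B
 have s: "chart_inv c -` B : sets borel" using measurable_sets[OF chart_inv_measurable[OF c] B] by simp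
 have "emeasure (cmeas c w) B = emeasure (density lborel (%x. enn (ind (im c) x * w x))) (chart_inv c -` B)"
  unfolding cmeas_def by (simp add: emeasure_distr)
 also have "... = (NN x. enn (ind (im c) x * w x) * ind (chart_inv c -` B) x)"
  by (rule emeasure_density) (use s in simp_all)
 also have "... = (NN x. enn (ind (im c) x * w x) * ind B (chart_inv c x))"
  by (rule nn_integral_cong) (simp add: indicator_def)
 finally show ?thesis .
qed

lemma chart_image_measurable:
 assumes c: "c : A" and B: "B : sets borel" "B <= fst c"
 shows "snd c ` B = im c \<inter> chart_inv c -` B" "snd c ` B : sets borel"
proof -
 have "x : snd c ` B \<longleftrightarrow> x : im c & chart_inv c x : B" for x
 proof
  assume "x : snd c ` B"
  then obtain p where "p : B" "x = snd c p" by blast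
  thus "x : im c & chart_inv c x : B" using B(2) chart_inv_chart[OF c, of p] by auto
 next
  assume x: "x : im c & chart_inv c x : B"
  hence "snd c (chart_inv c x) : snd c ` B" by blast
  thus "x : snd c ` B" using x chart_chart_inv[of x c] by simp
 qed
 thus *: "snd c ` B = im c \<inter> chart_inv c -` B" by blast
 have "chart_inv c -` B : sets borel" using measurable_sets[OF chart_inv_measurable[OF c] B(1)] by simp
 thus "snd c ` B : sets borel" unfolding * using open_im[OF c] by auto
qed

abbreviation rvol :: "('m, 'n) chart => real^'n => real" where "rvol c == (%x. sqrt (det (g c x)))"

lemma rvol_continuous: "c : A ==> continuous_on (im c) (rvol c)"
 by (rule smooth_on_continuous[OF smooth_sqrt_det])

lemma emeasure_cmeas_image:
 assumes c: "c : A" and w: "continuous_on (im c) w" and B: "B : sets borel" "B <= fst c"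
 shows "emeasure (cmeas c w) B = (NN x. enn (ind (snd c ` B) x * w x))"
 unfolding emeasure_cmeas[OF c w B(1)] chart_image_measurable(1)[OF c B]
 by (rule nn_integral_cong) (simp add: indicator_def)

text \<open>The transformation law gives \<open>det (g c x)\<close> as the squared Jacobian
  determinant times the determinant in the other chart; its square root absorbs the factor from the
  change of variables.\<close>

lemma cmeas_chart_independent:
 assumes c: "c : A" and d: "d : A" and B: "B : sets borel" "B <= fst c" "B <= fst d"
 shows "emeasure (cmeas c (rvol c)) B = emeasure (cmeas d (rvol d)) B"
proof -
 let ?S = "snd c ` B" and ?T = "transition c d"
 let ?T' = "%x. frechet_derivative ?T (at x)"
 have S: "?S <= overlap c d" using B by (auto simp: overlap_def)
 have TS: "?T ` ?S = snd d ` B"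
  unfolding transition_def o_def image_image by (rule image_cong[OF refl]) (use B(2) chart_inv_chart[OF c] in auto)
 have J: "abs (det (matrix (?T' x))) * rvol d (?T x) = rvol c x" if "x : ?S" for x
  using metric_transform[OF c d subsetD[OF S that]] by (simp add: jacobian_def det_mul real_sqrt_mult)
 have "(NN y. enn (ind (?T ` ?S) y * rvol d y))
   = (NN x. enn (ind ?S x * (abs (det (matrix (?T' x))) * rvol d (?T x))))"
 proof (rule nn_integral_change_of_variables)
  show "?S : sets borel" by (rule chart_image_measurable(2)[OF c B(1,2)])
  show "(?T has_derivative ?T' x) (at x)" if "x : ?S" for x
   using smooth_on_differentiable[OF open_overlap[OF c d] smooth_transition[OF c d] subsetD[OF S that]] frechet_derivative_works by blast
  show "inj_on ?T ?S"
   using B(2,3) chart_inv_chart[OF c] chart_inv_chart[OF d] by (intro inj_onI) (auto simp: transition_def, metis subsetD)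
  show "0 <= rvol d y" if "y : ?T ` ?S" for y
  proof -
   have "y : im d" using that B(3) unfolding TS by blast
   thus ?thesis using metric_det_pos[OF d, of y] by simp
  qed
  have m: "(%y. ind (snd e ` B) y * rvol e y) : bmb" if e: "e : A" "B <= fst e" for e
  proof -
   have "(%y. ind (snd e ` B) y * (ind (im e) y * rvol e y)) : bmb"
    by (intro borel_measurable_times borel_measurable_indicator chart_image_measurable(2)[OF e(1) B(1) e(2)] im_measurable rvol_continuous e(1))
   moreover have "ind (snd e ` B) y * (ind (im e) y * rvol e y) = ind (snd e ` B) y * rvol e y" for y
    using e(2) by (auto simp: indicator_def)
   ultimately show ?thesis by simp
  qed
  show "(%y. ind (?T ` ?S) y * rvol d y) : bmb" unfolding TS by (rule m[OF d B(3)])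
  have eq: "(%x. ind ?S x * (abs (det (matrix (?T' x))) * rvol d (?T x))) = (%x. ind ?S x * rvol c x)"
   using J by (auto simp: indicator_def fun_eq_iff)
  show "(%x. ind ?S x * (abs (det (matrix (?T' x))) * rvol d (?T x))) : bmb"
   unfolding eq by (rule m[OF c B(2)])
 qed
 also have "... = (NN x. enn (ind ?S x * rvol c x))"
  by (rule nn_integral_cong) (use J in "auto simp: indicator_def")
 finally show ?thesis
  by (simp add: TS emeasure_cmeas_image[OF c rvol_continuous[OF c] B(1,2)] emeasure_cmeas_image[OF d rvol_continuous[OF d] B(1,3)])
qed

lemma is_volume_iff:
 "is_volume A g mm \<longleftrightarrow> sets mm = sets borel &
  (ALL c:A. ALL B:sets borel. B <= fst c --> emeasure mm B = emeasure (cmeas c (rvol c)) B)"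
proof -
 have "(\<integral>\<^sup>+x\<in>snd c ` B. enn (rvol c x) \<partial>lborel) = emeasure (cmeas c (rvol c)) B"
  if "c : A" "B : sets borel" "B <= fst c" for c B
  unfolding emeasure_cmeas_image[OF that(1) rvol_continuous[OF that(1)] that(2,3)]
  by (rule nn_integral_cong) (simp add: indicator_def)
 thus ?thesis by (auto simp: is_volume_def)
qed

lemma suminf_swap_ennreal: "(\<Sum>i. \<Sum>k. F i k) = (\<Sum>k. \<Sum>i. F i k :: ennreal)" for F :: "nat => nat => ennreal"
 using nn_integral_suminf[of "%i k. F i k" "count_space UNIV"] by (simp add: nn_integral_count_space_nat)

text \<open>Second countability reduces the atlas to countably many charts, and disjoint pieces
  allow the chart measures to be added without double counting.\<close>

lemma countable_disjoint_cover:
 "EX (C :: nat => ('m, 'n) chart) D. (ALL k. C k : A & D k : sets borel & D k <= fst (C k)) & disjoint_family D & (\<Union>k. D k) = (UNIV :: 'm set)"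
proof -
 obtain F where F: "F <= fst ` A" "countable F" "\<Union>F = \<Union>(fst ` A)"
 proof (rule Lindelof[of "fst ` A"])
  show "open S" if "S : fst ` A" for S using that open_dom by auto
 qed (rule that)
 obtain A' where A': "countable A'" "A' <= A" "F = fst ` A'" using F(1,2) countable_subset_image[of F fst A] by blast
 have cover: "(UN c:A'. fst c) = UNIV" using F(3) A'(3) atlas by (simp add: smooth_atlas_def)
 hence "A' ~= {}" by auto
 define C where "C = from_nat_into A'"
 have C: "range C = A'" using A'(1) \<open>A' ~= {}\<close> by (simp add: C_def range_from_nat_into)
 have CA: "C k : A" for k using C A'(2) by auto
 have "range (disjointed (%k. fst (C k))) <= sets borel"
  by (rule sets.range_disjointed_sets) (intro image_subsetI borel_open open_dom CA)
 hence s: "disjointed (%k. fst (C k)) k : sets borel" for k by auto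
 have u: "(\<Union>k. disjointed (%k. fst (C k)) k) = UNIV" unfolding UN_disjointed_eq using cover C by (metis image_image)
 show ?thesis
  by (intro exI[of _ C] exI[of _ "disjointed (%k. fst (C k))"] conjI allI CA s u disjoint_family_disjointed disjointed_subset)
qed

text \<open>\<open>volume\<close> rests on a definite description, so nothing can be said about it
  before this. The measure is the sum of the chart measures over a countable disjoint cover;
  \<open>cmeas_chart_independent\<close> makes it right in every chart, and countable additivity
  leaves no choice.\<close>

lemma exists_unique_volume: "EX! mm. is_volume A g mm"
proof -
 obtain C :: "nat => ('m, 'n) chart" and D where CA: "!!k. C k : A" and D: "!!k. D k : sets borel" "!!k. D k <= fst (C k)" "disjoint_family D" "(\<Union>k. D k) = UNIV"
  using countable_disjoint_cover by auto
 let ?N = "%c. cmeas c (rvol c)"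
 have sN: "sets (?N c) = sets borel" for c by (simp add: cmeas_def)
 have dj: "disjoint_family (%k. B \<inter> D k)" for B using D(3) unfolding disjoint_family_on_def by blast
 define M where "M = (%B. \<Sum>k. emeasure (?N (C k)) (B \<inter> D k))"
 define mm where "mm = measure_of UNIV (sets borel) M"
 have smm: "sets mm = sets borel" using sets.sigma_sets_eq[of "borel :: 'm measure"] by (simp add: mm_def)
 have emm: "emeasure mm B = M B" if "B : sets borel" for B
 proof (rule emeasure_measure_of[OF mm_def])
  show "positive (sets mm) M" by (simp add: positive_def M_def)
  show "countably_additive (sets mm) M"
  proof (rule countably_additiveI)
   fix X :: "nat => 'm set" assume X: "range X <= sets mm" "disjoint_family X"
   have "(\<Sum>i. emeasure (?N (C k)) (X i \<inter> D k)) = emeasure (?N (C k)) ((\<Union>i. X i) \<inter> D k)" for k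
   proof -
    have "(\<Sum>i. emeasure (?N (C k)) (X i \<inter> D k)) = emeasure (?N (C k)) (\<Union>i. X i \<inter> D k)"
     by (rule suminf_emeasure) (use X D(1) smm sN in "auto simp: disjoint_family_on_def")
    thus ?thesis by simp
   qed
   thus "(\<Sum>i. M (X i)) = M (\<Union>i. X i)" unfolding M_def by (subst suminf_swap_ennreal) simp
  qed
 qed (use that smm in auto)
 have unique: "emeasure mm' B = M B" if mm': "is_volume A g mm'" and B: "B : sets borel" for mm' B
 proof -
  have s: "sets mm' = sets borel" using mm' by (simp add: is_volume_def)
  have "emeasure mm' B = emeasure mm' (\<Union>k. B \<inter> D k)" using D(4) by (simp flip: Int_UN_distrib)
  also have "... = (\<Sum>k. emeasure mm' (B \<inter> D k))"
   by (rule suminf_emeasure[symmetric, OF _ dj]) (use B D(1) s in auto)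
  also have "... = M B"
  proof -
   have "emeasure mm' (B \<inter> D k) = emeasure (?N (C k)) (B \<inter> D k)" for k
    using mm'[unfolded is_volume_iff] CA[of k] D(1,2)[of k] B by (simp add: le_infI2 sets.Int)
   thus ?thesis by (simp add: M_def)
  qed
  finally show ?thesis .
 qed
 have "is_volume A g mm"
  unfolding is_volume_iff
 proof (intro conjI ballI impI smm)
  fix c and B :: "'m set" assume c: "c : A" and B: "B : sets borel" "B <= fst c"
  have "emeasure mm B = (\<Sum>k. emeasure (?N c) (B \<inter> D k))"
   unfolding emm[OF B(1)] M_def using cmeas_chart_independent[OF CA c, of "B \<inter> D _"] B D(1,2) by (simp add: le_infI1 le_infI2)
  also have "... = emeasure (?N c) (\<Union>k. B \<inter> D k)"
   by (rule suminf_emeasure[OF _ dj]) (use B D(1) sN in auto)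
  also have "(\<Union>k. B \<inter> D k) = B" using D(4) by (simp flip: Int_UN_distrib)
  finally show "emeasure mm B = emeasure (?N c) B" .
 qed
 moreover have "mm' = mm" if "is_volume A g mm'" for mm'
  by (rule measure_eqI) (use that smm unique[OF that] emm in "auto simp: is_volume_def")
 ultimately show ?thesis by blast
qed

definition mu :: "'m measure" where "mu = (THE mm. is_volume A g mm)"
definition nu :: "'m measure" where "nu = density mu (%p. enn (exp (\<phi> p)))"

abbreviation nu_int (binder "NI " 10) where "nu_int f == integral\<^sup>L nu f"
abbreviation nu_nn_int (binder "NV " 10) where "nu_nn_int f == nn_integral nu f"

lemma mu_volume: "is_volume A g mu" unfolding mu_def by (rule theI'[OF exists_unique_volume])
lemma sets_mu [measurable_cong]: "sets mu = sets borel" using mu_volume by (simp add: is_volume_def)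
lemma sets_nu [measurable_cong]: "sets nu = sets borel" by (simp add: nu_def sets_mu)

lemma density_measurable: "\<phi> : bmb"
 by (rule borel_measurable_continuous_onI[OF smooth_fun_continuous[OF smooth_density]])

text \<open>Completion does not change the integral of a Borel function, and the factor
  \<open>exp \<phi>\<close> becomes the density of \<open>nu\<close>. Thus the integrals in
  \<open>lambda1\<close> are ordinary \<open>nu\<close> integrals.\<close>

lemma volume_integral:
 fixes F :: "'m => real"
 assumes [measurable]: "F : bmb"
 shows "(LINT p|volume A g. F p * exp (\<phi> p)) = (NI p. F p)"
proof -
 note [measurable] = density_measurable
 have "(LINT p|volume A g. F p * exp (\<phi> p)) = (\<integral>p. F p * exp (\<phi> p) \<partial>mu)"
  unfolding volume_def mu_def[symmetric] by (rule integral_completion) simp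
 also have "... = (NI p. F p)" unfolding nu_def by (subst integral_density) (simp_all add: mult.commute)
 finally show ?thesis .
qed

lemma vol_continuous: "c : A ==> continuous_on (im c) (vol c)"
 by (rule smooth_on_continuous[OF smooth_vol])

lemma nu_chart:
 assumes c: "c : A" shows "density nu (%p. enn (ind (fst c) p)) = cmeas c (vol c)"
proof (rule measure_eqI)
 note [measurable] = density_measurable chart_inv_measurable[OF c] im_measurable[OF c rvol_continuous[OF c]] borel_open[OF open_dom[OF c]]
 have N: "density mu (%p. enn (ind (fst c) p)) = cmeas c (rvol c)"
 proof (rule measure_eqI)
  fix B assume "B : sets (density mu (%p. enn (ind (fst c) p)))"
  hence B[measurable]: "B : sets borel" by (simp add: sets_mu)
  have "emeasure (density mu (%p. enn (ind (fst c) p))) B = (\<integral>\<^sup>+p. enn (ind (fst c) p) * ind B p \<partial>mu)"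
   by (rule emeasure_density) (simp_all add: sets_mu)
  also have "... = (\<integral>\<^sup>+p. ind (B \<inter> fst c) p \<partial>mu)"
   by (rule nn_integral_cong) (auto simp: indicator_def)
  also have "... = emeasure mu (B \<inter> fst c)" by simp
  also have "... = emeasure (cmeas c (rvol c)) (B \<inter> fst c)" using mu_volume[unfolded is_volume_iff] c by simp
  also have "... = emeasure (cmeas c (rvol c)) B"
   unfolding emeasure_cmeas[OF c rvol_continuous[OF c] B] emeasure_cmeas[OF c rvol_continuous[OF c] sets.Int[OF B borel_open[OF open_dom[OF c]]]]
   by (rule nn_integral_cong) (auto simp: indicator_def chart_inv_in)
  finally show "emeasure (density mu (%p. enn (ind (fst c) p))) B = emeasure (cmeas c (rvol c)) B" .
 qed (simp add: cmeas_def sets_mu)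
 fix B assume "B : sets (density nu (%p. enn (ind (fst c) p)))"
 hence B[measurable]: "B : sets borel" by (simp add: sets_nu)
 have "emeasure (density nu (%p. enn (ind (fst c) p))) B = (NV p. enn (ind (fst c) p) * ind B p)"
  by (subst emeasure_density) auto
 also have "... = (\<integral>\<^sup>+p. enn (ind (fst c) p) * (enn (exp (\<phi> p)) * ind B p) \<partial>mu)"
  unfolding nu_def by (subst nn_integral_density) (auto simp: mult_ac)
 also have "... = (\<integral>\<^sup>+p. enn (exp (\<phi> p)) * ind B p \<partial>cmeas c (rvol c))"
  unfolding N[symmetric] by (subst nn_integral_density) auto
 also have "... = (\<integral>\<^sup>+x. enn (exp (\<phi> (chart_inv c x))) * ind B (chart_inv c x) \<partial>density lborel (%x. enn (ind (im c) x * rvol c x)))"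
  unfolding cmeas_def by (subst nn_integral_distr) auto
 also have "... = (NN x. enn (ind (im c) x * rvol c x) * (enn (exp (\<phi> (chart_inv c x))) * ind B (chart_inv c x)))"
  by (subst nn_integral_density) auto
 also have "... = emeasure (cmeas c (vol c)) B"
  unfolding emeasure_cmeas[OF c vol_continuous[OF c] B] vol_def
  by (rule nn_integral_cong) (auto simp: indicator_def ennreal_mult'')
 finally show "emeasure (density nu (%p. enn (ind (fst c) p))) B = emeasure (cmeas c (vol c)) B" .
qed (simp add: cmeas_def sets_nu)

lemma
 fixes f :: "'m => real"
 assumes c: "c : A" and f: "f : bmb" "!!p. p ~: fst c ==> f p = 0"
 shows integral_chart: "(NI p. f p) = (LI x. ind (im c) x * vol c x * loc c f x)"
  and integrable_chart: "integrable nu f \<longleftrightarrow> integrable lborel (%x. ind (im c) x * vol c x * loc c f x)"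
proof -
 note [measurable] = f(1) chart_inv_measurable[OF c] im_measurable[OF c vol_continuous[OF c]] borel_open[OF open_dom[OF c]]
 have f': "(%p. ind (fst c) p * f p) = f" using f(2) by (auto simp: indicator_def fun_eq_iff)
 have nn: "0 <= ind (im c) x * vol c x" for x using vol_pos[OF c, of x] by (cases "x : im c") (simp_all add: less_imp_le)
 have "(NI p. f p) = (\<integral>p. f p \<partial>cmeas c (vol c))"
  unfolding nu_chart[OF c, symmetric] by (subst integral_density) (simp_all add: f')
 thus "(NI p. f p) = (LI x. ind (im c) x * vol c x * loc c f x)"
  unfolding cmeas_def by (simp add: integral_distr integral_density nn)
 have "integrable nu f \<longleftrightarrow> integrable (cmeas c (vol c)) f"
  unfolding nu_chart[OF c, symmetric] by (subst integrable_density) (simp_all add: f')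
 thus "integrable nu f \<longleftrightarrow> integrable lborel (%x. ind (im c) x * vol c x * loc c f x)"
  unfolding cmeas_def by (simp add: integrable_distr_eq integrable_density nn)
qed

lemma emeasure_nu_chart:
 assumes c: "c : A" and B: "B : sets borel" "B <= fst c"
 shows "emeasure nu B = (NN x. enn (ind (snd c ` B) x * vol c x))"
proof -
 have "emeasure nu B = (NV p. enn (ind (fst c) p) * ind B p)"
 proof -
  have "(NV p. enn (ind (fst c) p) * ind B p) = (NV p. ind B p)"
   by (rule nn_integral_cong) (use B(2) in "auto simp: indicator_def")
  thus ?thesis using B(1) by (simp add: sets_nu)
 qed
 also have "... = emeasure (cmeas c (vol c)) B"
  unfolding nu_chart[OF c, symmetric] using B(1) borel_open[OF open_dom[OF c]] by (subst emeasure_density) (auto simp: sets_nu)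
 finally show ?thesis by (simp add: emeasure_cmeas_image[OF c vol_continuous[OF c] B])
qed

lemma emeasure_nu_compact: assumes K: "compact K" shows "emeasure nu K < \<infinity>"
proof -
 have loc_fin: "EX V. open V & p : V & emeasure nu V < \<infinity>" for p
 proof -
  obtain c where c: "c : A" "p : fst c" using chart_cover by blast
  obtain r where r: "0 < r" "cball (snd c p) r <= im c" using open_contains_cball[of "im c"] open_im[OF c(1)] c(2) by auto
  obtain b where b: "!!x. x : cball (snd c p) r ==> vol c x <= b"
   using compact_imp_bounded[OF compact_continuous_image[OF continuous_on_subset[OF vol_continuous[OF c(1)] r(2)] compact_cball]]
   unfolding bounded_real by (metis abs_le_iff imageI)
  let ?V = "{q : fst c. snd c q : ball (snd c p) r}"
  have V: "open ?V" by (rule open_chart_vimage[OF c(1) open_ball])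
  have "emeasure nu ?V = (NN x. enn (ind (snd c ` ?V) x * vol c x))"
   by (rule emeasure_nu_chart[OF c(1)]) (use V in auto)
  also have "... <= (NN x. enn b * ind (ball (snd c p) r) x)"
  proof (rule nn_integral_mono)
   fix x
   show "enn (ind (snd c ` ?V) x * vol c x) <= enn b * ind (ball (snd c p) r) x"
   proof (cases "x : snd c ` ?V")
    case True
    hence x: "x : ball (snd c p) r" by blast
    hence "vol c x <= b" by (intro b) simp
    thus ?thesis using True x by (simp only: indicator_simps) (simp add: ennreal_leI)
   qed simp
  qed
  also have "... = enn b * emeasure lborel (ball (snd c p) r)" by (simp add: nn_integral_cmult_indicator)
  also have "... < \<infinity>" using emeasure_lborel_ball_finite[of "snd c p" r] by (simp add: ennreal_mult_less_top)
  finally show ?thesis using V c(2) r(1) by (intro exI[of _ ?V]) auto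
 qed
 define V where "V p = (SOME V. open V & p : V & emeasure nu V < \<infinity>)" for p
 have V: "open (V p)" "p : V p" "emeasure nu (V p) < \<infinity>" for p
  using someI_ex[OF loc_fin[of p]] by (simp_all add: V_def)
 obtain T where T: "finite T" "K <= (UN p:T. V p)"
 proof (rule compactE_image[OF K, of UNIV V])
  show "K <= (UN p:UNIV. V p)" using V(2) by blast
 qed (use V(1) in auto)
 have "emeasure nu K <= emeasure nu (UN p:T. V p)" by (rule emeasure_mono[OF T(2)]) (use V T(1) in "auto simp: sets_nu")
 also have "... <= (SUM p:T. emeasure nu (V p))" by (rule emeasure_subadditive_finite[OF T(1)]) (use V in "auto simp: sets_nu")
 also have "... < \<infinity>" using T(1) V(3) by (simp add: less_top[symmetric])
 finally show ?thesis .
qed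

lemma integrable_compact_support:
 fixes f :: "'m => real"
 assumes f: "continuous_on UNIV f" and K: "compact K" "!!p. p ~: K ==> f p = 0"
 shows "integrable nu f"
proof -
 obtain b where b: "!!p. p : K ==> norm (f p) <= b"
  using compact_imp_bounded[OF compact_continuous_image[OF continuous_on_subset[OF f] K(1)]] unfolding bounded_iff by auto
 show ?thesis
 proof (rule integrableI_bounded_set[of K nu f b])
  show "K : sets nu" using K(1) by (simp add: sets_nu compact_imp_closed borel_closed)
  show "f : borel_measurable nu" using borel_measurable_continuous_onI[OF f] sets_nu by (simp cong: measurable_cong_sets)
 qed (use b K emeasure_nu_compact[OF K(1)] in auto)
qed

text \<open>The density \<open>vol c\<close> is positive and nonempty open sets have positive
  Lebesgue measure. It turns almost-everywhere statements about continuous functions into pointwise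
  ones.\<close>

lemma nu_open_null: assumes V: "open V" "emeasure nu V = 0" shows "V = {}"
proof (rule ccontr)
 assume "V ~= {}"
 then obtain p where p: "p : V" by blast
 obtain c where c: "c : A" "p : fst c" using chart_cover by blast
 let ?B = "V \<inter> fst c"
 have B: "?B : sets borel" "?B <= fst c" "open ?B" using V(1) open_dom[OF c(1)] by auto
 have "emeasure nu ?B <= 0" using emeasure_mono[of ?B V nu] V by (simp add: sets_nu)
 hence "(NN x. enn (ind (snd c ` ?B) x * vol c x)) = 0" using emeasure_nu_chart[OF c(1) B(1,2)] by simp
 moreover have im: "snd c ` ?B = {x : im c. chart_inv c x : ?B}" using chart_image_measurable(1)[OF c(1) B(1,2)] by auto
 have op: "open (snd c ` ?B)" unfolding im by (rule open_chart_image[OF c(1) B(3)])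
 have "(%x. ind (snd c ` ?B) x * vol c x) = (%x. ind (snd c ` ?B) x * (ind (im c) x * vol c x))"
  by (rule ext) (auto simp: indicator_def)
 hence "(%x. ind (snd c ` ?B) x * vol c x) : bmb"
  using borel_measurable_times[OF borel_measurable_indicator[OF borel_open[OF op]] im_measurable[OF c(1) vol_continuous[OF c(1)]]] by simp
 ultimately have "AE x in lborel. enn (ind (snd c ` ?B) x * vol c x) = 0" by (subst (asm) nn_integral_0_iff_AE) auto
 hence "AE x in lborel. x ~: snd c ` ?B"
 proof eventually_elim
  case (elim x)
  show ?case
  proof
   assume x: "x : snd c ` ?B"
   hence "x : im c" by blast
   thus False using vol_pos[OF c(1), of x] elim x by (simp only: indicator_simps) simp
  qed
 qed
 hence "snd c ` ?B : null_sets lborel" using op by (simp add: AE_iff_null_sets)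
 hence "negligible (snd c ` ?B)" using negligible_iff_null_sets null_sets_completionI by blast
 thus False using open_not_negligible[OF op] p c(2) by auto
qed

lemma integral_eq_0_continuous:
 fixes f :: "'m => real"
 assumes f: "continuous_on UNIV f" "integrable nu f" "!!p. 0 <= f p" "(NI p. f p) = 0"
 shows "f p = 0"
proof -
 have m: "f : bmb" by (rule borel_measurable_continuous_onI[OF f(1)])
 have "AE p in nu. f p = 0" using integral_nonneg_eq_0_iff_AE[OF f(2)] f(3,4) by simp
 hence "emeasure nu {p. f p ~= 0} = 0" using m by (subst (asm) AE_iff_measurable[OF _ refl]) (auto simp: sets_nu space_borel sets_eq_imp_space_eq[OF sets_nu])
 moreover have "open {p. f p ~= 0}" by (rule open_Collect_neq[OF f(1)]) simp
 ultimately show ?thesis using nu_open_null by blast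
qed

section \<open>Gradients and integration by parts on the manifold\<close>

abbreviation gi :: "('m => real) => ('m => real) => 'm => real" where "gi == grad_inner A g"

lemma loc_diff_at: "smooth_fun A u ==> loc (chart_at A p) u differentiable (at (snd (chart_at A p) p))"
 by (rule smooth_loc_differentiable) (use chart_at in auto)

lemmas gi_chart_at = grad_inner_eq[OF chart_at]

lemma gi_sym: "smooth_fun A u ==> smooth_fun A v ==> gi u v p = gi v u p"
 unfolding gi_chart_at by (subst sum.swap) (simp add: ginv_sym[OF chart_at(1) imageI[OF chart_at(2)]] mult_ac cong: sum.cong)

lemma gi_nonneg: "smooth_fun A u ==> 0 <= gi u u p"
 using ginv_pos[OF chart_at(1) imageI[OF chart_at(2)], of "dloc (chart_at A p) u (snd (chart_at A p) p)" p]
 unfolding gi_chart_at by (cases "dloc (chart_at A p) u (snd (chart_at A p) p) = 0") (auto simp: vec_eq_iff less_imp_le)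

lemma gi_add: "smooth_fun A u ==> smooth_fun A w ==> smooth_fun A v ==> gi (%p. u p + w p) v p = gi u v p + gi w v p"
 by (simp add: gi_chart_at smooth_fun_add partial_add loc_diff_at sum.distrib algebra_simps)

lemma gi_mult: "smooth_fun A u ==> smooth_fun A w ==> smooth_fun A v ==> gi (%p. u p * w p) v p = u p * gi w v p + w p * gi u v p"
 by (simp add: gi_chart_at smooth_fun_mult partial_mult loc_diff_at sum.distrib chart_inv_chart chart_at algebra_simps sum_distrib_left)

lemma gi_compose: "smooth_fun A u ==> smooth_on UNIV th ==> (th has_real_derivative d) (at (u p)) ==> smooth_fun A v ==>
  gi (%p. th (u p)) v p = d * gi u v p"
 by (simp add: gi_chart_at smooth_fun_compose partial_compose_real[OF loc_diff_at] chart_inv_chart chart_at sum_distrib_left mult_ac)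

lemma gi_const: "smooth_fun A v ==> gi (%p. k) v p = 0"
 by (simp add: gi_chart_at smooth_fun_const)

lemma gi_cmult: "smooth_fun A u ==> smooth_fun A v ==> gi (%p. k * u p) v p = k * gi u v p"
 using gi_mult[OF smooth_fun_const, of u v k p] by (simp add: gi_const)

lemma gi_local: assumes V: "open V" "p : V" "!!q. q : V ==> u q = 0" and "smooth_fun A u" "smooth_fun A v" shows "gi u v p = 0"
proof -
 let ?c = "chart_at A p" let ?W = "{x : im ?c. chart_inv ?c x : V}"
 have "snd ?c p : ?W" using V(2) chart_at[of p] chart_inv_chart by auto
 hence "pt i (loc ?c u) (snd ?c p) = pt i (%_. 0) (snd ?c p)" for i
  by (rule partial_cong[OF open_chart_image[OF chart_at(1) V(1)]]) (use V(3) in auto)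
 thus ?thesis by (simp add: gi_chart_at assms)
qed

lemma continuous_from_charts:
 assumes "!!c. c : A ==> continuous_on (im c) (G c)" "!!c p. c : A ==> p : fst c ==> F p = G c (snd c p)"
 shows "continuous_on UNIV (F :: 'm => real)"
proof -
 have "continuous_on (UN c:A. fst c) F"
 proof (rule continuous_on_open_UN)
  fix c assume c: "c : A"
  have "continuous_on (fst c) (%p. G c (snd c p))"
   by (rule continuous_on_compose2[OF assms(1)[OF c] chart_continuous[OF c]]) auto
  thus "continuous_on (fst c) F" using assms(2)[OF c] by (simp cong: continuous_on_cong)
 qed (simp add: open_dom)
 thus ?thesis using atlas by (simp add: smooth_atlas_def)
qed

lemma gi_continuous: assumes u: "smooth_fun A u" and v: "smooth_fun A v" shows "continuous_on UNIV (gi u v)"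
proof (rule continuous_from_charts)
 fix c assume c: "c : A"
 show "continuous_on (im c) (%x. SU i. SU j. ginv c i j x * pt i (loc c u) x * pt j (loc c v) x)"
  by (rule smooth_on_continuous) (intro smooth_on_sum smooth_on_mult smooth_on_partial smooth_loc smooth_ginv open_im c u v)
qed (rule grad_inner_eq[OF _ _ u v])

lemma test_support: assumes "test f" obtains K where "compact K" "!!p. p ~: K ==> f p = 0" "!!u p. smooth_fun A u ==> p ~: K ==> gi f u p = 0"
proof -
 obtain K where K: "compact K" "!!p. p ~: K ==> f p = 0" using assms unfolding test_def by blast
 have "gi f u p = 0" if "smooth_fun A u" "p ~: K" for u p
  by (rule gi_local[of "- K"]) (use K that assms in "auto simp: compact_imp_closed open_Compl test_def")
 thus ?thesis using that K by blast
qed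

lemma test_integrable: assumes f: "test f" and h: "continuous_on UNIV h" shows "integrable nu (%p. h p * f p)"
proof -
 obtain K where K: "compact K" "!!p. p ~: K ==> f p = 0" using f unfolding test_def by blast
 show ?thesis
  by (rule integrable_compact_support[OF _ K(1)]) (simp_all add: K(2) continuous_on_mult h smooth_fun_continuous[OF test_smooth[OF f]])
qed

lemma gi_integrable:
 assumes f: "test f" and u: "smooth_fun A u" and h: "continuous_on UNIV h" shows "integrable nu (%p. h p * gi f u p)"
proof -
 obtain K where K: "compact K" "!!u p. smooth_fun A u ==> p ~: K ==> gi f u p = 0" using test_support[OF f] by metis
 show ?thesis
  by (rule integrable_compact_support[OF _ K(1)]) (simp_all add: K(2) u continuous_on_mult h gi_continuous[OF test_smooth[OF f]])
qed

lemma csupp_I: "open S ==> smooth_on S pp ==> compact K ==> K <= S ==> (!!x. x ~: K ==> pp x = 0) ==> csupp S pp"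
 unfolding csupp_def using smooth_extend[OF _ compact_imp_closed] by blast

lemma csupp_mult: assumes S: "open S" and p: "csupp S pp" and X: "smooth_on S X" shows "csupp S (%x. pp x * X x)"
proof -
 obtain K where K: "compact K" "K <= S" "!!x. x ~: K ==> pp x = 0" using p unfolding csupp_def by blast
 have "smooth_on S (%x. pp x * X x)" using p S X by (auto simp: csupp_def intro!: smooth_on_mult intro: smooth_on_subset)
 thus ?thesis by (rule csupp_I[OF S _ K(1,2)]) (simp add: K(3))
qed

lemma csupp_partial: assumes p: "csupp S pp" shows "csupp S (pt i pp)"
proof -
 obtain K where K: "compact K" "K <= S" "!!x. x ~: K ==> pp x = 0" using p unfolding csupp_def by blast
 have "pt i pp x = 0" if "x ~: K" for x
  using partial_cong[of "- K" x pp "%_. 0" i] K that by (simp add: compact_imp_closed open_Compl)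
 thus ?thesis using p K smooth_on_partial[of UNIV pp i] unfolding csupp_def by blast
qed

lemma csupp_sum: assumes "finite I" "!!i. i : I ==> csupp S (f i)" shows "csupp S (%x. SUM i:I. f i x)"
 using assms
proof (induction rule: finite_induct)
 case empty thus ?case unfolding csupp_def by (auto intro!: smooth_on_const)
next
 case (insert i I)
 obtain K where K: "compact K" "K <= S" "!!x. x ~: K ==> f i x = 0" using insert.prems[of i] unfolding csupp_def by blast
 have *: "csupp S (%x. SUM i:I. f i x)" using insert by simp
 then obtain L where L: "compact L" "L <= S" "!!x. x ~: L ==> (SUM i:I. f i x) = 0" unfolding csupp_def by blast
 have "smooth_on UNIV (%x. f i x + (SUM i:I. f i x))"
  using * insert.prems[of i] by (intro smooth_on_add) (simp_all add: csupp_def)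
 hence "csupp S (%x. f i x + (SUM i:I. f i x))"
  unfolding csupp_def by (intro conjI exI[of _ "K \<union> L"] compact_Un) (use K L in auto)
 thus ?case using insert by simp
qed

lemma csupp_by_parts:
 assumes S: "open S" and p: "csupp S pp" and X: "smooth_on S X"
 shows "(LI x. pp x * pt i X x) = - (LI x. pt i pp x * X x)"
proof -
 obtain K where K: "compact K" "K <= S" "!!x. x ~: K ==> pp x = 0" "!!x. x ~: K ==> pt i pp x = 0"
 proof -
  obtain K where K: "compact K" "K <= S" "!!x. x ~: K ==> pp x = 0" using p unfolding csupp_def by blast
  have "pt i pp x = 0" if "x ~: K" for x
   using partial_cong[of "- K" x pp "%_. 0" i] K that by (simp add: compact_imp_closed open_Compl)
  thus ?thesis using that K by blast
 qed
 have eq: "pt i (%x. pp x * X x) x = pp x * pt i X x + pt i pp x * X x" for x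
 proof (cases "x : S")
  case True
  thus ?thesis using partial_mult[OF tfun_differentiable[OF csupp_tfun[OF p]] smooth_on_differentiable[OF S X True]] by simp
 next
  case False
  hence x: "x : - K" using K(2) by blast
  have "pt i (%x. pp x * X x) x = pt i (%x. 0) x"
   by (rule partial_cong[OF _ x]) (use K in "auto simp: compact_imp_closed open_Compl")
  thus ?thesis using x K by simp
 qed
 have "(LI x. pp x * pt i X x + pt i pp x * X x) = 0"
  using tfun_integral_partial[OF csupp_tfun[OF csupp_mult[OF S p X]], of i] unfolding eq .
 moreover have "integrable lborel (%x. pp x * pt i X x)" "integrable lborel (%x. pt i pp x * X x)"
  by (rule tfun_integrable[OF csupp_tfun[OF csupp_mult[OF S p smooth_on_partial[OF X]]]],
   rule tfun_integrable[OF csupp_tfun[OF csupp_mult[OF S csupp_partial[OF p] X]]])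
 ultimately show ?thesis by simp
qed

lemma csupp_integrable: "open S ==> csupp S pp ==> smooth_on S X ==> integrable lborel (%x. pp x * X x)"
 by (intro tfun_integrable csupp_tfun csupp_mult)

lemma
 assumes c: "c : A" and p: "csupp (im c) pp" and w: "smooth_on (im c) w"
 shows ediv_by_parts: "(LI x. pp x * ediv c w x) = - (LI x. (SU i. SU j. acoef c i j x * pt i pp x * pt j w x))"
  and ediv_by_parts': "(LI x. ediv c pp x * w x) = - (LI x. (SU i. SU j. acoef c i j x * pt i pp x * pt j w x))"
proof -
 note o = open_im[OF c] and a = smooth_acoef[OF c]
 let ?X = "%i y. SU j. acoef c i j y * pt j w y" and ?Y = "%i y. SU j. acoef c i j y * pt j pp y"
 have X: "smooth_on (im c) (?X i)" for i by (intro smooth_on_sum smooth_on_mult a o smooth_on_partial w)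
 have Y: "csupp (im c) (?Y i)" for i
  using csupp_sum[of UNIV "im c" "%j y. pt j pp y * acoef c i j y"] csupp_mult[OF o csupp_partial[OF p] a] by (simp add: mult.commute)
 have "(LI x. pp x * ediv c w x) = (SU i. (LI x. pp x * pt i (?X i) x))"
  unfolding ediv_def sum_distrib_left by (rule Bochner_Integration.integral_sum) (intro csupp_integrable[OF o p] smooth_on_partial X)
 also have "... = - (SU i. (LI x. pt i pp x * ?X i x))" by (simp add: csupp_by_parts[OF o p X] sum_negf)
 also have "(SU i. (LI x. pt i pp x * ?X i x)) = (LI x. (SU i. pt i pp x * ?X i x))"
  by (rule Bochner_Integration.integral_sum[symmetric]) (intro csupp_integrable[OF o] csupp_partial p X)
 finally show "(LI x. pp x * ediv c w x) = - (LI x. (SU i. SU j. acoef c i j x * pt i pp x * pt j w x))"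
  by (simp add: sum_distrib_left mult_ac)
 have "(LI x. ediv c pp x * w x) = (SU i. (LI x. pt i (?Y i) x * w x))"
  unfolding ediv_def sum_distrib_right by (rule Bochner_Integration.integral_sum) (intro csupp_integrable[OF o] csupp_partial Y w)
 also have "... = - (SU i. (LI x. ?Y i x * pt i w x))"
  using csupp_by_parts[OF o Y w] by (simp add: sum_negf)
 also have "(SU i. (LI x. ?Y i x * pt i w x)) = (LI x. (SU i. ?Y i x * pt i w x))"
  by (rule Bochner_Integration.integral_sum[symmetric]) (intro csupp_integrable[OF o] Y w smooth_on_partial)
 also have "... = (LI x. (SU i. SU j. acoef c i j x * pt i pp x * pt j w x))"
 proof (rule Bochner_Integration.integral_cong[OF refl])
  fix x
  \<comment> \<open>Symmetry of \<open>acoef\<close> is known on the image of the chart only;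
    elsewhere the derivatives of \<open>pp\<close> vanish.\<close>
  have s: "acoef c i j x * pt j pp x = acoef c j i x * pt j pp x" for i j
   using ginv_sym[OF c, of x i j] csupp_outside[OF csupp_partial[OF p], of x j] by (cases "x : im c") (auto simp: acoef_def)
  have "(SU i. ?Y i x * pt i w x) = (SU i. SU j. acoef c j i x * pt j pp x * pt i w x)"
   unfolding sum_distrib_right by (rule sum.cong[OF refl], rule sum.cong[OF refl], subst s, rule refl)
  also have "... = (SU i. SU j. acoef c i j x * pt i pp x * pt j w x)" by (rule sum.swap)
  finally show "(SU i. ?Y i x * pt i w x) = ..." .
 qed
 finally show "(LI x. ediv c pp x * w x) = - (LI x. (SU i. SU j. acoef c i j x * pt i pp x * pt j w x))" .
qed

lemma integral_lift:
 assumes c: "c : A" and p: "csupp (im c) pp" and F: "F : bmb"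
 shows "(NI q. lift c pp q * F q) = (LI x. pp x * vol c x * loc c F x)"
proof -
 note [measurable] = F borel_measurable_continuous_onI[OF smooth_fun_continuous[OF test_smooth[OF test_lift[OF c p]]]]
 have "(NI q. lift c pp q * F q) = (LI x. ind (im c) x * vol c x * (lift c pp (chart_inv c x) * F (chart_inv c x)))"
 proof (rule integral_chart[OF c])
  show "lift c pp q * F q = 0" if "q ~: fst c" for q using that by (simp add: lift_def)
 qed measurable
 also have "... = (LI x. pp x * vol c x * loc c F x)"
  using loc_lift[OF c, of _ pp] csupp_outside[OF p] by (intro Bochner_Integration.integral_cong refl) (auto simp: indicator_def)
 finally show ?thesis .
qed

lemma integral_gi_lift:
 assumes c: "c : A" and p: "csupp (im c) pp" and u: "smooth_fun A u"
 shows "(NI q. gi (lift c pp) u q) = (LI x. (SU i. SU j. acoef c i j x * pt i pp x * pt j (loc c u) x))"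
proof -
 note t = test_lift[OF c p]
 obtain K where K: "compact K" "K <= im c" "!!x. x ~: K ==> pp x = 0" using p unfolding csupp_def by blast
 have "compact (chart_inv c ` K)" "chart_inv c ` K <= fst c" "q ~: chart_inv c ` K ==> lift c pp q = 0" for q
  using lift_support[where pp = pp, OF c K(1,2)] K(3) by auto
 hence z: "gi (lift c pp) u q = 0" if "q ~: fst c" for q
  using that by (intro gi_local[of "- chart_inv c ` K"] u test_smooth t) (auto simp: compact_imp_closed open_Compl)
 have "(NI q. gi (lift c pp) u q) = (LI x. ind (im c) x * vol c x * loc c (gi (lift c pp) u) x)"
  by (rule integral_chart[OF c borel_measurable_continuous_onI[OF gi_continuous[OF test_smooth[OF t] u]] z])
 also have "... = (LI x. (SU i. SU j. acoef c i j x * pt i pp x * pt j (loc c u) x))"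
 proof (rule Bochner_Integration.integral_cong[OF refl])
  fix x
  show "ind (im c) x * vol c x * loc c (gi (lift c pp) u) x = (SU i. SU j. acoef c i j x * pt i pp x * pt j (loc c u) x)"
  proof (cases "x : im c")
   case True
   have "pt i (loc c (lift c pp)) x = pt i pp x" for i
    by (rule partial_cong[OF open_im[OF c] True]) (rule loc_lift[OF c])
   thus ?thesis using True
    by (simp add: grad_inner_eq[OF c chart_inv_in[OF True] test_smooth[OF t] u] chart_chart_inv[OF True] acoef_def sum_distrib_left mult_ac)
  qed (simp add: csupp_outside[OF csupp_partial[OF p]])
 qed
 finally show ?thesis .
qed

lemma green_lift:
 assumes c: "c : A" and p: "csupp (im c) pp" and u: "smooth_fun A u"
 shows "(NI q. gi (lift c pp) u q) = - (LI x. pp x * ediv c (loc c u) x)"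
  and "(NI q. gi (lift c pp) u q) = - (LI x. ediv c pp x * loc c u x)"
 using ediv_by_parts[OF c p smooth_loc[OF u c]] ediv_by_parts'[OF c p smooth_loc[OF u c]] integral_gi_lift[OF c p u] by simp_all

lemma csupp_bump: assumes "0 < r" "cball a r <= S" shows "csupp S (bump a r)"
 unfolding csupp_def
proof (intro conjI smooth_bump open_UNIV exI[of _ "cball a r"] allI impI compact_cball assms(2))
 show "bump a r y = 0" if "y ~: cball a r" for y by (rule bump_zero[OF assms(1)]) (use that in auto)
qed

text \<open>Both sides represent the same functional \<open>F \<mapsto> - \<integral> g(\<nabla>F, \<nabla>u) d\<nu>\<close> on test functions
 supported in the overlap of the two charts.\<close>

lemma ediv_chart_independent:
 assumes c: "c : A" "p : fst c" and d: "d : A" "p : fst d" and u: "smooth_fun A u"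
 shows "ediv c (loc c u) (snd c p) / vol c (snd c p) = ediv d (loc d u) (snd d p) / vol d (snd d p)"
proof -
 let ?l = "%c x. ediv c (loc c u) x / vol c x"
 have l: "smooth_on (im e) (?l e)" if "e : A" for e
  by (intro smooth_on_divide open_im[OF that] smooth_ediv[OF that] order_refl smooth_loc u that smooth_vol vol_pos)
 let ?W = "overlap c d" let ?e = "%x. ?l c x - ?l d (transition c d x)"
 note W = open_overlap[OF c(1) d(1)] and W' = overlap_eq[OF c(1), of d]
 have We: "?W <= im c" by (auto simp: W')
 have e: "smooth_on ?W ?e"
  by (intro smooth_on_diff W smooth_on_subset[OF l[OF c(1)] We] smooth_on_compose[OF W open_im[OF d(1)] l[OF d(1)] smooth_transition[OF c(1) d(1)]])
   (auto simp: W' transition_def)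
 let ?x = "snd c p"
 have x: "?x : ?W" using c d by (auto simp: overlap_def)
 obtain r where r: "0 < r" "cball ?x r <= ?W" using open_contains_cball[of ?W] W x by blast
 have b: "csupp ?W (bump ?x r)" by (rule csupp_bump[OF r])
 let ?f = "%x. bump ?x r x * ?e x"
 have f: "csupp ?W ?f" by (rule csupp_mult[OF W b e])
 then obtain K where K: "compact K" "K <= ?W" "!!x. x ~: K ==> ?f x = 0" unfolding csupp_def by blast
 note fc = csupp_mono[OF f We]
 let ?F = "lift c ?f"
 have L: "compact (chart_inv c ` K)" "q ~: chart_inv c ` K ==> ?F q = 0" for q
  using lift_support[where pp = ?f, OF c(1) K(1)] K(2,3) We by auto
 have "chart_inv c ` K <= fst d" using K(2) by (auto simp: W')
 then obtain h where h: "csupp (im d) h" "?F = lift d h"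
  using test_eq_lift[OF d(1) test_smooth[OF test_lift[OF c(1) fc]] L(1)] L(2) by blast
 \<comment> \<open>With the bump times the difference \<open>?e\<close> as test function, the
   integrand is the bump times \<open>?e^2\<close>. It is nonnegative and integrates to 0, so
   \<open>?e\<close> vanishes where the bump is positive.\<close>
 let ?H = "lift c (%x. ?f x * ?e x)"
 have H: "csupp ?W (%x. ?f x * ?e x)" by (rule csupp_mult[OF W f e])
 note tH = test_lift[OF c(1) csupp_mono[OF H We]]
 have Hc: "csupp (im c) (%x. ?f x * ?l c x)" by (rule csupp_mult[OF open_im[OF c(1)] fc l[OF c(1)]])
 have Hd: "csupp (im d) (%x. h x * ?l d x)" by (rule csupp_mult[OF open_im[OF d(1)] h(1) l[OF d(1)]])
 have I: "(NI q. lift e (%x. k x * ?l e x) q) = (LI x. k x * ediv e (loc e u) x)"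
  if e: "e : A" and k: "csupp (im e) k" "csupp (im e) (%x. k x * ?l e x)" for e k
 proof -
  have "(NI q. lift e (%x. k x * ?l e x) q * 1) = (LI x. k x * ?l e x * vol e x * 1)"
   by (rule integral_lift[OF e k(2)]) simp
  also have "... = (LI x. k x * ediv e (loc e u) x)"
  proof (rule Bochner_Integration.integral_cong[OF refl])
   fix x show "k x * ?l e x * vol e x * 1 = k x * ediv e (loc e u) x"
    using vol_pos[OF e, of x] csupp_outside[OF k(1), of x] by (cases "x : im e") auto
  qed
  finally show ?thesis by simp
 qed
 have "?H q = lift c (%x. ?f x * ?l c x) q - lift d (%x. h x * ?l d x) q" for q
 proof (cases "q : fst c & q : fst d")
  case True
  hence "h (snd d q) = ?f (snd c q)" using fun_cong[OF h(2), of q] by (simp add: lift_def)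
  moreover have "transition c d (snd c q) = snd d q" using True chart_inv_chart[OF c(1)] by (simp add: transition_def)
  ultimately show ?thesis using True by (simp add: lift_def right_diff_distrib)
 next
  case False
  have F0: "?F q = 0"
  proof (cases "q : fst c")
   case True
   hence "q ~: chart_inv c ` K" using False \<open>chart_inv c ` K <= fst d\<close> by blast
   thus ?thesis by (rule L(2))
  qed (simp add: lift_def)
  hence "lift d h q = 0" using h(2) by simp
  thus ?thesis using F0 by (auto simp: lift_def split: if_splits)
 qed
 hence "(NI q. ?H q) = (NI q. lift c (%x. ?f x * ?l c x) q) - (NI q. lift d (%x. h x * ?l d x) q)"
  using test_integrable[OF test_lift[OF c(1) Hc], of "%_. 1"] test_integrable[OF test_lift[OF d(1) Hd], of "%_. 1"] by simp
 also have "... = 0"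
  using green_lift(1)[OF c(1) fc u] green_lift(1)[OF d(1) h(1) u] h(2) I[OF c(1) fc Hc] I[OF d(1) h(1) Hd] by simp
 finally have "?H p = 0"
 proof (intro integral_eq_0_continuous[OF smooth_fun_continuous[OF test_smooth[OF tH]]])
  show "integrable nu ?H" using test_integrable[OF tH, of "%_. 1"] by simp
  show "0 <= ?H q" for q using bump_nonneg[of ?x r] by (simp add: lift_def mult.assoc zero_le_mult_iff)
 qed
 moreover have "bump ?x r ?x > 0" using bump_pos_iff[OF r(1), of ?x ?x] r(1) by simp
 moreover have "transition c d ?x = snd d p" using chart_inv_chart[OF c] by (simp add: transition_def)
 ultimately show ?thesis using c(2) by (simp add: lift_def)
qed

lemma wlap_eq: "smooth_fun A u ==> c : A ==> p : fst c ==> wlap u p = ediv c (loc c u) (snd c p) / vol c (snd c p)"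
 using wlap_chart_at[OF _ refl] ediv_chart_independent[OF chart_at] by metis

lemma wlap_continuous: assumes u: "smooth_fun A u" shows "continuous_on UNIV (wlap u)"
proof (rule continuous_from_charts)
 fix c assume c: "c : A"
 show "continuous_on (im c) (%x. ediv c (loc c u) x / vol c x)"
  by (rule smooth_on_continuous) (intro smooth_on_divide open_im smooth_ediv order_refl smooth_loc u c smooth_vol vol_pos)
qed (rule wlap_eq[OF u])

lemma chart_cutoff:
 assumes S: "open S" "snd c p : S" "S <= im c" and c: "c : A" "p : fst c"
 shows "EX xx V. csupp S xx & open V & p : V & (ALL q:V. lift c xx q = 1)"
proof -
 obtain r where r: "0 < r" "cball (snd c p) r <= S" using open_contains_cball[of S] S(1,2) by blast
 obtain xx :: "real^'n => real" where x: "smooth_on UNIV xx" "!!x. 0 <= xx x" "!!x. xx x <= 1" "!!x. x : cball (snd c p) (r/2) ==> xx x = 1" "!!x. x ~: ball (snd c p) r ==> xx x = 0"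
  using exists_cutoff[of "r/2" r "snd c p"] r(1) by auto
 have "csupp S xx" unfolding csupp_def
 proof (intro conjI x(1) exI[of _ "cball (snd c p) r"] allI impI compact_cball r(2))
  show "xx y = 0" if "y ~: cball (snd c p) r" for y by (rule x(5)) (use that in auto)
 qed
 moreover have "open {q : fst c. snd c q : ball (snd c p) (r/2)}" by (rule open_chart_vimage[OF c(1) open_ball])
 ultimately show ?thesis using c r x(4) by (intro exI[of _ xx] exI[of _ "{q : fst c. snd c q : ball (snd c p) (r/2)}"]) (auto simp: lift_def)
qed

text \<open>In place of a partition of unity: finitely many sets, each with a cutoff equal to 1 on
  it, cover the support; \<open>f\<close> is split as \<open>f * xx + f * (1 - xx)\<close>, where
  the first summand lives in one chart and the second needs one set less.\<close>

lemma test_induct: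
 assumes f: "test f" and add: "!!f h. test f ==> test h ==> P f ==> P h ==> P (%p. f p + h p)"
  and loc: "!!p. EX c:A. EX S. open S & p : fst c & snd c p : S & S <= im c & (ALL pp. csupp S pp --> P (lift c pp))"
 shows "P f"
proof -
 obtain K where K: "compact K" "!!p. p ~: K ==> f p = 0" using f unfolding test_def by blast
 let ?G = "%V. EX c S xx. c : A & open S & S <= im c & csupp S xx & (ALL q:V. lift c xx q = 1) & (ALL pp. csupp S pp --> P (lift c pp))"
 have ex: "EX V. open V & p : V & ?G V" for p
 proof -
  obtain c S where c: "c : A" "open S" "p : fst c" "snd c p : S" "S <= im c" "ALL pp. csupp S pp --> P (lift c pp)"
   using loc[of p] by blast
  thus ?thesis using chart_cutoff[OF c(2,4,5,1,3)] by blast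
 qed
 define V where "V p = (SOME V. open V & p : V & ?G V)" for p
 have V: "open (V p)" "p : V p" "?G (V p)" for p
  using someI_ex[OF ex[of p]] unfolding V_def by blast+
 obtain T where T: "finite T" "K <= (UN p:T. V p)"
 proof (rule compactE_image[OF K(1), of UNIV V])
  show "K <= (UN p:UNIV. V p)" using V(2) by blast
 qed (use V(1) in auto)
 have "ALL f. test f --> (ALL p. f p ~= 0 --> p : (UN t:T. V t)) --> P f"
  using T(1)
 proof (induction rule: finite_induct)
  case empty
  \<comment> \<open>The zero function is obtained as the lift of 0 in some chart.\<close>
  obtain c S where c: "csupp S pp ==> P (lift c pp)" for pp using loc by blast
  have "csupp S (%x. 0)" unfolding csupp_def by (auto intro!: smooth_on_const)
  moreover have "lift c (%x. 0) = (%p. 0)" by (simp add: lift_def fun_eq_iff)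
  ultimately have P0: "P (%p. 0)" using c[of "%x. 0"] by simp
  show ?case
  proof (intro allI impI)
   fix f :: "'m => real" assume "ALL p. f p ~= 0 --> p : (UN t:{}. V t)"
   hence "f = (%p. 0)" by auto
   thus "P f" using P0 by simp
  qed
 next
  case (insert t T)
  show ?case
  proof (intro allI impI)
   fix f assume f: "test f" "ALL p. f p ~= 0 --> p : (UN t:insert t T. V t)"
   obtain c S xx where c: "c : A" "open S" "S <= im c" "csupp S xx" "!!q. q : V t ==> lift c xx q = 1" "!!pp. csupp S pp ==> P (lift c pp)"
    using V(3)[of t] by blast
   note tx = test_lift[OF c(1) csupp_mono[OF c(4,3)]]
   let ?f1 = "%p. f p * lift c xx p" and ?f2 = "%p. f p * (1 - lift c xx p)"
   have t1: "test ?f1" "test ?f2"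
    using test_smooth[OF tx] by (auto intro!: test_mult f(1) smooth_fun_diff smooth_fun_const)
   have "csupp S (%x. xx x * loc c f x)"
    by (rule csupp_mult[OF c(2,4) smooth_on_subset[OF smooth_loc[OF test_smooth[OF f(1)] c(1)] c(3)]])
   moreover have "?f1 = lift c (%x. xx x * loc c f x)"
    using chart_inv_chart[OF c(1)] by (auto simp: lift_def fun_eq_iff)
   ultimately have "P ?f1" using c(6) by simp
   moreover have "P ?f2" using insert.IH t1(2) f(2) c(5) by fastforce
   ultimately have "P (%p. ?f1 p + ?f2 p)" by (rule add[OF t1])
   thus "P f" by (simp add: algebra_simps)
  qed
 qed
 thus ?thesis using f K(2) T(2) by blast
qed

lemma green:
 assumes f: "test f" and u: "smooth_fun A u" shows "(NI p. gi f u p) = - (NI p. f p * wlap u p)"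
proof (rule test_induct[OF f])
 note w = wlap_continuous[OF u]
 fix f h assume *: "test f" "test h" "(NI p. gi f u p) = - (NI p. f p * wlap u p)" "(NI p. gi h u p) = - (NI p. h p * wlap u p)"
 have "integrable nu (gi k u)" "integrable nu (%p. k p * wlap u p)" if "test k" for k
  using gi_integrable[OF that u, of "%_. 1"] test_integrable[OF that w] by (simp_all add: mult.commute)
 thus "(NI p. gi (%p. f p + h p) u p) = - (NI p. (f p + h p) * wlap u p)"
  using * u by (simp add: gi_add test_smooth distrib_right)
next
 fix p
 have G: "(NI q. gi (lift c pp) u q) = - (NI q. lift c pp q * wlap u q)" if c: "c : A" and p: "csupp (im c) pp" for c pp
 proof -
 have "(NI p. lift c pp p * wlap u p) = (LI x. pp x * vol c x * loc c (wlap u) x)"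
  by (rule integral_lift[OF c p borel_measurable_continuous_onI[OF wlap_continuous[OF u]]])
 also have "... = (LI x. pp x * ediv c (loc c u) x)"
 proof (rule Bochner_Integration.integral_cong[OF refl])
  fix x show "pp x * vol c x * loc c (wlap u) x = pp x * ediv c (loc c u) x"
  proof (cases "x : im c")
   case True
   thus ?thesis using vol_pos[OF c True] by (simp add: wlap_eq[OF u c chart_inv_in] chart_chart_inv)
  qed (simp add: csupp_outside[OF p])
 qed
 finally show ?thesis using green_lift(1)[OF c p u] by simp
 qed
 show "EX c:A. EX S. open S & p : fst c & snd c p : S & S <= im c &
  (ALL pp. csupp S pp --> (NI q. gi (lift c pp) u q) = - (NI q. lift c pp q * wlap u q))"
  using chart_cover[of p] open_im G by blast
qed

end

section \<open>A discriminant criterion and translation estimates\<close>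

lemma discriminant_le:
 fixes a b c :: real
 assumes h: "!!t. 0 <= a + 2 * t * b + t^2 * c" and c: "0 <= c" shows "b^2 <= a * c"
proof (cases "c = 0")
 case True
 have "b = 0"
 proof (rule ccontr)
  assume "b ~= 0"
  thus False using h[of "- (a + 1) / (2 * b)"] True by (simp add: field_simps)
 qed
 thus ?thesis using True by simp
next
 case False
 hence "0 <= a - b^2 / c" using h[of "- b / c"] by (simp add: power2_eq_square field_simps)
 thus ?thesis using False c by (simp add: field_simps)
qed

text \<open>The weight \<open>exp (- t)\<close> absorbs the linear term: since
  \<open>2 * a * b - a^2 <= b^2\<close>, the derivative of \<open>exp (- t) * w^2\<close> along the
  segment is at most the squared directional derivative. The estimate stays linear in squared
  quantities and can be integrated over \<open>y\<close>.\<close>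

lemma translation_pointwise:
 fixes w :: "real^'n => real"
 assumes S: "open S" and w: "smooth_on S w" and seg: "!!t. 0 <= t ==> t <= 1 ==> y + t *. h : S"
 shows "enn ((w (y + h))^2) <= enn (exp 1 * (w y)^2) +
  enn (exp 1) * (NN t. ind {0..1} t * enn ((SU k. h $ k * pt k w (y + t *. h))^2))"
proof -
 let ?d = "%t. SU k. h $ k * pt k w (y + t *. h)" and ?F = "%t. exp (- t) * (w (y + t *. h))^2"
 let ?F' = "%t. exp (- t) * (2 * w (y + t *. h) * ?d t - (w (y + t *. h))^2)"
 have D: "(?F has_real_derivative ?F' t) (at t)" if "0 <= t" "t <= 1" for t
 proof -
  have "((%t. w (y + t *. h)) has_derivative (%s. SU k. (s *. h) $ k * pt k w (y + t *. h))) (at t)"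
   by (rule has_derivative_compose[of "%t. y + t *. h" _ _ _ w, OF _ partial_has_derivative[OF smooth_on_differentiable[OF S w seg[OF that]]]])
    (auto intro!: derivative_eq_intros)
  hence "((%t. w (y + t *. h)) has_real_derivative ?d t) (at t)"
   unfolding has_field_derivative_def by (rule has_derivative_eq_rhs) (simp add: fun_eq_iff sum_distrib_left mult_ac)
  thus ?thesis by (auto intro!: derivative_eq_intros simp: algebra_simps power2_eq_square)
 qed
 have 1: "(?F' has_integral ?F 1 - ?F 0) {0..1}"
  by (rule fundamental_theorem_of_calculus)
   (use D in "auto simp: has_real_derivative_iff_has_vector_derivative[symmetric] intro: has_field_derivative_at_within")
 have "continuous_on {0..1} (%t. pt k w (y + t *. h))" for k
  by (rule continuous_on_compose2[OF smooth_on_continuous[OF smooth_on_partial[OF w]]]) (use seg in "auto intro!: continuous_intros")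
 hence "continuous_on {0..1} (%t. (?d t)^2)" by (intro continuous_intros)
 then obtain J where J: "((%t. (?d t)^2) has_integral J) {0..1}" using integrable_continuous_real integrable_on_def by blast
 have "?F 1 - ?F 0 <= J"
 proof (rule has_integral_le[OF 1 J])
  fix t :: real assume "t : {0..1}"
  have "2 * w (y + t *. h) * ?d t - (w (y + t *. h))^2 <= (?d t)^2"
   using zero_le_power2[of "w (y + t *. h) - ?d t"] by (simp only: power2_diff)
  hence "?F' t <= exp (- t) * (?d t)^2" by (rule mult_left_mono) simp
  also have "... <= 1 * (?d t)^2" by (rule mult_right_mono) (use \<open>t : {0..1}\<close> in auto)
  finally show "?F' t <= (?d t)^2" by simp
 qed
 hence "exp (- 1) * (w (y + h))^2 <= (w y)^2 + J" by simp
 hence "exp 1 * (exp (- 1) * (w (y + h))^2) <= exp 1 * ((w y)^2 + J)" by (rule mult_left_mono) simp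
 hence le: "(w (y + h))^2 <= exp 1 * (w y)^2 + exp 1 * J" by (simp add: distrib_left mult.assoc[symmetric] flip: exp_add)
 have J0: "0 <= J" by (rule has_integral_nonneg[OF J]) simp
 have "enn J = (NN t. enn (ind {0..1} t * (?d t)^2))"
  by (rule nn_integral_has_integral_lebesgue[OF _ J, symmetric]) simp
 also have "... = (NN t. ind {0..1} t * enn ((?d t)^2))"
  by (rule nn_integral_cong) (simp add: indicator_def)
 finally have "enn J = ..." .
 moreover have "enn ((w (y + h))^2) <= enn (exp 1 * (w y)^2) + enn (exp 1) * enn J"
  using ennreal_leI[OF le] J0 by (simp add: ennreal_mult)
 ultimately show ?thesis by simp
qed

text \<open>After integrating the pointwise estimate over the ball, Fubini and translation
  invariance bound the contribution of each \<open>t\<close> by one and the same gradient integral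
  over the larger ball.\<close>

lemma translation_N2:
 fixes w :: "real^'n => real"
 assumes S: "open S" "ball a s <= S" and w: "smooth_on S w" "w : bmb"
  and seg: "!!y t. y : ball b de ==> 0 <= t ==> t <= 1 ==> y + t *. h : ball a s"
 shows "N2 (b + h) de w <= enn (exp 1) * (N2 b de w +
  (NN x. ind (ball a s) x * enn ((SU k. h $ k * pt k w x)^2)))"
proof -
 let ?G = "%x. ind (ball a s) x * enn ((SU k. h $ k * pt k w x)^2)"
 have "continuous_on (ball a s) (%x. (SU k. h $ k * pt k w x)^2)"
  by (intro continuous_intros continuous_on_subset[OF smooth_on_continuous[OF smooth_on_partial[OF w(1)]] S(2)])
 hence "(%x. ind (ball a s) x *. (SU k. h $ k * pt k w x)\<^sup>2) : bmb"
  by (intro borel_measurable_continuous_on_indicator) simp_all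
 hence "(%x. enn (ind (ball a s) x *. (SU k. h $ k * pt k w x)\<^sup>2)) : bmb" by measurable
 moreover have "(%x. enn (ind (ball a s) x *. (SU k. h $ k * pt k w x)\<^sup>2)) = ?G"
  by (rule ext) (simp add: indicator_def)
 ultimately have G[measurable]: "?G : bmb" by (simp only:)
 note [measurable] = w(2)
 have "N2 (b + h) de w = (NN y. ind (ball (b + h) de) (h + y) * enn ((w (h + y))^2))"
  unfolding N2_def by (rule nn_integral_translation[symmetric]) measurable
 also have "... <= (NN y. enn (exp 1) * (ind (ball b de) y * enn ((w y)^2)) +
   enn (exp 1) * (NN t. ind {0..1} t * ?G (y + t *. h)))"
 proof (rule nn_integral_mono)
  fix y
  show "ind (ball (b + h) de) (h + y) * enn ((w (h + y))^2) <= enn (exp 1) * (ind (ball b de) y * enn ((w y)^2)) +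
   enn (exp 1) * (NN t. ind {0..1} t * ?G (y + t *. h))"
  proof (cases "y : ball b de")
   case True
   have e: "(NN t. ind {0..1} t * ?G (y + t *. h))
    = (NN t. ind {0..1} t * enn ((SU k. h $ k * pt k w (y + t *. h))^2))"
    by (rule nn_integral_cong) (use seg[OF True] in "auto simp: indicator_def")
   have "y + t *. h : S" if "0 <= t" "t <= 1" for t using seg[OF True that] S(2) by blast
   note pw = translation_pointwise[OF S(1) w(1) this]
   have "h + y : ball (b + h) de" using True by (simp add: dist_norm algebra_simps)
   thus ?thesis unfolding e using pw True by (simp add: add.commute[of h y] ennreal_mult)
  next
   case False
   hence "h + y ~: ball (b + h) de" by (simp add: dist_norm algebra_simps)
   thus ?thesis by simp
  qed
 qed
 also have "... = enn (exp 1) * N2 b de w + enn (exp 1) * (NN y. (NN t. ind {0..1} t * ?G (y + t *. h)))"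
  unfolding N2_def by (subst nn_integral_add) (simp_all add: nn_integral_cmult)
 also have "(NN y. (NN t. ind {0..1} t * ?G (y + t *. h)))
   = (NN t. (NN y. ind {0..1} t * ?G (y + t *. h)))"
  by (rule lborel_pair.Fubini') measurable
 also have "... = (NN t. ind {0..1::real} t * (NN y. ?G y))"
  using nn_integral_translation[OF G] by (simp add: nn_integral_cmult add.commute[of _ "_ *. h"])
 also have "... = (NN y. ?G y)" by (simp add: nn_integral_multc)
 finally show ?thesis by (simp add: distrib_left)
qed

context density_manifold begin

section \<open>Green's formula and the energy form\<close>

text \<open>One form for both variational problems: \<open>V = rh\<close> gives the auxiliary
  energy, \<open>V = - q\<close> the stability form.\<close>

definition qf :: "('m => real) => ('m => real) => ('m => real) => real" where
 "qf V f h = (NI p. gi f h p + V p * f p * h p)"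

lemma qf_integrable: assumes "continuous_on UNIV V" "test f" "smooth_fun A h" shows "integrable nu (%p. gi f h p + V p * f p * h p)"
 using gi_integrable[OF assms(2,3), of "%_. 1"] test_integrable[OF assms(2) continuous_on_mult[OF assms(1) smooth_fun_continuous[OF assms(3)]]]
 by (simp add: mult_ac)

lemma qf_add: assumes "continuous_on UNIV V" "test f" "test k" "smooth_fun A h"
 shows "qf V (%p. f p + k p) h = qf V f h + qf V k h"
proof -
 have "qf V (%p. f p + k p) h = (NI p. (gi f h p + V p * f p * h p) + (gi k h p + V p * k p * h p))"
  unfolding qf_def using assms by (simp add: gi_add test_smooth algebra_simps)
 thus ?thesis unfolding qf_def using qf_integrable assms by simp
qed

lemma qf_cmult: "test f ==> smooth_fun A h ==> qf V (%p. k * f p) h = k * qf V f h"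
 unfolding qf_def by (subst integral_mult_right_zero[symmetric]) (simp add: gi_cmult test_smooth algebra_simps)

lemma qf_sym: "smooth_fun A f ==> smooth_fun A h ==> qf V f h = qf V h f"
 unfolding qf_def by (simp add: gi_sym[of f h] mult_ac)

lemma qf_expand: assumes V: "continuous_on UNIV V" and f: "test f" and k: "test k"
 shows "qf V (%p. f p + t * k p) (%p. f p + t * k p) = qf V f f + 2 * t * qf V f k + t^2 * qf V k k"
proof -
 note s = test_smooth[OF f] test_smooth[OF k] and tk = test_cmult[OF k, of t]
 note h = test_add[OF f tk]
 have "qf V (%p. f p + t * k p) (%p. f p + t * k p) = qf V (%p. f p + t * k p) f + t * qf V (%p. f p + t * k p) k"
  using qf_add[OF V f tk test_smooth[OF h]] qf_cmult[OF k test_smooth[OF h]] qf_sym[OF s(1) test_smooth[OF h]] qf_sym[OF s(2) test_smooth[OF h]] by simp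
 also have "... = qf V f f + 2 * t * qf V f k + t^2 * qf V k k"
  using qf_add[OF V f tk s(1)] qf_add[OF V f tk s(2)] qf_cmult[OF k s(1)] qf_cmult[OF k s(2)] qf_sym[OF s]
  by (simp add: power2_eq_square algebra_simps)
 finally show ?thesis .
qed

lemma qf_Cauchy_Schwarz:
 assumes V: "continuous_on UNIV V" and f: "test f" and k: "test k" and pos: "!!h. test h ==> 0 <= qf V h h"
 shows "(qf V f k)^2 <= qf V f f * qf V k k"
 using pos[OF test_add[OF f test_cmult[OF k]], unfolded qf_expand[OF V f k]] pos[OF k] by (rule discriminant_le)

lemma nn_integral_chart:
 assumes c: "c : A" and F: "F : bmb"
 shows "(NV q. enn (ind (fst c) q) * F q) = (NN x. enn (ind (im c) x * vol c x) * F (chart_inv c x))"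
proof -
 note [measurable] = F chart_inv_measurable[OF c] im_measurable[OF c vol_continuous[OF c]] borel_open[OF open_dom[OF c]]
 have "(NV q. enn (ind (fst c) q) * F q) = (\<integral>\<^sup>+q. F q \<partial>cmeas c (vol c))"
  unfolding nu_chart[OF c, symmetric] by (subst nn_integral_density) simp_all
 thus ?thesis unfolding cmeas_def by (simp add: nn_integral_distr nn_integral_density)
qed

lemma chart_ball_bounds:
 assumes c: "c : A" and K: "cball a s <= im c"
 obtains M where "0 < M" "!!x. x : cball a s ==> vol c x <= M" "!!x. x : cball a s ==> 1 <= M * vol c x"
  "!!x p. x : cball a s ==> (SU i. (p i)^2) <= M * (SU i. SU j. acoef c i j x * p i * p j)"
proof -
 have v: "continuous_on (cball a s) (vol c)" by (rule continuous_on_subset[OF vol_continuous[OF c] K])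
 have vp: "vol c x > 0" if "x : cball a s" for x using vol_pos[OF c] K that by blast
 obtain M1 where M1: "!!x. x : cball a s ==> vol c x <= M1"
  using compact_imp_bounded[OF compact_continuous_image[OF v compact_cball]] unfolding bounded_real by (metis abs_le_iff imageI)
 have "continuous_on (cball a s) (%x. 1 / vol c x)" by (intro continuous_intros v) (use vp in force)
 from compact_imp_bounded[OF compact_continuous_image[OF this compact_cball]]
 obtain M2 where M2: "!!x. x : cball a s ==> 1 / vol c x <= M2" unfolding bounded_real by (metis abs_le_iff imageI)
 have "EX lam>0. ALL x:cball a s. ALL p. lam * (SU i. (p i)^2) <= (SU i. SU j. acoef c i j x * p i * p j)"
 proof (rule uniform_ellipticity[OF compact_cball])
  show "continuous_on (cball a s) (acoef c i j)" for i j by (rule continuous_on_subset[OF smooth_on_continuous[OF smooth_acoef[OF c]] K])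
  fix x and p :: "real^'n" assume x: "x : cball a s" and p: "p ~= 0"
  show "0 < (SU i. SU j. acoef c i j x * p $ i * p $ j)"
   using mult_pos_pos[OF vp[OF x] ginv_pos[OF c subsetD[OF K x] p]] by (simp add: acoef_def sum_distrib_left mult_ac)
 qed
 then obtain lam where lam: "0 < lam" "!!x p. x : cball a s ==> lam * (SU i. (p i)^2) <= (SU i. SU j. acoef c i j x * p i * p j)" by blast
 define M where "M = Max {1, M1, M2, 1 / lam}"
 have M: "1 <= M" "M1 <= M" "M2 <= M" "1 / lam <= M" by (simp_all add: M_def)
 show ?thesis
 proof (rule that[of M])
  fix x assume x: "x : cball a s"
  show "vol c x <= M" using M1[OF x] M by linarith
  have "1 / vol c x <= M" using M2[OF x] M by linarith
  thus "1 <= M * vol c x" using vp[OF x] by (simp add: field_simps)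
  fix p :: "'n => real"
  let ?R = "SU i. SU j. acoef c i j x * p i * p j" and ?L = "SU i. (p i)^2"
  have "0 <= lam * ?L" using lam(1) by (simp add: sum_nonneg)
  hence "0 <= ?R" using lam(2)[OF x, of p] by linarith
  hence "1 / lam * ?R <= M * ?R" by (intro mult_right_mono M)
  moreover have "?L <= 1 / lam * ?R" using lam(2)[OF x, of p] lam(1) by (simp add: field_simps)
  ultimately show "?L <= M * ?R" by linarith
 qed (use M in simp)
qed

lemma nn_integral_gradient_ball:
 assumes c: "c : A" and K: "cball a s <= im c" and M: "0 < M"
  "!!x p. x : cball a s ==> (SU i. (p i)^2) <= M * (SU i. SU j. acoef c i j x * p i * p j)"
  and f: "test f"
 shows "(NN x. ind (ball a s) x * enn ((SU k. h $ k * pt k (loc c f) x)^2))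
  <= enn (h \<bullet> h * M * (NI p. gi f f p))"
proof -
 note s = test_smooth[OF f]
 have nn: "0 <= gi f f p" for p by (rule gi_nonneg[OF s])
 have m[measurable]: "gi f f : bmb" by (rule borel_measurable_continuous_onI[OF gi_continuous[OF s s]])
 note [measurable] = chart_inv_measurable[OF c] im_measurable[OF c vol_continuous[OF c]]
 have "(NN x. ind (ball a s) x * enn ((SU k. h $ k * pt k (loc c f) x)^2))
  <= (NN x. enn (h \<bullet> h * M) * (enn (ind (im c) x * vol c x) * enn (gi f f (chart_inv c x))))"
 proof (rule nn_integral_mono)
  fix x
  show "ind (ball a s) x * enn ((SU k. h $ k * pt k (loc c f) x)^2)
   <= enn (h \<bullet> h * M) * (enn (ind (im c) x * vol c x) * enn (gi f f (chart_inv c x)))"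
  proof (cases "x : ball a s")
   case True
   hence x: "x : cball a s" "x : im c" using K by auto
   have "(SU k. h $ k * pt k (loc c f) x)^2 = (h \<bullet> dloc c f x)^2" by (simp add: inner_vec_def)
   also have "... <= (h \<bullet> h) * (dloc c f x \<bullet> dloc c f x)" by (rule Cauchy_Schwarz_ineq)
   also have "dloc c f x \<bullet> dloc c f x <= M * (vol c x * gi f f (chart_inv c x))"
    using M(2)[OF x(1), of "%i. pt i (loc c f) x"] grad_inner_eq[OF c chart_inv_in[OF x(2)] s s] chart_chart_inv[OF x(2)]
    by (simp add: inner_vec_def power2_eq_square acoef_def sum_distrib_left mult_ac)
   hence "(h \<bullet> h) * (dloc c f x \<bullet> dloc c f x) <= (h \<bullet> h * M) * (vol c x * gi f f (chart_inv c x))"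
    by (simp add: mult_left_mono mult.assoc)
   finally have "enn ((SU k. h $ k * pt k (loc c f) x)^2) <= enn ((h \<bullet> h * M) * (vol c x * gi f f (chart_inv c x)))"
    by (rule ennreal_leI)
   also have "... = enn (h \<bullet> h * M) * (enn (vol c x) * enn (gi f f (chart_inv c x)))"
    using M(1) vol_pos[OF c x(2)] nn by (simp add: ennreal_mult)
   finally show ?thesis using True x(2) by simp
  qed simp
 qed
 also have "... = enn (h \<bullet> h * M) * (NV q. enn (ind (fst c) q) * enn (gi f f q))"
  by (subst nn_integral_cmult) (simp_all add: nn_integral_chart[OF c])
 also have "... <= enn (h \<bullet> h * M) * (NV q. enn (gi f f q))"
  by (intro mult_left_mono nn_integral_mono) (auto simp: indicator_def)
 also have "(NV q. enn (gi f f q)) = enn (NI p. gi f f p)"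
  by (rule nn_integral_eq_integral) (use gi_integrable[OF f s, of "%_. 1"] nn in auto)
 finally show ?thesis using M(1) Bochner_Integration.integral_nonneg[of nu "gi f f"] nn by (simp add: ennreal_mult)
qed

lemma N2_nu:
 assumes c: "c : A" and K: "cball a s <= im c" and M: "0 < M" "!!x. x : cball a s ==> vol c x <= M" "!!x. x : cball a s ==> 1 <= M * vol c x"
  and f: "f : bmb"
 defines "W == {q : fst c. snd c q : ball a s}"
 shows "N2 a s (loc c f) <= enn M * (NV q. ind W q * enn ((f q)^2))"
  and "(NV q. ind W q * enn ((f q)^2)) <= enn M * N2 a s (loc c f)"
proof -
 have W: "open W" unfolding W_def by (rule open_chart_vimage[OF c open_ball])
 note [measurable] = f borel_open[OF W] chart_inv_measurable[OF c] im_measurable[OF c vol_continuous[OF c]]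
 have "(NV q. ind W q * enn ((f q)^2)) = (NV q. enn (ind (fst c) q) * (ind W q * enn ((f q)^2)))"
  by (rule nn_integral_cong) (auto simp: indicator_def W_def)
 also have "... = (NN x. enn (ind (im c) x * vol c x) * (ind W (chart_inv c x) * enn ((loc c f x)^2)))"
  by (rule nn_integral_chart[OF c]) measurable
 finally have eq: "(NV q. ind W q * enn ((f q)^2)) = ..." .
 have p: "enn (ind (im c) x * vol c x) * (ind W (chart_inv c x) * enn ((loc c f x)^2))
   = ind (ball a s) x * (enn (vol c x) * enn ((loc c f x)^2))" for x
 proof (cases "x : im c")
  case True
  hence "chart_inv c x : W \<longleftrightarrow> x : ball a s" by (simp only: W_def mem_Collect_eq chart_inv_in chart_chart_inv simp_thms)
  thus ?thesis using True by (simp add: indicator_def)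
 next
  case False
  hence "x ~: ball a s" using K ball_subset_cball by blast
  thus ?thesis using False by simp
 qed
 have nn: "x : ball a s ==> 0 < vol c x" for x using vol_pos[OF c, of x] K ball_subset_cball by blast
 have "(NV q. ind W q * enn ((f q)^2)) <= (NN x. enn M * (ind (ball a s) x * enn ((loc c f x)^2)))"
  unfolding eq p by (rule nn_integral_mono) (use M(2) in "auto simp: indicator_def intro!: mult_right_mono ennreal_leI")
 thus "(NV q. ind W q * enn ((f q)^2)) <= enn M * N2 a s (loc c f)"
  unfolding N2_def by (simp add: nn_integral_cmult)
 have "N2 a s (loc c f) <= (NN x. enn M * (enn (ind (im c) x * vol c x) * (ind W (chart_inv c x) * enn ((loc c f x)^2))))"
  unfolding N2_def p
 proof (rule nn_integral_mono)
  fix x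
  show "ind (ball a s) x * enn ((loc c f x)^2) <= enn M * (ind (ball a s) x * (enn (vol c x) * enn ((loc c f x)^2)))"
  proof (cases "x : ball a s")
   case True
   have "1 * (loc c f x)^2 <= (M * vol c x) * (loc c f x)^2" by (rule mult_right_mono[OF M(3)]) (use True in auto)
   from ennreal_leI[OF this] show ?thesis using True M(1) nn[OF True] by (simp add: ennreal_mult mult.assoc)
  qed simp
 qed
 thus "N2 a s (loc c f) <= enn M * (NV q. ind W q * enn ((f q)^2))"
  unfolding eq by (simp add: nn_integral_cmult)
qed

lemma test_measurable: "test f ==> f : bmb"
 by (rule borel_measurable_continuous_onI[OF smooth_fun_continuous[OF test_smooth]])

text \<open>The chart-free counterpart of \<open>N2\<close>, in which limits found in different
  charts can be compared.\<close>

definition nsq :: "'m set => ('m => real) => ennreal" where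
 "nsq W a = (NV q. ind W q * enn ((a q)^2))"

lemma nsq_le: "W <= W' ==> (!!q. q : W ==> (a q)^2 <= (b q)^2) ==> nsq W a <= nsq W' b"
 unfolding nsq_def by (intro nn_integral_mono) (auto simp: indicator_def intro: ennreal_leI)

lemma nsq_add:
 assumes [measurable]: "a : bmb" "b : bmb" "W : sets borel"
 shows "nsq W (%q. a q + b q) <= 2 * nsq W a + 2 * nsq W b"
proof -
 have sq: "(v + w)^2 <= 2 * v^2 + 2 * w^2" for v w :: real
  using zero_le_power2[of "v - w"] by (simp add: power2_eq_square algebra_simps)
 have "nsq W (%q. a q + b q) <= (NV q. 2 * (ind W q * enn ((a q)^2)) + 2 * (ind W q * enn ((b q)^2)))"
  unfolding nsq_def
 proof (rule nn_integral_mono)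
  fix q
  have "enn ((a q + b q)^2) <= 2 * enn ((a q)^2) + 2 * enn ((b q)^2)"
   using ennreal_leI[OF sq[of "a q" "b q"]] by (simp add: ennreal_mult)
  thus "ind W q * enn ((a q + b q)^2) <= 2 * (ind W q * enn ((a q)^2)) + 2 * (ind W q * enn ((b q)^2))"
   by (cases "q : W") auto
 qed
 thus ?thesis by (simp add: nsq_def nn_integral_add nn_integral_cmult)
qed

lemma N2_le_nsq:
 assumes V: "open V" "q : V" and c: "c : A" "q : fst c" and r: "0 < r"
 obtains de M where "0 < de" "de <= r" "cball (snd c q) de <= im c" "0 < M"
  "!!f. f : bmb ==> N2 (snd c q) de (loc c f) <= enn M * nsq V f"
proof -
 let ?b = "snd c q"
 have "open {x : im c. chart_inv c x : V}" "?b : {x : im c. chart_inv c x : V}"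
  using open_chart_image[OF c(1) V(1)] V(2) c(2) chart_inv_chart[OF c] by auto
 then obtain d where d: "0 < d" "cball ?b d <= {x : im c. chart_inv c x : V}"
  using open_contains_cball[of "{x : im c. chart_inv c x : V}"] by blast
 define de where "de = min d r"
 have de: "0 < de" "de <= r" "cball ?b de <= {x : im c. chart_inv c x : V}" using d r by (auto simp: de_def)
 hence K: "cball ?b de <= im c" by blast
 obtain M where M: "0 < M" "!!x. x : cball ?b de ==> vol c x <= M" "!!x. x : cball ?b de ==> 1 <= M * vol c x"
  using chart_ball_bounds[OF c(1) K, of thesis] by blast
 have W: "{q : fst c. snd c q : ball ?b de} <= V"
 proof
  fix z assume z: "z : {q : fst c. snd c q : ball ?b de}"
  hence "snd c z : cball ?b de" by simp
  hence "chart_inv c (snd c z) : V" using de(3) by blast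
  thus "z : V" using z chart_inv_chart[OF c(1), of z] by simp
 qed
 show ?thesis
 proof (rule that[OF de(1,2) K M(1)])
  fix f :: "'m => real" assume f: "f : bmb"
  show "N2 ?b de (loc c f) <= enn M * nsq V f"
   by (rule order_trans[OF N2_nu(1)[OF c(1) K M f, folded nsq_def] mult_left_mono[OF nsq_le[OF W]]]) simp_all
 qed
qed

end

section \<open>Energy-minimising sequences and parabolicity\<close>

text \<open>The weight anchors the variational problem at \<open>p0\<close>; the Dirichlet energy
  alone need not bound any local L2 norm of a test function.\<close>

locale weighted_manifold = density_manifold A g \<phi>
 for A :: "('m::{t2_space, second_countable_topology}, 'n::finite) chart set" and g \<phi> +
 fixes rh :: "'m => real" and p0 :: 'm
 assumes weight: "test rh" and weight_nonneg: "!!p. 0 <= rh p" and weight_pos: "0 < rh p0"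
begin

lemma weight_continuous: "continuous_on UNIV rh"
 by (rule smooth_fun_continuous[OF test_smooth[OF weight]])

lemma dirichlet_integrable: "test f ==> integrable nu (gi f f)"
 using gi_integrable[of f f "%_. 1"] test_smooth[of f] by simp

lemma dirichlet_nonneg: "test f ==> 0 <= (NI p. gi f f p)"
 by (rule Bochner_Integration.integral_nonneg) (rule gi_nonneg[OF test_smooth])

lemma weight_integrable: "smooth_fun A u ==> integrable nu (%p. rh p * u p)"
 using test_integrable[OF weight smooth_fun_continuous, of u] by (simp add: mult.commute)

lemma weight_square_nonneg: "0 <= (NI p. rh p * (u p)^2)"
 by (rule Bochner_Integration.integral_nonneg) (simp add: weight_nonneg)

lemma energy_eq: assumes f: "test f" shows "qf rh f f = (NI p. gi f f p) + (NI p. rh p * (f p)^2)"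
 unfolding qf_def power2_eq_square mult.assoc
 by (rule Bochner_Integration.integral_add[OF dirichlet_integrable[OF f]])
  (rule weight_integrable[OF smooth_fun_mult[OF test_smooth[OF f] test_smooth[OF f]]])

lemma energy_ge: assumes f: "test f" shows "0 <= qf rh f f" "(NI p. gi f f p) <= qf rh f f" "(NI p. rh p * (f p)^2) <= qf rh f f"
 using dirichlet_nonneg[OF f] weight_square_nonneg[of f] energy_eq[OF f] by simp_all

text \<open>A local Poincare-type bound with a constant uniform over all test functions. It is
  evident where \<open>rh\<close> is positive; the set of such points is open by its definition and
  closed by \<open>controlled_closed\<close>, so connectedness gives it everywhere.\<close>

definition controlled :: "'m => bool" where
 "controlled p \<longleftrightarrow> (EX V C. open V & p : V & 0 <= C &
   (ALL f. test f --> nsq V f <= enn (C * qf rh f f)))"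

lemma controlled_p0: "controlled p0"
 unfolding controlled_def
proof (intro exI[of _ "{p. rh p0 / 2 < rh p}"] exI[of _ "2 / rh p0"] conjI allI impI)
 show "open {p. rh p0 / 2 < rh p}" by (rule open_Collect_less[OF continuous_on_const weight_continuous])
 fix f assume f: "test f"
 have "nsq {p. rh p0 / 2 < rh p} f <= (NV q. enn (2 / rh p0 * (rh q * (f q)^2)))"
  unfolding nsq_def
 proof (rule nn_integral_mono)
  fix q
  show "ind {p. rh p0 / 2 < rh p} q * enn ((f q)^2) <= enn (2 / rh p0 * (rh q * (f q)^2))"
  proof (cases "rh p0 / 2 < rh q")
   case True
   hence "1 * (f q)^2 <= (2 / rh p0 * rh q) * (f q)^2" using weight_pos by (intro mult_right_mono) (auto simp: field_simps)
   thus ?thesis using True by (simp add: ennreal_leI mult.assoc)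
  qed simp
 qed
 also have "... = enn (2 / rh p0 * (NI q. rh q * (f q)^2))"
  using weight_integrable[OF smooth_fun_mult[OF test_smooth[OF f] test_smooth[OF f]]] weight_nonneg weight_pos
  by (subst nn_integral_eq_integral) (auto simp: power2_eq_square)
 also have "... <= enn (2 / rh p0 * qf rh f f)"
  using energy_ge(3)[OF f] weight_pos by (intro ennreal_leI mult_left_mono) auto
 finally show "nsq {p. rh p0 / 2 < rh p} f <= enn (2 / rh p0 * qf rh f f)" .
qed (use weight_pos in auto)

lemma controlled_ball:
 assumes q: "controlled q" and c: "c : A" "q : fst c" and r: "0 < r"
 obtains de C where "0 < de" "de <= r" "cball (snd c q) de <= im c" "0 <= C"
  "!!f. test f ==> N2 (snd c q) de (loc c f) <= enn (C * qf rh f f)"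
proof -
 obtain V C where V: "open V" "q : V" "0 <= C" "!!f. test f ==> nsq V f <= enn (C * qf rh f f)"
  using q unfolding controlled_def by blast
 obtain de M where de: "0 < de" "de <= r" "cball (snd c q) de <= im c" "0 < M"
  "!!f. f : bmb ==> N2 (snd c q) de (loc c f) <= enn M * nsq V f"
  using N2_le_nsq[OF V(1,2) c r, of thesis] by blast
 show ?thesis
 proof (rule that[OF de(1,2,3), of "M * C"])
  fix f assume f: "test f"
  have "N2 (snd c q) de (loc c f) <= enn M * enn (C * qf rh f f)"
   by (rule order_trans[OF de(5)[OF test_measurable[OF f]] mult_left_mono[OF V(4)[OF f]]]) simp
  thus "N2 (snd c q) de (loc c f) <= enn (M * C * qf rh f f)"
   using de(4) V(3) energy_ge(1)[OF f] by (simp add: ennreal_mult mult.assoc)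
 qed (use de V in auto)
qed

text \<open>A controlled point \<open>q\<close> is found close to \<open>p\<close>, and its ball of
  control is translated onto \<open>p\<close> within one chart. By \<open>translation_N2\<close> the
  cost is a gradient integral, which the energy bounds.\<close>

lemma controlled_closed: assumes p: "p : closure {q. controlled q}" shows "controlled p"
proof -
 obtain c where c: "c : A" "p : fst c" using chart_cover by blast
 let ?a = "snd c p"
 obtain r0 where r0: "0 < r0" "cball ?a r0 <= im c" using open_contains_cball[of "im c"] open_im[OF c(1)] c(2) by auto
 define r where "r = r0 / 2"
 have r: "0 < r" "cball ?a (2 * r) <= im c" using r0 by (simp_all add: r_def)
 obtain M where M: "0 < M" "!!x. x : cball ?a (2 * r) ==> vol c x <= M" "!!x. x : cball ?a (2 * r) ==> 1 <= M * vol c x"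
  "!!x p. x : cball ?a (2 * r) ==> (SU i. (p i)^2) <= M * (SU i. SU j. acoef c i j x * p i * p j)"
  using chart_ball_bounds[OF c(1) r(2), of thesis] by blast
 let ?W = "{q : fst c. snd c q : ball ?a r}"
 have "~ {q. controlled q} <= - ?W"
 proof
  assume "{q. controlled q} <= - ?W"
  hence "closure {q. controlled q} <= - ?W"
   by (rule closure_minimal) (use open_chart_vimage[OF c(1) open_ball] in "simp only: closed_Compl")
  thus False using p c(2) r(1) by auto
 qed
 then obtain q where q: "controlled q" "q : fst c" "snd c q : ball ?a r" by blast
 let ?b = "snd c q"
 obtain de C where de: "0 < de" "de <= r" "cball ?b de <= im c" "0 <= C" "!!f. test f ==> N2 ?b de (loc c f) <= enn (C * qf rh f f)"
  using controlled_ball[OF q(1) c(1) q(2) r(1), of thesis] by blast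
 define h where "h = ?a - ?b"
 let ?V = "{z : fst c. snd c z : ball ?a de}" and ?C = "M * (exp 1 * (C + h \<bullet> h * M))"
 have C0: "0 <= h \<bullet> h * M" using M(1) by simp
 have sub: "cball ?a de <= cball ?a (2 * r)" using de(2) r(1) by (intro subset_cball) linarith
 have K: "cball ?a de <= im c" using sub r(2) by blast
 show ?thesis
  unfolding controlled_def
 proof (intro exI[of _ ?V] exI[of _ ?C] conjI allI impI)
  show "open ?V" by (rule open_chart_vimage[OF c(1) open_ball])
  fix f assume f: "test f"
  note E = energy_ge[OF f]
  have "N2 (?b + h) de (loc c f) <= enn (exp 1) * (N2 ?b de (loc c f) +
   (NN x. ind (ball ?a (2 * r)) x * enn ((SU k. h $ k * pt k (loc c f) x)^2)))"
  proof (rule translation_N2[OF open_im[OF c(1)] _ smooth_loc[OF test_smooth[OF f] c(1)]])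
   show "ball ?a (2 * r) <= im c" using r(2) ball_subset_cball by blast
   show "loc c f : bmb" by (rule measurable_compose[OF chart_inv_measurable[OF c(1)] test_measurable[OF f]])
   fix y and t :: real assume y: "y : ball ?b de" and t: "0 <= t" "t <= 1"
   have "norm (y + t *. h - ?a) = norm ((y - ?b) + (1 - t) *. (?b - ?a))" by (simp add: h_def algebra_simps)
   also have "... <= norm (y - ?b) + abs (1 - t) * norm (?b - ?a)" by (rule order_trans[OF norm_triangle_ineq]) simp
   also have "... <= norm (y - ?b) + 1 * norm (?b - ?a)" using t by (intro add_left_mono mult_right_mono) auto
   also have "... < 2 * r" using y q(3) de(2) by (simp add: dist_norm norm_minus_commute)
   finally show "y + t *. h : ball ?a (2 * r)" by (simp add: dist_norm norm_minus_commute)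
  qed
  also have "... <= enn (exp 1) * (enn (C * qf rh f f) + enn (h \<bullet> h * M * qf rh f f))"
  proof (intro mult_left_mono add_mono de(5)[OF f])
   show "(NN x. ind (ball ?a (2 * r)) x * enn ((SU k. h $ k * pt k (loc c f) x)^2)) <= enn (h \<bullet> h * M * qf rh f f)"
    by (rule order_trans[OF nn_integral_gradient_ball[OF c(1) r(2) M(1,4) f]]) (use C0 E in "auto intro!: ennreal_leI mult_left_mono")
  qed simp
  also have "... = enn (exp 1 * (C + h \<bullet> h * M) * qf rh f f)"
  proof -
   have "enn k * (enn x + enn y) = enn (k * (x + y))" if "0 <= x" "0 <= y" "0 <= k" for k x y
    using that by (simp add: ennreal_mult)
   from this[of "C * qf rh f f" "h \<bullet> h * M * qf rh f f" "exp 1"] show ?thesis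
    using de(4) mult_nonneg_nonneg[OF C0 E(1)] E(1) by (simp add: distrib_right mult.assoc)
  qed
  finally have N: "N2 ?a de (loc c f) <= enn (exp 1 * (C + h \<bullet> h * M) * qf rh f f)" by (simp add: h_def)
  have "nsq ?V f <= enn M * N2 ?a de (loc c f)"
   by (rule N2_nu(2)[OF c(1) K M(1) _ _ test_measurable[OF f], folded nsq_def]) (use M(2,3) sub in blast)+
  also have "... <= enn M * enn (exp 1 * (C + h \<bullet> h * M) * qf rh f f)" by (rule mult_left_mono[OF N]) simp
  also have "... = enn (?C * qf rh f f)" using M(1) de(4) C0 E(1) by (simp add: ennreal_mult[symmetric] mult.assoc)
  finally show "nsq ?V f <= enn (?C * qf rh f f)" .
 qed (use c(2) de(1,4) M(1) C0 in auto)
qed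

lemma all_controlled: "controlled p"
proof -
 have "open {q. controlled q}"
  by (subst open_subopen) (unfold controlled_def, blast)
 moreover have "closure {q. controlled q} <= {q. controlled q}" using controlled_closed by blast
 hence "closed {q. controlled q}" by (simp only: closure_subset_eq)
 moreover have "ALL T :: 'm set. open T & closed T --> T = {} \<or> T = UNIV" using conn unfolding connected_clopen by simp
 ultimately show ?thesis using controlled_p0 by blast
qed

text \<open>By \<open>J_eq\<close> this is the Dirichlet energy plus the integral of
  \<open>rh * (f - 1)^2\<close>. The form used here makes the expansion along lines
  immediate.\<close>

definition J :: "('m => real) => real" where
 "J f = qf rh f f - 2 * (NI p. rh p * f p) + (NI p. rh p)"

lemma J_eq: assumes f: "test f" shows "J f = (NI p. gi f f p) + (NI p. rh p * (f p - 1)^2)"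
proof -
 note s = test_smooth[OF f]
 have "(NI p. rh p * (f p - 1)^2) = (NI p. (rh p * (f p)^2 - 2 * (rh p * f p)) + rh p)"
  by (simp add: power2_diff algebra_simps)
 also have "... = (NI p. rh p * (f p)^2) - 2 * (NI p. rh p * f p) + (NI p. rh p)"
  using weight_integrable[OF smooth_fun_mult[OF s s]] weight_integrable[OF s] weight_integrable[OF smooth_fun_const, of 1]
  by (simp add: power2_eq_square)
 finally show ?thesis unfolding J_def energy_eq[OF f] by simp
qed

lemma J_nonneg: "test f ==> 0 <= J f"
 using J_eq[of f] dirichlet_nonneg[of f] weight_square_nonneg[of "%p. f p - 1"] by simp

lemma J_expand: assumes f: "test f" and k: "test k"
 shows "J (%p. f p + t * k p) = J f + 2 * t * (qf rh f k - (NI p. rh p * k p)) + t^2 * qf rh k k"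
proof -
 have "(NI p. rh p * (f p + t * k p)) = (NI p. rh p * f p + t * (rh p * k p))" by (simp add: algebra_simps)
 also have "... = (NI p. rh p * f p) + t * (NI p. rh p * k p)"
  using weight_integrable[OF test_smooth[OF f]] weight_integrable[OF test_smooth[OF k]] by simp
 finally show ?thesis unfolding J_def qf_expand[OF weight_continuous f k] by (simp add: algebra_simps)
qed

definition Jmin :: real where "Jmin = Inf (J ` {f. test f})"

lemma Jmin_le: "test f ==> Jmin <= J f"
 unfolding Jmin_def by (rule cInf_lower) (auto intro!: bdd_belowI[of _ 0] J_nonneg)

text \<open>On the line \<open>f + t * k\<close> the quadratic polynomial \<open>J - Jmin\<close>
  never becomes negative, so its discriminant is at most 0. This is the Euler-Lagrange equation with
  an explicit error, for any test function \<open>f\<close> in place of a minimiser.\<close>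

lemma first_variation: assumes f: "test f" and k: "test k"
 shows "(qf rh f k - (NI p. rh p * k p))^2 <= (J f - Jmin) * qf rh k k"
proof (rule discriminant_le[OF _ energy_ge(1)[OF k]])
 show "0 <= J f - Jmin + 2 * t * (qf rh f k - (NI p. rh p * k p)) + t^2 * qf rh k k" for t
  using Jmin_le[OF test_add[OF f test_cmult[OF k, of t]]] J_expand[OF f k, of t] by simp
qed

text \<open>The midpoint of \<open>f\<close> and \<open>k\<close> has \<open>J\<close> at least
  \<open>Jmin\<close>, which bounds the energy of the difference; minimising sequences are therefore
  Cauchy in energy.\<close>

lemma J_parallelogram: assumes f: "test f" and k: "test k"
 shows "qf rh (%p. f p - k p) (%p. f p - k p) <= 2 * (J f - Jmin) + 2 * (J k - Jmin)"
proof -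
 let ?d = "%p. f p - k p"
 have d: "test ?d" by (rule test_diff[OF f k])
 have "J f = J k + 2 * (qf rh k ?d - (NI p. rh p * ?d p)) + qf rh ?d ?d"
  using J_expand[OF k d, of 1] by simp
 moreover have "Jmin <= J k + (qf rh k ?d - (NI p. rh p * ?d p)) + qf rh ?d ?d / 4"
  using J_expand[OF k d, of "1/2"] Jmin_le[OF test_add[OF k test_cmult[OF d, of "1/2"]]] by (simp add: power2_eq_square)
 moreover have "e <= 2 * (a - m) + 2 * (b - m)" if "a = b + 2 * x + e" "m <= b + x + e / 4" for a b m x e :: real
  using that(2) unfolding that(1) by (simp add: algebra_simps)
 ultimately show ?thesis by blast
qed

definition minimizing :: "(nat => 'm => real) => bool" where
 "minimizing f \<longleftrightarrow> (ALL n. test (f n)) & (%n. J (f n)) ~~> Jmin"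

lemma exists_minimizing: "EX f. minimizing f"
proof -
 have "EX f. test f & J f < Jmin + 1 / real (Suc n)" for n
 proof -
  have "J ` {f. test f} ~= {}" using test_zero by blast
  hence "EX y:J ` {f. test f}. y < Jmin + 1 / real (Suc n)"
   unfolding Jmin_def by (intro cInf_lessD) (simp_all add: add_pos_pos)
  thus ?thesis by blast
 qed
 then obtain f where f: "!!n. test (f n)" "!!n. J (f n) < Jmin + 1 / real (Suc n)" by metis
 have "(%n. J (f n)) ~~> Jmin"
 proof (rule tendsto_sandwich[OF _ _ tendsto_const])
  show "(%n. Jmin + 1 / real (Suc n)) ~~> Jmin"
   using tendsto_add[OF tendsto_const[of Jmin] LIMSEQ_inverse_real_of_nat] by (simp add: inverse_eq_divide)
  show "EV n. J (f n) <= Jmin + 1 / real (Suc n)"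
   by (rule always_eventually, rule allI, rule less_imp_le, rule f(2))
 qed (use f(1) Jmin_le in simp)
 thus ?thesis using f unfolding minimizing_def by blast
qed

lemma minimizing_difference:
 assumes "minimizing f" "minimizing k"
 shows "(%n. qf rh (%p. f n p - k n p) (%p. f n p - k n p)) ~~> 0"
proof (rule tendsto_sandwich[OF _ _ tendsto_const])
 have "(%n. 2 * (J (f n) - Jmin) + 2 * (J (k n) - Jmin)) ~~> 2 * (Jmin - Jmin) + 2 * (Jmin - Jmin)"
  using assms by (intro tendsto_intros) (auto simp: minimizing_def)
 thus "(%n. 2 * (J (f n) - Jmin) + 2 * (J (k n) - Jmin)) ~~> 0" by simp
 show "EV n. qf rh (%p. f n p - k n p) (%p. f n p - k n p) <= 2 * (J (f n) - Jmin) + 2 * (J (k n) - Jmin)"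
  using assms J_parallelogram by (simp add: minimizing_def)
 show "EV n. 0 <= qf rh (%p. f n p - k n p) (%p. f n p - k n p)"
  using assms energy_ge(1)[OF test_diff] by (simp add: minimizing_def)
qed

end

section \<open>Local L2 limits on the manifold\<close>

context density_manifold begin

text \<open>Finite measure of \<open>W\<close> is recorded because \<open>abs_smooth\<close> needs a
  uniformly small error to be small in \<open>nsq W\<close> as well.\<close>

definition L2loc :: "(nat => 'm => real) => ('m => real) => bool" where
 "L2loc f u \<longleftrightarrow> (ALL p. EX W. open W & p : W & emeasure nu W < \<infinity> & (%n. nsq W (%q. f n q - u q)) ~~> 0)"

lemma nsq_tendsto_add:
 assumes "!!n. a n : bmb" "!!n. b n : bmb" "open W"
  and "(%n. nsq W (a n)) ~~> 0" "(%n. nsq W (b n)) ~~> 0"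
 shows "(%n. nsq W (%q. a n q + b n q)) ~~> 0"
proof (rule tendsto_sandwich[OF _ _ tendsto_const])
 have "(%n. 2 * nsq W (a n) + 2 * nsq W (b n)) ~~> 2 * 0 + 2 * 0"
  by (intro tendsto_add ennreal_tendsto_cmult assms) simp_all
 thus "(%n. 2 * nsq W (a n) + 2 * nsq W (b n)) ~~> 0" by simp
 show "EV n. nsq W (%q. a n q + b n q) <= 2 * nsq W (a n) + 2 * nsq W (b n)"
  by (intro always_eventually allI nsq_add assms borel_open)
qed simp

lemma nsq_tendsto_le:
 assumes "!!n. nsq V (b n) <= nsq W (a n)" "(%n. nsq W (a n)) ~~> 0" shows "(%n. nsq V (b n)) ~~> 0"
 by (rule tendsto_sandwich[OF _ _ tendsto_const assms(2)]) (simp_all add: assms(1))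

lemma nsq_eq_0:
 assumes W: "open W" and a: "continuous_on W a" "a : bmb" and 0: "nsq W a = 0" and q: "q : W"
 shows "a q = 0"
proof -
 let ?D = "W \<inter> a -` (- {0})"
 have D: "open ?D" by (rule continuous_open_preimage[OF a(1) W]) (intro open_Compl closed_singleton)
 note [measurable] = a(2) borel_open[OF W]
 have "AE q in nu. ind W q * enn ((a q)^2) = 0" using 0 unfolding nsq_def by (subst (asm) nn_integral_0_iff_AE) auto
 hence "AE q in nu. q ~: ?D" by eventually_elim (auto simp: indicator_def split: if_splits)
 hence "?D : null_sets nu" using D by (subst AE_iff_null_sets) (simp_all add: sets_nu)
 hence "?D = {}" using nu_open_null[OF D] by auto
 thus ?thesis using q by auto
qed

lemma L2loc_unique:
 assumes f: "!!n. f n : bmb" and W: "open W"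
  and u: "continuous_on W u" "u : bmb" "(%n. nsq W (%q. f n q - u q)) ~~> 0"
  and v: "continuous_on W v" "v : bmb" "(%n. nsq W (%q. f n q - v q)) ~~> 0" and q: "q : W"
 shows "u q = v q"
proof -
 have "nsq W (%q. v q - f n q) = nsq W (%q. f n q - v q)" for n by (simp add: nsq_def power2_commute)
 hence "(%n. nsq W (%q. (f n q - u q) + (v q - f n q))) ~~> 0"
  by (intro nsq_tendsto_add W borel_measurable_diff f u v) (simp add: v(3))
 hence "nsq W (%q. v q - u q) = 0" by (simp add: LIMSEQ_const_iff)
 thus ?thesis using nsq_eq_0[OF W continuous_on_diff[OF v(1) u(1)] borel_measurable_diff[OF v(2) u(2)] _ q] by simp
qed

text \<open>The negative part of \<open>u\<close> is bounded pointwise by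
  \<open>abs (f n - u)\<close>, hence has norm 0, and it is continuous.\<close>

lemma L2loc_nonneg:
 assumes L: "L2loc f u" and u: "continuous_on UNIV u" and f: "!!n q. 0 <= f n q" shows "0 <= u q"
proof -
 obtain W where W: "open W" "q : W" "(%n. nsq W (%q. f n q - u q)) ~~> 0" using L unfolding L2loc_def by blast
 let ?u = "%q. min (u q) 0"
 have c: "continuous_on UNIV ?u" by (intro continuous_intros u)
 have le: "nsq W ?u <= nsq W (%q. f n q - u q)" for n
 proof (rule nsq_le[OF order_refl])
  show "(min (u q) 0)^2 <= (f n q - u q)^2" for q
   by (rule abs_le_square_iff[THEN iffD1]) (use f[of n q] in \<open>cases "u q <= 0", simp_all add: min_def\<close>)
 qed
 have "nsq W ?u <= 0" by (rule tendsto_lowerbound[OF W(3)]) (simp_all add: le)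
 thus ?thesis
  using nsq_eq_0[OF W(1) continuous_on_subset[OF c] borel_measurable_continuous_onI[OF c] _ W(2)] by (simp add: min_def split: if_splits)
qed

lemma L2loc_N2:
 assumes L: "L2loc f u" and m: "!!n. f n : bmb" "u : bmb" and c: "c : A" "p : fst c"
 shows "EX r>0. cball (snd c p) r <= im c & (%n. N2 (snd c p) r (%x. loc c (f n) x - loc c u x)) ~~> 0"
proof -
 obtain W where W: "open W" "p : W" "(%n. nsq W (%q. f n q - u q)) ~~> 0" using L unfolding L2loc_def by blast
 obtain r M where r: "0 < r" "cball (snd c p) r <= im c" "!!f. f : bmb ==> N2 (snd c p) r (loc c f) <= enn M * nsq W f"
  using N2_le_nsq[OF W(1,2) c zero_less_one, of thesis] by blast
 have "(%n. N2 (snd c p) r (%x. loc c (f n) x - loc c u x)) ~~> 0"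
 proof (rule tendsto_sandwich[OF _ _ tendsto_const])
  show "(%n. enn M * nsq W (%q. f n q - u q)) ~~> 0" using ennreal_tendsto_cmult[OF _ W(3), of "enn M"] by simp
  show "EV n. N2 (snd c p) r (%x. loc c (f n) x - loc c u x) <= enn M * nsq W (%q. f n q - u q)"
   by (intro always_eventually allI r(3) borel_measurable_diff m)
 qed simp
 thus ?thesis using r by blast
qed

text \<open>The chart limit \<open>V\<close> is transplanted to the manifold as \<open>v\<close>,
  extended by 0: Borel everywhere and continuous on \<open>W\<close>, which is what
  \<open>L2loc_unique\<close> needs to compare two such limits.\<close>

lemma glue_point:
 assumes f: "!!n. f n : bmb" and c: "c : A" "p : fst c" and r: "0 < r" "cball (snd c p) r <= im c"
  and V: "smooth_on (ball (snd c p) r) V" "(%n. N2 (snd c p) r (%x. loc c (f n) x - V x)) ~~> 0"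
  and W_def: "W = {q : fst c. snd c q : ball (snd c p) r}" and v_def: "v = (%q. ind W q * V (snd c q))"
 shows "open W" "p : W" "emeasure nu W < \<infinity>" "continuous_on W v" "v : bmb"
  "(%n. nsq W (%q. f n q - v q)) ~~> 0" "smooth_on (ball (snd c p) r) (loc c v)" "!!x. x : ball (snd c p) r ==> chart_inv c x : W"
proof -
 let ?B = "ball (snd c p) r"
 show W: "open W" unfolding W_def by (rule open_chart_vimage[OF c(1) open_ball])
 show "p : W" using c r by (simp add: W_def)
 have B: "?B <= im c" using r(2) ball_subset_cball by blast
 show inW: "chart_inv c x : W" if "x : ?B" for x
  using that subsetD[OF B that] by (simp only: W_def mem_Collect_eq chart_inv_in chart_chart_inv simp_thms)
 have "W <= chart_inv c ` cball (snd c p) r"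
 proof
  fix q assume "q : W"
  hence "chart_inv c (snd c q) = q" "snd c q : cball (snd c p) r" by (auto simp: W_def chart_inv_chart[OF c(1)])
  thus "q : chart_inv c ` cball (snd c p) r" by (metis imageI)
 qed
 moreover have K: "compact (chart_inv c ` cball (snd c p) r)"
  by (intro compact_continuous_image continuous_on_subset[OF chart_inv_continuous[OF c(1)] r(2)]) simp
 ultimately have "emeasure nu W <= emeasure nu (chart_inv c ` cball (snd c p) r)"
  by (intro emeasure_mono) (simp_all add: sets_nu compact_imp_closed borel_closed)
 thus "emeasure nu W < \<infinity>" using emeasure_nu_compact[OF K] by (rule le_less_trans)
 have cV: "continuous_on W (%q. V (snd c q))"
  by (rule continuous_on_compose2[OF smooth_on_continuous[OF V(1)] continuous_on_subset[OF chart_continuous[OF c(1)]]]) (auto simp: W_def)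
 thus "continuous_on W v" by (simp add: v_def cong: continuous_on_cong)
 show m: "v : bmb" using borel_measurable_continuous_on_indicator[OF borel_open[OF W] cV] by (simp add: v_def)
 have vc: "loc c v x = V x" if "x : ?B" for x
  using inW[OF that] chart_chart_inv[OF subsetD[OF B that]] by (simp add: v_def)
 show "smooth_on ?B (loc c v)" by (rule smooth_on_cong[OF open_ball V(1)]) (simp only: vc)
 obtain M where M: "0 < M" "!!x. x : cball (snd c p) r ==> vol c x <= M" "!!x. x : cball (snd c p) r ==> 1 <= M * vol c x"
  using chart_ball_bounds[OF c(1) r(2), of thesis] by blast
 show "(%n. nsq W (%q. f n q - v q)) ~~> 0"
 proof (rule tendsto_sandwich[OF _ _ tendsto_const])
  show "(%n. enn M * N2 (snd c p) r (%x. loc c (f n) x - V x)) ~~> 0" using ennreal_tendsto_cmult[OF _ V(2), of "enn M"] by simp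
  have "N2 (snd c p) r (%x. loc c (f n) x - loc c v x) = N2 (snd c p) r (%x. loc c (f n) x - V x)" for n
   by (rule N2_cong) (simp only: vc)
  thus "EV n. nsq W (%q. f n q - v q) <= enn M * N2 (snd c p) r (%x. loc c (f n) x - V x)"
   using N2_nu(2)[OF c(1) r(2) M, of "%q. f _ q - v q", folded nsq_def W_def] borel_measurable_diff[OF f m] by simp
 qed simp
qed

text \<open>Limits found around different points agree on overlaps, by uniqueness of L2 limits among
  continuous functions. The diagonal value \<open>v p p\<close> therefore defines a global function
  that equals \<open>v p\<close> on all of \<open>W p\<close>.\<close>

lemma L2loc_glue:
 assumes f: "!!n. f n : bmb"
  and loc: "!!p. EX c:A. EX r>0. p : fst c & cball (snd c p) r <= im c &
   (EX V. smooth_on (ball (snd c p) r) V & (%n. N2 (snd c p) r (%x. loc c (f n) x - V x)) ~~> 0)"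
 obtains u where "smooth_fun A u" "L2loc f u"
proof -
 let ?G = "%p W v. open W & p : W & emeasure nu W < \<infinity> & continuous_on W v & v : bmb &
  (%n. nsq W (%q. f n q - v q)) ~~> 0 &
  (EX c:A. EX r>0. p : fst c & ball (snd c p) r <= im c & smooth_on (ball (snd c p) r) (loc c v) & (ALL x:ball (snd c p) r. chart_inv c x : W))"
 have ex: "EX Wv. ?G p (fst Wv) (snd Wv)" for p
 proof -
  obtain c r V where c: "c : A" "p : fst c" "0 < r" "cball (snd c p) r <= im c" and V: "smooth_on (ball (snd c p) r) V"
   "(%n. N2 (snd c p) r (%x. loc c (f n) x - V x)) ~~> 0" using loc[of p] by blast
  note G = glue_point[OF f c V refl refl]
  have "ball (snd c p) r <= im c" using c(4) ball_subset_cball by blast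
  hence G': "?G p {q : fst c. snd c q : ball (snd c p) r} (%q. ind {q : fst c. snd c q : ball (snd c p) r} q * V (snd c q))"
   using G c(1-3) by blast
  show ?thesis by (rule exI[of _ "(_, _)"], unfold fst_conv snd_conv, rule G')
 qed
 define Wv where "Wv p = (SOME Wv. ?G p (fst Wv) (snd Wv))" for p
 define W where "W p = fst (Wv p)" for p
 define v where "v p = snd (Wv p)" for p
 have "?G p (W p) (v p)" for p using someI_ex[OF ex[of p]] unfolding W_def v_def Wv_def .
 hence W: "open (W p)" "p : W p" "emeasure nu (W p) < \<infinity>" "continuous_on (W p) (v p)" "v p : bmb"
  "(%n. nsq (W p) (%q. f n q - v p q)) ~~> 0"
  and S: "EX c:A. EX r>0. p : fst c & ball (snd c p) r <= im c & smooth_on (ball (snd c p) r) (loc c (v p)) & (ALL x:ball (snd c p) r. chart_inv c x : W p)" for p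
  by blast+
 define u where "u p = v p p" for p
 have u: "u q = v p q" if q: "q : W p" for p q
  unfolding u_def
 proof (rule L2loc_unique[where f = f and W = "W p \<inter> W q" and u = "v q" and v = "v p", OF f])
  show "continuous_on (W p \<inter> W q) (v q)" "continuous_on (W p \<inter> W q) (v p)"
   by (rule continuous_on_subset[OF W(4)], blast)+
  show "(%n. nsq (W p \<inter> W q) (%z. f n z - v q z)) ~~> 0" "(%n. nsq (W p \<inter> W q) (%z. f n z - v p z)) ~~> 0"
   by (rule nsq_tendsto_le[OF nsq_le W(6)[of q]], auto) (rule nsq_tendsto_le[OF nsq_le W(6)[of p]], auto)
 qed (use W q in auto)
 have "smooth_fun A u"
 proof (rule smooth_fun_localI)
  fix p
  obtain c r where c: "c : A" "0 < r" "p : fst c" "ball (snd c p) r <= im c" "smooth_on (ball (snd c p) r) (loc c (v p))"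
   "ALL x:ball (snd c p) r. chart_inv c x : W p" using S[of p] by blast
  have "smooth_on (ball (snd c p) r) (loc c u)" by (rule smooth_on_cong[OF open_ball c(5)]) (rule u[symmetric], use c(6) in blast)
  thus "EX c:A. EX W. open W & p : fst c & snd c p : W & W <= im c & smooth_on W (loc c u)"
   using c(1-4) by (intro bexI[of _ c] exI[of _ "ball (snd c p) r"]) auto
 qed
 moreover have eq: "nsq (W p) (%q. f n q - u q) = nsq (W p) (%q. f n q - v p q)" for n p
  unfolding nsq_def by (intro nn_integral_cong) (auto simp: indicator_def u)
 have "(%n. nsq (W p) (%q. f n q - u q)) ~~> 0" for p unfolding eq by (rule W(6))
 hence "L2loc f u" unfolding L2loc_def using W(1-3) by blast
 ultimately show ?thesis by (rule that)
qed

lemma L2loc_weak: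
 assumes L: "L2loc f u" and f: "!!n. continuous_on UNIV (f n)" and u: "continuous_on UNIV u" and k: "test k"
 shows "(%n. (NI p. f n p * k p)) ~~> (NI p. u p * k p)"
proof (rule test_induct[OF k])
 note m = borel_measurable_continuous_onI[OF f] borel_measurable_continuous_onI[OF u]
 fix h k assume *: "test h" "test k" "(%n. (NI p. f n p * h p)) ~~> (NI p. u p * h p)" "(%n. (NI p. f n p * k p)) ~~> (NI p. u p * k p)"
 thus "(%n. (NI p. f n p * (h p + k p))) ~~> (NI p. u p * (h p + k p))"
  unfolding distrib_left using test_integrable[OF *(1)] test_integrable[OF *(2)] f u by (simp add: tendsto_add)
next
 note m = borel_measurable_continuous_onI[OF f] borel_measurable_continuous_onI[OF u]
 fix p
 obtain c where c: "c : A" "p : fst c" using chart_cover by blast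
 obtain r where r: "0 < r" "cball (snd c p) r <= im c" "(%n. N2 (snd c p) r (%x. loc c (f n) x - loc c u x)) ~~> 0"
  using L2loc_N2[OF L m c] by blast
 let ?B = "ball (snd c p) r"
 have B: "?B <= im c" using r(2) ball_subset_cball by blast
 have "(%n. (NI p. f n p * lift c pp p)) ~~> (NI p. u p * lift c pp p)" if p: "csupp ?B pp" for pp
 proof -
  note pc = csupp_mono[OF p B]
  have b: "csupp ?B (%x. pp x * vol c x)" by (rule csupp_mult[OF open_ball p smooth_on_subset[OF smooth_vol[OF c(1)] B]])
  have lm: "loc c h : bmb" if "h : bmb" for h :: "'m => real"
   by (rule measurable_compose[OF chart_inv_measurable[OF c(1)] that])
  have I: "(NI p. h p * lift c pp p) = (LI x. pp x * vol c x * loc c h x)" if "continuous_on UNIV h" for h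
   using integral_lift[OF c(1) pc borel_measurable_continuous_onI[OF that]] by (simp add: mult.commute)
  have i: "integrable lborel (%x. pp x * vol c x * loc c h x)" if h: "continuous_on UNIV h" for h
  proof -
   have t: "(%q. h q * lift c pp q) = (%q. lift c pp q * h q)" by (simp add: mult.commute)
   have "integrable nu (%q. h q * lift c pp q)" by (rule test_integrable[OF test_lift[OF c(1) pc] h])
   moreover have "integrable nu (%q. h q * lift c pp q) \<longleftrightarrow> integrable lborel (%x. ind (im c) x * vol c x * loc c (%q. h q * lift c pp q) x)"
    by (rule integrable_chart[OF c(1) borel_measurable_times[OF borel_measurable_continuous_onI[OF h] test_measurable[OF test_lift[OF c(1) pc]]]])
     (simp add: lift_def)
   moreover have "ind (im c) x * vol c x * loc c (%q. h q * lift c pp q) x = pp x * vol c x * loc c h x" for x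
    using loc_lift[OF c(1), of x pp] csupp_outside[OF pc, of x] by (cases "x : im c") auto
   ultimately show ?thesis by simp
  qed
  have "(%n. (LI x. pp x * vol c x * (loc c (f n) x - loc c u x))) ~~> 0"
   by (rule N2_tendsto_integral[OF _ r(3) csupp_tfun[OF b] _ r(1)]) (use csupp_outside[OF b] lm m in auto)
  hence "(%n. (NI p. f n p * lift c pp p) - (NI p. u p * lift c pp p)) ~~> 0"
   unfolding right_diff_distrib using i[OF f] i[OF u] I[OF f] I[OF u] by simp
  thus ?thesis by (rule LIM_zero_cancel)
 qed
 thus "EX c:A. EX S. open S & p : fst c & snd c p : S & S <= im c &
  (ALL pp. csupp S pp --> (%n. (NI p. f n p * lift c pp p)) ~~> (NI p. u p * lift c pp p))"
  using c r(1) B by (intro bexI[of _ c] exI[of _ ?B]) auto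
qed

lemma qf_lift:
 assumes c: "c : A" and p: "csupp (im c) pp" and u: "smooth_fun A u" and V: "smooth_fun A V"
 shows "qf V (lift c pp) u = - (LI x. (ediv c pp x + - (vol c x * loc c V x) * pp x) * loc c u x)"
proof -
 note o = open_im[OF c] and t = test_lift[OF c p] and Vu = smooth_fun_mult[OF V u]
 have e: "csupp (im c) (ediv c pp)"
  unfolding ediv_def using csupp_sum[of UNIV "im c" "%j y. pt j pp y * acoef c i j y" for i] csupp_mult[OF o csupp_partial[OF p] smooth_acoef[OF c]]
  by (intro csupp_sum csupp_partial) (simp_all add: mult.commute)
 have "qf V (lift c pp) u = (NI q. gi (lift c pp) u q) + (NI q. lift c pp q * (V q * u q))"
  unfolding qf_def using gi_integrable[OF t u, of "%_. 1"] test_integrable[OF t smooth_fun_continuous[OF Vu]]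
  by (subst Bochner_Integration.integral_add[symmetric]) (simp_all add: mult_ac)
 also have "... = - (LI x. ediv c pp x * loc c u x) + (LI x. pp x * (vol c x * loc c (%q. V q * u q) x))"
  by (simp add: green_lift(2)[OF c p u] integral_lift[OF c p borel_measurable_continuous_onI[OF smooth_fun_continuous[OF Vu]]] mult.assoc)
 also have "... = - ((LI x. ediv c pp x * loc c u x) - (LI x. pp x * (vol c x * loc c (%q. V q * u q) x)))" by simp
 also have "(LI x. ediv c pp x * loc c u x) - (LI x. pp x * (vol c x * loc c (%q. V q * u q) x))
   = (LI x. ediv c pp x * loc c u x - pp x * (vol c x * loc c (%q. V q * u q) x))"
  by (rule Bochner_Integration.integral_diff[symmetric])
   (intro csupp_integrable[OF o] e p smooth_loc[OF u c] smooth_on_mult[OF o smooth_vol[OF c] smooth_loc[OF Vu c]])+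
 finally show ?thesis by (simp add: algebra_simps)
qed

text \<open>\<open>qf_lift\<close> moves all derivatives onto the test function, so in coordinates
  the hypothesis becomes that of \<open>weyl_local\<close>, with \<open>- vol c * P\<close> as
  zero-order coefficient. Used with \<open>P = h = rh\<close> for the minimiser, and with
  \<open>P = - q\<close>, \<open>h = 0\<close> for \<open>abs u\<close>.\<close>

lemma weyl_chart_limit:
 assumes t: "!!n. test (f n)" and P: "smooth_fun A P" and h: "smooth_fun A h"
  and c: "c : A" "p : fst c" and de: "0 < de" "cball (snd c p) de <= im c"
  and C: "!!e. 0 < e ==> EX N. ALL i>=N. ALL j>=N. N2 (snd c p) de (%x. loc c (f i) x - loc c (f j) x) <= enn e"
  and weak: "!!k. test k ==> (%n. qf P (f n) k) ~~> (NI p. h p * k p)"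
 shows "EX c:A. EX r>0. p : fst c & cball (snd c p) r <= im c &
   (EX V. smooth_on (ball (snd c p) r) V & (%n. N2 (snd c p) r (%x. loc c (f n) x - V x)) ~~> 0)"
proof -
 note s = test_smooth[OF t] and o = open_im[OF c(1)]
 let ?a = "snd c p"
 define r where "r = de / 3"
 have r: "0 < r" "cball ?a (3 * r) <= im c" "2 * r <= de" using de by (simp_all add: r_def)
 have "EX V. smooth_on (ball ?a r) V & (%n. N2 ?a r (%x. loc c (f n) x - V x)) ~~> 0"
 proof (rule weyl_local[where F = "%n. loc c (f n)" and A = "acoef c", OF o r(2,1) smooth_acoef[OF c(1)]])
  show "acoef c i j x = acoef c j i x" if "x : im c" for i j x using ginv_sym[OF c(1) that] by (simp add: acoef_def)
  show "0 < (SU i. SU j. acoef c i j x * p $ i * p $ j)" if "x : im c" "p ~= 0" for x and p :: "real^'n"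
   using mult_pos_pos[OF vol_pos[OF c(1) that(1)] ginv_pos[OF c(1) that]] by (simp add: acoef_def sum_distrib_left mult_ac)
  show "smooth_on (im c) (%x. - (vol c x * loc c P x))" "smooth_on (im c) (%x. - (vol c x * loc c h x))"
   by (intro smooth_on_uminus smooth_on_mult o smooth_vol smooth_loc P h c(1))+
  show "smooth_on (im c) (loc c (f j))" for j by (rule smooth_loc[OF s c(1)])
 next
  fix e :: real assume "0 < e"
  thus "EX N. ALL i>=N. ALL j>=N. N2 ?a (2 * r) (%x. loc c (f i) x - loc c (f j) x) <= enn e"
   using C[of e] order_trans[OF N2_mono[OF r(3)]] by meson
 next
  fix pp assume pp: "tfun pp" "!!y. y ~: ball ?a (2 * r) ==> pp y = 0"
  have p: "csupp (im c) pp"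
   unfolding csupp_def
  proof (intro conjI tfun_smooth[OF pp(1)] exI[of _ "cball ?a (2 * r)"] allI impI compact_cball)
   show "cball ?a (2 * r) <= im c" using r by (intro order_trans[OF subset_cball r(2)]) simp
   show "pp y = 0" if "y ~: cball ?a (2 * r)" for y by (rule pp(2)) (use that in auto)
  qed
  note k = test_lift[OF c(1) p]
  have "(%n. - qf P (f n) (lift c pp)) ~~> - (NI q. h q * lift c pp q)" by (intro tendsto_intros weak k)
  moreover have "(NI q. h q * lift c pp q) = (LI x. pp x * vol c x * loc c h x)"
   using integral_lift[OF c(1) p borel_measurable_continuous_onI[OF smooth_fun_continuous[OF h]]] by (simp add: mult.commute)
  ultimately show "(%n. (LI y. ((SU i. pt i (%y. SU j. acoef c i j y * pt j pp y) y) + - (vol c y * loc c P y) * pp y) * loc c (f n) y))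
    ~~> (LI y. pp y * - (vol c y * loc c h y))"
   using qf_lift[OF c(1) p s P] qf_sym[OF s test_smooth[OF k]] by (simp add: ediv_def mult.assoc)
 qed
 thus ?thesis using c r(1,2) by (intro bexI[of _ c] exI[of _ r]) (auto intro: order_trans[OF subset_cball])
qed

lemma smooth_wlap: assumes u: "smooth_fun A u" shows "smooth_fun A (wlap u)"
 unfolding smooth_fun_def o_def
proof
 fix c assume c: "c : A"
 have "smooth_on (im c) (%x. ediv c (loc c u) x / vol c x)"
  by (intro smooth_on_divide open_im smooth_ediv order_refl smooth_loc u c smooth_vol vol_pos)
 thus "smooth_on (im c) (%x. wlap u (chart_inv c x))"
  by (rule smooth_on_cong[OF open_im[OF c]]) (simp add: wlap_eq[OF u c chart_inv_in] chart_chart_inv)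
qed

lemma fundamental_lemma:
 assumes w: "smooth_fun A w" and 0: "!!c pp. c : A ==> csupp (im c) pp ==> (NI q. lift c pp q * w q) = 0"
 shows "w p = 0"
proof -
 obtain c where c: "c : A" "p : fst c" using chart_cover by blast
 let ?x = "snd c p"
 obtain r where r: "0 < r" "cball ?x r <= im c" using open_contains_cball[of "im c"] open_im[OF c(1)] c(2) by auto
 have "csupp (im c) (bump ?x r)" by (rule csupp_bump[OF r])
 note b = csupp_mult[OF open_im[OF c(1)] this smooth_loc[OF w c(1)]]
 let ?k = "lift c (%y. bump ?x r y * loc c w y)"
 note t = test_mult[OF test_lift[OF c(1) b] w]
 have "?k p * w p = 0"
 proof (rule integral_eq_0_continuous[OF smooth_fun_continuous[OF test_smooth[OF t]] _ _ 0[OF c(1) b]])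
  show "integrable nu (%q. ?k q * w q)" using test_integrable[OF t, of "%_. 1"] by simp
  show "0 <= ?k q * w q" for q using bump_nonneg[of ?x r "snd c q"] by (simp add: lift_def chart_inv_chart[OF c(1)] mult.assoc)
 qed
 moreover have "bump ?x r ?x > 0" using bump_pos_iff[OF r(1), of ?x ?x] r(1) by simp
 ultimately show ?thesis using c by (simp add: lift_def chart_inv_chart)
qed

end

text \<open>A smooth substitute for \<open>abs (a - t)\<close>, within distance \<open>e\<close> of
  it; \<open>a = 0\<close> serves the absolute value and \<open>a = 1\<close> the reflection at
  1.\<close>

lemma smooth_on_sqrt_square: "e ~= 0 ==> smooth_on UNIV (%t::real. sqrt ((a - t)^2 + e^2))"
 by (rule smooth_on_sqrt[OF open_UNIV], intro smooth_on_add smooth_on_power smooth_on_diff smooth_on_const smooth_on_id open_UNIV)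
  (simp add: add_nonneg_pos)

lemma sqrt_square_bounds: assumes "0 <= e" shows "abs t <= sqrt (t^2 + e^2)" "sqrt (t^2 + e^2) <= abs t + e" "e <= sqrt (t^2 + e^2)"
 using real_sqrt_le_mono[of "t^2" "t^2 + e^2"] real_sqrt_le_mono[of "e^2" "t^2 + e^2"] sqrt_add_le_add_sqrt[of "t^2" "e^2"] assms by simp_all

lemma DERIV_sqrt_square:
 assumes e: "0 < e"
 shows "((%t. sqrt ((a - t)^2 + e^2)) has_real_derivative - (a - t) / sqrt ((a - t)^2 + e^2)) (at t)"
  and "abs ((a - t) / sqrt ((a - t)^2 + e^2)) <= 1"
proof -
 have pos: "0 < (a - t)^2 + e^2" using e by (simp add: add_nonneg_pos)
 show "((%t. sqrt ((a - t)^2 + e^2)) has_real_derivative - (a - t) / sqrt ((a - t)^2 + e^2)) (at t)"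
 proof -
  have "((%t. (a - t)^2 + e^2) has_real_derivative - 2 * (a - t)) (at t)" by (auto intro!: derivative_eq_intros)
  note D = DERIV_chain2[where f = sqrt and g = "%t. (a - t)^2 + e^2", OF DERIV_real_sqrt[OF pos] this]
  have gen: "inverse s / 2 * (- 2 * x) = - x / s" for s x :: real by (cases "s = 0") (simp_all add: field_simps)
  show ?thesis by (rule DERIV_cong[OF D gen])
 qed
 show "abs ((a - t) / sqrt ((a - t)^2 + e^2)) <= 1"
  using sqrt_square_bounds(1)[of e "a - t"] e pos by (simp add: abs_divide)
qed

section \<open>The limit of minimising sequences\<close>

context weighted_manifold begin

lemma minimizing_test_limit:
 assumes f: "minimizing f" and k: "test k" shows "(%n. qf rh (f n) k) ~~> (NI p. rh p * k p)"
proof -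
 let ?x = "%n. qf rh (f n) k - (NI p. rh p * k p)"
 have "(%n. (?x n)^2) ~~> 0"
 proof (rule tendsto_sandwich[OF _ _ tendsto_const])
  have "(%n. (J (f n) - Jmin) * qf rh k k) ~~> (Jmin - Jmin) * qf rh k k"
   using f by (intro tendsto_intros) (simp add: minimizing_def)
  thus "(%n. (J (f n) - Jmin) * qf rh k k) ~~> 0" by simp
 qed (use f first_variation[OF _ k] in "simp_all add: minimizing_def")
 hence "(%n. sqrt ((?x n)^2)) ~~> sqrt 0" by (rule tendsto_real_sqrt)
 hence "?x ~~> 0" using tendsto_rabs_zero_iff[of ?x sequentially] by simp
 thus ?thesis by (rule LIM_zero_cancel)
qed

lemma minimizing_chart_limit:
 assumes f: "minimizing f"
 shows "EX c:A. EX r>0. p : fst c & cball (snd c p) r <= im c &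
   (EX V. smooth_on (ball (snd c p) r) V & (%n. N2 (snd c p) r (%x. loc c (f n) x - V x)) ~~> 0)"
proof -
 have t: "test (f n)" for n using f by (simp add: minimizing_def)
 obtain c where c: "c : A" "p : fst c" using chart_cover by blast
 let ?a = "snd c p"
 obtain de C where de: "0 < de" "cball ?a de <= im c" "0 <= C" "!!f. test f ==> N2 ?a de (loc c f) <= enn (C * qf rh f f)"
  using controlled_ball[OF all_controlled c zero_less_one, of thesis] by blast
 show ?thesis
 proof (rule weyl_chart_limit[OF t test_smooth[OF weight] test_smooth[OF weight] c de(1,2) _ minimizing_test_limit[OF f]])
  fix e :: real assume e: "0 < e"
  \<comment> \<open>\<open>J_parallelogram\<close> bounds the energy of a difference by
    \<open>4 * d\<close>; the constant \<open>C\<close> of local control is enlarged to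
    \<open>C + 1\<close> to keep the denominator positive.\<close>
  define d where "d = e / (4 * (C + 1))"
  have d: "0 < d" using e de(3) by (simp add: d_def)
  have "EV n. J (f n) < Jmin + d"
   by (rule order_tendstoD(2)[of _ Jmin]) (use f d in "simp_all add: minimizing_def")
  then obtain N where N: "!!n. N <= n ==> J (f n) < Jmin + d" by (auto simp: eventually_sequentially)
  show "EX N. ALL i>=N. ALL j>=N. N2 ?a de (%x. loc c (f i) x - loc c (f j) x) <= enn e"
  proof (intro exI[of _ N] allI impI)
   fix i j assume "N <= i" "N <= j"
   hence "qf rh (%p. f i p - f j p) (%p. f i p - f j p) <= 4 * d"
    using J_parallelogram[OF t t, of i j] N[of i] N[of j] unfolding right_diff_distrib by linarith
   hence "C * qf rh (%p. f i p - f j p) (%p. f i p - f j p) <= (C + 1) * (4 * d)"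
    using energy_ge(1)[OF test_diff[OF t t]] de(3) by (intro mult_mono) auto
   also have "... = e"
   proof -
    have "k * (4 * (e / (4 * k))) = e" if "k ~= 0" for k using that by simp
    from this[of "C + 1"] show ?thesis using de(3) by (simp only: d_def)
   qed
   finally have "enn (C * qf rh (%p. f i p - f j p) (%p. f i p - f j p)) <= enn e" by (rule ennreal_leI)
   thus "N2 ?a de (%x. loc c (f i) x - loc c (f j) x) <= enn e"
    using de(4)[OF test_diff[OF t[of i] t[of j]]] by (rule order_trans[rotated])
  qed
 qed
qed

text \<open>Only L2 convergence of the sequence is known. The weighted form is therefore rewritten
  as an L2 pairing with a test function before the limit is taken, and Green's formula restores the
  classical equation for the smooth limit.\<close>

lemma minimizing_limit_equation:
 assumes f: "minimizing f" and u: "smooth_fun A u" and L: "L2loc f u" shows "wlap u p = rh p * (u p - 1)"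
proof -
 have t: "test (f n)" for n using f by (simp add: minimizing_def)
 note srh = test_smooth[OF weight]
 let ?w = "%p. rh p * (u p - 1) - wlap u p"
 have w: "smooth_fun A ?w" by (intro smooth_fun_diff smooth_fun_mult srh u smooth_fun_const smooth_wlap)
 have "?w p = 0"
 proof (rule fundamental_lemma[OF w])
  fix c pp assume c: "c : A" and p: "csupp (im c) pp"
  note k = test_lift[OF c p] and o = open_im[OF c]
  \<comment> \<open>After integration by parts the form pairs its argument with
    \<open>- ?b / vol c\<close>; the division passes from Lebesgue measure to
    \<open>nu\<close>.\<close>
  let ?b = "%x. ediv c pp x + - (vol c x * loc c rh x) * pp x"
  have b: "csupp (im c) (%x. - ?b x / vol c x)"
  proof -
   have "csupp (im c) (%x. pt i (%y. SU j. pt j pp y * acoef c i j y) x)" for i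
    by (intro csupp_partial csupp_sum finite csupp_mult[OF o] p smooth_acoef c)
   hence "csupp (im c) (ediv c pp)" unfolding ediv_def by (intro csupp_sum) (simp_all add: mult.commute)
   then obtain K1 where K1: "compact K1" "K1 <= im c" "!!x. x ~: K1 ==> ediv c pp x = 0" unfolding csupp_def by blast
   obtain K2 where K2: "compact K2" "K2 <= im c" "!!x. x ~: K2 ==> pp x = 0" using p unfolding csupp_def by blast
   have sp: "smooth_on (im c) pp" using p by (auto simp: csupp_def intro: smooth_on_subset)
   show ?thesis
   proof (rule csupp_I[OF o, where K = "K1 \<union> K2"])
    show "smooth_on (im c) (%x. - ?b x / vol c x)"
     by (intro smooth_on_divide smooth_on_uminus smooth_on_add smooth_on_mult o smooth_ediv[OF c o order_refl sp] smooth_vol[OF c]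
       smooth_loc[OF srh c] sp vol_pos[OF c])
   qed (use K1 K2 in auto)
  qed
  have I: "(NI q. h q * lift c (%x. - ?b x / vol c x) q) = qf rh (lift c pp) h" if h: "smooth_fun A h" for h
  proof -
   have "(NI q. lift c (%x. - ?b x / vol c x) q * h q) = (LI x. - ?b x / vol c x * vol c x * loc c h x)"
    by (rule integral_lift[OF c b borel_measurable_continuous_onI[OF smooth_fun_continuous[OF h]]])
   also have "... = (LI x. - (?b x * loc c h x))"
   proof (rule Bochner_Integration.integral_cong[OF refl])
    fix x
    have z: "?b x = 0" if "x ~: im c"
    proof -
     have "pt i (%y. SU j. pt j pp y * acoef c i j y) x = 0" for i
      by (rule csupp_outside[OF _ that]) (intro csupp_partial csupp_sum finite csupp_mult[OF o] p smooth_acoef c)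
     hence "ediv c pp x = 0" by (simp add: ediv_def mult.commute)
     thus ?thesis using csupp_outside[OF p that] by simp
    qed
    show "- ?b x / vol c x * vol c x * loc c h x = - (?b x * loc c h x)"
    proof (cases "x : im c")
     case True
     hence "- ?b x / vol c x * vol c x = - ?b x" using vol_pos[OF c True] by simp
     thus ?thesis by (simp only: minus_mult_left)
    next
     case False thus ?thesis unfolding z[OF False] by simp
    qed
   qed
   finally show ?thesis using qf_lift[OF c p h srh] by (simp add: mult.commute)
  qed
  have "(%n. qf rh (lift c pp) (f n)) ~~> qf rh (lift c pp) u"
   using L2loc_weak[OF L smooth_fun_continuous[OF test_smooth[OF t]] smooth_fun_continuous[OF u] test_lift[OF c b]]
   by (simp only: I[OF u] I[OF test_smooth[OF t]])
  moreover have "(%n. qf rh (lift c pp) (f n)) ~~> (NI p. rh p * lift c pp p)"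
   using minimizing_test_limit[OF f k] qf_sym[OF test_smooth[OF t] test_smooth[OF k]] by simp
  ultimately have "qf rh (lift c pp) u = (NI p. rh p * lift c pp p)" by (rule LIMSEQ_unique)
  moreover have "qf rh (lift c pp) u = (NI q. gi (lift c pp) u q) + (NI q. (rh q * u q) * lift c pp q)"
   unfolding qf_def using gi_integrable[OF k u, of "%_. 1"] test_integrable[OF k smooth_fun_continuous[OF smooth_fun_mult[OF srh u]]]
   by (subst Bochner_Integration.integral_add[symmetric]) (simp_all add: mult_ac)
  ultimately have "(NI q. (rh q * u q) * lift c pp q) - (NI q. wlap u q * lift c pp q) - (NI q. rh q * lift c pp q) = 0"
   using green[OF k u] by (simp add: mult.commute)
  also have "(NI q. (rh q * u q) * lift c pp q) - (NI q. wlap u q * lift c pp q) - (NI q. rh q * lift c pp q)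
    = (NI q. (rh q * u q) * lift c pp q - wlap u q * lift c pp q - rh q * lift c pp q)"
   using test_integrable[OF k smooth_fun_continuous] smooth_fun_mult[OF srh u] smooth_wlap[OF u] srh by simp
  finally show "(NI q. lift c pp q * ?w q) = 0" by (simp add: algebra_simps)
 qed
 thus ?thesis by simp
qed

text \<open>The difference of two minimising sequences has energy tending to 0, hence tends to 0 in
  local L2 because every point is controlled. Truncated sequences thus keep the limit of the
  original one.\<close>

lemma minimizing_transfer:
 assumes f: "minimizing f" and k: "minimizing k" and L: "L2loc f u" and u: "u : bmb" shows "L2loc k u"
 unfolding L2loc_def
proof
 fix p
 have t: "test (f n)" "test (k n)" for n using f k by (simp_all add: minimizing_def)
 obtain V C where V: "open V" "p : V" "0 <= C" "!!f. test f ==> nsq V f <= enn (C * qf rh f f)"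
  using all_controlled[of p] unfolding controlled_def by blast
 obtain W where W: "open W" "p : W" "emeasure nu W < \<infinity>" "(%n. nsq W (%q. f n q - u q)) ~~> 0" using L unfolding L2loc_def by blast
 have lim: "(%n. nsq V (%q. k n q - f n q)) ~~> 0"
 proof (rule tendsto_sandwich[OF _ _ tendsto_const])
  have "(%n. enn (C * qf rh (%p. k n p - f n p) (%p. k n p - f n p))) ~~> ennreal (C * 0)"
   by (intro tendsto_ennrealI tendsto_mult_left minimizing_difference k f)
  thus "(%n. enn (C * qf rh (%p. k n p - f n p) (%p. k n p - f n p))) ~~> 0" by simp
 qed (use V(4) t test_diff in simp_all)
 have "(%n. nsq (V \<inter> W) (%q. k n q - f n q)) ~~> 0" by (rule nsq_tendsto_le[OF nsq_le lim]) auto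
 moreover have "(%n. nsq (V \<inter> W) (%q. f n q - u q)) ~~> 0" by (rule nsq_tendsto_le[OF nsq_le W(4)]) auto
 ultimately have "(%n. nsq (V \<inter> W) (%q. (k n q - f n q) + (f n q - u q))) ~~> 0"
  by (intro nsq_tendsto_add borel_measurable_diff test_measurable t u open_Int V W)
 moreover have "emeasure nu (V \<inter> W) <= emeasure nu W" by (rule emeasure_mono) (use W in "auto simp: sets_nu")
 ultimately show "EX W. open W & p : W & emeasure nu W < \<infinity> & (%n. nsq W (%q. k n q - u q)) ~~> 0"
  using V W by (intro exI[of _ "V \<inter> W"]) (auto intro: le_less_trans)
qed

text \<open>Smooth approximations of \<open>t \<mapsto> \<bar>t\<bar>\<close> and of the reflection \<open>t \<mapsto> 1 - \<bar>1 - t\<bar>\<close>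
 do not increase \<open>J\<close> in the limit, so the minimiser has values between \<open>0\<close> and \<open>1\<close>.\<close>

lemma minimizing_truncate:
 assumes f: "minimizing f" and s: "!!n. smooth_on UNIV (th n)" and 0: "!!n. th n 0 = 0"
  and d: "!!n t. (th n has_real_derivative th' n t) (at t)" "!!n t. abs (th' n t) <= 1"
  and c: "!!n t. abs (th n t - 1) <= abs (t - 1) + 1 / real (Suc n)"
 shows "minimizing (%n p. th n (f n p))"
proof -
 have t: "test (f n)" "test (%p. th n (f n p))" for n using f s 0 by (simp_all add: minimizing_def test_compose)
 let ?e = "%n. 1 / real (Suc n)"
 have I: "integrable nu (%p. rh p * (h p - 1)^2)" if "test h" for h
  using that by (intro weight_integrable) (simp add: power2_eq_square smooth_fun_mult smooth_fun_diff smooth_fun_const test_smooth)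
 have i: "integrable nu rh" using weight_integrable[OF smooth_fun_const, of 1] by simp
 have le: "J (%p. th n (f n p)) <= J (f n) + ?e n * (J (f n) + 2 * (NI p. rh p))" for n
 proof -
  have "(NI p. gi (%p. th n (f n p)) (%p. th n (f n p)) p) <= (NI p. gi (f n) (f n) p)"
  proof (rule integral_mono[OF dirichlet_integrable[OF t(2)] dirichlet_integrable[OF t(1)]])
   fix p
   note ss = test_smooth[OF t(1)[of n]] test_smooth[OF t(2)[of n]]
   have "gi (%p. th n (f n p)) (%p. th n (f n p)) p = (th' n (f n p))^2 * gi (f n) (f n) p"
    using gi_compose[OF ss(1) s d(1) ss(2), of n] gi_compose[OF ss(1) s d(1) ss(1), of n] gi_sym[OF ss]
    by (simp add: power2_eq_square)
   also have "... <= 1 * gi (f n) (f n) p" using d(2)[of n "f n p"] gi_nonneg[OF ss(1)] by (intro mult_right_mono) (simp_all add: abs_square_le_1)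
   finally show "gi (%p. th n (f n p)) (%p. th n (f n p)) p <= gi (f n) (f n) p" by simp
  qed
  moreover have "(NI p. rh p * (th n (f n p) - 1)^2) <= (NI p. (1 + ?e n) * (rh p * (f n p - 1)^2) + 2 * ?e n * rh p)"
  proof (rule integral_mono[OF I[OF t(2)]])
   fix p
   have "(th n (f n p) - 1)^2 <= (abs (f n p - 1) + ?e n)^2" using c[of n "f n p"] by (subst abs_le_square_iff[symmetric]) simp
   also have "... <= (1 + ?e n) * (f n p - 1)^2 + 2 * ?e n"
   proof -
    \<comment> \<open>The right side exceeds the left by \<open>e * (x - 1)^2 + e * (1 - e)\<close>.
      Keeping the factor of \<open>x^2\<close> at \<open>1 + e\<close> makes the increase of
      \<open>J\<close> small relative to \<open>J\<close> itself.\<close>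
    have "(x + e)^2 <= (1 + e) * x^2 + 2 * e" if "0 <= e" "e <= 1" for x e :: real
    proof -
     have "0 <= e * (x - 1)^2 + e * (1 - e)" using that by simp
     thus ?thesis by (simp add: power2_eq_square algebra_simps)
    qed
    from this[of "?e n" "abs (f n p - 1)"] show ?thesis by simp
   qed
   finally have "rh p * (th n (f n p) - 1)^2 <= rh p * ((1 + ?e n) * (f n p - 1)^2 + 2 * ?e n)" by (rule mult_left_mono) (rule weight_nonneg)
   thus "rh p * (th n (f n p) - 1)^2 <= (1 + ?e n) * (rh p * (f n p - 1)^2) + 2 * ?e n * rh p" by (simp only: distrib_left mult_ac)
  qed (use I[OF t(1)] i in simp)
  moreover have "(NI p. (1 + ?e n) * (rh p * (f n p - 1)^2) + 2 * ?e n * rh p) = (1 + ?e n) * (NI p. rh p * (f n p - 1)^2) + 2 * ?e n * (NI p. rh p)"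
   using I[OF t(1)] i by simp
  moreover have "0 <= ?e n * (NI p. gi (f n) (f n) p)" using dirichlet_nonneg[OF t(1)] by simp
  ultimately show ?thesis unfolding J_eq[OF t(1)] J_eq[OF t(2)] distrib_left distrib_right by linarith
 qed
 have "(%n. J (f n) + ?e n * (J (f n) + 2 * (NI p. rh p))) ~~> Jmin + 0 * (Jmin + 2 * (NI p. rh p))"
  using f LIMSEQ_inverse_real_of_nat by (intro tendsto_intros) (simp_all add: minimizing_def inverse_eq_divide)
 hence lim: "(%n. J (f n) + ?e n * (J (f n) + 2 * (NI p. rh p))) ~~> Jmin" by simp
 have "(%n. J (%p. th n (f n p))) ~~> Jmin"
  by (rule tendsto_sandwich[OF _ _ tendsto_const lim]) (intro always_eventually allI Jmin_le t(2) le)+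
 thus ?thesis using t(2) by (simp add: minimizing_def)
qed

lemma minimizing_limit_one:
 assumes par: "parabolic A g \<phi>" and f: "minimizing f" and u: "smooth_fun A u" and L: "L2loc f u" shows "u p = 1"
proof -
 let ?e = "%n. 1 / real (Suc n)"
 note cu = smooth_fun_continuous[OF u] and eq = minimizing_limit_equation[OF f u L]
 note mu = borel_measurable_continuous_onI[OF cu]
 \<comment> \<open>The constants subtracted here and in \<open>th2\<close> make both functions
   vanish at 0, so compact support is kept. Still \<open>th1\<close> is nonnegative and
   \<open>th2\<close> at most 1, which gives the two bounds on \<open>u\<close>.\<close>
 define th1 where "th1 n t = sqrt ((0 - t)^2 + (?e n)^2) - ?e n" for n t
 define th2 where "th2 n t = sqrt (1 + (?e n)^2) - sqrt ((1 - t)^2 + (?e n)^2)" for n t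
 have e: "0 < ?e n" for n by simp
 have m1: "minimizing (%n p. th1 n (f n p))"
 proof (rule minimizing_truncate[OF f, where th' = "%n t. - (0 - t) / sqrt ((0 - t)^2 + (?e n)^2)"])
  fix n t
  show "(th1 n has_real_derivative - (0 - t) / sqrt ((0 - t)^2 + (?e n)^2)) (at t)"
   unfolding th1_def by (rule DERIV_cong[OF DERIV_diff[OF DERIV_sqrt_square(1)[OF e] DERIV_const]]) simp
  show "abs (- (0 - t) / sqrt ((0 - t)^2 + (?e n)^2)) <= 1" using DERIV_sqrt_square(2)[OF e, of 0 t n] by simp
  show "smooth_on UNIV (th1 n)" unfolding th1_def by (intro smooth_on_diff smooth_on_sqrt_square smooth_on_const open_UNIV) simp
  show "abs (th1 n t - 1) <= abs (t - 1) + ?e n"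
   using sqrt_square_bounds(1,2)[OF less_imp_le[OF e], of "0 - t" n] unfolding th1_def by linarith
 qed (simp add: th1_def)
 have m2: "minimizing (%n p. th2 n (f n p))"
 proof (rule minimizing_truncate[OF f, where th' = "%n t. (1 - t) / sqrt ((1 - t)^2 + (?e n)^2)"])
  fix n t
  show "(th2 n has_real_derivative (1 - t) / sqrt ((1 - t)^2 + (?e n)^2)) (at t)"
   unfolding th2_def by (rule DERIV_cong[OF DERIV_diff[OF DERIV_const DERIV_sqrt_square(1)[OF e]]]) (simp only: minus_divide_left[symmetric] diff_0 minus_minus)
  show "abs ((1 - t) / sqrt ((1 - t)^2 + (?e n)^2)) <= 1" by (rule DERIV_sqrt_square(2)[OF e])
  show "smooth_on UNIV (th2 n)" unfolding th2_def by (intro smooth_on_diff smooth_on_sqrt_square smooth_on_const open_UNIV) simp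
  show "abs (th2 n t - 1) <= abs (t - 1) + ?e n"
   using sqrt_square_bounds(1,2)[OF less_imp_le[OF e], of "1 - t" n] sqrt_square_bounds(1,2)[OF less_imp_le[OF e], of 1 n]
   unfolding th2_def power_one abs_minus_commute[of 1 t] by linarith
 qed (simp add: th2_def)
 have u0: "0 <= u q" for q
  by (rule L2loc_nonneg[OF minimizing_transfer[OF f m1 L mu] cu])
   (use sqrt_square_bounds(3)[OF less_imp_le[OF e]] in \<open>simp add: th1_def\<close>)
 have L2: "L2loc (%n q. 1 - th2 n (f n q)) (%q. 1 - u q)"
 proof -
  have "nsq W (%q. 1 - th2 n (f n q) - (1 - u q)) = nsq W (%q. th2 n (f n q) - u q)" for W n
   by (simp add: nsq_def power2_commute)
  thus ?thesis using minimizing_transfer[OF f m2 L mu] unfolding L2loc_def by simp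
 qed
 have "0 <= 1 - u q" for q
 proof (rule L2loc_nonneg[OF L2])
  show "continuous_on UNIV (%q. 1 - u q)" by (intro continuous_intros cu)
  show "0 <= 1 - th2 n (f n q)" for n q
   using sqrt_square_bounds(3)[OF less_imp_le[OF e], of n "1 - f n q"] sqrt_square_bounds(2)[OF less_imp_le[OF e], of 1 n] unfolding th2_def power_one by linarith
 qed
 hence "wlap u q <= 0" for q unfolding eq using weight_nonneg[of q] by (intro mult_nonneg_nonpos) (simp_all add: algebra_simps)
 then obtain k where k: "!!q. u q = k" using par u u0 unfolding parabolic_def wlap_def by metis
 hence uk: "u = (%q. k)" by auto
 have "wlap u p0 = 0" unfolding uk wlap_chart_at[OF smooth_fun_const refl] by (simp add: ediv_def)
 hence "u p0 = 1" using eq[of p0] weight_pos by simp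
 thus ?thesis using k by simp
qed

text \<open>With limit 1, the form \<open>qf rh (f n) (f n)\<close> tends to \<open>Jmin\<close>
  plus the integral of \<open>rh\<close>; testing the first variation with \<open>f n\<close> itself
  forces the integral of \<open>rh\<close> as limit. Hence \<open>Jmin = 0\<close>, and
  \<open>J\<close> dominates the Dirichlet energy.\<close>

lemma exists_parabolic_sequence:
 assumes par: "parabolic A g \<phi>"
 shows "EX f. (ALL n. test (f n)) & L2loc f (%p. 1) & (%n. (NI p. gi (f n) (f n) p)) ~~> 0"
proof -
 obtain f where f: "minimizing f" using exists_minimizing by blast
 have t: "test (f n)" for n using f by (simp add: minimizing_def)
 have Jf: "(%n. J (f n)) ~~> Jmin" using f by (simp add: minimizing_def)
 obtain u where u: "smooth_fun A u" "L2loc f u" by (rule L2loc_glue[OF test_measurable[OF t] minimizing_chart_limit[OF f]])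
 have "u = (%p. 1)" using minimizing_limit_one[OF par f u] by auto
 hence L: "L2loc f (%p. 1)" using u(2) by simp
 let ?R = "(NI p. rh p)" and ?a = "%n. qf rh (f n) (f n) - (NI p. rh p * f n p)"
 have i: "integrable nu rh" using weight_integrable[OF smooth_fun_const, of 1] by simp
 have R: "(%n. (NI p. rh p * f n p)) ~~> ?R"
  using L2loc_weak[OF L smooth_fun_continuous[OF test_smooth[OF t]] continuous_on_const weight] by (simp add: mult.commute)
 have E: "qf rh (f n) (f n) = J (f n) + 2 * (NI p. rh p * f n p) - ?R" for n by (simp add: J_def)
 have Elim: "(%n. qf rh (f n) (f n)) ~~> Jmin + 2 * ?R - ?R" unfolding E by (intro tendsto_intros Jf R)
 have "(%n. (?a n)^2) ~~> 0"
 proof (rule tendsto_sandwich[OF _ _ tendsto_const])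
  have "(%n. (J (f n) - Jmin) * qf rh (f n) (f n)) ~~> (Jmin - Jmin) * (Jmin + 2 * ?R - ?R)" by (intro tendsto_intros Jf Elim)
  thus "(%n. (J (f n) - Jmin) * qf rh (f n) (f n)) ~~> 0" by simp
 qed (use first_variation[OF t t] in simp_all)
 moreover have "(%n. (?a n)^2) ~~> ((Jmin + 2 * ?R - ?R) - ?R)^2" by (intro tendsto_intros Elim R)
 ultimately have "((Jmin + 2 * ?R - ?R) - ?R)^2 = 0" using LIMSEQ_unique by blast
 hence "Jmin = 0" by simp
 have "(%n. (NI p. gi (f n) (f n) p)) ~~> 0"
 proof (rule tendsto_sandwich[OF _ _ tendsto_const])
  show "(%n. J (f n)) ~~> 0" using Jf \<open>Jmin = 0\<close> by simp
  show "EV n. (NI p. gi (f n) (f n) p) <= J (f n)"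
   using J_eq[OF t] weight_square_nonneg[of "%p. f _ p - 1"] by simp
 qed (use dirichlet_nonneg[OF t] in simp)
 thus ?thesis using t L by blast
qed

end

section \<open>Stability and the smoothness of the absolute value\<close>

context density_manifold begin

lemma parabolic_sequence:
 assumes "parabolic A g \<phi>"
 shows "EX f. (ALL n. test (f n)) & L2loc f (%p. 1) & (%n. (NI p. gi (f n) (f n) p)) ~~> 0"
proof -
 fix p0 :: 'm
 obtain c where c: "c : A" "p0 : fst c" using chart_cover by blast
 let ?x = "snd c p0"
 obtain r where r: "0 < r" "cball ?x r <= im c" using open_contains_cball[of "im c"] open_im[OF c(1)] c(2) by auto
 have b: "csupp (im c) (bump ?x r)" by (rule csupp_bump[OF r])
 interpret weighted_manifold A g \<phi> "lift c (bump ?x r)" p0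
  by unfold_locales
   (use test_lift[OF c(1) b] bump_nonneg[of ?x r] bump_pos_iff[OF r(1), of ?x ?x] r(1) c(2) in "auto simp: lift_def")
 show ?thesis by (rule exists_parabolic_sequence[OF assms])
qed

lemma stable_form_nonneg:
 assumes st: "stable_operator A g \<phi> q" and q: "continuous_on UNIV q" and f: "test f"
 shows "0 <= qf (%p. - q p) f f"
proof (cases "f = (%p. 0)")
 case True
 thus ?thesis by (simp add: qf_def gi_const smooth_fun_const)
next
 case False
 note s = test_smooth[OF f] and cf = smooth_fun_continuous[OF test_smooth[OF f]]
 note [measurable] = borel_measurable_continuous_onI[OF gi_continuous[OF s s]] borel_measurable_continuous_onI[OF q] test_measurable[OF f]
 obtain K where K: "compact K" "!!p. p ~: K ==> f p = 0" using f unfolding test_def by blast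
 have "closure {p. f p ~= 0} <= K" by (rule closure_minimal) (use K compact_imp_closed in auto)
 hence "compact (closure {p. f p ~= 0})" using compact_Int_closed[OF K(1) closed_closure, of "{p. f p ~= 0}"] by (simp add: Int_absorb1)
 \<comment> \<open>A smooth function is piecewise smooth with the single piece \<open>UNIV\<close>,
   whose frontier is empty.\<close>
 hence "f : C0_infty A g"
  unfolding C0_infty_def piecewise_smooth_def using cf s by (auto intro!: exI[of _ "{UNIV}"])
 hence L: "lambda1 A g \<phi> q <= ereal ((LINT p|volume A g. (gi f f p - q p * (f p)^2) * exp (\<phi> p)) / (LINT p|volume A g. (f p)^2 * exp (\<phi> p)))"
  unfolding lambda1_def using False by (intro INF_lower) auto
 have "0 <= (LINT p|volume A g. (gi f f p - q p * (f p)^2) * exp (\<phi> p)) / (LINT p|volume A g. (f p)^2 * exp (\<phi> p))"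
  using order_trans[OF st[unfolded stable_operator_def] L] by simp
 moreover have "(LINT p|volume A g. (gi f f p - q p * (f p)^2) * exp (\<phi> p)) = (NI p. gi f f p - q p * (f p)^2)"
  by (rule volume_integral) measurable
 moreover have "(LINT p|volume A g. (f p)^2 * exp (\<phi> p)) = (NI p. (f p)^2)" by (rule volume_integral) measurable
 ultimately have le: "0 <= qf (%p. - q p) f f / (NI p. (f p)^2)" by (simp add: qf_def power2_eq_square mult.assoc)
 have i: "integrable nu (%p. (f p)^2)" using test_integrable[OF f cf] by (simp add: power2_eq_square)
 have "(NI p. (f p)^2) ~= 0"
 proof
  assume "(NI p. (f p)^2) = 0"
  hence "(f p)^2 = 0" for p by (intro integral_eq_0_continuous[OF _ i]) (auto intro!: continuous_intros cf)
  thus False using False by auto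
 qed
 moreover have "0 <= (NI p. (f p)^2)" by simp
 ultimately have "0 < (NI p. (f p)^2)" by linarith
 thus ?thesis using le by (simp add: zero_le_divide_iff)
qed

lemma smooth_fun_sqrt: "smooth_fun A u ==> 0 < d ==> smooth_fun A (%p. sqrt ((0 - u p)^2 + d^2))"
 by (rule smooth_fun_compose[where th = "%t. sqrt ((0 - t)^2 + d^2)", OF _ smooth_on_sqrt_square]) simp_all

text \<open>For a solution \<open>u\<close>, \<open>w \<nabla>w = u \<nabla>u\<close> and \<open>\<bar>\<nabla>w\<bar> \<le> \<bar>\<nabla>u\<bar>\<close> for \<open>w = sqrt (u\<^sup>2 + d\<^sup>2)\<close>; the equation is
 tested with \<open>et\<^sup>2 u\<close>.\<close>

lemma form_sqrt_le:
 assumes q: "smooth_fun A q" and u: "smooth_fun A u" and eq: "!!p. wlap u p = - q p * u p" and et: "test et" and d: "0 < d"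
 defines "w == %p. sqrt ((0 - u p)^2 + d^2)"
 shows "qf (%p. - q p) (%p. et p * w p) (%p. et p * w p) <= (NI p. (w p)^2 * gi et et p) - d^2 * (NI p. q p * (et p)^2)"
proof -
 note s = test_smooth[OF et] and cq = smooth_fun_continuous[OF q]
 have w: "smooth_fun A w" unfolding w_def by (rule smooth_fun_sqrt[OF u d])
 have wpos: "0 < w p" and w2: "(w p)^2 = (u p)^2 + d^2" for p using d by (simp_all add: w_def add_nonneg_pos)
 have chain: "gi w k p = u p / w p * gi u k p" if k: "smooth_fun A k" for k p
 proof -
  have "((%t. sqrt ((0 - t)^2 + d^2)) has_real_derivative - (0 - u p) / sqrt ((0 - u p)^2 + d^2)) (at (u p))"
   by (rule DERIV_sqrt_square(1)[OF d])
  from gi_compose[OF u smooth_on_sqrt_square this k] show ?thesis using d unfolding w_def by simp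
 qed
 let ?v = "%p. et p * w p" and ?F = "%p. et p * (et p * u p)"
 have v: "test ?v" and F: "test ?F" by (intro test_mult et w smooth_fun_mult s u)+
 have gv: "gi ?v ?v p + - q p * ?v p * ?v p <= (w p)^2 * gi et et p + gi ?F u p - q p * u p * ?F p - d^2 * (q p * (et p)^2)" for p
 proof -
  note [simp] = gi_mult[OF s w] gi_mult[OF s s] gi_mult[OF s smooth_fun_mult[OF s u]] gi_mult[OF s u]
  have wv: "gi w ?v p = w p * gi et w p + et p * gi w w p" "gi et ?v p = et p * gi et w p + w p * gi et et p"
   using gi_sym[OF w test_smooth[OF v], of p] gi_sym[OF s test_smooth[OF v], of p] gi_sym[OF s w, of p] w s by simp_all
  have a: "w p * gi et w p = u p * gi et u p"
   using chain[OF s, of p] gi_sym[OF s w, of p] gi_sym[OF s u, of p] wpos[of p] by simp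
  have "gi w w p = (u p / w p)^2 * gi u u p"
   using chain[OF w, of p] chain[OF u, of p] gi_sym[OF u w, of p] by (simp add: power2_eq_square)
  also have "... <= 1 * gi u u p"
  proof (rule mult_right_mono[OF _ gi_nonneg[OF u]])
   have "(u p)^2 <= (w p)^2" using w2[of p] by simp
   thus "(u p / w p)^2 <= 1" using wpos[of p] by (simp add: power_divide)
  qed
  finally have b: "(et p)^2 * gi w w p <= (et p)^2 * gi u u p" by (intro mult_left_mono) simp_all
  have "gi ?v ?v p = (w p)^2 * gi et et p + 2 * et p * (w p * gi et w p) + (et p)^2 * gi w w p"
   using test_smooth[OF v] by (simp add: wv power2_eq_square algebra_simps)
  moreover have "gi ?F u p = 2 * et p * (u p * gi et u p) + (et p)^2 * gi u u p"
   using u by (simp add: power2_eq_square algebra_simps)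
  moreover have "q p * ?v p * ?v p = q p * u p * ?F p + d^2 * (q p * (et p)^2)"
  proof -
   have "q p * ?v p * ?v p = q p * (et p)^2 * (w p)^2" by (simp add: power2_eq_square)
   thus ?thesis unfolding w2 by (simp add: power2_eq_square algebra_simps)
  qed
  ultimately show ?thesis using a b by simp
 qed
 have i1: "integrable nu (%p. (w p)^2 * gi et et p)"
  by (rule gi_integrable[OF et s]) (intro continuous_intros smooth_fun_continuous w)
 have i2: "integrable nu (gi ?F u)" using gi_integrable[OF F u, of "%_. 1"] by simp
 have i3: "integrable nu (%p. q p * u p * ?F p)" by (rule test_integrable[OF F]) (intro continuous_intros cq smooth_fun_continuous u)
 have i4: "integrable nu (%p. q p * (et p)^2)"
  using test_integrable[OF et, of "%p. q p * et p"] continuous_on_mult[OF cq smooth_fun_continuous[OF s]] by (simp add: power2_eq_square mult.assoc)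
 have "qf (%p. - q p) ?v ?v <= (NI p. (w p)^2 * gi et et p + gi ?F u p - q p * u p * ?F p - d^2 * (q p * (et p)^2))"
  unfolding qf_def
 proof (rule integral_mono[OF qf_integrable[OF _ v test_smooth[OF v]] _ gv])
  show "continuous_on UNIV (%p. - q p)" by (intro continuous_intros cq)
 qed (use i1 i2 i3 i4 in simp)
 also have "... = (NI p. (w p)^2 * gi et et p) + (NI p. gi ?F u p) - (NI p. q p * u p * ?F p) - d^2 * (NI p. q p * (et p)^2)"
  using i1 i2 i3 i4 by simp
 \<comment> \<open>Green's formula and the equation for \<open>u\<close>: this integral cancels
   against the third one.\<close>
 also have "(NI p. gi ?F u p) = (NI p. q p * u p * ?F p)" unfolding green[OF F u] eq by (simp add: mult_ac)
 finally show ?thesis by simp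
qed

text \<open>Form values tending to 0 along \<open>v\<close> become, by Cauchy-Schwarz for the
  nonnegative form, the weak equation in the limit against every test function. Regularity then
  yields a smooth local L2 limit of \<open>v\<close>, which must coincide with the continuous limit
  \<open>abs u\<close>.\<close>

lemma abs_smooth:
 assumes par: "parabolic A g \<phi>" and st: "stable_operator A g \<phi> q" and q: "smooth_fun A q"
  and u: "smooth_fun A u" "!!p. wlap u p = - q p * u p" and bd: "!!p. abs (u p) <= M"
 shows "smooth_fun A (%p. abs (u p))"
proof -
 obtain f where f: "!!n. test (f n)" "L2loc f (%p. 1)" and Df: "(%n. (NI p. gi (f n) (f n) p)) ~~> 0"
  using parabolic_sequence[OF par] by blast
 note sf = test_smooth[OF f(1)] and cq = smooth_fun_continuous[OF q]
 let ?X = "%n. abs ((NI p. q p * (f n p)^2))" and ?e = "%n. 1 / real (Suc n)"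
 \<comment> \<open>The smoothing parameter must depend on \<open>n\<close>: it has to beat
   \<open>?X n\<close>, which need not stay bounded as the supports of \<open>f n\<close> grow. The
   added 1 keeps the quotient defined and \<open>d n\<close> below \<open>?e n\<close>.\<close>
 define d where "d n = ?e n / (1 + ?X n)" for n
 have d: "0 < d n" "d n <= ?e n" "(d n)^2 * ?X n <= ?e n" "(d n)^2 <= 1" for n
 proof -
  show d0: "0 < d n" by (simp add: d_def add_pos_nonneg)
  have dX: "d n * (1 + ?X n) = ?e n" using abs_ge_zero[of "(NI p. q p * (f n p)^2)"] unfolding d_def by simp
  hence "d n * 1 + d n * ?X n = ?e n" by (simp only: distrib_left)
  moreover have X0: "0 <= d n * ?X n" using d0 by simp
  ultimately show d1: "d n <= ?e n" by linarith
  have e1: "?e n <= 1" by simp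
  have "d n * (d n * ?X n) <= 1 * (d n * ?X n)" using X0 d1 e1 by (intro mult_right_mono) linarith+
  thus "(d n)^2 * ?X n <= ?e n" using dX d0 unfolding distrib_left power2_eq_square mult.assoc by linarith
  show "(d n)^2 <= 1" using d0 d1 e1 by (intro power_le_one) linarith+
 qed
 define w where "w n p = sqrt ((0 - u p)^2 + (d n)^2)" for n p
 define v where "v n p = f n p * w n p" for n p
 have w: "smooth_fun A (w n)" for n unfolding w_def by (rule smooth_fun_sqrt[OF u(1) d(1)])
 have v: "test (v n)" for n unfolding v_def by (rule test_mult[OF f(1) w])
 have cq': "continuous_on UNIV (%p. - q p)" by (intro continuous_intros cq)
 have w2: "(w n p)^2 <= M^2 + 1" for n p
 proof -
  have "(u p)^2 <= M^2" using bd[of p] by (simp add: abs_le_square_iff[symmetric])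
  moreover have "(w n p)^2 = (u p)^2 + (d n)^2" by (simp add: w_def)
  ultimately show ?thesis using d(4)[of n] by linarith
 qed
 have qv: "0 <= qf (%p. - q p) (v n) (v n)" for n by (rule stable_form_nonneg[OF st cq v])
 have "qf (%p. - q p) (v n) (v n) <= (M^2 + 1) * (NI p. gi (f n) (f n) p) + ?e n" for n
 proof -
  have a: "qf (%p. - q p) (v n) (v n) <= (NI p. (w n p)^2 * gi (f n) (f n) p) - (d n)^2 * (NI p. q p * (f n p)^2)"
   using form_sqrt_le[OF q u f(1) d(1)[of n], of n] unfolding v_def w_def .
  have "(NI p. (w n p)^2 * gi (f n) (f n) p) <= (NI p. (M^2 + 1) * gi (f n) (f n) p)"
  proof (rule integral_mono)
   show "(w n p)^2 * gi (f n) (f n) p <= (M^2 + 1) * gi (f n) (f n) p" for p by (rule mult_right_mono[OF w2 gi_nonneg[OF sf]])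
  qed (intro gi_integrable[OF f(1) sf] continuous_intros smooth_fun_continuous w)+
  hence b: "(NI p. (w n p)^2 * gi (f n) (f n) p) <= (M^2 + 1) * (NI p. gi (f n) (f n) p)" by simp
  have "- ((d n)^2 * (NI p. q p * (f n p)^2)) <= ?e n"
  proof -
   have "(d n)^2 * - (NI p. q p * (f n p)^2) <= (d n)^2 * ?X n" by (rule mult_left_mono) simp_all
   thus ?thesis using d(3)[of n] by simp
  qed
  thus ?thesis using a b by linarith
 qed
 note qle = this
 have qv0: "(%n. qf (%p. - q p) (v n) (v n)) ~~> 0"
 proof (rule tendsto_sandwich[OF always_eventually[OF allI[OF qv]] always_eventually[OF allI[OF qle]] tendsto_const])
  have "(%n. (M^2 + 1) * (NI p. gi (f n) (f n) p) + ?e n) ~~> (M^2 + 1) * 0 + 0"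
   using LIMSEQ_inverse_real_of_nat by (intro tendsto_intros Df) (simp add: inverse_eq_divide)
  thus "(%n. (M^2 + 1) * (NI p. gi (f n) (f n) p) + ?e n) ~~> 0" by simp
 qed
 have weak: "(%n. qf (%p. - q p) (v n) k) ~~> (NI p. 0 * k p)" if k: "test k" for k
 proof -
  have "(%n. (qf (%p. - q p) (v n) k)^2) ~~> 0"
  proof (rule tendsto_sandwich[OF _ _ tendsto_const])
   show "(%n. qf (%p. - q p) (v n) (v n) * qf (%p. - q p) k k) ~~> 0" using tendsto_mult_right[OF qv0] by simp
  qed (simp_all add: qf_Cauchy_Schwarz[OF cq' v k stable_form_nonneg[OF st cq]])
  hence "(%n. sqrt ((qf (%p. - q p) (v n) k)^2)) ~~> sqrt 0" by (rule tendsto_real_sqrt)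
  thus ?thesis using tendsto_rabs_zero_iff[of "%n. qf (%p. - q p) (v n) k" sequentially] by simp
 qed
 have mu: "(%p. abs (u p)) : bmb" and cu: "continuous_on UNIV (%p. abs (u p))"
  using smooth_fun_continuous[OF u(1)] by (auto intro!: borel_measurable_continuous_onI continuous_intros)
 have mw: "w n : bmb" for n by (rule borel_measurable_continuous_onI[OF smooth_fun_continuous[OF w]])
 have L: "L2loc v (%p. abs (u p))"
  unfolding L2loc_def
 proof
  fix p
  obtain W where W: "open W" "p : W" "emeasure nu W < \<infinity>" "(%n. nsq W (%q. f n q - 1)) ~~> 0" using f(2) unfolding L2loc_def by blast
  note [measurable] = test_measurable[OF f(1)] borel_open[OF W(1)]
  have 1: "(%n. nsq W (%q. w n q * (f n q - 1))) ~~> 0"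
  proof (rule tendsto_sandwich[OF _ _ tendsto_const])
   show "(%n. enn (M^2 + 1) * nsq W (%q. f n q - 1)) ~~> 0" using ennreal_tendsto_cmult[OF _ W(4), of "enn (M^2 + 1)"] by simp
   have "nsq W (%q. w n q * (f n q - 1)) <= (NV q. enn (M^2 + 1) * (ind W q * enn ((f n q - 1)^2)))" for n
    unfolding nsq_def
   proof (rule nn_integral_mono)
    fix q
    have "(w n q * (f n q - 1))^2 <= (M^2 + 1) * (f n q - 1)^2" unfolding power_mult_distrib by (rule mult_right_mono[OF w2]) simp
    from ennreal_leI[OF this] show "ind W q * enn ((w n q * (f n q - 1))^2) <= enn (M^2 + 1) * (ind W q * enn ((f n q - 1)^2))"
     by (cases "q : W") (simp_all add: ennreal_mult)
   qed
   thus "EV n. nsq W (%q. w n q * (f n q - 1)) <= enn (M^2 + 1) * nsq W (%q. f n q - 1)"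
    by (simp add: nsq_def nn_integral_cmult)
  qed simp
  have 2: "(%n. nsq W (%q. w n q - abs (u q))) ~~> 0"
  proof (rule tendsto_sandwich[OF _ _ tendsto_const])
   have "(%n. enn (?e n)) ~~> ennreal 0" using LIMSEQ_inverse_real_of_nat by (intro tendsto_ennrealI) (simp add: inverse_eq_divide)
   hence "(%n. emeasure nu W * enn (?e n)) ~~> emeasure nu W * enn 0" using W(3) by (intro ennreal_tendsto_cmult) simp_all
   thus "(%n. emeasure nu W * enn (?e n)) ~~> 0" by simp
   have le: "nsq W (%q. w n q - abs (u q)) <= (NV q. enn (?e n) * ind W q)" for n
    unfolding nsq_def
   proof (rule nn_integral_mono)
    fix q
    have "0 <= w n q - abs (u q)" "w n q - abs (u q) <= ?e n"
     using sqrt_square_bounds(1,2)[of "d n" "0 - u q"] d(1,2)[of n] unfolding w_def by simp_all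
    moreover have "?e n <= 1" by simp
    ultimately have "(w n q - abs (u q))^2 <= ?e n * 1" unfolding power2_eq_square by (intro mult_mono) linarith+
    thus "ind W q * enn ((w n q - abs (u q))^2) <= enn (?e n) * ind W q"
     by (cases "q : W") (simp_all add: ennreal_leI)
   qed
   have "(NV q. enn (?e n) * ind W q) = enn (?e n) * emeasure nu W" for n
    by (rule nn_integral_cmult_indicator) (simp add: sets_nu W(1))
   thus "EV n. nsq W (%q. w n q - abs (u q)) <= emeasure nu W * enn (?e n)"
    using le by (intro always_eventually allI) (simp only: mult.commute[of "emeasure nu W"])
  qed simp
  \<comment> \<open>\<open>v n - abs u\<close> splits into the error of \<open>f n\<close> against
    1, multiplied by the bounded \<open>w n\<close>, and the smoothing error of \<open>w n\<close>,
    which is uniformly at most \<open>?e n\<close>.\<close>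
  have "(%n. nsq W (%q. w n q * (f n q - 1) + (w n q - abs (u q)))) ~~> 0"
   by (rule nsq_tendsto_add[OF _ _ W(1) 1 2]) (use mw mu in measurable)
  hence "(%n. nsq W (%q. v n q - abs (u q))) ~~> 0" by (simp add: v_def algebra_simps)
  thus "EX W. open W & p : W & emeasure nu W < \<infinity> & (%n. nsq W (%q. v n q - abs (u q))) ~~> 0" using W(1-3) by blast
 qed
 have loc: "EX c:A. EX r>0. p : fst c & cball (snd c p) r <= im c &
   (EX V. smooth_on (ball (snd c p) r) V & (%n. N2 (snd c p) r (%x. loc c (v n) x - V x)) ~~> 0)" for p
 proof -
  obtain c where c: "c : A" "p : fst c" using chart_cover by blast
  obtain r where r: "0 < r" "cball (snd c p) r <= im c" "(%n. N2 (snd c p) r (%x. loc c (v n) x - loc c (%p. abs (u p)) x)) ~~> 0"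
   using L2loc_N2[OF L test_measurable[OF v] mu c] by blast
  let ?D = "%n x. loc c (v n) x - loc c (%p. abs (u p)) x"
  have m: "?D n : bmb" for n
   by (intro borel_measurable_diff measurable_compose[OF chart_inv_measurable[OF c(1)]] test_measurable[OF v] mu)
  show ?thesis
  proof (rule weyl_chart_limit[OF v _ smooth_fun_const c r(1,2) _ weak])
   show "smooth_fun A (%p. - q p)" using smooth_fun_diff[OF smooth_fun_const q, of 0] by simp
   fix e :: real assume e: "0 < e"
   have "EV n. N2 (snd c p) r (?D n) < enn (e / 4)" by (rule order_tendstoD(2)[OF r(3)]) (use e in simp)
   then obtain N where N: "!!n. N <= n ==> N2 (snd c p) r (?D n) < enn (e / 4)" by (auto simp: eventually_sequentially)
   show "EX N. ALL i>=N. ALL j>=N. N2 (snd c p) r (%x. loc c (v i) x - loc c (v j) x) <= enn e"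
   proof (intro exI[of _ N] allI impI)
    fix i j assume ij: "N <= i" "N <= j"
    have "N2 (snd c p) r (%x. loc c (v i) x - loc c (v j) x) = N2 (snd c p) r (%x. ?D i x + - ?D j x)" by simp
    also have "... <= 2 * N2 (snd c p) r (?D i) + 2 * N2 (snd c p) r (%x. - ?D j x)" by (rule N2_add[OF m borel_measurable_uminus[OF m]])
    also have "N2 (snd c p) r (%x. - ?D j x) = N2 (snd c p) r (?D j)" unfolding N2_def by (simp only: power2_minus)
    also have "2 * N2 (snd c p) r (?D i) + 2 * N2 (snd c p) r (?D j) <= 2 * enn (e / 4) + 2 * enn (e / 4)"
     by (intro add_mono mult_left_mono less_imp_le N ij) simp_all
    also have "2 * enn (e / 4) = enn (e / 2)" using ennreal_mult[of 2 "e / 4"] e by simp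
    also have "enn (e / 2) + enn (e / 2) = enn e" using ennreal_plus[of "e / 2" "e / 2"] e by simp
    finally show "N2 (snd c p) r (%x. loc c (v i) x - loc c (v j) x) <= enn e" .
   qed
  qed
 qed
 obtain h where h: "smooth_fun A h" "L2loc v h" by (rule L2loc_glue[OF test_measurable[OF v] loc])
 have "abs (u p) = h p" for p
 proof -
  obtain W1 where W1: "open W1" "p : W1" "(%n. nsq W1 (%q. v n q - abs (u q))) ~~> 0" using L unfolding L2loc_def by blast
  obtain W2 where W2: "open W2" "p : W2" "(%n. nsq W2 (%q. v n q - h q)) ~~> 0" using h(2) unfolding L2loc_def by blast
  note ch = smooth_fun_continuous[OF h(1)]
  show ?thesis
  proof (rule L2loc_unique[where f = v and W = "W1 \<inter> W2" and u = "%p. abs (u p)" and v = h, OF test_measurable[OF v] open_Int[OF W1(1) W2(1)]])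
   show "(%n. nsq (W1 \<inter> W2) (%q. v n q - abs (u q))) ~~> 0" by (rule nsq_tendsto_le[OF nsq_le W1(3)]) auto
   show "(%n. nsq (W1 \<inter> W2) (%q. v n q - h q)) ~~> 0" by (rule nsq_tendsto_le[OF nsq_le W2(3)]) auto
  qed (use W1(2) W2(2) mu borel_measurable_continuous_onI[OF ch] continuous_on_subset[OF cu] continuous_on_subset[OF ch] in auto)
 qed
 thus ?thesis using h(1) by simp
qed

end

section \<open>The strong maximum principle\<close>

lemma exp_square:
 fixes z :: "real^'n"
 shows exp_square_differentiable: "(%x. exp (- al * ((x - z) \<bullet> (x - z))) + k) differentiable at x"
  and exp_square_partial: "pt j (%x. exp (- al * ((x - z) \<bullet> (x - z))) + k) x = - 2 * al * (x $ j - z $ j) * exp (- al * ((x - z) \<bullet> (x - z)))"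
proof -
 have "((%x. exp (- al * ((x - z) \<bullet> (x - z))) + k) has_derivative
   (%h. exp (- al * ((x - z) \<bullet> (x - z))) * (- al * (2 * ((x - z) \<bullet> h))))) (at x)"
  by (auto intro!: derivative_eq_intros simp: inner_commute fun_eq_iff algebra_simps)
 thus "(%x. exp (- al * ((x - z) \<bullet> (x - z))) + k) differentiable at x"
  and "pt j (%x. exp (- al * ((x - z) \<bullet> (x - z))) + k) x = - 2 * al * (x $ j - z $ j) * exp (- al * ((x - z) \<bullet> (x - z)))"
  unfolding differentiable_def by (blast, simp add: partial_eqI inner_axis)
qed

lemma continuous_bounded_cball:
 fixes f :: "real^'n => real"
 assumes "continuous_on (cball z R) f"
 obtains C where "!!x. x : cball z R ==> abs (f x) <= C"
proof -
 have "bounded (f ` cball z R)" by (rule compact_imp_bounded[OF compact_continuous_image[OF assms compact_cball]])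
 then obtain C where "ALL y:f ` cball z R. abs y <= C" unfolding bounded_real by blast
 thus ?thesis using that[of C] by simp
qed

context density_manifold begin

lemma ediv_linear:
 assumes c: "c : A" and x: "x : im c" and v: "smooth_on (im c) v" and h: "smooth_on (im c) h"
 shows "ediv c (%x. k * v x + l * h x) x = k * ediv c v x + l * ediv c h x"
proof -
 note o = open_im[OF c] and dv = smooth_on_differentiable[OF open_im[OF c] v] and dh = smooth_on_differentiable[OF open_im[OF c] h]
 let ?X = "%v i y. SU j. acoef c i j y * pt j v y"
 have X: "?X w i differentiable at x" if "smooth_on (im c) w" for w i
  by (rule smooth_on_differentiable[OF o _ x]) (intro smooth_on_sum smooth_on_mult smooth_acoef smooth_on_partial c o that)
 have lin: "pt i (%x. k * a x + l * b x) y = k * pt i a y + l * pt i b y"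
  if "a differentiable at y" "b differentiable at y" for a b :: "real^'n => real" and i y
  using that by (subst partial_add) (auto simp: partial_mult)
 have e: "pt i (?X (%x. k * v x + l * h x) i) x = k * pt i (?X v i) x + l * pt i (?X h i) x" for i
 proof -
  have "pt i (?X (%x. k * v x + l * h x) i) x = pt i (%y. k * ?X v i y + l * ?X h i y) x"
   by (rule partial_cong[OF o x]) (simp add: lin dv dh sum_distrib_left sum.distrib algebra_simps)
  also have "... = k * pt i (?X v i) x + l * pt i (?X h i) x" by (rule lin[OF X[OF v] X[OF h]])
  finally show ?thesis .
 qed
 show ?thesis unfolding ediv_def e sum.distrib sum_distrib_left by (rule refl)
qed

text \<open>Each derivative of the Gaussian brings down a factor \<open>al\<close>. The second-order
  term is quadratic in \<open>al\<close>, and by ellipticity its coefficient is bounded below on the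
  outer half of the ball, so for large \<open>al\<close> it beats the remaining term. The constant
  \<open>k\<close> is free so that the barrier can be made to vanish on the sphere.\<close>

lemma barrier:
 assumes c: "c : A" and K: "cball z R <= im c" "0 < R"
 obtains al where "0 < al" "!!x. x : ball z R ==> R / 2 <= dist z x ==>
  L * exp (- al * ((x - z) \<bullet> (x - z))) <= ediv c (%x. exp (- al * ((x - z) \<bullet> (x - z))) + k) x"
proof -
 note o = open_im[OF c]
 let ?Y = "%i y. SU j. acoef c i j y * (y $ j - z $ j)"
 let ?C = "%x. SU i. pt i (?Y i) x"
 have Y: "smooth_on (im c) (?Y i)" for i
  by (intro smooth_on_sum smooth_on_mult smooth_acoef smooth_on_diff smooth_on_nth smooth_on_const c o)
 have "continuous_on (cball z R) ?C" by (intro continuous_on_subset[OF smooth_on_continuous K(1)] smooth_on_sum smooth_on_partial Y o)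
 from continuous_bounded_cball[OF this] obtain C0 where C0: "!!x. x : cball z R ==> abs (?C x) <= C0" by blast
 obtain M where M: "0 < M" "!!x p. x : cball z R ==> (SU i. (p i)^2) <= M * (SU i. SU j. acoef c i j x * p i * p j)"
  using chart_ball_bounds[OF c K(1), of thesis] by blast
 \<comment> \<open>Chosen so that \<open>al * (R^2 / M)\<close> dominates
   \<open>2 * C0 + abs L\<close>, where \<open>R^2 / M <= 4 * ?Q\<close> on the outer half;
   \<open>al >= 1\<close> allows one further factor \<open>al\<close> to be dropped.\<close>
 define al where "al = max 1 (M * (2 * C0 + abs L) / R^2)"
 have al: "1 <= al" "M * (2 * C0 + abs L) / R^2 <= al" by (simp_all add: al_def)
 show ?thesis
 proof (rule that[of al])
  fix x assume x: "x : ball z R" "R / 2 <= dist z x"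
  have xi: "x : im c" using x K(1) ball_subset_cball by blast
  let ?E = "%x. exp (- al * ((x - z) \<bullet> (x - z))) + 0" and ?Q = "SU i. (x $ i - z $ i) * ?Y i x"
  have pE: "pt i ?E y = - 2 * al * (y $ i - z $ i) * ?E y" for i y using exp_square_partial[of i al z 0 y] by simp
  have dE: "?E differentiable at x" by (rule exp_square_differentiable)
  have "(%y. SU j. acoef c i j y * pt j (%x. exp (- al * ((x - z) \<bullet> (x - z))) + k) y) = (%y. - 2 * al * (?E y * ?Y i y))" for i
   unfolding exp_square_partial by (simp add: sum_distrib_left algebra_simps)
  moreover have "pt i (%y. - 2 * al * (?E y * ?Y i y)) x = - 2 * al * (?E x * pt i (?Y i) x + - 2 * al * (x $ i - z $ i) * ?E x * ?Y i x)" for i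
  proof -
   note dY = smooth_on_differentiable[OF o Y xi]
   have "pt i (%y. - 2 * al * (?E y * ?Y i y)) x = - 2 * al * pt i (%y. ?E y * ?Y i y) x"
    using partial_mult[of "%y. - 2 * al" x "%y. ?E y * ?Y i y" i] dE dY by (simp only: partial_const differentiable_const differentiable_mult simp_thms)
   thus ?thesis unfolding partial_mult[OF dE dY] pE .
  qed
  ultimately have "ediv c (%x. exp (- al * ((x - z) \<bullet> (x - z))) + k) x = (SU i. - 2 * al * (?E x * pt i (?Y i) x + - 2 * al * (x $ i - z $ i) * ?E x * ?Y i x))"
   unfolding ediv_def by simp
  also have "... = - 2 * al * ?E x * ?C x + 4 * al^2 * ?E x * ?Q"
  proof -
   have "(SU i. - 2 * al * (e * D i + - 2 * al * d i * e * Y i)) = - 2 * al * e * (SU i. D i) + 4 * al^2 * e * (SU i. d i * Y i)"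
    for e and D d Y :: "'n => real" unfolding sum_distrib_left sum.distrib[symmetric] by (rule sum.cong) (simp_all add: power2_eq_square algebra_simps)
   thus ?thesis .
  qed
  also have "... = ?E x * (al * (4 * al * ?Q - 2 * ?C x))" by (simp add: power2_eq_square algebra_simps)
  finally have eq: "ediv c (%x. exp (- al * ((x - z) \<bullet> (x - z))) + k) x = ..." .
  have "(R / 2)^2 <= (dist z x)^2" using x(2) K(2) by (intro power_mono) auto
  also have "(dist z x)^2 = (x - z) \<bullet> (x - z)" by (simp add: dist_commute dist_norm power2_norm_eq_inner)
  also have "... = (SU i. (x $ i - z $ i)^2)" by (simp add: inner_vec_def power2_eq_square)
  also have "... <= M * ?Q" using M(2)[of x "%i. x $ i - z $ i"] x(1) by (simp add: sum_distrib_left mult_ac)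
  finally have "R^2 / M <= 4 * ?Q" using M(1) by (simp add: power_divide field_simps)
  hence "al * (R^2 / M) <= al * (4 * ?Q)" using al(1) by (intro mult_left_mono) simp_all
  moreover have "2 * C0 + abs L <= al * (R^2 / M)" using al(2) M(1) K(2) by (simp add: field_simps)
  moreover have "abs (?C x) <= C0" by (rule C0) (use x(1) in simp)
  ultimately have "abs L <= 4 * al * ?Q - 2 * ?C x" by linarith
  hence "1 * abs L <= al * (4 * al * ?Q - 2 * ?C x)" using al(1) by (intro mult_mono) simp_all
  hence "?E x * L <= ?E x * (al * (4 * al * ?Q - 2 * ?C x))" by (intro mult_left_mono) simp_all
  thus "L * exp (- al * ((x - z) \<bullet> (x - z))) <= ediv c (%x. exp (- al * ((x - z) \<bullet> (x - z))) + k) x"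
   unfolding eq by (simp add: mult.commute)
 qed (use al in simp)
qed

text \<open>The inequality is tested with a smooth function of the negative part of \<open>ze\<close>.\<close>

lemma weak_minimum:
 assumes c: "c : A" and K: "cball z R <= im c" and s: "smooth_on (im c) ze"
  and bd: "!!x. dist z x = R ==> 0 <= ze x" and neg: "!!x. x : ball z R ==> ze x < 0 ==> ediv c ze x < 0" and x: "x : ball z R"
 shows "0 <= ze x"
proof (rule ccontr)
 assume "~ 0 <= ze x"
 \<comment> \<open>A level strictly between \<open>ze x\<close> and 0: the sublevel set at
   \<open>- ka\<close> is compact inside the open ball because of the boundary values, and it
   contains \<open>x\<close> in its interior, so \<open>F x\<close> is positive.\<close>
 define ka where "ka = - ze x / 2"
 have ka: "0 < ka" "ze x < - ka" using \<open>~ 0 <= ze x\<close> by (simp_all add: ka_def)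
 let ?B = "ball z R"
 have B: "?B <= im c" using K ball_subset_cball by blast
 define F where "F y = (if y : ?B then flat 0 (- ka - ze y) else 0)" for y
 have Fs: "smooth_on ?B F"
  by (rule smooth_on_cong[OF open_ball smooth_on_flat_compose[of ?B "%y. - ka - ze y" 0]])
   (auto simp: F_def intro!: smooth_on_diff smooth_on_const smooth_on_subset[OF s B])
 let ?N = "{y : cball z R. ze y <= - ka}"
 have "compact ?N"
  using continuous_closed_preimage[OF continuous_on_subset[OF smooth_on_continuous[OF s] K] closed_cball closed_atMost[of "- ka"]]
   compact_Int_closed[OF compact_cball[of z R], of ?N] by (simp add: vimage_def Int_def conj_ac cong: conj_cong)
 moreover have "?N <= ?B"
 proof
  fix y assume y: "y : ?N"
  hence "dist z y ~= R" using bd[of y] ka(1) by auto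
  thus "y : ?B" using y by auto
 qed
 ultimately have F: "csupp ?B F"
  by (intro csupp_I[OF open_ball Fs, of ?N]) (auto simp: F_def flat_zero)
 note Fc = csupp_mono[OF F B]
 have F0: "0 <= F y" for y by (cases "- ka - ze y > 0") (auto simp: F_def flat_zero less_imp_le flat_pos)
 have pF: "pt i F y = - flat 2 (- ka - ze y) * pt i ze y" if "y : ?B" for i y
 proof -
  have dze: "ze differentiable at y" using smooth_on_differentiable[OF open_im[OF c] s] that B by blast
  have "pt i F y = pt i (%y. flat 0 (- ka - ze y)) y" by (rule partial_cong[OF open_ball that]) (simp add: F_def)
  also have "... = flat 2 (- ka - ze y) * pt i (%y. - ka - ze y) y"
   by (rule partial_compose_real) (use dze flat_deriv[of 0 "- ka - ze y"] in "auto intro!: derivative_intros simp: numeral_2_eq_2")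
  also have "pt i (%y. - ka - ze y) y = - pt i ze y" using partial_diff[OF differentiable_const dze] by simp
  finally show ?thesis by simp
 qed
 have sE: "smooth_on (im c) (ediv c ze)" by (rule smooth_ediv[OF c open_im[OF c] order_refl s])
 have le: "F y * ediv c ze y <= 0" for y
 proof (cases "F y = 0")
  case False
  hence "y : ?B" "~ - ka - ze y <= 0" using flat_zero[of "- ka - ze y" 0] by (auto simp: F_def split: if_splits)
  moreover from this have "ze y < 0" using ka(1) by linarith
  ultimately show ?thesis using neg[of y] F0[of y] by (simp add: mult_nonneg_nonpos less_imp_le)
 qed simp
 have nn: "(SU i. SU j. acoef c i j y * pt i F y * pt j ze y) <= 0" for y
 proof (cases "y : ?B")
  case True
  have "0 <= (SU i. SU j. acoef c i j y * pt i ze y * pt j ze y)"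
  proof (cases "(\<chi> i. pt i ze y) = 0")
   case False
   have "y : im c" using True B by blast
   from mult_pos_pos[OF vol_pos[OF c this] ginv_pos[OF c this False]] show ?thesis by (simp add: acoef_def sum_distrib_left mult_ac)
  qed (simp add: vec_eq_iff)
  moreover have "0 <= flat 2 (- ka - ze y)" by (cases "- ka - ze y > 0") (auto simp: flat_zero less_imp_le flat_pos)
  ultimately have "0 <= flat 2 (- ka - ze y) * (SU i. SU j. acoef c i j y * pt i ze y * pt j ze y)" by simp
  also have "... = - (SU i. SU j. acoef c i j y * pt i F y * pt j ze y)"
   by (simp add: pF[OF True] sum_distrib_left sum_negf mult_ac)
  finally show ?thesis by simp
 qed (simp add: csupp_outside[OF csupp_partial[OF F]])
 have "(LI y. - (SU i. SU j. acoef c i j y * pt i F y * pt j ze y)) >= 0"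
  by (rule Bochner_Integration.integral_nonneg) (simp add: nn)
 hence "(LI y. F y * ediv c ze y) >= 0" using ediv_by_parts[OF c Fc s] by simp
 note b = csupp_mult[OF open_im[OF c] Fc smooth_on_divide[OF open_im[OF c] sE smooth_vol[OF c] vol_pos[OF c]]]
 let ?G = "%y. F y * (ediv c ze y / vol c y)"
 note t = test_lift[OF c b]
 have "(NI q. lift c ?G q * 1) = (LI y. ?G y * vol c y * 1)" by (rule integral_lift[OF c b borel_measurable_const])
 also have "... = (LI y. F y * ediv c ze y)"
 proof (rule Bochner_Integration.integral_cong[OF refl])
  show "?G y * vol c y * 1 = F y * ediv c ze y" for y using vol_pos[OF c, of y] csupp_outside[OF Fc, of y] by (cases "y : im c") auto
 qed
 finally have G0: "0 <= (NI q. lift c ?G q)" using \<open>(LI y. F y * ediv c ze y) >= 0\<close> by simp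
 have Gn: "lift c ?G q <= 0" for q
 proof (cases "q : fst c")
  case True
  hence "vol c (snd c q) > 0" using vol_pos[OF c] by blast
  thus ?thesis using True le[of "snd c q"] by (simp add: lift_def divide_nonpos_pos)
 qed (simp add: lift_def)
 have i: "integrable nu (lift c ?G)" using test_integrable[OF t, of "%_. 1"] by simp
 have xi: "x : im c" using x B by blast
 have "- lift c ?G (chart_inv c x) = 0"
 proof (rule integral_eq_0_continuous[where f="%q. - lift c ?G q"])
  show "continuous_on UNIV (%q. - lift c ?G q)" by (intro continuous_on_minus smooth_fun_continuous[OF test_smooth[OF t]])
  show "integrable nu (%q. - lift c ?G q)" by (intro Bochner_Integration.integrable_minus i)
  show "0 <= - lift c ?G q" for q using Gn[of q] by simp
  hence "0 <= (NI q. - lift c ?G q)" by (intro Bochner_Integration.integral_nonneg)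
  thus "(NI q. - lift c ?G q) = 0" using G0 by simp
 qed
 hence "?G x = 0" using loc_lift[OF c xi, of ?G] by simp
 hence "F x * ediv c ze x = 0" using vol_pos[OF c xi] by simp
 moreover have "0 < F x" using ka(2) x by (simp add: F_def flat_pos)
 ultimately show False using neg[OF x] ka by simp
qed

text \<open>Hopf's boundary point argument: a multiple of the barrier lies below \<open>v\<close> in
  the ball and forces a positive inward slope at \<open>y\<close>, whereas \<open>y\<close> is an
  interior minimum of the nonnegative smooth \<open>v\<close> and the slope must be 0.\<close>

lemma hopf:
 assumes c: "c : A" and K: "cball z R <= im c" "0 < R" and v: "smooth_on (im c) v" "!!x. x : im c ==> 0 <= v x" "!!x. x : ball z R ==> 0 < v x"
  and ineq: "!!x. x : ball z R ==> ediv c v x <= k * v x" "0 <= k" and y: "dist z y = R" "v y = 0"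
 shows False
proof -
 note o = open_im[OF c]
 \<comment> \<open>This constant makes the barrier vanish on the sphere of radius
   \<open>R\<close>.\<close>
 define l where "l al = - exp (- al * R^2)" for al
 \<comment> \<open>The additive constant depends on \<open>al\<close>, so the bound is stated for
   every \<open>l\<close>, of which derivatives are independent. Of the factor \<open>k + 1\<close>,
   \<open>k\<close> pays for the right side of the inequality for \<open>v\<close>, and 1 makes the
   result strict.\<close>
 obtain al where al: "0 < al" "!!l x. x : ball z R ==> R / 2 <= dist z x ==>
  (k + 1) * exp (- al * ((x - z) \<bullet> (x - z))) <= ediv c (%x. exp (- al * ((x - z) \<bullet> (x - z))) + l) x"
 proof -
  obtain al where a: "0 < al" "!!x. x : ball z R ==> R / 2 <= dist z x ==>
   (k + 1) * exp (- al * ((x - z) \<bullet> (x - z))) <= ediv c (%x. exp (- al * ((x - z) \<bullet> (x - z))) + 0) x"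
   using barrier[OF c K, of "k + 1" 0 thesis] by blast
  thus ?thesis using that[of al] unfolding ediv_def exp_square_partial by blast
 qed
 let ?E = "%x. exp (- al * ((x - z) \<bullet> (x - z)))" and ?h = "%x. exp (- al * ((x - z) \<bullet> (x - z))) + l al"
 have nz: "(x - z) \<bullet> (x - z) = (dist z x)^2" for x by (simp add: dist_commute dist_norm power2_norm_eq_inner)
 have hE: "?h x <= ?E x" "?h x <= 1" for x
 proof -
  show "?h x <= ?E x" by (simp add: l_def)
  have "?E x <= 1" using al(1) by simp
  moreover have "l al <= 0" by (simp add: l_def)
  ultimately show "?h x <= 1" by linarith
 qed
 have h: "smooth_on (im c) ?h"
  unfolding nz by (intro smooth_on_add smooth_on_exp_compose smooth_on_mult smooth_on_const smooth_on_dist_square o)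
 have sub: "cball z (R / 2) <= ball z R" using K(2) by (auto simp: subset_iff)
 have "EX x0:cball z (R / 2). ALL x:cball z (R / 2). v x0 <= v x"
  by (rule continuous_attains_inf)
   (use K sub ball_subset_cball[of z R] in "auto intro!: continuous_on_subset[OF smooth_on_continuous[OF v(1)]]")
 then obtain x0 where x0: "x0 : cball z (R / 2)" "!!x. x : cball z (R / 2) ==> v x0 <= v x" by blast
 \<comment> \<open>The minimum of \<open>v\<close> on the inner half ball; as the barrier is at most
   1, \<open>?ze\<close> is nonnegative there, and only the outer half remains, where
   \<open>al\<close> applies.\<close>
 define ep where "ep = v x0"
 have ep: "0 < ep" using v(3) sub x0(1) by (auto simp: ep_def)
 let ?ze = "%x. 1 * v x + - ep * ?h x"
 have pos: "0 <= ?ze x" if x: "x : ball z R" for x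
 proof (rule weak_minimum[OF c K(1) _ _ _ x])
  show "smooth_on (im c) ?ze" by (intro smooth_on_add smooth_on_mult smooth_on_const o v h)
  show "0 <= ?ze x" if "dist z x = R" for x
  proof -
   have "x : im c" using that K(1) by auto
   moreover have "?h x = 0" unfolding nz that by (simp add: l_def)
   ultimately show ?thesis using v(2) by simp
  qed
  show "ediv c ?ze x < 0" if x: "x : ball z R" "?ze x < 0" for x
  proof -
   have xi: "x : im c" using x K(1) ball_subset_cball by blast
   have lt: "v x < ep * ?h x" using x(2) by simp
   have "R / 2 <= dist z x"
   proof (rule ccontr)
    assume "~ R / 2 <= dist z x"
    hence "ep * 1 <= v x" using x0(2)[of x] by (simp add: ep_def)
    moreover have "ep * ?h x <= ep * 1" using ep hE(2)[of x] by (intro mult_left_mono) simp_all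
    ultimately show False using lt by linarith
   qed
   hence "ep * ((k + 1) * ?E x) <= ep * ediv c ?h x" using al(2)[OF x(1)] ep by (intro mult_left_mono) simp_all
   moreover have "k * v x <= k * (ep * ?E x)"
    using lt mult_left_mono[OF hE(1)[of x] less_imp_le[OF ep]] ineq(2) by (intro mult_left_mono) linarith+
   moreover have "0 < ep * ?E x" using ep by simp
   moreover have "ep * ((k + 1) * ?E x) = k * (ep * ?E x) + ep * ?E x" by (simp add: algebra_simps)
   ultimately have "ediv c v x - ep * ediv c ?h x < 0" using ineq(1)[OF x(1)] by linarith
   thus ?thesis unfolding ediv_linear[OF c xi v(1) h] by simp
  qed
 qed
 have yi: "y : im c" using y(1) K(1) by auto
 obtain v' where v': "(v has_derivative v') (at y)" using smooth_on_differentiable[OF o v(1) yi] unfolding differentiable_def by blast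
 \<comment> \<open>\<open>y\<close> lies on the sphere but in the interior of the chart image, where
   \<open>v\<close> attains its minimum 0.\<close>
 have "v' = (%_. 0)" by (rule differential_zero_maxmin[OF yi o v']) (use v(2) y(2) in auto)
 hence v0: "(v has_derivative (%_. 0)) (at y)" using v' by simp
 \<comment> \<open>The comparison function \<open>?ze\<close> along the inward radius at
   \<open>y\<close>. The slope of \<open>v\<close> is 0 and that of the barrier positive, so
   \<open>?f\<close> drops below \<open>?f 0 = 0\<close> inside the ball, against
   \<open>pos\<close>.\<close>
 let ?f = "%t. v (y + t *. (z - y)) - ep * (exp (- al * ((1 - t)^2 * R^2)) + l al)"
 have "((%t. v (y + t *. (z - y))) has_derivative (%_. 0)) (at 0)"
  by (rule has_derivative_compose[of "%t. y + t *. (z - y)" _ _ _ v]) (use v0 in "auto intro!: derivative_eq_intros")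
 hence "((%t. v (y + t *. (z - y))) has_real_derivative 0) (at 0)" by (simp add: has_field_derivative_def lambda_zero)
 hence "(?f has_real_derivative 0 - ep * (exp (- al * R^2) * (2 * al * R^2))) (at 0)"
  by (auto intro!: derivative_eq_intros simp: algebra_simps)
 moreover have "0 - ep * (exp (- al * R^2) * (2 * al * R^2)) < 0" using ep al(1) K(2) by simp
 ultimately obtain d where d: "0 < d" "!!t. 0 < t ==> t < d ==> ?f (0 + t) < ?f 0" using DERIV_neg_dec_right by blast
 define t where "t = min (d / 2) (1 / 2)"
 have t: "0 < t" "t < d" "t < 1" using d(1) by (auto simp: t_def)
 have "z - (y + t *. (z - y)) = (1 - t) *. (z - y)" by (simp add: algebra_simps)
 hence dt: "dist z (y + t *. (z - y)) = (1 - t) * R" using t y(1) by (simp add: dist_norm)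
 hence "y + t *. (z - y) : ball z R" using t K(2) by simp
 from pos[OF this] have "0 <= ?f t" unfolding nz dt by (simp add: power_mult_distrib)
 moreover have "?f 0 = 0" using y(2) by (simp add: l_def)
 ultimately show False using d(2)[OF t(1,2)] by simp
qed

text \<open>Were the zero set not open, some ball free of zeros would touch it at a point
  \<open>y\<close>. On the ball \<open>abs u\<close> is locally plus or minus \<open>u\<close> and
  inherits a differential inequality; as \<open>abs u\<close> is smooth across \<open>y\<close>,
  \<open>hopf\<close> gives a contradiction. Connectedness finishes.\<close>

lemma strong_maximum_principle:
 assumes q: "smooth_fun A q" and u: "smooth_fun A u" "!!p. wlap u p = - q p * u p" and au: "smooth_fun A (%p. abs (u p))"
 shows "(ALL p. u p = 0) \<or> (ALL p. u p ~= 0)"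
proof -
 let ?Z = "{p. u p = 0}"
 have closed: "closed ?Z" by (rule closed_Collect_eq[OF smooth_fun_continuous[OF u(1)]]) simp
 have "open ?Z"
 proof (rule ccontr)
  assume "~ open ?Z"
  then obtain p where p: "u p = 0" "p ~: interior ?Z" unfolding interior_eq[symmetric] using interior_subset[of ?Z] by blast
  obtain c where c: "c : A" "p : fst c" using chart_cover by blast
  let ?a = "snd c p"
  obtain r0 where r0: "0 < r0" "cball ?a r0 <= im c" using open_contains_cball[of "im c"] open_im[OF c(1)] c(2) by auto
  define r where "r = r0 / 2"
  have r: "0 < r" "cball ?a (2 * r) <= im c" using r0 by (simp_all add: r_def)
  let ?W = "{q : fst c. snd c q : ball ?a r}" and ?v = "loc c (%p. abs (u p))"
  have "p : ?W" using c(2) r(1) by simp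
  hence "~ ?W <= ?Z" using interior_maximal[of ?W ?Z] open_chart_vimage[OF c(1) open_ball, of ?a r] p(2) by blast
  then obtain s where s: "s : fst c" "snd c s : ball ?a r" "u s ~= 0" by blast
  let ?z = "snd c s"
  have v: "smooth_on (im c) ?v" by (rule smooth_loc[OF au c(1)])
  let ?Y = "{x : cball ?a (2 * r). ?v x = 0}"
  have "closed ?Y"
   using continuous_closed_preimage_constant[OF continuous_on_subset[OF smooth_on_continuous[OF v] r(2)] closed_cball, of 0] by simp
  moreover have "?a : ?Y" using p(1) chart_inv_chart[OF c] r(1) by simp
  \<comment> \<open>The zero nearest to \<open>?z\<close>. Since \<open>?a\<close> is itself a zero
    at distance less than \<open>r\<close>, the touching ball has radius below \<open>r\<close> and
    stays within \<open>cball ?a (2 * r)\<close>.\<close>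
  ultimately obtain y where y: "y : ?Y" "!!x. x : ?Y ==> dist ?z y <= dist ?z x" using distance_attains_inf[of ?Y ?z] by blast
  define R where "R = dist ?z y"
  have vz: "?v ?z ~= 0" using s chart_inv_chart[OF c(1) s(1)] by simp
  have R: "0 < R" "R < r"
  proof -
   show "0 < R" using vz y(1) by (auto simp: R_def)
   show "R < r" using y(2)[OF \<open>?a : ?Y\<close>] s(2) by (simp add: R_def dist_commute)
  qed
  have sub: "cball ?z R <= cball ?a (2 * r)"
  proof
   fix x assume "x : cball ?z R"
   hence "dist ?a x <= dist ?a ?z + R" using dist_triangle[of ?a x ?z] by simp
   thus "x : cball ?a (2 * r)" using s(2) R(2) by simp
  qed
  hence K: "cball ?z R <= im c" using r(2) by blast
  have vp: "0 < ?v x" if "x : ball ?z R" for x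
  proof -
   have "x : cball ?a (2 * r)" using that sub ball_subset_cball by blast
   thus ?thesis using y(2)[of x] that by (fastforce simp: R_def)
  qed
  have "continuous_on (cball ?z R) (%x. - (loc c q x * vol c x))"
   by (intro continuous_intros continuous_on_subset[OF smooth_on_continuous K] smooth_loc[OF q c(1)] smooth_vol[OF c(1)])
  from continuous_bounded_cball[OF this] obtain k where k: "!!x. x : cball ?z R ==> abs (- (loc c q x * vol c x)) <= k" by blast
  have eq: "ediv c (loc c u) x = - (loc c q x * vol c x) * loc c u x" if "x : im c" for x
   using wlap_eq[OF u(1) c(1) chart_inv_in[OF that]] u(2)[of "chart_inv c x"] vol_pos[OF c(1) that]
   by (simp add: chart_chart_inv[OF that] field_simps)
  have ev: "ediv c ?v x <= k * ?v x" if x: "x : ball ?z R" for x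
  proof -
   have xi: "x : im c" using x K ball_subset_cball by blast
   define sg where "sg = sgn (loc c u x)"
   let ?O = "{y : im c. chart_inv c y : {p. 0 < sg * u p}}"
   have O: "open ?O"
    by (rule open_chart_image[OF c(1) open_Collect_less[OF continuous_on_const continuous_on_mult[OF continuous_on_const smooth_fun_continuous[OF u(1)]]]])
   have u0: "loc c u x ~= 0" using vp[OF x] by auto
   have xO: "x : ?O" using xi u0 by (simp add: sg_def mult_sgn_abs sgn_mult_self_eq abs_sgn_eq sgn_mult_abs mult.commute flip: abs_sgn)
   have sg: "sg = 1 \<or> sg = -1" using u0 by (auto simp: sg_def sgn_if)
   \<comment> \<open>On the open set where \<open>u\<close> has the sign \<open>sg\<close>, the
     absolute value is linear in \<open>u\<close>; the zero summand only fits the shape of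
     \<open>ediv_linear\<close>.\<close>
   have "?v y = sg * loc c u y + 0 * loc c u y" if "y : ?O" for y using sg that by auto
   hence "pt i ?v y = pt i (%y. sg * loc c u y + 0 * loc c u y) y" if "y : ?O" for i y by (intro partial_cong[OF O that])
   hence "ediv c ?v x = ediv c (%y. sg * loc c u y + 0 * loc c u y) x"
    unfolding ediv_def by (intro sum.cong refl partial_cong[OF O xO]) simp
   also have "... = sg * ediv c (loc c u) x" using ediv_linear[OF c(1) xi smooth_loc[OF u(1) c(1)] smooth_loc[OF u(1) c(1)], of sg 0] by simp
   also have "... = - (loc c q x * vol c x) * ?v x" unfolding eq[OF xi] using sg xO by auto
   also have "... <= k * ?v x" using k[of x] x vp[OF x] by (intro mult_right_mono) auto
   finally show ?thesis .
  qed
  show False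
  proof (rule hopf[OF c(1) K R(1) v _ vp ev])
   show "0 <= k" using k[of ?z] R(1) by (simp add: order_trans[OF abs_ge_zero])
   show "dist ?z y = R" by (simp add: R_def)
  qed (use y(1) in auto)
 qed
 moreover have "ALL T :: 'm set. open T & closed T --> T = {} \<or> T = UNIV" using conn unfolding connected_clopen by simp
 ultimately have "?Z = {} \<or> ?Z = UNIV" using closed by blast
 thus ?thesis by blast
qed

lemma schroedinger_eq: "schroedinger A g \<phi> q u p = wlap u p + q p * u p"
 by (simp add: schroedinger_def wlap_def)

lemma bounded_kernel_dichotomy:
 assumes "parabolic A g \<phi>" "smooth_fun A q" "stable_operator A g \<phi> q" "u : bounded_kernel A g \<phi> q"
 shows "(ALL p. u p = 0) \<or> (ALL p. u p ~= 0)"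
proof -
 have u: "smooth_fun A u" "bounded (range u)" "!!p. wlap u p = - q p * u p"
  using assms(4) by (auto simp: bounded_kernel_def schroedinger_eq eq_neg_iff_add_eq_0)
 obtain M where "!!p. abs (u p) <= M" using u(2) unfolding bounded_real by auto
 thus ?thesis using strong_maximum_principle[OF assms(2) u(1,3) abs_smooth[OF assms(1,3,2) u(1,3)]] by blast
qed

lemma bounded_kernel_linear:
 assumes "u : bounded_kernel A g \<phi> q" "v : bounded_kernel A g \<phi> q"
 shows "(%p. k * u p + l * v p) : bounded_kernel A g \<phi> q"
proof -
 have u: "smooth_fun A u" "bounded (range u)" "!!p. wlap u p + q p * u p = 0"
  and v: "smooth_fun A v" "bounded (range v)" "!!p. wlap v p + q p * v p = 0"
  using assms by (auto simp: bounded_kernel_def schroedinger_eq)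
 have s: "smooth_fun A (%p. k * u p + l * v p)" by (intro smooth_fun_add smooth_fun_mult smooth_fun_const u v)
 have "wlap (%p. k * u p + l * v p) p = k * wlap u p + l * wlap v p" for p
  unfolding wlap_chart_at[OF s refl] wlap_chart_at[OF u(1) refl] wlap_chart_at[OF v(1) refl]
  by (subst ediv_linear) (auto simp: chart_at smooth_loc u v add_divide_distrib)
 hence "wlap (%p. k * u p + l * v p) p + q p * (k * u p + l * v p) = k * (wlap u p + q p * u p) + l * (wlap v p + q p * v p)" for p
  by (simp add: algebra_simps)
 moreover have "bounded (range (%p. k * u p + l * v p))"
  by (intro bounded_plus_comp[of "%p. k * u p" UNIV "%p. l * v p", simplified])
   (use bounded_scaling[OF u(2), of k] bounded_scaling[OF v(2), of l] in "simp_all add: image_image")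
 ultimately show ?thesis using s u(3) v(3) by (simp add: bounded_kernel_def schroedinger_eq)
qed

end

theorem theorem3p3:
  fixes A :: "('m::{t2_space, second_countable_topology}, 'n::finite) chart set"
    and g :: "('m, 'n) metric_tensor"
    and \<phi> q :: "'m \<Rightarrow> real"
  assumes "manifold_with_density A g \<phi>"
    and "complete_manifold A g"
    and "parabolic A g \<phi>"
    and "smooth_fun A q"
    and "stable_operator A g \<phi> q"
  shows "(\<forall>u. smooth_fun A u \<and> bounded (range u) \<and> (\<forall>p. schroedinger A g \<phi> q u p = 0)
            \<longrightarrow> (\<forall>p. u p = 0) \<or> (\<forall>p. u p \<noteq> 0)) \<and>
         ((\<exists>u. smooth_fun A u \<and> bounded (range u) \<and> (\<forall>p. schroedinger A g \<phi> q u p = 0) \<and>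
               (\<exists>p. u p \<noteq> 0))
            \<longrightarrow> module.subspace scale_fun (bounded_kernel A g \<phi> q) \<and>
                vector_space.dim scale_fun (bounded_kernel A g \<phi> q) = 1)"
proof -
 interpret density_manifold A g \<phi> by unfold_locales (rule assms(1))
 interpret vs: vector_space "scale_fun :: real => ('m => real) => _" by (rule vector_space_scale_fun)
 let ?V = "bounded_kernel A g \<phi> q"
 note dich = bounded_kernel_dichotomy[OF assms(3,4,5)] and lin = bounded_kernel_linear[of _ q]
 have one: "vs.subspace ?V & vs.dim ?V = 1" if w: "w : ?V" "w p ~= 0" for w p
 proof
  show "vs.subspace ?V"
  proof (rule vs.subspaceI)
   show "0 : ?V" using lin[OF w(1) w(1), of 0 0] by (simp add: zero_fun_def)
   show "x + y : ?V" if "x : ?V" "y : ?V" for x y using lin[OF that, of 1 1] by (simp add: plus_fun_def)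
   show "scale_fun k x : ?V" if "x : ?V" for k x using lin[OF that that, of k 0] by (simp add: scale_fun_def)
  qed
  have w0: "w a ~= 0" for a using dich[OF w(1)] w(2) by blast
  have "?V <= vs.span {w}"
  proof
   fix v assume v: "v : ?V"
   have "w p * v p + - v p * w p = 0" by simp
   hence "ALL a. w p * v a + - v p * w a = 0" using dich[OF lin[OF v w(1), of "w p" "- v p"]] by blast
   hence "v a = v p / w p * w a" for a using w(2) by (simp add: field_simps)
   hence "v = scale_fun (v p / w p) w" unfolding scale_fun_def by (rule ext)
   thus "v : vs.span {w}" by (auto simp: vs.span_singleton)
  qed
  moreover have "w ~= 0" using w(2) by auto
  hence "vs.independent {w}" by simp
  ultimately show "vs.dim ?V = 1" using vs.dim_unique[of "{w}" ?V 1] w(1) by simp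
 qed
 show ?thesis using dich one unfolding bounded_kernel_def by blast
qed

end
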